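(* Let $(M,g,J)$ be a locally conformal Kaehler manifold with Lee form $\omega$ and Lee vector field $B_1$, let $(B,g_B)$ be a Riemannian manifold, and let $\pi$ be a Lagrangian Riemannian submersion from $M$ onto $B$. Assume $B_1\in\Gamma(\ker\pi_* )$. Then $M$ is a locally product manifold if and only if $$g_B((\nabla\pi_* )(X,JY),\pi_*JV)=-\tfrac12 g(JY,B_1)g(X,JV)-\tfrac12 g(X,Y)g(B_1,V)$$ and $$\mathcal{T}_VJW=0$$ for all $X,Y\in\Gamma((\ker\pi_* )^\bot)$ and $V,W\in\Gamma(\ker\pi_* )$.
   Context: Locally conformal Kaehler (l.c.K.) manifold: a Hermitian manifold $(M,J,g)$, with $\Omega(X,Y)=g(X,JY)$, for which there is a globally defined closed $1$-form $\omega$ (the Lee form) with $d\Omega=\omega\wedge\Omega$. The Lee vector field $B_1$ is defined by $g(X,B_1)=\omega(X)$; set $\theta=\omega\circ J$ and $A=-JB_1$. The Levi-Civita connection $\nabla$ of $g$ then satisfies $(\nabla_XJ)Y=\frac12\{\theta(Y)X-\omega(Y)JX-g(X,Y)A-\Omega(X,Y)B_1\}$. Riemannian submersion $\pi:(M,g)\to(B,g_B)$ (with $\dim M>\dim B$): a surjective smooth map of maximal rank whose differential $\pi_*$ preserves lengths of horizontal vectors. $\ker\pi_*$ is the vertical distribution, $(\ker\pi_* )^\bot$ the horizontal one; $\mathcal V,\mathcal H$ are the orthogonal projections onto them. The O'Neill tensor $\mathcal T$ is $\mathcal{T}_EF=\mathcal{H}\nabla_{\mathcal{V}E}\mathcal{V}F+\mathcal{V}\nabla_{\mathcal{V}E}\mathcal{H}F$.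 $\pi$ is Lagrangian if $J(\ker\pi_* )=(\ker\pi_* )^\bot$. Second fundamental form of $\pi$: $(\nabla\pi_* )(E,F)=\nabla^{\pi}_E\pi_*(F)-\pi_*(\nabla_EF)$, with $\nabla^\pi$ the pullback connection of the Levi-Civita connection of $B$. "$M$ is a locally product manifold" means that $M$ is locally the usual Riemannian product of integral manifolds of $(\ker\pi_* )^\bot$ and $\ker\pi_*$, equivalently that both $(\ker\pi_* )^\bot$ and $\ker\pi_*$ define totally geodesic foliations on $M$. *)

theory Defs
  imports "HOL-Analysis.Analysis" "HOL-Library.Function_Algebras"
begin

section \<open>Smooth manifolds\<close>

fun Ck_on :: "nat \<Rightarrow> 'e::euclidean_space set \<Rightarrow> ('e \<Rightarrow> 'f::real_normed_vector) \<Rightarrow> bool" where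
  "Ck_on 0 S f \<longleftrightarrow> continuous_on S f"
| "Ck_on (Suc k) S f \<longleftrightarrow>
     f differentiable_on S \<and> (\<forall>w. Ck_on k S (\<lambda>x. frechet_derivative f (at x) w))"

text \<open>Only used for open \<open>S\<close>.\<close>

definition smooth_on :: "'e::euclidean_space set \<Rightarrow> ('e \<Rightarrow> 'f::real_normed_vector) \<Rightarrow> bool" where
  "smooth_on S f \<longleftrightarrow> (\<forall>k. Ck_on k S f)"

type_synonym ('a, 'e) chart = "'a set \<times> ('a \<Rightarrow> 'e)"
type_synonym ('a, 'e) atlas = "('a, 'e) chart set"

definition chart_inv :: "('a, 'e) chart \<Rightarrow> 'e \<Rightarrow> 'a" where
  "chart_inv c = inv_into (fst c) (snd c)"

definition is_chart :: "('a::topological_space, 'e::euclidean_space) chart \<Rightarrow> bool" where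
  "is_chart c \<longleftrightarrow> open (fst c) \<and> open (snd c ` fst c) \<and> inj_on (snd c) (fst c) \<and>
     continuous_on (fst c) (snd c) \<and> continuous_on (snd c ` fst c) (chart_inv c)"

definition compatible ::
    "('a, 'e::euclidean_space) chart \<Rightarrow> ('a, 'e) chart \<Rightarrow> bool" where
  "compatible c d \<longleftrightarrow> smooth_on (snd c ` (fst c \<inter> fst d)) (snd d \<circ> chart_inv c) \<and>
     smooth_on (snd d ` (fst c \<inter> fst d)) (snd c \<circ> chart_inv d)"

text \<open>The underlying set of the manifold is the whole (Hausdorff, second countable) type
  \<open>'a\<close>; its dimension is \<open>DIM('e)\<close>.\<close>

definition smooth_manifold ::
    "('a::{t2_space,second_countable_topology}, 'e::euclidean_space) atlas \<Rightarrow> bool" where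
  "smooth_manifold A \<longleftrightarrow> (\<forall>c\<in>A. is_chart c) \<and> (\<Union>c\<in>A. fst c) = UNIV \<and>
     (\<forall>c\<in>A. \<forall>d\<in>A. compatible c d)"

text \<open>Charts of the maximal atlas.\<close>

definition admissible_chart ::
    "('a::topological_space, 'e::euclidean_space) atlas \<Rightarrow> ('a, 'e) chart \<Rightarrow> bool" where
  "admissible_chart A c \<longleftrightarrow> is_chart c \<and> (\<forall>d\<in>A. compatible c d)"

definition smooth_functions ::
    "('a, 'e::euclidean_space) atlas \<Rightarrow> ('a \<Rightarrow> real) set" where
  "smooth_functions A = {f. \<forall>c\<in>A. smooth_on (snd c ` fst c) (f \<circ> chart_inv c)}"

definition smooth_map ::
    "('a::topological_space, 'e::euclidean_space) atlas \<Rightarrow>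
     ('b::topological_space, 'f::euclidean_space) atlas \<Rightarrow> ('a \<Rightarrow> 'b) \<Rightarrow> bool" where
  "smooth_map A A' \<pi> \<longleftrightarrow> continuous_on UNIV \<pi> \<and>
     (\<forall>c\<in>A. \<forall>d\<in>A'. smooth_on (snd c ` (fst c \<inter> \<pi> -` fst d)) (snd d \<circ> \<pi> \<circ> chart_inv c))"


section \<open>Tangent vectors and vector fields\<close>

text \<open>Tangent vectors at \<open>p\<close> are derivations of the algebra of smooth functions on the
  manifold. They are set to \<open>0\<close> on non-smooth functions, so that equality of tangent
  vectors is equality of HOL functions. Addition, subtraction and zero of tangent vectors
  and of vector fields are the pointwise ones of \<open>Function_Algebras\<close>.\<close>

type_synonym 'a tvec = "('a \<Rightarrow> real) \<Rightarrow> real"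
type_synonym 'a vfield = "'a \<Rightarrow> 'a tvec"

definition tangent :: "('a, 'e::euclidean_space) atlas \<Rightarrow> 'a \<Rightarrow> 'a tvec set" where
  "tangent A p = {v.
     (\<forall>f\<in>smooth_functions A. \<forall>h\<in>smooth_functions A. v (\<lambda>x. f x + h x) = v f + v h) \<and>
     (\<forall>a. \<forall>f\<in>smooth_functions A. v (\<lambda>x. a * f x) = a * v f) \<and>
     (\<forall>f\<in>smooth_functions A. \<forall>h\<in>smooth_functions A.
        v (\<lambda>x. f x * h x) = v f * h p + f p * v h) \<and>
     (\<forall>f. f \<notin> smooth_functions A \<longrightarrow> v f = 0)}"

definition tscale :: "real \<Rightarrow> 'a tvec \<Rightarrow> 'a tvec" where
  "tscale a v = (\<lambda>f. a * v f)"

definition vector_fields :: "('a, 'e::euclidean_space) atlas \<Rightarrow> 'a vfield set" where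
  "vector_fields A = {X. (\<forall>p. X p \<in> tangent A p) \<and>
     (\<forall>f\<in>smooth_functions A. (\<lambda>p. X p f) \<in> smooth_functions A)}"

text \<open>The scaling is also used for vector fields along a map, hence the second type
  variable.\<close>

definition fscale :: "('a \<Rightarrow> real) \<Rightarrow> ('a \<Rightarrow> 'b tvec) \<Rightarrow> ('a \<Rightarrow> 'b tvec)" where
  "fscale h X = (\<lambda>p. tscale (h p) (X p))"

definition lie_bracket :: "'a vfield \<Rightarrow> 'a vfield \<Rightarrow> 'a vfield" where
  "lie_bracket X Y = (\<lambda>p f. X p (\<lambda>q. Y q f) - Y p (\<lambda>q. X q f))"

text \<open>Smooth global sections of a distribution \<open>D\<close>.\<close>

definition sections ::
    "('a, 'e::euclidean_space) atlas \<Rightarrow> ('a \<Rightarrow> 'a tvec set) \<Rightarrow> 'a vfield set" where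
  "sections A D = {X \<in> vector_fields A. \<forall>p. X p \<in> D p}"

definition differential ::
    "('b, 'f::euclidean_space) atlas \<Rightarrow> ('a \<Rightarrow> 'b) \<Rightarrow> 'a tvec \<Rightarrow> 'b tvec" where
  "differential A' \<pi> v = (\<lambda>f. if f \<in> smooth_functions A' then v (f \<circ> \<pi>) else 0)"

text \<open>The tangent vector at \<open>q\<close> whose components in the chart \<open>c\<close> are \<open>w\<close>.\<close>

definition coord_vector ::
    "('a, 'e::euclidean_space) atlas \<Rightarrow> ('a, 'e) chart \<Rightarrow> 'a \<Rightarrow> 'e \<Rightarrow> 'a tvec" where
  "coord_vector A c q w = (\<lambda>f. if f \<in> smooth_functions A
     then frechet_derivative (f \<circ> chart_inv c) (at (snd c q)) w else 0)"


section \<open>Tensor fields, Riemannian metrics and connections\<close>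

type_synonym 'a form1 = "'a \<Rightarrow> 'a tvec \<Rightarrow> real"
type_synonym 'a form2 = "'a \<Rightarrow> 'a tvec \<Rightarrow> 'a tvec \<Rightarrow> real"
type_synonym 'a endo = "'a \<Rightarrow> 'a tvec \<Rightarrow> 'a tvec"
type_synonym 'a connection = "'a vfield \<Rightarrow> 'a vfield \<Rightarrow> 'a vfield"

definition one_form :: "('a, 'e::euclidean_space) atlas \<Rightarrow> 'a form1 \<Rightarrow> bool" where
  "one_form A \<omega> \<longleftrightarrow>
     (\<forall>p. \<forall>u\<in>tangent A p. \<forall>v\<in>tangent A p. \<omega> p (u + v) = \<omega> p u + \<omega> p v) \<and>
     (\<forall>p a. \<forall>u\<in>tangent A p. \<omega> p (tscale a u) = a * \<omega> p u) \<and>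
     (\<forall>X\<in>vector_fields A. (\<lambda>p. \<omega> p (X p)) \<in> smooth_functions A)"

definition riemannian_metric :: "('a, 'e::euclidean_space) atlas \<Rightarrow> 'a form2 \<Rightarrow> bool" where
  "riemannian_metric A g \<longleftrightarrow>
     (\<forall>p. \<forall>u\<in>tangent A p. \<forall>v\<in>tangent A p. g p u v = g p v u) \<and>
     (\<forall>p. \<forall>u\<in>tangent A p. \<forall>v\<in>tangent A p. \<forall>w\<in>tangent A p.
        g p (u + v) w = g p u w + g p v w) \<and>
     (\<forall>p a. \<forall>u\<in>tangent A p. \<forall>v\<in>tangent A p. g p (tscale a u) v = a * g p u v) \<and>
     (\<forall>p. \<forall>u\<in>tangent A p. u \<noteq> 0 \<longrightarrow> g p u u > 0) \<and>
     (\<forall>X\<in>vector_fields A. \<forall>Y\<in>vector_fields A.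
        (\<lambda>p. g p (X p) (Y p)) \<in> smooth_functions A)"

definition riemannian_manifold ::
    "('a::{t2_space,second_countable_topology}, 'e::euclidean_space) atlas \<Rightarrow> 'a form2 \<Rightarrow> bool"
  where "riemannian_manifold A g \<longleftrightarrow> smooth_manifold A \<and> riemannian_metric A g"

text \<open>\<open>D X Y\<close> stands for the covariant derivative of \<open>Y\<close> along \<open>X\<close>; nothing is said about
  \<open>D\<close> on arguments that are not smooth vector fields.\<close>

definition levi_civita ::
    "('a, 'e::euclidean_space) atlas \<Rightarrow> 'a form2 \<Rightarrow> 'a connection \<Rightarrow> bool" where
  "levi_civita A g D \<longleftrightarrow>
     (\<forall>X\<in>vector_fields A. \<forall>Y\<in>vector_fields A. D X Y \<in> vector_fields A) \<and>
     (\<forall>X\<in>vector_fields A. \<forall>Y\<in>vector_fields A. \<forall>Z\<in>vector_fields A.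
        D (X + Y) Z = D X Z + D Y Z \<and> D X (Y + Z) = D X Y + D X Z) \<and>
     (\<forall>h\<in>smooth_functions A. \<forall>X\<in>vector_fields A. \<forall>Y\<in>vector_fields A.
        D (fscale h X) Y = fscale h (D X Y) \<and>
        D X (fscale h Y) = fscale (\<lambda>p. X p h) Y + fscale h (D X Y)) \<and>
     (\<forall>X\<in>vector_fields A. \<forall>Y\<in>vector_fields A. D X Y - D Y X = lie_bracket X Y) \<and>
     (\<forall>X\<in>vector_fields A. \<forall>Y\<in>vector_fields A. \<forall>Z\<in>vector_fields A. \<forall>p.
        X p (\<lambda>q. g q (Y q) (Z q)) = g p (D X Y p) (Z p) + g p (Y p) (D X Z p))"

definition app :: "'a endo \<Rightarrow> 'a vfield \<Rightarrow> 'a vfield" where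
  "app J X = (\<lambda>p. J p (X p))"


section \<open>Locally conformal Kaehler manifolds\<close>

definition almost_complex :: "('a, 'e::euclidean_space) atlas \<Rightarrow> 'a endo \<Rightarrow> bool" where
  "almost_complex A J \<longleftrightarrow>
     (\<forall>p. \<forall>u\<in>tangent A p. J p u \<in> tangent A p \<and> J p (J p u) = - u) \<and>
     (\<forall>p. \<forall>u\<in>tangent A p. \<forall>v\<in>tangent A p. J p (u + v) = J p u + J p v) \<and>
     (\<forall>p a. \<forall>u\<in>tangent A p. J p (tscale a u) = tscale a (J p u)) \<and>
     (\<forall>X\<in>vector_fields A. app J X \<in> vector_fields A)"

definition nijenhuis :: "'a endo \<Rightarrow> 'a vfield \<Rightarrow> 'a vfield \<Rightarrow> 'a vfield" where
  "nijenhuis J X Y = lie_bracket (app J X) (app J Y) - lie_bracket X Y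
     - app J (lie_bracket (app J X) Y) - app J (lie_bracket X (app J Y))"

definition hermitian_manifold ::
    "('a::{t2_space,second_countable_topology}, 'e::euclidean_space) atlas \<Rightarrow>
     'a endo \<Rightarrow> 'a form2 \<Rightarrow> bool" where
  "hermitian_manifold A J g \<longleftrightarrow> riemannian_manifold A g \<and> almost_complex A J \<and>
     (\<forall>X\<in>vector_fields A. \<forall>Y\<in>vector_fields A. nijenhuis J X Y = 0) \<and>
     (\<forall>p. \<forall>u\<in>tangent A p. \<forall>v\<in>tangent A p. g p (J p u) (J p v) = g p u v)"

definition fundamental_form :: "'a endo \<Rightarrow> 'a form2 \<Rightarrow> 'a form2" where
  "fundamental_form J g = (\<lambda>p u v. g p u (J p v))"

text \<open>Exterior derivatives and wedge product, evaluated on vector fields. No factors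
  \<open>1/2\<close>, \<open>1/3\<close> are used; with them (in both derivative and wedge) the equations below
  would be the same.\<close>

definition ext_deriv1 :: "'a form1 \<Rightarrow> 'a vfield \<Rightarrow> 'a vfield \<Rightarrow> 'a \<Rightarrow> real" where
  "ext_deriv1 \<omega> X Y p =
     X p (\<lambda>q. \<omega> q (Y q)) - Y p (\<lambda>q. \<omega> q (X q)) - \<omega> p (lie_bracket X Y p)"

definition ext_deriv2 ::
    "'a form2 \<Rightarrow> 'a vfield \<Rightarrow> 'a vfield \<Rightarrow> 'a vfield \<Rightarrow> 'a \<Rightarrow> real" where
  "ext_deriv2 \<Omega> X Y Z p =
     X p (\<lambda>q. \<Omega> q (Y q) (Z q)) - Y p (\<lambda>q. \<Omega> q (X q) (Z q)) + Z p (\<lambda>q. \<Omega> q (X q) (Y q))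
     - \<Omega> p (lie_bracket X Y p) (Z p) + \<Omega> p (lie_bracket X Z p) (Y p)
     - \<Omega> p (lie_bracket Y Z p) (X p)"

definition wedge12 ::
    "'a form1 \<Rightarrow> 'a form2 \<Rightarrow> 'a vfield \<Rightarrow> 'a vfield \<Rightarrow> 'a vfield \<Rightarrow> 'a \<Rightarrow> real" where
  "wedge12 \<omega> \<Omega> X Y Z p =
     \<omega> p (X p) * \<Omega> p (Y p) (Z p) - \<omega> p (Y p) * \<Omega> p (X p) (Z p)
     + \<omega> p (Z p) * \<Omega> p (X p) (Y p)"

definition lck_manifold ::
    "('a::{t2_space,second_countable_topology}, 'e::euclidean_space) atlas \<Rightarrow>
     'a endo \<Rightarrow> 'a form2 \<Rightarrow> 'a form1 \<Rightarrow> bool" where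
  "lck_manifold A J g \<omega> \<longleftrightarrow> hermitian_manifold A J g \<and> one_form A \<omega> \<and>
     (\<forall>X\<in>vector_fields A. \<forall>Y\<in>vector_fields A. \<forall>p. ext_deriv1 \<omega> X Y p = 0) \<and>
     (\<forall>X\<in>vector_fields A. \<forall>Y\<in>vector_fields A. \<forall>Z\<in>vector_fields A. \<forall>p.
        ext_deriv2 (fundamental_form J g) X Y Z p = wedge12 \<omega> (fundamental_form J g) X Y Z p)"

definition lee_vector_field ::
    "('a, 'e::euclidean_space) atlas \<Rightarrow> 'a form2 \<Rightarrow> 'a form1 \<Rightarrow> 'a vfield \<Rightarrow> bool" where
  "lee_vector_field A g \<omega> B1 \<longleftrightarrow> B1 \<in> vector_fields A \<and>
     (\<forall>p. \<forall>v\<in>tangent A p. g p v (B1 p) = \<omega> p v)"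


section \<open>Riemannian submersions\<close>

definition vertical ::
    "('a, 'e::euclidean_space) atlas \<Rightarrow> ('b, 'f::euclidean_space) atlas \<Rightarrow> ('a \<Rightarrow> 'b) \<Rightarrow>
     'a \<Rightarrow> 'a tvec set" where
  "vertical A A' \<pi> p = {v \<in> tangent A p. differential A' \<pi> v = 0}"

definition horizontal ::
    "('a, 'e::euclidean_space) atlas \<Rightarrow> ('b, 'f::euclidean_space) atlas \<Rightarrow> 'a form2 \<Rightarrow>
     ('a \<Rightarrow> 'b) \<Rightarrow> 'a \<Rightarrow> 'a tvec set" where
  "horizontal A A' g \<pi> p = {v \<in> tangent A p. \<forall>w\<in>vertical A A' \<pi> p. g p v w = 0}"

definition riemannian_submersion ::
    "('a::{t2_space,second_countable_topology}, 'e::euclidean_space) atlas \<Rightarrow> 'a form2 \<Rightarrow>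
     ('b::{t2_space,second_countable_topology}, 'f::euclidean_space) atlas \<Rightarrow> 'b form2 \<Rightarrow>
     ('a \<Rightarrow> 'b) \<Rightarrow> bool" where
  "riemannian_submersion A g A' gB \<pi> \<longleftrightarrow>
     riemannian_manifold A g \<and> riemannian_manifold A' gB \<and> DIM('e) > DIM('f) \<and>
     surj \<pi> \<and> smooth_map A A' \<pi> \<and>
     (\<forall>p. differential A' \<pi> ` tangent A p = tangent A' (\<pi> p)) \<and>
     (\<forall>p. \<forall>v\<in>horizontal A A' g \<pi> p.
        gB (\<pi> p) (differential A' \<pi> v) (differential A' \<pi> v) = g p v v)"

definition lagrangian_submersion ::
    "('a::{t2_space,second_countable_topology}, 'e::euclidean_space) atlas \<Rightarrow> 'a endo \<Rightarrow>
     'a form2 \<Rightarrow> ('b::{t2_space,second_countable_topology}, 'f::euclidean_space) atlas \<Rightarrow>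
     'b form2 \<Rightarrow> ('a \<Rightarrow> 'b) \<Rightarrow> bool" where
  "lagrangian_submersion A J g A' gB \<pi> \<longleftrightarrow> riemannian_submersion A g A' gB \<pi> \<and>
     (\<forall>p. J p ` vertical A A' \<pi> p = horizontal A A' g \<pi> p)"

definition vproj ::
    "('a, 'e::euclidean_space) atlas \<Rightarrow> ('b, 'f::euclidean_space) atlas \<Rightarrow> 'a form2 \<Rightarrow>
     ('a \<Rightarrow> 'b) \<Rightarrow> 'a endo" where
  "vproj A A' g \<pi> p u =
     (THE v. v \<in> vertical A A' \<pi> p \<and> u - v \<in> horizontal A A' g \<pi> p)"

definition hproj ::
    "('a, 'e::euclidean_space) atlas \<Rightarrow> ('b, 'f::euclidean_space) atlas \<Rightarrow> 'a form2 \<Rightarrow>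
     ('a \<Rightarrow> 'b) \<Rightarrow> 'a endo" where
  "hproj A A' g \<pi> p u = u - vproj A A' g \<pi> p u"

definition oneill_T ::
    "('a, 'e::euclidean_space) atlas \<Rightarrow> ('b, 'f::euclidean_space) atlas \<Rightarrow> 'a form2 \<Rightarrow>
     'a connection \<Rightarrow> ('a \<Rightarrow> 'b) \<Rightarrow> 'a vfield \<Rightarrow> 'a vfield \<Rightarrow> 'a vfield" where
  "oneill_T A A' g D \<pi> E F =
     (let V = app (vproj A A' g \<pi>); H = app (hproj A A' g \<pi>)
      in H (D (V E) (V F)) + V (D (V E) (H F)))"

text \<open>Smooth sections of the pullback of the tangent bundle along \<open>\<pi>\<close>.\<close>

definition fields_along ::
    "('a, 'e::euclidean_space) atlas \<Rightarrow> ('b, 'f::euclidean_space) atlas \<Rightarrow> ('a \<Rightarrow> 'b) \<Rightarrow>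
     ('a \<Rightarrow> 'b tvec) set" where
  "fields_along A A' \<pi> = {s. (\<forall>p. s p \<in> tangent A' (\<pi> p)) \<and>
     (\<forall>f\<in>smooth_functions A'. (\<lambda>p. s p f) \<in> smooth_functions A)}"

text \<open>In the last clause, the derivative of \<open>Z\<close> in the direction of the single tangent
  vector \<open>\<pi>\<^sub>* (E p)\<close> is expressed by means of any vector field \<open>W\<close> extending that vector.\<close>

definition pullback_connection ::
    "('a, 'e::euclidean_space) atlas \<Rightarrow> ('b, 'f::euclidean_space) atlas \<Rightarrow> ('a \<Rightarrow> 'b) \<Rightarrow>
     'b connection \<Rightarrow> ('a vfield \<Rightarrow> ('a \<Rightarrow> 'b tvec) \<Rightarrow> ('a \<Rightarrow> 'b tvec)) \<Rightarrow> bool" where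
  "pullback_connection A A' \<pi> DB DP \<longleftrightarrow>
     (\<forall>E\<in>vector_fields A. \<forall>s\<in>fields_along A A' \<pi>. DP E s \<in> fields_along A A' \<pi>) \<and>
     (\<forall>E\<in>vector_fields A. \<forall>F\<in>vector_fields A. \<forall>s\<in>fields_along A A' \<pi>.
        DP (E + F) s = DP E s + DP F s) \<and>
     (\<forall>E\<in>vector_fields A. \<forall>s\<in>fields_along A A' \<pi>. \<forall>t\<in>fields_along A A' \<pi>.
        DP E (s + t) = DP E s + DP E t) \<and>
     (\<forall>h\<in>smooth_functions A. \<forall>E\<in>vector_fields A. \<forall>s\<in>fields_along A A' \<pi>.
        DP (fscale h E) s = fscale h (DP E s) \<and>
        DP E (fscale h s) = fscale (\<lambda>p. E p h) s + fscale h (DP E s)) \<and>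
     (\<forall>E\<in>vector_fields A. \<forall>Z\<in>vector_fields A'. \<forall>W\<in>vector_fields A'. \<forall>p.
        W (\<pi> p) = differential A' \<pi> (E p) \<longrightarrow> DP E (Z \<circ> \<pi>) p = DB W Z (\<pi> p))"

definition second_fundamental_form ::
    "('b, 'f::euclidean_space) atlas \<Rightarrow> ('a \<Rightarrow> 'b) \<Rightarrow> 'a connection \<Rightarrow>
     ('a vfield \<Rightarrow> ('a \<Rightarrow> 'b tvec) \<Rightarrow> ('a \<Rightarrow> 'b tvec)) \<Rightarrow>
     'a vfield \<Rightarrow> 'a vfield \<Rightarrow> ('a \<Rightarrow> 'b tvec)" where
  "second_fundamental_form A' \<pi> D DP E F =
     DP E (\<lambda>p. differential A' \<pi> (F p)) - (\<lambda>p. differential A' \<pi> (D E F p))"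


section \<open>Local Riemannian products\<close>

text \<open>Around every point there is a chart \<open>c\<close> of the manifold whose image is a product
  \<open>S1 \<times> S2\<close> (realised as \<open>{a + b | a \<in> S1, b \<in> S2}\<close> in complementary subspaces \<open>W1\<close>, \<open>W2\<close> of
  the model space), whose slices \<open>S1 \<times> {b}\<close> and \<open>{a} \<times> S2\<close> are integral manifolds of
  \<open>D1\<close> and \<open>D2\<close>, and in which \<open>g\<close> is the product of a metric \<open>h1\<close> on \<open>S1\<close> and a metric
  \<open>h2\<close> on \<open>S2\<close>. That \<open>S1\<close>, \<open>S2\<close> are open in \<open>W1\<close>, \<open>W2\<close> and that \<open>h1\<close>, \<open>h2\<close> are smooth
  Riemannian metrics follows from the corresponding properties of \<open>c\<close> and \<open>g\<close>.\<close>

definition locally_product ::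
    "('a::topological_space, 'e::euclidean_space) atlas \<Rightarrow> 'a form2 \<Rightarrow>
     ('a \<Rightarrow> 'a tvec set) \<Rightarrow> ('a \<Rightarrow> 'a tvec set) \<Rightarrow> bool" where
  "locally_product A g D1 D2 \<longleftrightarrow>
     (\<forall>p. \<exists>c W1 W2 S1 S2. \<exists>h1 h2 :: 'e \<Rightarrow> 'e \<Rightarrow> 'e \<Rightarrow> real.
        admissible_chart A c \<and> p \<in> fst c \<and>
        subspace W1 \<and> subspace W2 \<and> W1 \<inter> W2 = {0} \<and> {a + b | a b. a \<in> W1 \<and> b \<in> W2} = UNIV \<and>
        S1 \<subseteq> W1 \<and> S2 \<subseteq> W2 \<and> snd c ` fst c = {a + b | a b. a \<in> S1 \<and> b \<in> S2} \<and>
        (\<forall>q\<in>fst c. coord_vector A c q ` W1 = D1 q \<and> coord_vector A c q ` W2 = D2 q) \<and>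
        (\<forall>a\<in>S1. \<forall>b\<in>S2. \<forall>u1\<in>W1. \<forall>u2\<in>W2. \<forall>v1\<in>W1. \<forall>v2\<in>W2.
           let q = chart_inv c (a + b)
           in g q (coord_vector A c q (u1 + u2)) (coord_vector A c q (v1 + v2))
              = h1 a u1 v1 + h2 b u2 v2))"

end

theory Submission
  imports Defs
begin

text \<open>Write \<open>H\<close> and \<open>V\<close> for the horizontal and the vertical distribution, \<open>\<nabla>\<close> for the Levi-Civita connection.
The two conditions of the theorem say that \<open>H\<close> and \<open>V\<close> are totally geodesic. For horizontal \<open>X\<close>, \<open>Y\<close> and vertical
\<open>V\<close> the field \<open>JY\<close> is vertical, so the second fundamental form at \<open>(X, JY)\<close> is \<open>- \<pi>\<^sub>*(\<nabla>\<^sub>X JY)\<close>, and the formula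
for \<open>\<nabla>J\<close> on a locally conformal Kaehler manifold (\<open>DJ_formula\<close>) turns the first condition into \<open>g(\<nabla>\<^sub>X Y, V) = 0\<close>
(\<open>second_form_condition_iff\<close>). The second one says that \<open>\<nabla>\<^sub>V JW\<close> is horizontal, which is dual to \<open>\<nabla>\<^sub>V U\<close> being
vertical (\<open>conditions_iff_totally_geodesic\<close>).

If the metric is locally a product, Koszul's formula in product coordinates shows that both factors are totally
geodesic (\<open>locally_product_geodesic\<close>).

The converse would in general need Frobenius' theorem and a proof that the metric splits. Here the situation is much
more rigid: \<^emph>\<open>\<open>M\<close> is flat and \<open>J\<close> is parallel\<close>. Both distributions are parallel (\<open>D_SH\<close>, \<open>D_SV\<close>), so
\<open>(\<nabla>\<^sub>X J)Y\<close> is vertical for horizontal \<open>X\<close>, \<open>Y\<close>, whereas \<open>DJ_formula\<close> makes it horizontal; hence it is zero, and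
the algebraic identity for the Lee field that this forces (\<open>lee_relation\<close>) kills the other components of \<open>\<nabla>J\<close>
(\<open>D_J\<close>). The curvature then commutes with \<open>J\<close> and preserves \<open>H\<close> and \<open>V\<close>. The Bianchi identity leaves only
\<open>R(X, JY)Z\<close> with horizontal entries, which is symmetric in \<open>X\<close>, \<open>Y\<close>, \<open>Z\<close> and skew as an endomorphism of \<open>Z\<close>, hence
zero (\<open>R_zero\<close>).

On a flat manifold the product chart can be written down. A parallel frame of \<open>H\<close> solves a total linear differential
equation whose integrability condition is flatness (\<open>flat_linear_system\<close>, \<open>parallel_frame\<close>); applying \<open>J\<close> gives a
parallel frame of \<open>V\<close>. The metric duals of the frame are closed forms, so they are differentials of functions
(\<open>poincare_lemma\<close>), and by the inverse function theorem these functions are coordinates. In them both distributions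
and the metric have constant coefficients (\<open>totally_geodesic_imp_locally_product\<close>).

Vector fields are global derivations, so all local constructions are multiplied by bump functions; smooth sections of
\<open>H\<close> come from the horizontal lift (\<open>horizontal_frame\<close>).\<close>

section \<open>Functions of class \<open>C\<^sup>k\<close>\<close>

lemma Ck_on_cong:
  assumes "open S" "\<And>x. x \<in> S \<Longrightarrow> f x = g x" "Ck_on k S f"
  shows "Ck_on k S g"
  using assms(2,3)
proof (induction k arbitrary: f g)
  case 0 then show ?case by (simp cong: continuous_on_cong)
next
  case (Suc k)
  have fd: "f differentiable at x" if "x \<in> S" for x
    using Suc.prems that assms(1) by (simp add: differentiable_on_eq_differentiable_at)
  have eq: "frechet_derivative f (at x) = frechet_derivative g (at x)" if "x \<in> S" for x
    using frechet_derivative_transform_within_open[OF fd assms(1)] that Suc.prems(1) by blast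
  have gd: "g differentiable at x" if "x \<in> S" for x
    using differentiable_transform_within[of f x UNIV] fd[OF that]
      has_derivative_transform_within_open[OF _ assms(1) that] Suc.prems(1)
    unfolding differentiable_def by metis
  show ?case
    using Suc.IH[of "\<lambda>x. frechet_derivative f (at x) w" "\<lambda>x. frechet_derivative g (at x) w" for w]
      Suc.prems eq gd assms(1) by (auto simp: differentiable_on_eq_differentiable_at)
qed

lemma Ck_on_subset:
  assumes "open S" "open T" "T \<subseteq> S" "Ck_on k S f"
  shows "Ck_on k T f"
  using assms(4)
proof (induction k arbitrary: f)
  case 0 then show ?case using assms continuous_on_subset by auto
next
  case (Suc k) then show ?case using assms differentiable_on_subset by auto
qed

lemma Ck_on_Suc_D: "Ck_on (Suc k) S f \<Longrightarrow> Ck_on k S f"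
proof (induction k arbitrary: f)
  case 0 then show ?case by (simp add: differentiable_imp_continuous_on)
next
  case (Suc k) then show ?case by (metis Ck_on.simps(2))
qed

lemma Ck_on_le: "Ck_on n S f \<Longrightarrow> k \<le> n \<Longrightarrow> Ck_on k S f"
  by (induction n) (auto simp: le_Suc_eq simp del: Ck_on.simps dest: Ck_on_Suc_D)

lemma Ck_on_continuous: "Ck_on k S f \<Longrightarrow> continuous_on S f"
  using Ck_on_le[of k S f 0] by simp

lemma Ck_on_local:
  assumes "open S" "\<And>x. x \<in> S \<Longrightarrow> \<exists>U. open U \<and> x \<in> U \<and> U \<subseteq> S \<and> Ck_on k U f"
  shows "Ck_on k S f"
  using assms(2)
proof (induction k arbitrary: f)
  case 0
  have "isCont f x" if "x \<in> S" for x using 0[OF that] continuous_on_eq_continuous_at by auto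
  then show ?case by (simp add: continuous_at_imp_continuous_on)
next
  case (Suc k)
  have "f differentiable_on S"
    unfolding differentiable_on_eq_differentiable_at[OF assms(1)]
    using Suc.prems by (metis Ck_on.simps(2) differentiable_on_eq_differentiable_at)
  moreover have "Ck_on k S (\<lambda>x. frechet_derivative f (at x) w)" for w
    using Suc.prems by (intro Suc.IH) (metis Ck_on.simps(2))
  ultimately show ?case by simp
qed

text \<open>\<open>Ck_on\<close> is defined by means of \<open>frechet_derivative\<close>; this is the form in which it is established, with a known
  derivative.\<close>

lemma Ck_on_SucI:
  assumes "open S" "\<And>x. x \<in> S \<Longrightarrow> (f has_derivative F x) (at x)"
    "\<And>w. Ck_on k S (\<lambda>x. F x w)"
  shows "Ck_on (Suc k) S f"
proof -
  have "frechet_derivative f (at x) = F x" if "x \<in> S" for x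
    using assms(2)[OF that] frechet_derivative_at by metis
  then have "Ck_on k S (\<lambda>x. frechet_derivative f (at x) w)" for w
    by (intro Ck_on_cong[OF assms(1) _ assms(3)]) auto
  then show ?thesis
    using assms(2) by (auto simp: differentiable_on_eq_differentiable_at[OF assms(1)] differentiable_def)
qed

lemma Ck_on_has_derivative:
  assumes "open S" "Ck_on (Suc k) S f" "x \<in> S"
  shows "(f has_derivative frechet_derivative f (at x)) (at x)"
  using assms by (simp add: differentiable_on_eq_differentiable_at frechet_derivative_works)

lemma smooth_on_Ck: "smooth_on S f \<Longrightarrow> Ck_on k S f"
  by (simp add: smooth_on_def)

lemma smooth_on_has_derivative:
  assumes "open S" "smooth_on S f" "x \<in> S"
  shows "(f has_derivative frechet_derivative f (at x)) (at x)"
  using assms Ck_on_has_derivative smooth_on_Ck by blast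

lemma smooth_on_dd: "smooth_on S f \<Longrightarrow> smooth_on S (\<lambda>x. frechet_derivative f (at x) w)"
  unfolding smooth_on_def by (metis Ck_on.simps(2))

lemma smooth_on_continuous: "smooth_on S f \<Longrightarrow> continuous_on S f"
  using smooth_on_Ck Ck_on_continuous by blast

lemma Ck_on_const [simp]: "Ck_on k S (\<lambda>x. c)"
  by (induction k arbitrary: c) auto

lemma Ck_on_bounded_linear:
  assumes "open S" "bounded_linear L" "Ck_on k S f"
  shows "Ck_on k S (\<lambda>x. L (f x))"
  using assms(3)
proof (induction k arbitrary: f)
  case 0 then show ?case using bounded_linear.continuous_on[OF assms(2)] by auto
next
  case (Suc k)
  show ?case
  proof (rule Ck_on_SucI[OF assms(1)])
    show "((\<lambda>x. L (f x)) has_derivative (\<lambda>w. L (frechet_derivative f (at x) w))) (at x)" if "x \<in> S" for x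
      using bounded_linear.has_derivative[OF assms(2) Ck_on_has_derivative[OF assms(1) Suc.prems that]] .
  qed (use Suc in auto)
qed

lemma Ck_on_add:
  assumes "open S" "Ck_on k S f" "Ck_on k S g"
  shows "Ck_on k S (\<lambda>x. f x + g x)"
  using assms(2,3)
proof (induction k arbitrary: f g)
  case 0 then show ?case by (auto intro: continuous_on_add)
next
  case (Suc k)
  show ?case
  proof (rule Ck_on_SucI[OF assms(1)])
    show "((\<lambda>x. f x + g x) has_derivative (\<lambda>w. frechet_derivative f (at x) w + frechet_derivative g (at x) w)) (at x)" if "x \<in> S" for x
      using Ck_on_has_derivative[OF assms(1) _ that] Suc.prems has_derivative_add by blast
  qed (use Suc in auto)
qed

lemma Ck_on_sum:
  assumes "open S" "\<And>i. i \<in> I \<Longrightarrow> Ck_on k S (f i)"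
  shows "Ck_on k S (\<lambda>x. \<Sum>i\<in>I. f i x)"
  using assms(2) by (induction I rule: infinite_finite_induct) (auto intro: Ck_on_add[OF assms(1)])

lemma Ck_on_bilinear:
  assumes "open S" "bounded_bilinear m" "Ck_on k S f" "Ck_on k S g"
  shows "Ck_on k S (\<lambda>x. m (f x) (g x))"
  using assms(3,4)
proof (induction k arbitrary: f g)
  case 0 then show ?case using bounded_bilinear.continuous_on[OF assms(2)] by auto
next
  case (Suc k)
  show ?case
  proof (rule Ck_on_SucI[OF assms(1)])
    show "((\<lambda>x. m (f x) (g x)) has_derivative (\<lambda>w. m (f x) (frechet_derivative g (at x) w)
        + m (frechet_derivative f (at x) w) (g x))) (at x)" if "x \<in> S" for x
      by (rule bounded_bilinear.FDERIV[OF assms(2) Ck_on_has_derivative[OF assms(1) Suc.prems(1) that]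
            Ck_on_has_derivative[OF assms(1) Suc.prems(2) that]])
    show "Ck_on k S (\<lambda>x. m (f x) (frechet_derivative g (at x) w)
        + m (frechet_derivative f (at x) w) (g x))" for w
      using Suc.prems Ck_on_Suc_D[OF Suc.prems(1)] Ck_on_Suc_D[OF Suc.prems(2)]
      by (intro Ck_on_add[OF assms(1)] Suc.IH) auto
  qed
qed

lemma Ck_on_id: "open S \<Longrightarrow> Ck_on k S (\<lambda>x. x)"
proof (cases k)
  case (Suc m)
  assume "open S"
  then have "Ck_on (Suc m) S (\<lambda>x. x)"
    by (rule Ck_on_SucI[where F="\<lambda>_ w. w"]) auto
  then show ?thesis using Suc by simp
qed simp

lemma frechet_derivative_Basis_sum:
  fixes f :: "'e::euclidean_space \<Rightarrow> 'c::real_normed_vector"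
  assumes "f differentiable at x"
  shows "frechet_derivative f (at x) w = (\<Sum>b\<in>Basis. (w \<bullet> b) *\<^sub>R frechet_derivative f (at x) b)"
proof -
  have lin: "linear (frechet_derivative f (at x))"
    using assms frechet_derivative_works has_derivative_bounded_linear bounded_linear.linear by blast
  show ?thesis
    using linear_sum[OF lin, of "\<lambda>b. (w \<bullet> b) *\<^sub>R b" Basis] by (simp add: euclidean_representation linear_cmul[OF lin])
qed

text \<open>By the chain rule the derivative of the inner function becomes the direction in which the outer one is
  differentiated, and \<open>Ck_on\<close> only speaks of fixed directions. Expanding the direction in the basis turns the derivative
  into a sum of products, to which the induction hypothesis applies.\<close>

lemma Ck_on_compose:
  fixes f :: "'e::euclidean_space \<Rightarrow> 'c::real_normed_vector" and g :: "'d::euclidean_space \<Rightarrow> 'e"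
  assumes "open S" "open T" "g ` S \<subseteq> T" "Ck_on k T f" "Ck_on k S g"
  shows "Ck_on k S (\<lambda>x. f (g x))"
  using assms(4,5)
proof (induction k arbitrary: f)
  case 0 then show ?case using assms(3) continuous_on_compose2 by auto
next
  case (Suc k)
  show ?case
  proof (rule Ck_on_SucI[OF assms(1)])
    show "((\<lambda>x. f (g x)) has_derivative (\<lambda>w. \<Sum>b\<in>Basis. (frechet_derivative g (at x) w \<bullet> b) *\<^sub>R
       frechet_derivative f (at (g x)) b)) (at x)" if "x \<in> S" for x
    proof -
      have gx: "g x \<in> T" using that assms(3) by auto
      have fd: "f differentiable at (g x)" using Ck_on_has_derivative[OF assms(2) Suc.prems(1) gx] differentiable_def by blast
      have "(\<lambda>w. \<Sum>b\<in>Basis. (frechet_derivative g (at x) w \<bullet> b) *\<^sub>R frechet_derivative f (at (g x)) b)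
          = (\<lambda>w. frechet_derivative f (at (g x)) (frechet_derivative g (at x) w))"
        by (intro ext frechet_derivative_Basis_sum[symmetric] fd)
      then show ?thesis
        using has_derivative_compose[OF Ck_on_has_derivative[OF assms(1) Suc.prems(2) that]
            Ck_on_has_derivative[OF assms(2) Suc.prems(1) gx]] by metis
    qed
    show "Ck_on k S (\<lambda>x. \<Sum>b\<in>Basis. (frechet_derivative g (at x) w \<bullet> b) *\<^sub>R
       frechet_derivative f (at (g x)) b)" for w
    proof (intro Ck_on_sum[OF assms(1)] Ck_on_bilinear[OF assms(1) bounded_bilinear_scaleR])
      fix b :: 'e
      show "Ck_on k S (\<lambda>x. frechet_derivative g (at x) w \<bullet> b)"
        using Suc.prems by (intro Ck_on_bounded_linear[OF assms(1) bounded_linear_inner_left]) auto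
      show "Ck_on k S (\<lambda>x. frechet_derivative f (at (g x)) b)"
        using Suc.prems(1) Ck_on_Suc_D[OF Suc.prems(2)] by (intro Suc.IH) auto
    qed
  qed
qed

section \<open>Smooth functions on open sets\<close>

lemma smooth_on_cong:
  "open S \<Longrightarrow> (\<And>x. x \<in> S \<Longrightarrow> f x = g x) \<Longrightarrow> smooth_on S f \<Longrightarrow> smooth_on S g"
  unfolding smooth_on_def using Ck_on_cong by blast

lemma smooth_on_subset: "open S \<Longrightarrow> open T \<Longrightarrow> T \<subseteq> S \<Longrightarrow> smooth_on S f \<Longrightarrow> smooth_on T f"
  unfolding smooth_on_def using Ck_on_subset by blast

lemma smooth_on_local:
  assumes "open S" "\<And>x. x \<in> S \<Longrightarrow> \<exists>U. open U \<and> x \<in> U \<and> U \<subseteq> S \<and> smooth_on U f"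
  shows "smooth_on S f"
  unfolding smooth_on_def using Ck_on_local[OF assms(1)] assms(2) smooth_on_Ck by metis

lemma smooth_on_const [simp]: "smooth_on S (\<lambda>x. c)"
  by (simp add: smooth_on_def)

lemma smooth_on_id: "open S \<Longrightarrow> smooth_on S (\<lambda>x. x)"
  by (simp add: smooth_on_def Ck_on_id)

lemma smooth_on_bounded_linear:
  "open S \<Longrightarrow> bounded_linear L \<Longrightarrow> smooth_on S f \<Longrightarrow> smooth_on S (\<lambda>x. L (f x))"
  by (simp add: smooth_on_def Ck_on_bounded_linear)

lemma smooth_on_add: "open S \<Longrightarrow> smooth_on S f \<Longrightarrow> smooth_on S g \<Longrightarrow> smooth_on S (\<lambda>x. f x + g x)"
  by (simp add: smooth_on_def Ck_on_add)

lemma smooth_on_sum: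
  "open S \<Longrightarrow> (\<And>i. i \<in> I \<Longrightarrow> smooth_on S (f i)) \<Longrightarrow> smooth_on S (\<lambda>x. \<Sum>i\<in>I. f i x)"
  by (simp add: smooth_on_def Ck_on_sum)

lemma smooth_on_bilinear:
  "open S \<Longrightarrow> bounded_bilinear m \<Longrightarrow> smooth_on S f \<Longrightarrow> smooth_on S g \<Longrightarrow> smooth_on S (\<lambda>x. m (f x) (g x))"
  by (simp add: smooth_on_def Ck_on_bilinear)

lemmas smooth_on_scaleR = smooth_on_bilinear[OF _ bounded_bilinear_scaleR]
lemmas smooth_on_mult = smooth_on_bilinear[OF _ bounded_bilinear_mult]
lemmas smooth_on_inner = smooth_on_bilinear[OF _ bounded_bilinear_inner]

lemma smooth_on_minus: "open S \<Longrightarrow> smooth_on S f \<Longrightarrow> smooth_on S (\<lambda>x. - f x)"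
  using smooth_on_bounded_linear[OF _ bounded_linear_minus[OF bounded_linear_ident]] by auto

lemma smooth_on_diff: "open S \<Longrightarrow> smooth_on S f \<Longrightarrow> smooth_on S g \<Longrightarrow> smooth_on S (\<lambda>x. f x - g x)"
  using smooth_on_add[OF _ _ smooth_on_minus] by fastforce

lemma smooth_on_compose:
  fixes f :: "'e::euclidean_space \<Rightarrow> 'c::real_normed_vector" and g :: "'d::euclidean_space \<Rightarrow> 'e"
  assumes "open S" "open T" "g ` S \<subseteq> T" "smooth_on T f" "smooth_on S g"
  shows "smooth_on S (\<lambda>x. f (g x))"
  using assms by (simp add: smooth_on_def Ck_on_compose)

text \<open>A solution of a differential equation is smooth: as soon as the derivative is as regular as the function,
  each order of regularity gives the next one.\<close>

lemma smooth_on_bootstrap: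
  assumes "open S" "\<And>x. x \<in> S \<Longrightarrow> (f has_derivative F x) (at x)"
    "\<And>k w. Ck_on k S f \<Longrightarrow> Ck_on k S (\<lambda>x. F x w)"
  shows "smooth_on S f"
  unfolding smooth_on_def
proof
  fix k show "Ck_on k S f"
  proof (induction k)
    case 0
    have "f differentiable_on S"
      using assms(2) unfolding differentiable_on_eq_differentiable_at[OF assms(1)] differentiable_def by blast
    then show ?case by (simp add: differentiable_imp_continuous_on)
  next
    case (Suc k) then show ?case by (intro Ck_on_SucI[OF assms(1,2)] assms(3))
  qed
qed

lemma smooth_on_inverse:
  fixes f :: "'e::euclidean_space \<Rightarrow> real"
  assumes "open S" "smooth_on S f" "\<And>x. x \<in> S \<Longrightarrow> f x \<noteq> 0"
  shows "smooth_on S (\<lambda>x. inverse (f x))"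
proof (rule smooth_on_bootstrap[OF assms(1)])
  show "((\<lambda>x. inverse (f x)) has_derivative
      (\<lambda>w. - (inverse (f x) * frechet_derivative f (at x) w * inverse (f x)))) (at x)" if "x \<in> S" for x
    using Deriv.has_derivative_inverse[OF assms(3)[OF that] smooth_on_has_derivative[OF assms(1,2) that]] .
  fix k w assume k: "Ck_on k S (\<lambda>x. inverse (f x))"
  have f: "Ck_on k S (\<lambda>x. frechet_derivative f (at x) w)"
    using smooth_on_Ck[OF smooth_on_dd[OF assms(2)]] .
  show "Ck_on k S (\<lambda>x. - (inverse (f x) * frechet_derivative f (at x) w * inverse (f x)))"
    by (intro Ck_on_bounded_linear[OF assms(1) bounded_linear_minus[OF bounded_linear_ident]]
        Ck_on_bilinear[OF assms(1) bounded_bilinear_mult] k f)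
qed

section \<open>Bump functions\<close>

text \<open>The function \<open>p(1/t) exp(-1/t)\<close>, which vanishes to infinite order at \<open>0\<close>. With an arbitrary polynomial \<open>p\<close> the family
  is closed under differentiation, so that smoothness is a plain induction.\<close>

definition flat_fun :: "real poly \<Rightarrow> real \<Rightarrow> real" where
  "flat_fun p t = (if t > 0 then poly p (inverse t) * exp (- inverse t) else 0)"

lemma poly_exp_tendsto_0: "((\<lambda>u::real. poly p u * exp (- u)) \<longlongrightarrow> 0) at_top"
proof -
  have "((\<lambda>u. \<Sum>i\<le>degree p. coeff p i * (u ^ i / exp u)) \<longlongrightarrow> (\<Sum>i\<le>degree p. coeff p i * 0)) at_top"
    by (intro tendsto_sum tendsto_mult tendsto_const tendsto_power_div_exp_0)
  then show ?thesis
    by (simp add: poly_altdef sum_distrib_right exp_minus divide_inverse mult.assoc)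
qed

lemma flat_fun_derivative:
  "(flat_fun p has_field_derivative flat_fun (monom 1 2 * (p - pderiv p)) t) (at t)"
proof -
  consider "t > 0" | "t < 0" | "t = 0" by linarith
  then show ?thesis
  proof cases
    case 1
    have i: "(inverse has_field_derivative - (inverse t ^ Suc (Suc 0))) (at t)"
      using 1 by (intro DERIV_inverse) simp
    have "((\<lambda>t. poly p (inverse t) * exp (- inverse t)) has_field_derivative
        flat_fun (monom 1 2 * (p - pderiv p)) t) (at t)"
      using DERIV_mult'[OF DERIV_chain2[OF poly_DERIV i] DERIV_chain2[OF DERIV_exp DERIV_minus[OF i]]] 1
      by (simp add: flat_fun_def poly_monom algebra_simps power2_eq_square)
    then show ?thesis
      by (rule has_field_derivative_transform_within_open[where S="{0<..}"]) (use 1 in \<open>auto simp: flat_fun_def\<close>)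
  next
    case 2
    have "((\<lambda>t. 0) has_field_derivative 0) (at t)" by simp
    then have "(flat_fun p has_field_derivative 0) (at t)"
      by (rule has_field_derivative_transform_within_open[where S="{..<0}"]) (use 2 in \<open>auto simp: flat_fun_def\<close>)
    then show ?thesis using 2 by (simp add: flat_fun_def)
  next
    case 3
    have "((\<lambda>y. flat_fun p y / y) \<longlongrightarrow> 0) (at_right 0)"
    proof -
      have "((\<lambda>y. poly (monom 1 1 * p) (inverse y) * exp (- inverse y)) \<longlongrightarrow> 0) (at_right (0::real))"
        by (rule filterlim_compose[OF poly_exp_tendsto_0 filterlim_inverse_at_top_right])
      moreover have "\<forall>\<^sub>F y in at_right (0::real). poly (monom 1 1 * p) (inverse y) * exp (- inverse y) = flat_fun p y / y"
        by (auto simp: eventually_at_filter flat_fun_def poly_monom field_simps)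
      ultimately show ?thesis by (rule Lim_transform_eventually)
    qed
    moreover have "((\<lambda>y. flat_fun p y / y) \<longlongrightarrow> 0) (at_left 0)"
      by (rule Lim_transform_eventually[OF tendsto_const]) (auto simp: eventually_at_filter flat_fun_def)
    ultimately have "((\<lambda>y. flat_fun p y / y) \<longlongrightarrow> 0) (at 0)"
      by (simp add: filterlim_split_at)
    then show ?thesis using 3 by (simp add: has_field_derivative_iff flat_fun_def)
  qed
qed

lemma smooth_flat_fun: "smooth_on UNIV (flat_fun p)"
  unfolding smooth_on_def
proof
  fix k show "Ck_on k UNIV (flat_fun p)"
  proof (induction k arbitrary: p)
    case 0 show ?case
      using flat_fun_derivative DERIV_isCont continuous_at_imp_continuous_on by (metis Ck_on.simps(1))
  next
    case (Suc k)
    show ?case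
    proof (rule Ck_on_SucI)
      show "(flat_fun p has_derivative (\<lambda>w. w *\<^sub>R flat_fun (monom 1 2 * (p - pderiv p)) x)) (at x)" for x
        using flat_fun_derivative[of p x] unfolding has_field_derivative_def
        by (rule has_derivative_eq_rhs) (simp add: fun_eq_iff mult.commute)
      show "Ck_on k UNIV (\<lambda>x. w *\<^sub>R flat_fun (monom 1 2 * (p - pderiv p)) x)" for w
        by (intro Ck_on_bounded_linear[OF open_UNIV bounded_linear_scaleR_right] Suc)
    qed simp
  qed
qed

text \<open>The quotient \<open>a / (a + b)\<close>, where \<open>a\<close> is positive exactly inside the ball of radius \<open>r\<close> and \<open>b\<close> exactly outside the
  one of radius \<open>r/2\<close>; so \<open>a + b\<close> has no zero.\<close>

lemma smooth_bump:
  fixes c :: "'e::euclidean_space"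
  assumes "0 < r"
  obtains \<psi> :: "'e \<Rightarrow> real" where "smooth_on UNIV \<psi>" "\<And>x. dist c x \<le> r / 2 \<Longrightarrow> \<psi> x = 1"
    "\<And>x. dist c x \<ge> r \<Longrightarrow> \<psi> x = 0"
proof
  let ?n = "\<lambda>x::'e. (x - c) \<bullet> (x - c)"
  let ?a = "\<lambda>x. flat_fun 1 (r\<^sup>2 - ?n x)" and ?b = "\<lambda>x. flat_fun 1 (?n x - (r/2)\<^sup>2)"
  have pos: "flat_fun 1 t > 0 \<longleftrightarrow> t > 0" "flat_fun 1 t \<ge> 0" for t by (auto simp: flat_fun_def)
  have sq: "?n x = (dist c x)\<^sup>2" for x by (simp add: dist_norm norm_minus_commute[of c x] flip: power2_norm_eq_inner)
  have n: "smooth_on UNIV ?n" by (intro smooth_on_inner smooth_on_diff smooth_on_id) auto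
  have ab: "smooth_on UNIV ?a" "smooth_on UNIV ?b"
    by (intro smooth_on_compose[OF _ _ _ smooth_flat_fun] smooth_on_diff n; simp)+
  have "?a x + ?b x \<noteq> 0" for x
  proof (cases "?n x < r\<^sup>2")
    case True then show ?thesis using pos(1)[of "r\<^sup>2 - ?n x"] pos(2)[of "?n x - (r/2)\<^sup>2"] by linarith
  next
    case False
    moreover have "(r/2)\<^sup>2 < r\<^sup>2" using assms by (simp add: power_strict_mono)
    ultimately show ?thesis using pos(2)[of "r\<^sup>2 - ?n x"] pos(1)[of "?n x - (r/2)\<^sup>2"] by linarith
  qed
  then show "smooth_on UNIV (\<lambda>x. ?a x * inverse (?a x + ?b x))"
    by (intro smooth_on_mult smooth_on_inverse smooth_on_add ab) auto
  show "?a x * inverse (?a x + ?b x) = 1" if "dist c x \<le> r / 2" for x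
  proof -
    have 1: "(dist c x)\<^sup>2 \<le> (r/2)\<^sup>2" using that by (simp add: power_mono)
    moreover have "(r/2)\<^sup>2 < r\<^sup>2" using assms by (simp add: power_strict_mono)
    ultimately have "?b x = 0" "?a x > 0" unfolding sq by (auto simp: flat_fun_def)
    then show ?thesis by simp
  qed
  show "?a x * inverse (?a x + ?b x) = 0" if "dist c x \<ge> r" for x
  proof -
    have "r\<^sup>2 \<le> (dist c x)\<^sup>2" using that assms by (simp add: power_mono)
    then have "?a x = 0" unfolding sq by (auto simp: flat_fun_def)
    then show ?thesis by simp
  qed
qed

section \<open>Averages along rays\<close>

text \<open>The weight \<open>t\<^sup>m\<close> makes the family closed under differentiation in \<open>x\<close>. Hadamard's lemma, the Poincare lemma and Picard
  iteration along rays are all statements about this operator.\<close>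

definition ray_mean :: "nat \<Rightarrow> 'e::euclidean_space \<Rightarrow> ('e \<Rightarrow> 'c::euclidean_space) \<Rightarrow> 'e \<Rightarrow> 'c" where
  "ray_mean m c q x = integral {0..1} (\<lambda>t. t ^ m *\<^sub>R q (c + t *\<^sub>R (x - c)))"

lemma ray_in:
  fixes c x :: "'e::euclidean_space"
  assumes "convex S" "c \<in> S" "x \<in> S" "0 \<le> t" "t \<le> (1::real)"
  shows "c + t *\<^sub>R (x - c) \<in> S"
proof -
  have "c + t *\<^sub>R (x - c) = (1 - t) *\<^sub>R c + t *\<^sub>R x" by (simp add: algebra_simps)
  then show ?thesis using assms by (simp add: convex_alt)
qed

lemma ray_continuous:
  fixes q :: "'e::euclidean_space \<Rightarrow> 'c::euclidean_space"
  assumes "convex S" "c \<in> S" "continuous_on S q"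
  shows "continuous_on (S \<times> {0..1}) (\<lambda>(x, t). t ^ m *\<^sub>R q (c + t *\<^sub>R (x - c)))"
  unfolding case_prod_beta
  by (intro continuous_intros continuous_on_compose2[OF assms(3)]) (use ray_in[OF assms(1,2)] in auto)

lemma ray_integrable:
  fixes q :: "'e::euclidean_space \<Rightarrow> 'c::euclidean_space"
  assumes "convex S" "c \<in> S" "continuous_on S q" "x \<in> S"
  shows "(\<lambda>t. t ^ m *\<^sub>R q (c + t *\<^sub>R (x - c))) integrable_on {0..1}"
  by (intro integrable_continuous_interval continuous_intros continuous_on_compose2[OF assms(3)])
    (use ray_in[OF assms(1,2,4)] in auto)

lemma ray_mean_cong:
  fixes q :: "'e::euclidean_space \<Rightarrow> 'c::euclidean_space"
  assumes "convex S" "c \<in> S" "x \<in> S" "\<And>y. y \<in> S \<Longrightarrow> q y = q' y"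
  shows "ray_mean m c q x = ray_mean m c q' x"
  unfolding ray_mean_def by (intro integral_cong) (use assms ray_in[OF assms(1,2,3)] in auto)

lemma ray_mean_add:
  fixes q :: "'e::euclidean_space \<Rightarrow> 'c::euclidean_space"
  assumes "convex S" "c \<in> S" "x \<in> S" "continuous_on S q" "continuous_on S q'"
  shows "ray_mean m c (\<lambda>y. q y + q' y) x = ray_mean m c q x + ray_mean m c q' x"
  unfolding ray_mean_def scaleR_add_right
  by (intro integral_add ray_integrable[OF assms(1,2)] assms)

lemma ray_mean_diff:
  fixes q :: "'e::euclidean_space \<Rightarrow> 'c::euclidean_space"
  assumes "convex S" "c \<in> S" "x \<in> S" "continuous_on S q" "continuous_on S q'"
  shows "ray_mean m c (\<lambda>y. q y - q' y) x = ray_mean m c q x - ray_mean m c q' x"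
  using integral_diff[OF ray_integrable[OF assms(1,2,4,3)] ray_integrable[OF assms(1,2,5,3)], of m m]
  unfolding ray_mean_def by (simp add: scaleR_diff_right)

lemma ray_mean_scaleR: "ray_mean m c (\<lambda>y. a *\<^sub>R q y) x = a *\<^sub>R ray_mean m c q x"
  using integral_cmul[of "{0..1}" a "\<lambda>t. t ^ m *\<^sub>R q (c + t *\<^sub>R (x - c))"]
  unfolding ray_mean_def by (simp add: mult.commute)

lemma ray_mean_sum:
  fixes q :: "'i \<Rightarrow> 'e::euclidean_space \<Rightarrow> 'c::euclidean_space"
  assumes "convex S" "c \<in> S" "x \<in> S" "finite I" "\<And>i. i \<in> I \<Longrightarrow> continuous_on S (q i)"
  shows "ray_mean m c (\<lambda>y. \<Sum>i\<in>I. q i y) x = (\<Sum>i\<in>I. ray_mean m c (q i) x)"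
  using assms(4,5)
proof (induction I rule: finite_induct)
  case empty then show ?case by (simp add: ray_mean_def)
next
  case (insert i I) then show ?case
    by (simp add: ray_mean_add[OF assms(1-3)] continuous_on_sum)
qed

lemma ray_mean_has_derivative:
  fixes q :: "'e::euclidean_space \<Rightarrow> 'c::euclidean_space"
  assumes "convex S" "open S" "c \<in> S" "x \<in> S" "Ck_on 1 S q"
  shows "(ray_mean m c q has_derivative
    (\<lambda>w. ray_mean (Suc m) c (\<lambda>y. frechet_derivative q (at y) w) x)) (at x)"
proof -
  let ?l = "\<lambda>x t. c + t *\<^sub>R (x - c)"
  have C: "Ck_on (Suc 0) S q" using assms(5) by simp
  have cd: "continuous_on S (\<lambda>y. frechet_derivative q (at y) w)" for w using C by simp
  note hd = Ck_on_has_derivative[OF assms(2) C]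
  have bl: "bounded_linear (frechet_derivative q (at y))" if "y \<in> S" for y
    using hd[OF that] has_derivative_bounded_linear by blast
  define fx where "fx = (\<lambda>x t. Blinfun (\<lambda>w. t ^ Suc m *\<^sub>R frechet_derivative q (at (?l x t)) w))"
  have fxa: "blinfun_apply (fx x t) = (\<lambda>w. t ^ Suc m *\<^sub>R frechet_derivative q (at (?l x t)) w)"
    if "x \<in> S" "t \<in> {0..1}" for x t
    unfolding fx_def using bl[OF ray_in[OF assms(1,3) that(1)]] that(2)
    by (intro bounded_linear_Blinfun_apply bounded_linear_const_scaleR) auto
  have cont: "continuous_on (S \<times> {0..1}) (\<lambda>(x, t). fx x t)"
  proof (rule continuous_on_blinfun_componentwise)
    fix i :: 'e
    show "continuous_on (S \<times> {0..1}) (\<lambda>z. blinfun_apply (case z of (x, t) \<Rightarrow> fx x t) i)"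
      by (rule continuous_on_eq[OF ray_continuous[OF assms(1,3) cd[of i], of "Suc m"]]) (auto simp: fxa)
  qed
  have "((\<lambda>x. integral (cbox 0 1) (\<lambda>t. t ^ m *\<^sub>R q (?l x t))) has_derivative
      blinfun_apply (integral (cbox 0 1) (fx x))) (at x within S)"
  proof (rule leibniz_rule[OF _ _ _ assms(4,1)])
    fix x t assume "x \<in> S" and t: "t \<in> cbox 0 (1::real)"
    then have "?l x t \<in> S" using ray_in[OF assms(1,3)] by auto
    have "((\<lambda>x. ?l x t) has_derivative (\<lambda>w. t *\<^sub>R w)) (at x within S)"
      by (auto intro!: derivative_eq_intros)
    from has_derivative_compose[OF this hd[OF \<open>?l x t \<in> S\<close>]]
    have "((\<lambda>x. t ^ m *\<^sub>R q (?l x t)) has_derivative (\<lambda>w. t ^ m *\<^sub>R frechet_derivative q (at (?l x t)) (t *\<^sub>R w))) (at x within S)"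
      by (rule has_derivative_scaleR_right)
    moreover have "(\<lambda>w. t ^ m *\<^sub>R frechet_derivative q (at (?l x t)) (t *\<^sub>R w)) = blinfun_apply (fx x t)"
      using fxa[OF \<open>x \<in> S\<close>] t linear_scale[OF bounded_linear.linear[OF bl[OF \<open>?l x t \<in> S\<close>]]] by auto
    ultimately show "((\<lambda>x. t ^ m *\<^sub>R q (?l x t)) has_derivative blinfun_apply (fx x t)) (at x within S)" by simp
  next
    show "(\<lambda>t. t ^ m *\<^sub>R q (?l x t)) integrable_on cbox 0 1" if "x \<in> S" for x
      using ray_integrable[OF assms(1,3) Ck_on_continuous[OF C] that] by simp
    show "continuous_on (S \<times> cbox 0 1) (\<lambda>(x, t). fx x t)" using cont by simp
  qed
  moreover have "blinfun_apply (integral (cbox 0 1) (fx x))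
      = (\<lambda>w. ray_mean (Suc m) c (\<lambda>y. frechet_derivative q (at y) w) x)"
  proof
    fix w
    have "continuous_on {0..1} (\<lambda>t. (x, t))" by (intro continuous_intros)
    from continuous_on_compose2[OF cont this] have "continuous_on {0..1} (fx x)"
      using assms(4) by auto
    then have "fx x integrable_on cbox 0 1" by (simp add: integrable_continuous_interval)
    then show "blinfun_apply (integral (cbox 0 1) (fx x)) w
      = ray_mean (Suc m) c (\<lambda>y. frechet_derivative q (at y) w) x" unfolding ray_mean_def
      by (subst blinfun_apply_integral) (auto intro!: integral_cong simp: fxa[OF assms(4)])
  qed
  ultimately show ?thesis
    unfolding ray_mean_def[abs_def] by (simp only: at_within_open[OF assms(4,2)] cbox_interval)
qed

lemma Ck_on_ray_mean:
  fixes q :: "'e::euclidean_space \<Rightarrow> 'c::euclidean_space"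
  assumes "convex S" "open S" "c \<in> S" "Ck_on k S q"
  shows "Ck_on k S (ray_mean m c q)"
  using assms(4)
proof (induction k arbitrary: q m)
  case 0
  then have "continuous_on (S \<times> cbox 0 1) (\<lambda>(x, t). t ^ m *\<^sub>R q (c + t *\<^sub>R (x - c)))"
    using ray_continuous[OF assms(1,3)] by simp
  from integral_continuous_on_param[OF this] show ?case by (simp add: ray_mean_def[abs_def])
next
  case (Suc k)
  then have "Ck_on 1 S q" using Ck_on_le[of "Suc k" S q 1] by simp
  then show ?case
    using Suc by (intro Ck_on_SucI[OF assms(2) ray_mean_has_derivative[OF assms(1-3)]]) auto
qed

text \<open>The fundamental theorem of calculus for \<open>t q(c + t(x - c))\<close> and for \<open>q(c + t(x - c))\<close>.\<close>

lemma ray_mean_parts: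
  fixes q :: "'e::euclidean_space \<Rightarrow> 'c::euclidean_space"
  assumes "convex S" "open S" "c \<in> S" "x \<in> S" "Ck_on 1 S q"
  shows "ray_mean 0 c q x + ray_mean 1 c (\<lambda>y. frechet_derivative q (at y) (x - c)) x = q x"
    and "ray_mean 0 c (\<lambda>y. frechet_derivative q (at y) (x - c)) x = q x - q c"
proof -
  let ?l = "\<lambda>t. c + t *\<^sub>R (x - c)"
  have C: "Ck_on (Suc 0) S q" using assms(5) by simp
  have cd: "continuous_on S (\<lambda>y. frechet_derivative q (at y) w)" for w using C by simp
  note hd = Ck_on_has_derivative[OF assms(2) C]
  have q: "((\<lambda>t. q (?l t)) has_vector_derivative frechet_derivative q (at (?l t)) (x - c)) (at t within {0..1})"
    if "t \<in> {0..1}" for t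
  proof -
    have lS: "?l t \<in> S" using ray_in[OF assms(1,3,4)] that by auto
    have "(?l has_derivative (\<lambda>s. s *\<^sub>R (x - c))) (at t within {0..1})" by (auto intro!: derivative_eq_intros)
    from has_derivative_compose[OF this hd[OF lS]] show ?thesis
      unfolding has_vector_derivative_def
      using linear_scale[OF bounded_linear.linear[OF has_derivative_bounded_linear[OF hd[OF lS]]]] by simp
  qed
  have "((\<lambda>t. frechet_derivative q (at (?l t)) (x - c)) has_integral q (?l 1) - q (?l 0)) {0..1}"
    using q by (intro fundamental_theorem_of_calculus) auto
  then show "ray_mean 0 c (\<lambda>y. frechet_derivative q (at y) (x - c)) x = q x - q c"
    unfolding ray_mean_def by (simp add: integral_unique)
  have "((\<lambda>t. t *\<^sub>R frechet_derivative q (at (?l t)) (x - c) + 1 *\<^sub>R q (?l t)) has_integral 1 *\<^sub>R q (?l 1) - 0 *\<^sub>R q (?l 0)) {0..1}"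
    by (intro fundamental_theorem_of_calculus has_vector_derivative_scaleR q) (auto intro: DERIV_subset)
  then have "q x = integral {0..1} (\<lambda>t. t ^ 1 *\<^sub>R frechet_derivative q (at (?l t)) (x - c) + t ^ 0 *\<^sub>R q (?l t))"
    by (simp add: integral_unique)
  also have "\<dots> = ray_mean 1 c (\<lambda>y. frechet_derivative q (at y) (x - c)) x + ray_mean 0 c q x"
    unfolding ray_mean_def
    by (intro integral_add ray_integrable[OF assms(1,3) _ assms(4)] cd Ck_on_continuous[OF C])
  finally show "ray_mean 0 c q x + ray_mean 1 c (\<lambda>y. frechet_derivative q (at y) (x - c)) x = q x"
    by simp
qed

section \<open>The Poincare lemma and the symmetry of second derivatives\<close>

lemma linear_basis_sum:
  fixes L :: "'e::euclidean_space \<Rightarrow> 'c::real_normed_vector"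
  assumes "linear L"
  shows "L w = (\<Sum>b\<in>Basis. (w \<bullet> b) *\<^sub>R L b)"
  using linear_sum[OF assms, of "\<lambda>b. (w \<bullet> b) *\<^sub>R b" Basis]
  by (simp add: euclidean_representation linear_cmul[OF assms])

text \<open>The product rule for a family of linear maps applied to a function. The family is only known to be
  differentiable at each fixed argument; expanding \<open>f\<close> in the basis reduces to that.\<close>

lemma has_derivative_linear_family:
  fixes T :: "'e::euclidean_space \<Rightarrow> 'd::euclidean_space \<Rightarrow> 'g::real_normed_vector"
  assumes "open S" "x \<in> S" "\<And>y. y \<in> S \<Longrightarrow> linear (T y)"
    "\<And>v. (\<lambda>y. T y v) differentiable (at x)" "(f has_derivative f') (at x)"
  shows "((\<lambda>y. T y (f y)) has_derivative
    (\<lambda>w. frechet_derivative (\<lambda>y. T y (f x)) (at x) w + T x (f' w))) (at x)"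
proof -
  have d: "((\<lambda>y. T y v) has_derivative frechet_derivative (\<lambda>y. T y v) (at x)) (at x)" for v
    using assms(4) frechet_derivative_works by blast
  have 1: "((\<lambda>y. \<Sum>b\<in>Basis. a b *\<^sub>R T y b) has_derivative
      (\<lambda>w. \<Sum>b\<in>Basis. a b *\<^sub>R frechet_derivative (\<lambda>y. T y b) (at x) w)) (at x)" for a :: "'d \<Rightarrow> real"
    by (intro has_derivative_sum has_derivative_scaleR_right d)
  have "((\<lambda>y. T y v) has_derivative
      (\<lambda>w. \<Sum>b\<in>Basis. (v \<bullet> b) *\<^sub>R frechet_derivative (\<lambda>y. T y b) (at x) w)) (at x)" for v
    by (rule has_derivative_transform_within_open[OF 1 assms(1,2)])
      (rule linear_basis_sum[OF assms(3), symmetric])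
  then have 2: "frechet_derivative (\<lambda>y. T y v) (at x)
      = (\<lambda>w. \<Sum>b\<in>Basis. (v \<bullet> b) *\<^sub>R frechet_derivative (\<lambda>y. T y b) (at x) w)" for v
    by (rule frechet_derivative_at[symmetric])
  have 3: "((\<lambda>y. \<Sum>b\<in>Basis. (f y \<bullet> b) *\<^sub>R T y b) has_derivative
      (\<lambda>w. \<Sum>b\<in>Basis. (f x \<bullet> b) *\<^sub>R frechet_derivative (\<lambda>y. T y b) (at x) w + (f' w \<bullet> b) *\<^sub>R T x b)) (at x)"
    by (intro has_derivative_sum has_derivative_scaleR has_derivative_inner_left assms(5) d)
  have "((\<lambda>y. T y (f y)) has_derivative
      (\<lambda>w. \<Sum>b\<in>Basis. (f x \<bullet> b) *\<^sub>R frechet_derivative (\<lambda>y. T y b) (at x) w + (f' w \<bullet> b) *\<^sub>R T x b)) (at x)"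
    by (rule has_derivative_transform_within_open[OF 3 assms(1,2)])
      (rule linear_basis_sum[OF assms(3), symmetric])
  then show ?thesis
    by (rule has_derivative_eq_rhs)
      (intro ext, simp only: 2[of "f x"] sum.distrib linear_basis_sum[OF assms(3)[OF assms(2)], symmetric])
qed

lemma Ck_on_linear_family:
  fixes T :: "'e::euclidean_space \<Rightarrow> 'd::euclidean_space \<Rightarrow> 'g::real_normed_vector"
  assumes "open S" "\<And>y. y \<in> S \<Longrightarrow> linear (T y)" "\<And>v. Ck_on k S (\<lambda>y. T y v)" "Ck_on k S f"
  shows "Ck_on k S (\<lambda>y. T y (f y))"
proof (rule Ck_on_cong[OF assms(1)])
  show "(\<Sum>b\<in>Basis. (f y \<bullet> b) *\<^sub>R T y b) = T y (f y)" if "y \<in> S" for y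
    using linear_basis_sum[OF assms(2)[OF that]] by metis
  show "Ck_on k S (\<lambda>y. \<Sum>b\<in>Basis. (f y \<bullet> b) *\<^sub>R T y b)"
    by (intro Ck_on_sum Ck_on_bilinear[OF _ bounded_bilinear_scaleR]
        Ck_on_bounded_linear[OF _ bounded_linear_inner_left] assms)
qed

lemma smooth_on_linear_family:
  fixes T :: "'e::euclidean_space \<Rightarrow> 'd::euclidean_space \<Rightarrow> 'g::real_normed_vector"
  assumes "open S" "\<And>y. y \<in> S \<Longrightarrow> linear (T y)" "\<And>v. smooth_on S (\<lambda>y. T y v)" "smooth_on S f"
  shows "smooth_on S (\<lambda>y. T y (f y))"
  using assms by (simp add: smooth_on_def Ck_on_linear_family)

text \<open>The homotopy formula \<open>d(h \<eta>) + h(d\<eta>) = \<eta>\<close> for a one-form \<open>\<eta>\<close> on a convex set, where \<open>h\<close> integrates along the rays from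
  \<open>c\<close>.\<close>

lemma homotopy_derivative:
  fixes \<eta> :: "'e::euclidean_space \<Rightarrow> 'e \<Rightarrow> 'c::euclidean_space"
  assumes "convex S" "open S" "c \<in> S" "x \<in> S" "\<And>y. y \<in> S \<Longrightarrow> linear (\<eta> y)"
    "\<And>v. Ck_on 1 S (\<lambda>y. \<eta> y v)"
  shows "((\<lambda>x. ray_mean 0 c (\<lambda>y. \<eta> y (x - c)) x) has_derivative
    (\<lambda>v. \<eta> x v + ray_mean 1 c (\<lambda>y. frechet_derivative (\<lambda>z. \<eta> z (x - c)) (at y) v
        - frechet_derivative (\<lambda>z. \<eta> z v) (at y) (x - c)) x)) (at x)"
proof -
  have C: "Ck_on (Suc 0) S (\<lambda>y. \<eta> y v)" for v using assms(6) by simp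
  have cont: "continuous_on S (\<lambda>y. \<eta> y v)"
    "continuous_on S (\<lambda>y. frechet_derivative (\<lambda>z. \<eta> z v) (at y) w)" for v w
    using C[of v] Ck_on_continuous[OF C] by auto
  have df: "(\<lambda>z. \<eta> z v) differentiable (at y)" if "y \<in> S" for v y
    using Ck_on_has_derivative[OF assms(2) C that] differentiable_def by blast
  have ex: "ray_mean m c (\<lambda>y. \<eta> y h) z = (\<Sum>b\<in>Basis. (h \<bullet> b) *\<^sub>R ray_mean m c (\<lambda>y. \<eta> y b) z)"
    if "z \<in> S" for z h m
  proof -
    have "ray_mean m c (\<lambda>y. \<eta> y h) z = ray_mean m c (\<lambda>y. \<Sum>b\<in>Basis. (h \<bullet> b) *\<^sub>R \<eta> y b) z"
      by (intro ray_mean_cong[OF assms(1,3) that] linear_basis_sum assms(5))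
    also have "\<dots> = (\<Sum>b\<in>Basis. ray_mean m c (\<lambda>y. (h \<bullet> b) *\<^sub>R \<eta> y b) z)"
      by (rule ray_mean_sum[OF assms(1,3) that finite_Basis]) (intro continuous_on_scaleR continuous_on_const cont(1))
    finally show ?thesis by (simp add: ray_mean_scaleR)
  qed
  let ?h = "x - c"
  have dsum: "frechet_derivative (\<lambda>z. \<eta> z ?h) (at y) v
      = (\<Sum>b\<in>Basis. (?h \<bullet> b) *\<^sub>R frechet_derivative (\<lambda>z. \<eta> z b) (at y) v)" if "y \<in> S" for y v
  proof -
    have "((\<lambda>z. \<Sum>b\<in>Basis. (?h \<bullet> b) *\<^sub>R \<eta> z b) has_derivative
        (\<lambda>v. \<Sum>b\<in>Basis. (?h \<bullet> b) *\<^sub>R frechet_derivative (\<lambda>z. \<eta> z b) (at y) v)) (at y)"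
      by (intro has_derivative_sum has_derivative_scaleR_right Ck_on_has_derivative[OF assms(2) C that])
    then have "((\<lambda>z. \<eta> z ?h) has_derivative
        (\<lambda>v. \<Sum>b\<in>Basis. (?h \<bullet> b) *\<^sub>R frechet_derivative (\<lambda>z. \<eta> z b) (at y) v)) (at y)"
      by (rule has_derivative_transform_within_open[OF _ assms(2) that])
        (rule linear_basis_sum[OF assms(5), symmetric])
    from fun_cong[OF frechet_derivative_at[OF this], of v] show ?thesis by (rule sym)
  qed
  have dRM: "(\<Sum>b\<in>Basis. (?h \<bullet> b) *\<^sub>R ray_mean 1 c (\<lambda>y. frechet_derivative (\<lambda>z. \<eta> z b) (at y) v) x)
      = ray_mean 1 c (\<lambda>y. frechet_derivative (\<lambda>z. \<eta> z ?h) (at y) v) x" for v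
  proof -
    have "ray_mean 1 c (\<lambda>y. frechet_derivative (\<lambda>z. \<eta> z ?h) (at y) v) x
        = ray_mean 1 c (\<lambda>y. \<Sum>b\<in>Basis. (?h \<bullet> b) *\<^sub>R frechet_derivative (\<lambda>z. \<eta> z b) (at y) v) x"
      by (rule ray_mean_cong[OF assms(1,3,4)]) (rule dsum)
    also have "\<dots> = (\<Sum>b\<in>Basis. ray_mean 1 c (\<lambda>y. (?h \<bullet> b) *\<^sub>R frechet_derivative (\<lambda>z. \<eta> z b) (at y) v) x)"
      by (rule ray_mean_sum[OF assms(1,3,4) finite_Basis]) (intro continuous_on_scaleR continuous_on_const cont(2))
    finally show ?thesis by (simp add: ray_mean_scaleR)
  qed
  have "((\<lambda>x. \<Sum>b\<in>Basis. ((x - c) \<bullet> b) *\<^sub>R ray_mean 0 c (\<lambda>y. \<eta> y b) x) has_derivative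
      (\<lambda>v. \<Sum>b\<in>Basis. (?h \<bullet> b) *\<^sub>R ray_mean (Suc 0) c (\<lambda>y. frechet_derivative (\<lambda>z. \<eta> z b) (at y) v) x
        + ((v - 0) \<bullet> b) *\<^sub>R ray_mean 0 c (\<lambda>y. \<eta> y b) x)) (at x)"
    by (intro has_derivative_sum has_derivative_scaleR has_derivative_inner_left has_derivative_diff
        has_derivative_ident has_derivative_const ray_mean_has_derivative[OF assms(1-4)] assms(6))
  then have "((\<lambda>x. ray_mean 0 c (\<lambda>y. \<eta> y (x - c)) x) has_derivative
      (\<lambda>v. \<Sum>b\<in>Basis. (?h \<bullet> b) *\<^sub>R ray_mean (Suc 0) c (\<lambda>y. frechet_derivative (\<lambda>z. \<eta> z b) (at y) v) x
        + ((v - 0) \<bullet> b) *\<^sub>R ray_mean 0 c (\<lambda>y. \<eta> y b) x)) (at x)"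
    by (rule has_derivative_transform_within_open[OF _ assms(2,4)]) (rule ex[symmetric])
  then show ?thesis
  proof (rule has_derivative_eq_rhs, intro ext)
    fix v
    have "(\<Sum>b\<in>Basis. (?h \<bullet> b) *\<^sub>R ray_mean (Suc 0) c (\<lambda>y. frechet_derivative (\<lambda>z. \<eta> z b) (at y) v) x
        + ((v - 0) \<bullet> b) *\<^sub>R ray_mean 0 c (\<lambda>y. \<eta> y b) x)
      = ray_mean 1 c (\<lambda>y. frechet_derivative (\<lambda>z. \<eta> z ?h) (at y) v) x + ray_mean 0 c (\<lambda>y. \<eta> y v) x"
      using dRM[of v] ex[OF assms(4), of 0 v] by (simp add: sum.distrib)
    also have "ray_mean 0 c (\<lambda>y. \<eta> y v) x
        = \<eta> x v - ray_mean 1 c (\<lambda>y. frechet_derivative (\<lambda>z. \<eta> z v) (at y) ?h) x"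
      using ray_mean_parts(1)[OF assms(1-4,6), of v] by (simp add: algebra_simps)
    finally show "(\<Sum>b\<in>Basis. (?h \<bullet> b) *\<^sub>R ray_mean (Suc 0) c (\<lambda>y. frechet_derivative (\<lambda>z. \<eta> z b) (at y) v) x
        + ((v - 0) \<bullet> b) *\<^sub>R ray_mean 0 c (\<lambda>y. \<eta> y b) x) = \<eta> x v + ray_mean 1 c (\<lambda>y. frechet_derivative (\<lambda>z. \<eta> z (x - c)) (at y) v
        - frechet_derivative (\<lambda>z. \<eta> z v) (at y) (x - c)) x"
      by (subst ray_mean_diff[OF assms(1,3,4) cont(2) cont(2)]) simp
  qed
qed

lemma ray_mean_zero: "ray_mean m c (\<lambda>y. 0) x = 0"
  by (simp add: ray_mean_def)

lemma poincare_lemma: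
  fixes \<eta> :: "'e::euclidean_space \<Rightarrow> 'e \<Rightarrow> 'c::euclidean_space"
  assumes "convex S" "open S" "c \<in> S" "\<And>y. y \<in> S \<Longrightarrow> linear (\<eta> y)"
    "\<And>v. Ck_on 1 S (\<lambda>y. \<eta> y v)"
    "\<And>y u v. y \<in> S \<Longrightarrow> frechet_derivative (\<lambda>z. \<eta> z u) (at y) v = frechet_derivative (\<lambda>z. \<eta> z v) (at y) u"
  obtains f where "\<And>x. x \<in> S \<Longrightarrow> (f has_derivative \<eta> x) (at x)"
proof
  fix x assume x: "x \<in> S"
  have "ray_mean 1 c (\<lambda>y. frechet_derivative (\<lambda>z. \<eta> z (x - c)) (at y) v
        - frechet_derivative (\<lambda>z. \<eta> z v) (at y) (x - c)) x = ray_mean 1 c (\<lambda>y. 0) x" for v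
    by (rule ray_mean_cong[OF assms(1,3) x]) (simp add: assms(6))
  then show "((\<lambda>x. ray_mean 0 c (\<lambda>y. \<eta> y (x - c)) x) has_derivative \<eta> x) (at x)"
    using homotopy_derivative[OF assms(1-3) x assms(4,5)] by (simp add: ray_mean_zero)
qed

text \<open>Apply the homotopy formula to the form \<open>df\<close>. Since \<open>h(df) = f - f(c)\<close>, the ray mean of the skew part \<open>W\<close>
  of the second derivative vanishes. At the point \<open>c + s u\<close> it is \<open>s\<close> times a continuous function of \<open>s\<close> with value
  \<open>W(c)/2\<close> at \<open>0\<close>.\<close>

lemma second_derivative_symmetric:
  fixes f :: "'e::euclidean_space \<Rightarrow> 'c::euclidean_space"
  assumes "open S" "c \<in> S" "smooth_on S f"
  shows "frechet_derivative (\<lambda>y. frechet_derivative f (at y) u) (at c) v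
       = frechet_derivative (\<lambda>y. frechet_derivative f (at y) v) (at c) u"
proof -
  obtain r where r: "r > 0" "ball c r \<subseteq> S" using assms(1,2) open_contains_ball by blast
  let ?B = "ball c r"
  have B: "convex ?B" "open ?B" "c \<in> ?B" using r by auto
  have f: "smooth_on ?B f" using smooth_on_subset[OF assms(1) B(2) r(2) assms(3)] .
  define \<eta> where "\<eta> = (\<lambda>y. frechet_derivative f (at y))"
  have lin: "linear (\<eta> y)" if "y \<in> ?B" for y
    unfolding \<eta>_def using smooth_on_has_derivative[OF B(2) f that] has_derivative_bounded_linear bounded_linear.linear by blast
  have sm: "smooth_on ?B (\<lambda>y. \<eta> y v)" for v
    unfolding \<eta>_def by (rule smooth_on_dd[OF f])
  define W where "W = (\<lambda>h v y. frechet_derivative (\<lambda>z. \<eta> z h) (at y) v - frechet_derivative (\<lambda>z. \<eta> z v) (at y) h)"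
  have eq: "ray_mean 0 c (\<lambda>y. \<eta> y (x - c)) x + f c = f x" if "x \<in> ?B" for x
    using ray_mean_parts(2)[OF B that smooth_on_Ck[OF f]] by (simp add: \<eta>_def)
  have z: "ray_mean 1 c (W (x - c) v) x = 0" if x: "x \<in> ?B" for x v
  proof -
    have "((\<lambda>x. ray_mean 0 c (\<lambda>y. \<eta> y (x - c)) x + f c) has_derivative
       (\<lambda>v. \<eta> x v + ray_mean 1 c (W (x - c) v) x)) (at x)"
      unfolding W_def using homotopy_derivative[OF B x lin smooth_on_Ck[OF sm]]
      by (intro has_derivative_add_const) auto
    then have "(f has_derivative (\<lambda>v. \<eta> x v + ray_mean 1 c (W (x - c) v) x)) (at x)"
      by (rule has_derivative_transform_within_open[OF _ B(2) x]) (rule eq)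
    from frechet_derivative_at[OF this]
    have "(\<lambda>v. \<eta> x v + ray_mean 1 c (W (x - c) v) x) = \<eta> x" by (simp only: \<eta>_def)
    from fun_cong[OF this, of v] show ?thesis by simp
  qed
  have Wh: "W (s *\<^sub>R h) v y = s *\<^sub>R W h v y" if "y \<in> ?B" for s h v y
  proof -
    note d = smooth_on_has_derivative[OF B(2) sm that]
    have "((\<lambda>z. s *\<^sub>R \<eta> z h) has_derivative (\<lambda>w. s *\<^sub>R frechet_derivative (\<lambda>z. \<eta> z h) (at y) w)) (at y)"
      by (intro has_derivative_scaleR_right d)
    then have "((\<lambda>z. \<eta> z (s *\<^sub>R h)) has_derivative (\<lambda>w. s *\<^sub>R frechet_derivative (\<lambda>z. \<eta> z h) (at y) w)) (at y)"
      by (rule has_derivative_transform_within_open[OF _ B(2) that]) (simp add: linear_cmul[OF lin])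
    from fun_cong[OF frechet_derivative_at[OF this], of v]
    have "frechet_derivative (\<lambda>z. \<eta> z (s *\<^sub>R h)) (at y) v = s *\<^sub>R frechet_derivative (\<lambda>z. \<eta> z h) (at y) v"
      by (rule sym)
    moreover have "frechet_derivative (\<lambda>z. \<eta> z v) (at y) (s *\<^sub>R h) = s *\<^sub>R frechet_derivative (\<lambda>z. \<eta> z v) (at y) h"
      using linear_cmul[OF bounded_linear.linear[OF has_derivative_bounded_linear[OF d]]] by blast
    ultimately show ?thesis by (simp add: W_def scaleR_diff_right)
  qed
  have smW: "smooth_on ?B (W h v)" for h v
    unfolding W_def by (intro smooth_on_diff smooth_on_dd sm B)
  have "W u v c = 0"
  proof -
    let ?g = "\<lambda>s. ray_mean 1 c (W u v) (c + s *\<^sub>R u)"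
    have "isCont (ray_mean 1 c (W u v)) c"
      using Ck_on_continuous[OF Ck_on_ray_mean[OF B smooth_on_Ck[OF smW]]] B continuous_on_eq_continuous_at by blast
    moreover have lim: "((\<lambda>s::real. c + s *\<^sub>R u) \<longlongrightarrow> c) (at 0)"
      by (rule tendsto_eq_intros refl | simp)+
    ultimately have "(?g \<longlongrightarrow> ray_mean 1 c (W u v) c) (at 0)" by (rule isCont_tendsto_compose)
    moreover have "(?g \<longlongrightarrow> 0) (at 0)"
    proof (rule Lim_transform_eventually[OF tendsto_const])
      have "\<forall>\<^sub>F s in at 0. c + s *\<^sub>R u \<in> ?B" using topological_tendstoD[OF lim B(2,3)] .
      then show "\<forall>\<^sub>F s in at 0. 0 = ?g s"
      proof (rule eventually_mono[OF eventually_conj[OF _ eventually_neq_at_within[of 0]]], elim conjE)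
        fix s :: real assume s: "c + s *\<^sub>R u \<in> ?B" "s \<noteq> 0"
        have "0 = ray_mean 1 c (W (s *\<^sub>R u) v) (c + s *\<^sub>R u)" using z[OF s(1), of v] by simp
        also have "\<dots> = ray_mean 1 c (\<lambda>y. s *\<^sub>R W u v y) (c + s *\<^sub>R u)"
          by (rule ray_mean_cong[OF B(1,3) s(1) Wh])
        also have "\<dots> = s *\<^sub>R ?g s" by (rule ray_mean_scaleR)
        finally show "0 = ?g s" using s(2) by simp
      qed
    qed
    ultimately have "ray_mean 1 c (W u v) c = 0" by (rule tendsto_unique[OF at_neq_bot])
    moreover have "ray_mean 1 c (W u v) c = (1/2) *\<^sub>R W u v c"
      by (simp add: ray_mean_def integral_unique[OF has_integral_scaleR_left[OF ident_has_integral]])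
    ultimately show ?thesis by simp
  qed
  then show ?thesis by (simp add: W_def \<eta>_def)
qed

section \<open>Linear equations with smooth coefficients\<close>

text \<open>Continuity of \<open>a\<close> is enough here, since the change of \<open>a\<close> is multiplied by \<open>b\<close>, which is of first order.\<close>

lemma has_derivative_scaleR_vanishing:
  fixes b :: "'e::euclidean_space \<Rightarrow> 'g::real_normed_vector"
  assumes a: "isCont a x" and b: "(b has_derivative b') (at x)" "b x = 0"
  shows "((\<lambda>y. a y *\<^sub>R b y) has_derivative (\<lambda>w. a x *\<^sub>R b' w)) (at x)"
proof -
  have bl: "bounded_linear b'" using b(1) has_derivative_bounded_linear by blast
  then obtain K where K: "\<And>w. norm (b' w) \<le> norm w * K" "0 \<le> K" using bounded_linear.nonneg_bounded by blast
  let ?q = "\<lambda>y. norm (b y - b x - b' (y - x)) / norm (y - x)"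
  have q: "(?q \<longlongrightarrow> 0) (at x)" using b(1) unfolding has_derivative_iff_norm by blast
  have lim: "((\<lambda>y. \<bar>a y - a x\<bar> * (?q y + K)) \<longlongrightarrow> \<bar>a x - a x\<bar> * (0 + K)) (at x)"
    by (intro tendsto_mult tendsto_rabs tendsto_diff tendsto_add q tendsto_const a[unfolded isCont_def])
  have "((\<lambda>y. norm ((a y - a x) *\<^sub>R b y - (a x - a x) *\<^sub>R b x - 0) / norm (y - x)) \<longlongrightarrow> 0) (at x)"
  proof (rule Lim_null_comparison)
    show "\<forall>\<^sub>F y in at x. norm (norm ((a y - a x) *\<^sub>R b y - (a x - a x) *\<^sub>R b x - 0) / norm (y - x)) \<le> \<bar>a y - a x\<bar> * (?q y + K)"
    proof (rule eventually_at_filter[THEN iffD2], rule always_eventually, intro allI impI)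
      fix y assume y: "y \<noteq> x"
      have "norm (b y) \<le> norm (b y - b x - b' (y - x)) + norm (y - x) * K"
        using norm_triangle_sub[of "b y" "b' (y - x)"] K(1)[of "y - x"] b(2) by simp
      then have "norm (b y) / norm (y - x) \<le> ?q y + K"
        using y by (simp add: field_simps)
      then have "\<bar>a y - a x\<bar> * (norm (b y) / norm (y - x)) \<le> \<bar>a y - a x\<bar> * (?q y + K)"
        by (rule mult_left_mono) simp
      then show "norm (norm ((a y - a x) *\<^sub>R b y - (a x - a x) *\<^sub>R b x - 0) / norm (y - x)) \<le> \<bar>a y - a x\<bar> * (?q y + K)"
        by simp
    qed
    show "((\<lambda>y. \<bar>a y - a x\<bar> * (?q y + K)) \<longlongrightarrow> 0) (at x)" using lim by simp
  qed
  then have "((\<lambda>y. (a y - a x) *\<^sub>R b y) has_derivative (\<lambda>w. 0)) (at x)"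
    by (simp add: has_derivative_iff_norm)
  from has_derivative_add[OF this has_derivative_scaleR_right[OF b(1), of "a x"]]
  show ?thesis by (simp add: algebra_simps)
qed

text \<open>Locally uniform injectivity of \<open>T x\<close> makes \<open>u\<close> continuous. With a left inverse \<open>L\<close> of \<open>T x\<close>, \<open>u\<close> is a fixed
  affine function of \<open>\<beta>\<close> and of a product as in the previous lemma, hence differentiable at \<open>x\<close>. Its derivative solves
  the same system with the right-hand side \<open>d\<beta> - (dT) u\<close>, and induction on the order of differentiability applies. Since
  \<open>T x\<close> may fail to be onto, a solution cannot be written as an inverse applied to \<open>\<beta>\<close>.\<close>

lemma smooth_linear_solve:
  fixes T :: "'e::euclidean_space \<Rightarrow> 'd::euclidean_space \<Rightarrow> 'g::euclidean_space"
  assumes S: "open S" and lin: "\<And>x. x \<in> S \<Longrightarrow> linear (T x)" and inj: "\<And>x. x \<in> S \<Longrightarrow> inj (T x)"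
    and T: "\<And>v. smooth_on S (\<lambda>x. T x v)" and \<beta>: "smooth_on S \<beta>"
    and eq: "\<And>x. x \<in> S \<Longrightarrow> T x (u x) = \<beta> x"
  shows "smooth_on S u"
proof -
  have cT: "isCont (\<lambda>x. T x v) x" if "x \<in> S" for x v
    using smooth_on_continuous[OF T] continuous_on_eq_continuous_at[OF S] that by blast
  have low: "\<exists>\<mu>>0. \<forall>\<^sub>F y in nhds x. \<forall>v. \<mu> * norm v \<le> norm (T y v)" if x: "x \<in> S" for x
  proof -
    obtain B where B: "B > 0" "\<And>v. B * norm v \<le> norm (T x v)"
      using linear_inj_bounded_below_pos[OF lin[OF x] inj[OF x]] by blast
    have "((\<lambda>y. \<Sum>b\<in>Basis. norm (T y b - T x b)) \<longlongrightarrow> (\<Sum>b\<in>(Basis::'d set). norm (T x b - T x b))) (nhds x)"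
      by (intro tendsto_sum tendsto_norm tendsto_diff tendsto_const
          tendsto_at_iff_tendsto_nhds[THEN iffD1] cT[OF x, unfolded isCont_def])
    then have "\<forall>\<^sub>F y in nhds x. (\<Sum>b\<in>(Basis::'d set). norm (T y b - T x b)) < B / 2"
      using B(1) by (intro order_tendstoD) auto
    moreover have "\<forall>\<^sub>F y in nhds x. y \<in> S" using S x eventually_nhds by blast
    ultimately have "\<forall>\<^sub>F y in nhds x. \<forall>v. B / 2 * norm v \<le> norm (T y v)"
    proof eventually_elim
      case (elim y)
      show ?case
      proof
        fix v :: 'd
        have "T y v - T x v = (\<Sum>b\<in>Basis. (v \<bullet> b) *\<^sub>R (T y b - T x b))"
          by (subst linear_basis_sum[OF lin[OF elim(2)], of v], subst linear_basis_sum[OF lin[OF x], of v])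
            (simp add: sum_subtractf scaleR_diff_right)
        also have "norm \<dots> \<le> (\<Sum>b\<in>Basis. norm v * norm (T y b - T x b))"
          by (rule sum_norm_le) (auto intro!: mult_right_mono Basis_le_norm)
        also have "\<dots> \<le> norm v * (B / 2)"
          unfolding sum_distrib_left[symmetric] using elim(1) by (intro mult_left_mono) auto
        finally have "norm (T y v - T x v) \<le> B / 2 * norm v" by (simp add: mult.commute)
        then show "B / 2 * norm v \<le> norm (T y v)"
          using B(2)[of v] norm_triangle_sub[of "T x v" "T y v"] by (simp add: norm_minus_commute)
      qed
    qed
    then show ?thesis using B(1) by (intro exI[of _ "B / 2"]) auto
  qed
  have cont: "isCont u x" if x: "x \<in> S" and \<beta>: "isCont \<beta> x" and eq: "\<And>x. x \<in> S \<Longrightarrow> T x (u x) = \<beta> x"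
    for u :: "'e \<Rightarrow> 'd" and \<beta> x
  proof -
    obtain \<mu> where \<mu>: "\<mu> > 0" "\<forall>\<^sub>F y in nhds x. \<forall>v. \<mu> * norm v \<le> norm (T y v)" using low[OF x] by blast
    have "((\<lambda>y. norm (\<beta> y - T y (u x)) / \<mu>) \<longlongrightarrow> norm (\<beta> x - T x (u x)) / \<mu>) (at x)"
      by (intro tendsto_divide tendsto_norm tendsto_diff tendsto_const \<beta>[unfolded isCont_def] cT[OF x, unfolded isCont_def])
        (use \<mu>(1) in simp)
    then have lim: "((\<lambda>y. norm (\<beta> y - T y (u x)) / \<mu>) \<longlongrightarrow> 0) (at x)" using eq[OF x] by simp
    have "\<forall>\<^sub>F y in nhds x. y \<in> S" using S x eventually_nhds by blast
    with \<mu>(2) have "\<forall>\<^sub>F y in nhds x. norm (u y - u x) \<le> norm (\<beta> y - T y (u x)) / \<mu>"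
    proof eventually_elim
      case (elim y)
      have "\<mu> * norm (u y - u x) \<le> norm (T y (u y - u x))" using elim(1) by blast
      also have "T y (u y - u x) = \<beta> y - T y (u x)" using linear_diff[OF lin[OF elim(2)]] eq[OF elim(2)] by simp
      finally show ?case using \<mu>(1) by (simp add: field_simps)
    qed
    then have "\<forall>\<^sub>F y in at x. norm (u y - u x) \<le> norm (\<beta> y - T y (u x)) / \<mu>"
      using eventually_nhds_conv_at by blast
    from Lim_null_comparison[OF this lim] have "((\<lambda>y. u y - u x) \<longlongrightarrow> 0) (at x)" .
    then show ?thesis by (simp add: isCont_def LIM_zero_iff)
  qed
  have "Ck_on k S u" if "Ck_on k S \<beta>" "\<And>x. x \<in> S \<Longrightarrow> T x (u x) = \<beta> x" for k \<beta> u
    using that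
  proof (induction k arbitrary: \<beta> u)
    case 0
    then have "isCont u x" if "x \<in> S" for x
      using cont[OF that _ 0(2)] continuous_on_eq_continuous_at[OF S] that by auto
    then show ?case by (simp add: continuous_at_imp_continuous_on)
  next
    case (Suc k)
    note d\<beta> = Ck_on_has_derivative[OF S Suc.prems(1)]
    have dT: "((\<lambda>x. T x v) has_derivative frechet_derivative (\<lambda>x. T x v) (at x)) (at x)" if "x \<in> S" for v x
      by (rule smooth_on_has_derivative[OF S T that])
    have "\<exists>u'. (u has_derivative u') (at x)" if x: "x \<in> S" for x
    proof -
      have cu: "isCont u x"
        using cont[OF x _ Suc.prems(2)] Ck_on_continuous[OF Suc.prems(1)] continuous_on_eq_continuous_at[OF S] x by blast
      obtain L where L: "linear L" "L \<circ> T x = id"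
        using linear_injective_left_inverse[OF lin[OF x] inj[OF x]] by blast
      have bL: "bounded_linear L" using L(1) linear_conv_bounded_linear by blast
      have LT: "L (T x v) = v" for v using L(2) by (metis comp_apply id_apply)
      have 1: "((\<lambda>y. u x + (L (\<beta> y - \<beta> x) - L (\<Sum>b\<in>Basis. (u y \<bullet> b) *\<^sub>R (T y b - T x b)))) has_derivative
        (\<lambda>w. 0 + (L (frechet_derivative \<beta> (at x) w - 0) -
            L (\<Sum>b\<in>Basis. (u x \<bullet> b) *\<^sub>R (frechet_derivative (\<lambda>y. T y b) (at x) w - 0))))) (at x)"
        by (intro has_derivative_add has_derivative_diff has_derivative_const bounded_linear.has_derivative[OF bL]
            has_derivative_sum has_derivative_scaleR_vanishing d\<beta> dT x)
          (use cu in \<open>auto intro!: continuous_inner continuous_const\<close>)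
      have "u x + (L (\<beta> y - \<beta> x) - L (\<Sum>b\<in>Basis. (u y \<bullet> b) *\<^sub>R (T y b - T x b))) = u y" if "y \<in> S" for y
      proof -
        have "(\<Sum>b\<in>Basis. (u y \<bullet> b) *\<^sub>R (T y b - T x b)) = T y (u y) - T x (u y)"
          unfolding scaleR_diff_right sum_subtractf
          by (simp only: linear_basis_sum[OF lin[OF x], of "u y", symmetric] linear_basis_sum[OF lin[OF that], of "u y", symmetric])
        then show ?thesis
          using Suc.prems(2)[OF that] Suc.prems(2)[OF x, symmetric] by (simp add: linear_diff[OF L(1)] LT)
      qed
      from has_derivative_transform_within_open[OF 1 S x this] show ?thesis by blast
    qed
    then obtain u' where u': "\<And>x. x \<in> S \<Longrightarrow> (u has_derivative u' x) (at x)" by metis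
    have u'eq: "T x (u' x w) = frechet_derivative \<beta> (at x) w - frechet_derivative (\<lambda>y. T y (u x)) (at x) w"
      if x: "x \<in> S" for x w
    proof -
      have "((\<lambda>y. T y (u y)) has_derivative
        (\<lambda>w. frechet_derivative (\<lambda>y. T y (u x)) (at x) w + T x (u' x w))) (at x)"
        using dT[OF x] by (intro has_derivative_linear_family[OF S x lin] u'[OF x]) (auto simp: differentiable_def)
      then have "(\<beta> has_derivative
        (\<lambda>w. frechet_derivative (\<lambda>y. T y (u x)) (at x) w + T x (u' x w))) (at x)"
        by (rule has_derivative_transform_within_open[OF _ S x Suc.prems(2)])
      from fun_cong[OF frechet_derivative_at[OF this], of w] show ?thesis by (simp add: algebra_simps)
    qed
    have uk: "Ck_on k S u" by (rule Suc.IH[OF Ck_on_Suc_D[OF Suc.prems(1)] Suc.prems(2)])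
    have dTsum: "frechet_derivative (\<lambda>y. T y v) (at x) w = (\<Sum>b\<in>Basis. (v \<bullet> b) *\<^sub>R frechet_derivative (\<lambda>y. T y b) (at x) w)"
      if x: "x \<in> S" for x v w
    proof -
      have "((\<lambda>y. \<Sum>b\<in>Basis. (v \<bullet> b) *\<^sub>R T y b) has_derivative
          (\<lambda>w. \<Sum>b\<in>Basis. (v \<bullet> b) *\<^sub>R frechet_derivative (\<lambda>y. T y b) (at x) w)) (at x)"
        by (intro has_derivative_sum has_derivative_scaleR_right dT x)
      then have "((\<lambda>y. T y v) has_derivative
          (\<lambda>w. \<Sum>b\<in>Basis. (v \<bullet> b) *\<^sub>R frechet_derivative (\<lambda>y. T y b) (at x) w)) (at x)"
        by (rule has_derivative_transform_within_open[OF _ S x]) (rule linear_basis_sum[OF lin, symmetric])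
      from fun_cong[OF frechet_derivative_at[OF this], of w] show ?thesis by (rule sym)
    qed
    show ?case
    proof (rule Ck_on_SucI[OF S u'], assumption)
      fix w
      show "Ck_on k S (\<lambda>x. u' x w)"
      proof (rule Suc.IH[OF _ u'eq], rule Ck_on_cong[OF S])
        show "frechet_derivative \<beta> (at x) w + - (\<Sum>b\<in>Basis. (u x \<bullet> b) *\<^sub>R frechet_derivative (\<lambda>y. T y b) (at x) w)
          = frechet_derivative \<beta> (at x) w - frechet_derivative (\<lambda>y. T y (u x)) (at x) w" if "x \<in> S" for x
          using dTsum[OF that, of "u x" w] by simp
        show "Ck_on k S (\<lambda>x. frechet_derivative \<beta> (at x) w + - (\<Sum>b\<in>Basis. (u x \<bullet> b) *\<^sub>R frechet_derivative (\<lambda>y. T y b) (at x) w))"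
          using Suc.prems(1)
          by (intro Ck_on_add[OF S] Ck_on_bounded_linear[OF S bounded_linear_minus[OF bounded_linear_ident]] Ck_on_sum[OF S]
              Ck_on_bilinear[OF S bounded_bilinear_scaleR] Ck_on_bounded_linear[OF S bounded_linear_inner_left]
              uk smooth_on_Ck[OF smooth_on_dd[OF T]]) simp
      qed
    qed
  qed
  from this[OF smooth_on_Ck[OF \<beta>] eq] show ?thesis by (auto simp: smooth_on_def)
qed


section \<open>Flat systems of linear differential equations\<close>

lemma norm_ray_mean_le:
  fixes q :: "'e::euclidean_space \<Rightarrow> 'c::euclidean_space"
  assumes "convex S" "c \<in> S" "x \<in> S" "continuous_on S q" "\<And>y. y \<in> S \<Longrightarrow> norm (q y) \<le> M"
  shows "norm (ray_mean m c q x) \<le> M"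
proof -
  have M: "0 \<le> M" using assms(2,5) norm_ge_zero order_trans by blast
  have "norm (integral {0..1} (\<lambda>t. t ^ m *\<^sub>R q (c + t *\<^sub>R (x - c)))) \<le> integral {0..1} (\<lambda>t::real. M)"
  proof (rule integral_norm_bound_integral[OF ray_integrable[OF assms(1,2,4,3)]])
    fix t :: real assume t: "t \<in> {0..1}"
    then have "norm (q (c + t *\<^sub>R (x - c))) \<le> M" using assms(5) ray_in[OF assms(1-3)] by auto
    moreover have "\<bar>t ^ m\<bar> \<le> 1" using t by (simp add: power_abs power_le_one)
    ultimately have "\<bar>t ^ m\<bar> * norm (q (c + t *\<^sub>R (x - c))) \<le> 1 * M"
      using M by (intro mult_mono) auto
    then show "norm (t ^ m *\<^sub>R q (c + t *\<^sub>R (x - c))) \<le> M" by simp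
  qed auto
  then show ?thesis by (simp add: ray_mean_def)
qed

lemma bilinear_family_bound:
  fixes C :: "'e::euclidean_space \<Rightarrow> 'e \<Rightarrow> 'f::euclidean_space \<Rightarrow> 'f"
  assumes "compact S"
    and lin1: "\<And>x a. x \<in> S \<Longrightarrow> linear (\<lambda>v. C x v a)" and lin2: "\<And>x v. x \<in> S \<Longrightarrow> linear (C x v)"
    and cont: "\<And>v a. continuous_on S (\<lambda>x. C x v a)"
  obtains K where "K > 0" "\<And>x v a. x \<in> S \<Longrightarrow> norm (C x v a) \<le> K * norm v * norm a"
proof -
  let ?n = "\<lambda>x. \<Sum>i\<in>Basis. \<Sum>j\<in>Basis. norm (C x i j)"
  have "continuous_on S ?n" by (intro continuous_on_sum continuous_on_norm cont)
  then have "bounded (?n ` S)" using assms(1) compact_continuous_image compact_imp_bounded by blast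
  then obtain K where K: "K > 0" "\<forall>y\<in>?n ` S. norm y \<le> K" using bounded_pos by blast
  show ?thesis
  proof (rule that[OF K(1)])
    fix x v a assume x: "x \<in> S"
    have "C x v a = (\<Sum>i\<in>Basis. (v \<bullet> i) *\<^sub>R C x i a)" by (rule linear_basis_sum[OF lin1[OF x]])
    also have "\<dots> = (\<Sum>i\<in>Basis. (v \<bullet> i) *\<^sub>R (\<Sum>j\<in>Basis. (a \<bullet> j) *\<^sub>R C x i j))"
      using linear_basis_sum[OF lin2[OF x]] by (intro sum.cong refl arg_cong2[where f=scaleR]) blast
    also have "norm \<dots> \<le> (\<Sum>i\<in>Basis. norm v * (norm a * (\<Sum>j\<in>Basis. norm (C x i j))))"
    proof (rule sum_norm_le)
      fix i :: 'e assume i: "i \<in> Basis"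
      have "norm (\<Sum>j\<in>Basis. (a \<bullet> j) *\<^sub>R C x i j) \<le> (\<Sum>j\<in>Basis. norm a * norm (C x i j))"
        by (rule sum_norm_le) (auto intro!: mult_right_mono Basis_le_norm)
      then have "norm (\<Sum>j\<in>Basis. (a \<bullet> j) *\<^sub>R C x i j) \<le> norm a * (\<Sum>j\<in>Basis. norm (C x i j))"
        by (simp only: sum_distrib_left)
      then show "norm ((v \<bullet> i) *\<^sub>R (\<Sum>j\<in>Basis. (a \<bullet> j) *\<^sub>R C x i j)) \<le> norm v * (norm a * (\<Sum>j\<in>Basis. norm (C x i j)))"
        unfolding norm_scaleR by (intro mult_mono Basis_le_norm[OF i]) auto
    qed
    also have "\<dots> = norm v * norm a * ?n x" by (simp add: sum_distrib_left mult.assoc)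
    also have "\<dots> \<le> norm v * norm a * K"
      using K(2) x by (intro mult_left_mono) (auto dest: spec[of _ "?n x"])
    finally show "norm (C x v a) \<le> K * norm v * norm a" by (simp add: mult_ac)
  qed
qed

text \<open>The equation \<open>da = C a\<close> prescribes all partial derivatives of \<open>a\<close>. Picard iteration along the rays from \<open>c\<close>
  solves it in the radial direction. The defect \<open>e\<^sub>m\<close> of the iterates in the other directions obeys, by the homotopy formula
  and flatness, a recursion that is linear in \<open>e\<^sub>m\<close> up to the difference of two iterates; on a small ball it therefore tends
  to \<open>0\<close> geometrically, and the derivatives of the iterates converge to \<open>C a\<close>. The radius depends on \<open>C\<close> only.\<close>

lemma flat_linear_system:
  fixes C :: "'e::euclidean_space \<Rightarrow> 'e \<Rightarrow> 'f::euclidean_space \<Rightarrow> 'f"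
  assumes R: "R > 0"
    and lin1: "\<And>x a. x \<in> ball c R \<Longrightarrow> linear (\<lambda>v. C x v a)"
    and lin2: "\<And>x v. x \<in> ball c R \<Longrightarrow> linear (C x v)"
    and smooth: "\<And>v a. smooth_on (ball c R) (\<lambda>x. C x v a)"
    and flat: "\<And>x u v a. x \<in> ball c R \<Longrightarrow>
      frechet_derivative (\<lambda>y. C y u a) (at x) v + C x u (C x v a) =
      frechet_derivative (\<lambda>y. C y v a) (at x) u + C x v (C x u a)"
  obtains r where "0 < r" "r \<le> R"
    "\<And>a0. \<exists>a. a c = a0 \<and> (\<forall>x\<in>ball c r. (a has_derivative (\<lambda>v. C x v (a x))) (at x))"
proof -
  have "cball c (R/2) \<subseteq> ball c R" using R by auto
  then obtain K where K: "K > 0" "\<And>x v a. x \<in> cball c (R/2) \<Longrightarrow> norm (C x v a) \<le> K * norm v * norm a"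
    using bilinear_family_bound[of "cball c (R/2)" C] lin1 lin2 smooth_on_continuous[OF smooth] continuous_on_subset
    by (metis compact_cball subsetD)
  \<comment> \<open>With \<open>K r \<le> 1/8\<close> both recursions below contract at least by the factor \<open>1/2\<close>.\<close>
  define r where "r = min (R/2) (1 / (8 * K))"
  have r: "0 < r" "r \<le> R" "K * r \<le> 1/8" and rR: "r \<le> R/2"
    using R K(1) by (auto simp: r_def min_def field_simps)
  let ?B = "ball c r"
  have B: "convex ?B" "open ?B" "c \<in> ?B" "?B \<subseteq> ball c R" "?B \<subseteq> cball c (R/2)" using r rR by auto
  note l1 = lin1[OF subsetD[OF B(4)]] and l2 = lin2[OF subsetD[OF B(4)]] and Kb = K(2)[OF subsetD[OF B(5)]]
  have sm: "smooth_on ?B (\<lambda>x. C x v a)" for v a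
    using smooth_on_subset[OF _ B(2,4) smooth] by simp
  note dC = smooth_on_has_derivative[OF B(2) sm]
  have smC: "smooth_on ?B (\<lambda>y. C y v (f y))" if "smooth_on ?B f" for f v
    by (rule smooth_on_linear_family[OF B(2) l2 sm that])
  show ?thesis
  proof (rule that[OF r(1,2)])
    fix a0 :: 'f
    define A where "A = rec_nat (\<lambda>_. a0) (\<lambda>_ A x. a0 + ray_mean 0 c (\<lambda>y. C y (x - c) (A y)) x)"
    have A0: "A 0 = (\<lambda>_. a0)" and AS: "A (Suc m) = (\<lambda>x. a0 + ray_mean 0 c (\<lambda>y. C y (x - c) (A m y)) x)" for m
      by (simp_all add: A_def)
    have smA: "smooth_on ?B (A m)" for m
    proof (induction m)
      case 0 then show ?case by (simp add: A0)
    next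
      case (Suc m)
      show ?case
      proof (rule smooth_on_cong[OF B(2)])
        show "smooth_on ?B (\<lambda>x. a0 + (\<Sum>b\<in>Basis. ((x - c) \<bullet> b) *\<^sub>R ray_mean 0 c (\<lambda>y. C y b (A m y)) x))"
          by (intro smooth_on_add smooth_on_sum smooth_on_scaleR smooth_on_inner smooth_on_diff smooth_on_id
              smooth_on_const B(2)) (simp add: smooth_on_def Ck_on_ray_mean[OF B(1-3)] smooth_on_Ck[OF smC[OF Suc]])
        fix x assume x: "x \<in> ?B"
        have "ray_mean 0 c (\<lambda>y. C y (x - c) (A m y)) x
            = ray_mean 0 c (\<lambda>y. \<Sum>b\<in>Basis. ((x - c) \<bullet> b) *\<^sub>R C y b (A m y)) x"
          by (rule ray_mean_cong[OF B(1,3) x]) (rule linear_basis_sum[OF l1])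
        also have "\<dots> = (\<Sum>b\<in>Basis. ray_mean 0 c (\<lambda>y. ((x - c) \<bullet> b) *\<^sub>R C y b (A m y)) x)"
          by (rule ray_mean_sum[OF B(1,3) x finite_Basis])
            (intro continuous_on_scaleR continuous_on_const smooth_on_continuous[OF smC[OF Suc]])
        finally show "a0 + (\<Sum>b\<in>Basis. ((x - c) \<bullet> b) *\<^sub>R ray_mean 0 c (\<lambda>y. C y b (A m y)) x) = A (Suc m) x"
          by (simp add: AS ray_mean_scaleR)
      qed
    qed
    define DA where "DA = (\<lambda>m x. frechet_derivative (A m) (at x))"
    have DA: "(A m has_derivative DA m x) (at x)" if "x \<in> ?B" for m x
      unfolding DA_def by (rule smooth_on_has_derivative[OF B(2) smA that])
    have cDA: "smooth_on ?B (\<lambda>x. DA m x v)" for m v unfolding DA_def by (rule smooth_on_dd[OF smA])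
    define e where "e = (\<lambda>m x v. DA m x v - C x v (A m x))"
    have cCe: "smooth_on ?B (\<lambda>y. C y h (e m y v))" for h m v
      unfolding e_def by (intro smC smooth_on_diff B(2) cDA smA)
    have DAS: "DA (Suc m) x v = C x v (A m x) + ray_mean 1 c (\<lambda>y. C y (x - c) (e m y v) - C y v (e m y (x - c))) x"
      if x: "x \<in> ?B" for m x v
    proof -
      let ?h = "x - c"
      have prod: "frechet_derivative (\<lambda>z. C z u (A m z)) (at y) w
          = frechet_derivative (\<lambda>z. C z u (A m y)) (at y) w + C y u (DA m y w)" if y: "y \<in> ?B" for y u w
        using fun_cong[OF frechet_derivative_at[OF has_derivative_linear_family[where T="\<lambda>z. C z u", OF B(2) y l2 _ DA[OF y, of m]]], of w] dC[OF y]
        unfolding differentiable_def by metis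
      have "((\<lambda>x. a0 + ray_mean 0 c (\<lambda>y. C y (x - c) (A m y)) x) has_derivative
        (\<lambda>v. 0 + (C x v (A m x) + ray_mean 1 c (\<lambda>y. frechet_derivative (\<lambda>z. C z ?h (A m z)) (at y) v
          - frechet_derivative (\<lambda>z. C z v (A m z)) (at y) ?h) x))) (at x)"
        by (intro has_derivative_add has_derivative_const homotopy_derivative[OF B(1-3) x l1] smooth_on_Ck[OF smC[OF smA]])
      then have "DA (Suc m) x v = C x v (A m x) + ray_mean 1 c (\<lambda>y. frechet_derivative (\<lambda>z. C z ?h (A m z)) (at y) v
          - frechet_derivative (\<lambda>z. C z v (A m z)) (at y) ?h) x"
        unfolding AS[symmetric] using has_derivative_unique[OF DA[OF x, of "Suc m"]] by (metis (mono_tags, lifting) add_0)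
      also have "ray_mean 1 c (\<lambda>y. frechet_derivative (\<lambda>z. C z ?h (A m z)) (at y) v
          - frechet_derivative (\<lambda>z. C z v (A m z)) (at y) ?h) x
        = ray_mean 1 c (\<lambda>y. C y ?h (e m y v) - C y v (e m y ?h)) x"
      proof (rule ray_mean_cong[OF B(1,3) x])
        fix y assume y: "y \<in> ?B"
        show "frechet_derivative (\<lambda>z. C z ?h (A m z)) (at y) v - frechet_derivative (\<lambda>z. C z v (A m z)) (at y) ?h
          = C y ?h (e m y v) - C y v (e m y ?h)"
          using flat[of y ?h "A m y" v] subsetD[OF B(4) y]
          by (simp add: prod[OF y] e_def linear_diff[OF l2[OF y]] algebra_simps)
      qed
      finally show ?thesis .
    qed
    have nh: "norm (x - c) \<le> r" if "x \<in> ?B" for x using that by (simp add: dist_norm norm_minus_commute)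
    have diff: "norm (A (Suc m) x - A m x) \<le> norm a0 / 2 ^ m" if "x \<in> ?B" for m x
      using that
    proof (induction m arbitrary: x)
      case 0
      have "norm (ray_mean 0 c (\<lambda>y. C y (x - c) a0) x) \<le> K * r * norm a0"
      proof (rule norm_ray_mean_le[OF B(1,3) 0 smooth_on_continuous[OF sm]])
        fix y assume "y \<in> ?B"
        from Kb[OF this, of "x - c" a0] show "norm (C y (x - c) a0) \<le> K * r * norm a0"
          by (rule order_trans) (intro mult_right_mono mult_left_mono nh[OF 0] norm_ge_zero, use K in simp)
      qed
      also have "\<dots> \<le> 1 * norm a0" using r(3) by (intro mult_right_mono) auto
      finally show ?case by (simp add: A0 AS)
    next
      case (Suc m)
      have "A (Suc (Suc m)) x - A (Suc m) x
          = ray_mean 0 c (\<lambda>y. C y (x - c) (A (Suc m) y) - C y (x - c) (A m y)) x"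
        unfolding AS[of "Suc m"] AS[of m, THEN fun_cong, of x]
        by (subst ray_mean_diff[OF B(1,3) Suc.prems]) (auto intro!: smooth_on_continuous smC smA)
      also have "norm \<dots> \<le> K * r * (norm a0 / 2 ^ m)"
      proof (rule norm_ray_mean_le[OF B(1,3) Suc.prems])
        show "continuous_on ?B (\<lambda>y. C y (x - c) (A (Suc m) y) - C y (x - c) (A m y))"
          by (intro smooth_on_continuous smooth_on_diff smC smA B(2))
        fix y assume y: "y \<in> ?B"
        have "norm (C y (x - c) (A (Suc m) y - A m y)) \<le> K * norm (x - c) * norm (A (Suc m) y - A m y)"
          by (rule Kb[OF y])
        also have "\<dots> \<le> K * r * (norm a0 / 2 ^ m)"
          using nh[OF Suc.prems] Suc.IH[OF y] K(1) r(1) by (intro mult_mono) auto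
        finally show "norm (C y (x - c) (A (Suc m) y) - C y (x - c) (A m y)) \<le> K * r * (norm a0 / 2 ^ m)"
          by (simp add: linear_diff[OF l2[OF y]])
      qed
      also have "\<dots> \<le> (1/2) * (norm a0 / 2 ^ m)" using r(3) by (intro mult_right_mono) auto
      finally show ?case by simp
    qed
    \<comment> \<open>The factor \<open>4\<close> makes the contribution of the difference of two iterates a quarter of the bound for the defect.\<close>
    define E where "E = 4 * K * norm a0"
    have E: "0 \<le> E" using K(1) by (simp add: E_def)
    have err: "norm (e m x v) \<le> E / 2 ^ m * norm v" if "x \<in> ?B" for m x v
      using that
    proof (induction m arbitrary: x v)
      case 0
      have "((\<lambda>_. a0) has_derivative DA 0 x) (at x)" using DA[OF 0, of 0] by (simp add: A0)
      then have "DA 0 x = (\<lambda>_. 0)" using has_derivative_unique[OF _ has_derivative_const] by blast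
      then have "norm (e 0 x v) = norm (C x v a0)" by (simp add: e_def A0)
      also have "\<dots> \<le> K * norm v * norm a0" by (rule Kb[OF 0])
      also have "\<dots> \<le> 4 * (K * norm v * norm a0)" using K(1) by simp
      finally show ?case by (simp add: E_def mult_ac)
    next
      case (Suc m)
      let ?I = "ray_mean 1 c (\<lambda>y. C y (x - c) (e m y v) - C y v (e m y (x - c))) x"
      have "norm ?I \<le> 2 * (K * r * (E / 2 ^ m * norm v))"
      proof (rule norm_ray_mean_le[OF B(1,3) Suc.prems])
        show "continuous_on ?B (\<lambda>y. C y (x - c) (e m y v) - C y v (e m y (x - c)))"
          by (intro smooth_on_continuous smooth_on_diff cCe B(2))
        fix y assume y: "y \<in> ?B"
        have "norm (C y (x - c) (e m y v)) \<le> K * norm (x - c) * norm (e m y v)" by (rule Kb[OF y])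
        also have "\<dots> \<le> K * r * (E / 2 ^ m * norm v)"
          using nh[OF Suc.prems] Suc.IH[OF y] K(1) r(1) by (intro mult_mono) auto
        finally have 1: "norm (C y (x - c) (e m y v)) \<le> K * r * (E / 2 ^ m * norm v)" .
        have "norm (C y v (e m y (x - c))) \<le> K * norm v * norm (e m y (x - c))" by (rule Kb[OF y])
        also have "\<dots> \<le> K * norm v * (E / 2 ^ m * r)"
          using nh[OF Suc.prems] K(1) r(1) E
          by (intro mult_left_mono order_trans[OF Suc.IH[OF y]]) auto
        finally have 2: "norm (C y v (e m y (x - c))) \<le> K * r * (E / 2 ^ m * norm v)" by (simp add: mult_ac)
        show "norm (C y (x - c) (e m y v) - C y v (e m y (x - c))) \<le> 2 * (K * r * (E / 2 ^ m * norm v))"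
          using order_trans[OF norm_triangle_ineq4 add_mono[OF 1 2]] by (simp only: mult_2)
      qed
      also have "\<dots> \<le> 2 * (1/8 * (E / 2 ^ m * norm v))"
        using r(3) E by (intro mult_left_mono mult_right_mono) auto
      finally have I: "norm ?I \<le> E / 2 ^ m * norm v / 4" by simp
      have "norm (C x v (A (Suc m) x - A m x)) \<le> K * norm v * norm (A (Suc m) x - A m x)" by (rule Kb[OF Suc.prems])
      also have "\<dots> \<le> K * norm v * (norm a0 / 2 ^ m)"
        using diff[OF Suc.prems] K(1) by (intro mult_left_mono) auto
      also have "\<dots> = E / 2 ^ m * norm v / 4" by (simp add: E_def)
      finally have D: "norm (C x v (A (Suc m) x - A m x)) \<le> E / 2 ^ m * norm v / 4" .
      have "e (Suc m) x v = ?I - C x v (A (Suc m) x - A m x)"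
        using DAS[OF Suc.prems, of m v] by (simp add: e_def linear_diff[OF l2[OF Suc.prems]])
      then show ?case
        using norm_triangle_ineq4[of ?I "C x v (A (Suc m) x - A m x)"] I D by simp
    qed
    define a where "a = (\<lambda>x. a0 + (\<Sum>i. A (Suc i) x - A i x))"
    have "uniform_limit ?B (\<lambda>n x. \<Sum>i<n. A (Suc i) x - A i x) (\<lambda>x. \<Sum>i. A (Suc i) x - A i x) sequentially"
    proof (rule Weierstrass_m_test)
      show "summable (\<lambda>m. norm a0 / 2 ^ m)"
        using summable_mult[OF summable_geometric[of "1/2::real"], of "norm a0"] by (simp add: power_divide)
    qed (use diff in auto)
    then have "uniform_limit ?B (\<lambda>n x. a0 + (\<Sum>i<n. A (Suc i) x - A i x)) a sequentially"
      unfolding a_def by (intro uniform_limit_add uniform_limit_const)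
    moreover have "a0 + (\<Sum>i<n. A (Suc i) x - A i x) = A n x" for n x
      using sum_lessThan_telescope[of "\<lambda>i. A i x" n] by (simp add: A0)
    ultimately have ul: "uniform_limit ?B A a sequentially" by simp
    have "\<exists>g. \<forall>x\<in>?B. (\<lambda>n. A n x) \<longlonglongrightarrow> g x \<and> (g has_derivative (\<lambda>v. C x v (a x))) (at x within ?B)"
    proof (rule has_derivative_sequence[OF B(1) _ _ B(3)])
      show "(A n has_derivative DA n x) (at x within ?B)" if "x \<in> ?B" for n x
        using DA[OF that] has_derivative_at_withinI by blast
      show "(\<lambda>n. A n c) \<longlonglongrightarrow> a c" using tendsto_uniform_limitI[OF ul B(3)] .
      fix d :: real assume d: "d > 0"
      have "(\<lambda>m. E * (1/2) ^ m) \<longlonglongrightarrow> E * 0" by (intro tendsto_mult tendsto_const LIMSEQ_realpow_zero) auto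
      then have "\<forall>\<^sub>F m in sequentially. E * (1/2) ^ m < d / 2" using d by (intro order_tendstoD) auto
      moreover have "\<forall>\<^sub>F m in sequentially. \<forall>x\<in>?B. dist (A m x) (a x) < d / (2 * K)"
        using uniform_limitD[OF ul] d K(1) by simp
      ultimately show "\<forall>\<^sub>F n in sequentially. \<forall>x\<in>?B. \<forall>h. norm (DA n x h - C x h (a x)) \<le> d * norm h"
      proof eventually_elim
        case (elim m)
        show ?case
        proof (intro ballI allI)
          fix x h assume x: "x \<in> ?B"
          have "norm (e m x h) \<le> d / 2 * norm h"
            using err[OF x, of m h] elim(1) by (intro order_trans[OF err[OF x]] mult_right_mono) (auto simp: power_divide)
          moreover have "norm (C x h (A m x - a x)) \<le> d / 2 * norm h"
          proof -
            have "norm (C x h (A m x - a x)) \<le> K * norm h * norm (A m x - a x)" by (rule Kb[OF x])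
            also have "\<dots> \<le> K * norm h * (d / (2 * K))"
              using elim(2) x K(1) by (intro mult_left_mono) (auto simp: dist_norm less_imp_le)
            finally show ?thesis using K(1) by (simp add: field_simps)
          qed
          moreover have "DA m x h - C x h (a x) = e m x h + C x h (A m x - a x)"
            by (simp add: e_def linear_diff[OF l2[OF x]])
          ultimately show "norm (DA m x h - C x h (a x)) \<le> d * norm h"
            using norm_triangle_ineq[of "e m x h" "C x h (A m x - a x)"] by (simp add: field_simps)
        qed
      qed
    qed
    then obtain g where g: "\<And>x. x \<in> ?B \<Longrightarrow> (\<lambda>n. A n x) \<longlonglongrightarrow> g x"
      "\<And>x. x \<in> ?B \<Longrightarrow> (g has_derivative (\<lambda>v. C x v (a x))) (at x within ?B)" by blast
    have ga: "g x = a x" if "x \<in> ?B" for x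
      using LIMSEQ_unique[OF g(1)[OF that] tendsto_uniform_limitI[OF ul that]] .
    have "A n c = a0" for n
    proof (cases n)
      case (Suc m)
      have "ray_mean 0 c (\<lambda>y. C y (c - c) (A m y)) c = ray_mean 0 c (\<lambda>y. 0) c"
        by (rule ray_mean_cong[OF B(1,3,3)]) (simp add: linear_0[OF l1])
      then show ?thesis using Suc by (simp add: AS ray_mean_zero)
    qed (simp add: A0)
    then have "g c = a0" using g(1)[OF B(3)] LIMSEQ_unique[OF tendsto_const] by auto
    moreover have "(g has_derivative (\<lambda>v. C x v (g x))) (at x)" if "x \<in> ?B" for x
      using g(2)[OF that] ga[OF that] at_within_open[OF that B(2)] by simp
    ultimately show "\<exists>a. a c = a0 \<and> (\<forall>x\<in>?B. (a has_derivative (\<lambda>v. C x v (a x))) (at x))" by blast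
  qed
qed

section \<open>Smooth functions on a manifold\<close>

lemma eventually_in_open: "open U \<Longrightarrow> p \<in> U \<Longrightarrow> \<forall>\<^sub>F q in nhds p. q \<in> U"
  using eventually_nhds by blast

lemma is_chart_inv:
  assumes "is_chart c"
  shows "q \<in> fst c \<Longrightarrow> chart_inv c (snd c q) = q"
    and "x \<in> snd c ` fst c \<Longrightarrow> snd c (chart_inv c x) = x"
    and "x \<in> snd c ` fst c \<Longrightarrow> chart_inv c x \<in> fst c"
  using assms by (auto simp: is_chart_def chart_inv_def f_inv_into_f inv_into_into)

lemma chart_image_Int_eq:
  assumes "is_chart c"
  shows "snd c ` (fst c \<inter> U) = (snd c ` fst c) \<inter> chart_inv c -` U"
  using is_chart_inv[OF assms] by force

lemma chart_image_open:
  assumes "is_chart c" "open U"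
  shows "open (snd c ` (fst c \<inter> U))"
  unfolding chart_image_Int_eq[OF assms(1)]
  using assms by (intro continuous_open_preimage) (auto simp: is_chart_def)

lemma chart_preimage_open:
  assumes "is_chart c" "open U"
  shows "open (fst c \<inter> snd c -` U)"
  using assms by (intro continuous_open_preimage) (auto simp: is_chart_def)

lemma eventually_chart_inv:
  assumes "is_chart c" "q \<in> fst c" "\<forall>\<^sub>F q' in nhds q. P q'"
  shows "\<forall>\<^sub>F y in nhds (snd c q). y \<in> snd c ` fst c \<and> P (chart_inv c y)"
proof -
  obtain U where U: "open U" "q \<in> U" "\<And>q'. q' \<in> U \<Longrightarrow> P q'" using assms(3) eventually_nhds by metis
  have "\<forall>\<^sub>F y in nhds (snd c q). y \<in> snd c ` (fst c \<inter> U)"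
    using assms U by (intro eventually_in_open chart_image_open) auto
  then show ?thesis by eventually_elim (use is_chart_inv[OF assms(1)] U in auto)
qed

lemma eventually_chart:
  assumes "is_chart c" "q \<in> fst c" "\<forall>\<^sub>F y in nhds (snd c q). P y"
  shows "\<forall>\<^sub>F q' in nhds q. q' \<in> fst c \<and> P (snd c q')"
proof -
  obtain U where U: "open U" "snd c q \<in> U" "\<And>y. y \<in> U \<Longrightarrow> P y" using assms(3) eventually_nhds by metis
  have "\<forall>\<^sub>F q' in nhds q. q' \<in> fst c \<inter> snd c -` U"
    using assms U by (intro eventually_in_open chart_preimage_open) auto
  then show ?thesis by eventually_elim (use U in auto)
qed

lemma admissible_is_chart: "admissible_chart A c \<Longrightarrow> is_chart c"
  by (simp add: admissible_chart_def)

locale manifold =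
  fixes A :: "('a::{t2_space,second_countable_topology}, 'e::euclidean_space) atlas"
  assumes manifold: "smooth_manifold A"
begin

lemma admissible_in: "c \<in> A \<Longrightarrow> admissible_chart A c"
  using manifold by (auto simp: smooth_manifold_def admissible_chart_def)

lemma chart_at: obtains c where "c \<in> A" "p \<in> fst c"
proof -
  have "p \<in> (\<Union>c\<in>A. fst c)" using manifold by (simp add: smooth_manifold_def)
  then show ?thesis using that by blast
qed

text \<open>Smoothness was defined through the charts of the atlas; it holds in every chart of the maximal atlas.\<close>

lemma smooth_function_chart:
  assumes f: "f \<in> smooth_functions A" and c: "admissible_chart A c"
  shows "smooth_on (snd c ` fst c) (\<lambda>x. f (chart_inv c x))"
proof (rule smooth_on_local)
  note ci = is_chart_inv[OF admissible_is_chart[OF c]]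
  show "open (snd c ` fst c)" using c by (auto simp: admissible_chart_def is_chart_def)
  fix x assume x: "x \<in> snd c ` fst c"
  obtain d where d: "d \<in> A" "chart_inv c x \<in> fst d" using chart_at .
  note di = is_chart_inv[OF admissible_is_chart[OF admissible_in[OF d(1)]]]
  let ?U = "snd c ` (fst c \<inter> fst d)"
  have od: "open (fst d)" "open (snd d ` fst d)"
    using admissible_in[OF d(1)] by (auto simp: admissible_chart_def is_chart_def)
  have oU: "open ?U" using chart_image_open[OF admissible_is_chart[OF c] od(1)] .
  have tr: "smooth_on ?U (\<lambda>x. snd d (chart_inv c x))"
    using c d by (auto simp: admissible_chart_def compatible_def comp_def)
  have fd: "smooth_on (snd d ` fst d) (\<lambda>x. f (chart_inv d x))"
    using f d by (auto simp: smooth_functions_def comp_def)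
  have "smooth_on ?U (\<lambda>x. f (chart_inv d (snd d (chart_inv c x))))"
    by (rule smooth_on_compose[OF oU od(2) _ fd tr]) (use ci in auto)
  then have "smooth_on ?U (\<lambda>x. f (chart_inv c x))"
    by (rule smooth_on_cong[OF oU, rotated]) (use ci di in auto)
  moreover have "x \<in> ?U" using ci x d by force
  ultimately show "\<exists>U. open U \<and> x \<in> U \<and> U \<subseteq> snd c ` fst c \<and> smooth_on U (\<lambda>x. f (chart_inv c x))"
    using oU by blast
qed

text \<open>Smoothness may be checked on germs, each of which may be extended in its own way.\<close>

lemma smooth_functions_local:
  assumes "\<And>p. \<exists>f'\<in>smooth_functions A. \<forall>\<^sub>F q in nhds p. f q = f' q"
  shows "f \<in> smooth_functions A"
  unfolding smooth_functions_def
proof (intro CollectI ballI)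
  fix c assume c: "c \<in> A"
  note ac = admissible_in[OF c] and cc = admissible_is_chart[OF admissible_in[OF c]]
  have oi: "open (snd c ` fst c)" using cc by (auto simp: is_chart_def)
  show "smooth_on (snd c ` fst c) (f \<circ> chart_inv c)" unfolding comp_def
  proof (rule smooth_on_local[OF oi])
    fix x assume x: "x \<in> snd c ` fst c"
    let ?p = "chart_inv c x"
    obtain f' U where f': "f' \<in> smooth_functions A" "open U" "?p \<in> U" "\<And>q. q \<in> U \<Longrightarrow> f q = f' q"
      using assms[of ?p] unfolding eventually_nhds by blast
    let ?V = "snd c ` (fst c \<inter> U)"
    have oV: "open ?V" by (rule chart_image_open[OF cc f'(2)])
    have "smooth_on ?V (\<lambda>x. f' (chart_inv c x))"
      by (rule smooth_on_subset[OF oi oV _ smooth_function_chart[OF f'(1) ac]]) auto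
    then have "smooth_on ?V (\<lambda>x. f (chart_inv c x))"
      by (rule smooth_on_cong[OF oV, rotated]) (use f'(4) is_chart_inv[OF cc] in auto)
    moreover have "x \<in> ?V" using x f'(3) is_chart_inv[OF cc] by force
    ultimately show "\<exists>U. open U \<and> x \<in> U \<and> U \<subseteq> snd c ` fst c \<and> smooth_on U (\<lambda>x. f (chart_inv c x))"
      using oV by blast
  qed
qed

lemma sf_open: "c \<in> A \<Longrightarrow> open (snd c ` fst c)"
  using admissible_in by (auto simp: admissible_chart_def is_chart_def)

lemma sf_const [simp]: "(\<lambda>q. a) \<in> smooth_functions A"
  by (auto simp: smooth_functions_def comp_def)

lemma sf_add: "f \<in> smooth_functions A \<Longrightarrow> h \<in> smooth_functions A \<Longrightarrow> (\<lambda>q. f q + h q) \<in> smooth_functions A"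
  by (auto simp: smooth_functions_def comp_def intro!: smooth_on_add sf_open)

lemma sf_mult: "f \<in> smooth_functions A \<Longrightarrow> h \<in> smooth_functions A \<Longrightarrow> (\<lambda>q. f q * h q) \<in> smooth_functions A"
  by (auto simp: smooth_functions_def comp_def intro!: smooth_on_mult sf_open)

lemma sf_diff: "f \<in> smooth_functions A \<Longrightarrow> h \<in> smooth_functions A \<Longrightarrow> (\<lambda>q. f q - h q) \<in> smooth_functions A"
  by (auto simp: smooth_functions_def comp_def intro!: smooth_on_diff sf_open)

lemma sf_minus: "f \<in> smooth_functions A \<Longrightarrow> (\<lambda>q. - f q) \<in> smooth_functions A"
  by (auto simp: smooth_functions_def comp_def intro!: smooth_on_minus sf_open)

lemma sf_sum: "(\<And>i. i \<in> I \<Longrightarrow> f i \<in> smooth_functions A) \<Longrightarrow> (\<lambda>q. \<Sum>i\<in>I. f i q) \<in> smooth_functions A"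
  by (auto simp: smooth_functions_def comp_def intro!: smooth_on_sum sf_open)

text \<open>The ball is compact, so its image is closed in the Hausdorff space \<open>M\<close>. This is what makes the extension smooth at
  points that the chart does not reach.\<close>

lemma extend_by_zero:
  assumes c: "admissible_chart A c" and k: "smooth_on UNIV (k :: 'e \<Rightarrow> real)"
    and K: "cball x0 r \<subseteq> snd c ` fst c" "\<forall>x. x \<notin> cball x0 r \<longrightarrow> k x = 0"
  shows "(\<lambda>q. if q \<in> fst c then k (snd c q) else 0) \<in> smooth_functions A" (is "?f \<in> _")
    and "closed (chart_inv c ` cball x0 r)" "chart_inv c ` cball x0 r \<subseteq> fst c"
      "\<And>q. q \<notin> chart_inv c ` cball x0 r \<Longrightarrow> (if q \<in> fst c then k (snd c q) else 0) = 0"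
proof -
  note cc = admissible_is_chart[OF c]
  note ci = is_chart_inv[OF cc]
  let ?K = "chart_inv c ` cball x0 r"
  have "continuous_on (cball x0 r) (chart_inv c)"
    using cc K(1) continuous_on_subset by (auto simp: is_chart_def)
  then have "compact ?K" by (rule compact_continuous_image) simp
  then show cl: "closed ?K" by (rule compact_imp_closed)
  show "?K \<subseteq> fst c" using ci K(1) by blast
  have 0: "k (snd c q) = 0" if "q \<notin> ?K" "q \<in> fst c" for q
  proof -
    have "snd c q \<notin> cball x0 r" using that ci(1)[of q] by (metis imageI)
    then show ?thesis using K(2) by blast
  qed
  then show "(if q \<in> fst c then k (snd c q) else 0) = 0" if "q \<notin> ?K" for q
    using that by simp
  show "?f \<in> smooth_functions A"
    unfolding smooth_functions_def
  proof (intro CollectI ballI)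
    fix d assume d: "d \<in> A"
    note dc = admissible_is_chart[OF admissible_in[OF d]]
    have oi: "open (snd d ` fst d)" using dc by (auto simp: is_chart_def)
    show "smooth_on (snd d ` fst d) (?f \<circ> chart_inv d)" unfolding comp_def
    proof (rule smooth_on_local[OF oi])
      fix x assume x: "x \<in> snd d ` fst d"
      let ?p = "chart_inv d x"
      show "\<exists>U. open U \<and> x \<in> U \<and> U \<subseteq> snd d ` fst d \<and> smooth_on U (\<lambda>x. ?f (chart_inv d x))"
      proof (cases "?p \<in> fst c")
        case True
        let ?U = "snd d ` (fst d \<inter> fst c)"
        have oU: "open ?U" using chart_image_open[OF dc] cc by (auto simp: is_chart_def)
        have tr: "smooth_on ?U (\<lambda>x. snd c (chart_inv d x))"
          using c d by (auto simp: admissible_chart_def compatible_def comp_def Int_commute)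
        have "smooth_on ?U (\<lambda>x. k (snd c (chart_inv d x)))"
          by (rule smooth_on_compose[OF oU open_UNIV _ k tr]) simp
        then have "smooth_on ?U (\<lambda>x. ?f (chart_inv d x))"
          by (rule smooth_on_cong[OF oU, rotated]) (use is_chart_inv[OF dc] in auto)
        moreover have "x \<in> ?U" using x True is_chart_inv[OF dc] by force
        ultimately show ?thesis using oU by blast
      next
        case False
        let ?U = "snd d ` (fst d \<inter> - ?K)"
        have oU: "open ?U" using chart_image_open[OF dc] cl by blast
        have "smooth_on ?U (\<lambda>x. ?f (chart_inv d x))"
          by (rule smooth_on_cong[OF oU _ smooth_on_const[of _ 0]]) (use is_chart_inv[OF dc] 0 in auto)
        moreover have "x \<in> ?U" using x False ci K(1) is_chart_inv[OF dc] by force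
        ultimately show ?thesis using oU by blast
      qed
    qed
  qed
qed

lemma bump_function:
  assumes c: "admissible_chart A c" and p: "p \<in> fst c" and U: "open U" "p \<in> U"
  obtains \<psi> K where "\<psi> \<in> smooth_functions A" "\<forall>\<^sub>F q in nhds p. \<psi> q = 1"
    "closed K" "K \<subseteq> fst c \<inter> U" "\<And>q. q \<notin> K \<Longrightarrow> \<psi> q = 0"
proof -
  note cc = admissible_is_chart[OF c]
  have "open (snd c ` (fst c \<inter> U))" "snd c p \<in> snd c ` (fst c \<inter> U)"
    using chart_image_open[OF cc U(1)] p U(2) by auto
  then obtain r where r: "r > 0" "cball (snd c p) r \<subseteq> snd c ` (fst c \<inter> U)"
    using open_contains_cball by blast
  obtain k :: "'e \<Rightarrow> real" where k: "smooth_on UNIV k" "\<And>x. dist (snd c p) x \<le> r / 2 \<Longrightarrow> k x = 1"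
    "\<And>x. dist (snd c p) x \<ge> r \<Longrightarrow> k x = 0" using smooth_bump[OF r(1)] by metis
  have sub: "cball (snd c p) r \<subseteq> snd c ` fst c" using r(2) by auto
  have z: "\<forall>x. x \<notin> cball (snd c p) r \<longrightarrow> k x = 0" using k(3) by auto
  note ex = extend_by_zero[OF c k(1) sub z]
  show ?thesis
  proof (rule that[OF ex(1) _ ex(2) _ ex(4)])
    have "\<forall>\<^sub>F y in nhds (snd c p). y \<in> ball (snd c p) (r/2)" using r(1) by (intro eventually_in_open) auto
    from eventually_chart[OF cc p this]
    show "\<forall>\<^sub>F q in nhds p. (if q \<in> fst c then k (snd c q) else 0) = 1"
      by eventually_elim (use k(2) in auto)
    show "chart_inv c ` cball (snd c p) r \<subseteq> fst c \<inter> U"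
    proof
      fix q assume "q \<in> chart_inv c ` cball (snd c p) r"
      then obtain x where x: "x \<in> cball (snd c p) r" "q = chart_inv c x" by blast
      then obtain q' where "x = snd c q'" "q' \<in> fst c \<inter> U" using r(2) by blast
      then show "q \<in> fst c \<inter> U" using x is_chart_inv(1)[OF cc] by simp
    qed
  qed
qed

text \<open>Tangent vectors act on global functions only, so each function of the coordinates is replaced by a global function
  with the same germ.\<close>

lemma lift_function:
  assumes c: "admissible_chart A c" and p: "p \<in> fst c" and U: "open U" "snd c p \<in> U"
    and h: "smooth_on U (h :: 'e \<Rightarrow> real)"
  obtains f where "f \<in> smooth_functions A" "\<forall>\<^sub>F q in nhds p. f q = h (snd c q)"
proof -
  note cc = admissible_is_chart[OF c]
  have "open (snd c ` fst c \<inter> U)" "snd c p \<in> snd c ` fst c \<inter> U"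
    using cc p U by (auto simp: is_chart_def)
  then obtain r where r: "r > 0" "cball (snd c p) r \<subseteq> snd c ` fst c \<inter> U"
    using open_contains_cball by blast
  obtain k :: "'e \<Rightarrow> real" where k: "smooth_on UNIV k" "\<And>x. dist (snd c p) x \<le> r / 2 \<Longrightarrow> k x = 1"
    "\<And>x. dist (snd c p) x \<ge> r \<Longrightarrow> k x = 0" using smooth_bump[OF r(1)] by metis
  let ?k = "\<lambda>x. if x \<in> U then k x * h x else 0"
  have "smooth_on UNIV ?k"
  proof (rule smooth_on_local[OF open_UNIV])
    fix x :: 'e
    show "\<exists>V. open V \<and> x \<in> V \<and> V \<subseteq> UNIV \<and> smooth_on V ?k"
    proof (cases "x \<in> U")
      case True
      have "smooth_on U (\<lambda>x. k x * h x)"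
        by (intro smooth_on_mult U h smooth_on_subset[OF open_UNIV U(1) _ k(1)]) auto
      then have "smooth_on U ?k" by (rule smooth_on_cong[OF U(1), rotated]) auto
      then show ?thesis using U True by blast
    next
      case False
      let ?V = "- cball (snd c p) r"
      have V: "open ?V" by auto
      have "smooth_on ?V ?k" by (rule smooth_on_cong[OF V _ smooth_on_const[of _ 0]]) (use k(3) in auto)
      moreover have "x \<in> ?V" using False r by auto
      ultimately show ?thesis using V by blast
    qed
  qed
  moreover have sub: "cball (snd c p) r \<subseteq> snd c ` fst c" using r(2) by auto
  moreover have "\<forall>x. x \<notin> cball (snd c p) r \<longrightarrow> ?k x = 0" using k(3) by auto
  ultimately have f: "(\<lambda>q. if q \<in> fst c then ?k (snd c q) else 0) \<in> smooth_functions A"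
    by (rule extend_by_zero(1)[OF c])
  show ?thesis
  proof (rule that[OF f])
    have "\<forall>\<^sub>F y in nhds (snd c p). y \<in> ball (snd c p) (r/2)" using r(1) by (intro eventually_in_open) auto
    from eventually_chart[OF cc p this]
    show "\<forall>\<^sub>F q in nhds p. (if q \<in> fst c then ?k (snd c q) else 0) = h (snd c q)"
    proof eventually_elim
      case (elim q)
      then have "snd c q \<in> cball (snd c p) r" "k (snd c q) = 1" using k(2) r(1) by auto
      then show ?case using elim r(2) by auto
    qed
  qed
qed

lemma bump_times_chart_function:
  assumes c: "admissible_chart A c" and \<psi>: "\<psi> \<in> smooth_functions A"
    and K: "closed K" "K \<subseteq> fst c" "\<And>q. q \<notin> K \<Longrightarrow> \<psi> q = 0"
    and h: "smooth_on (snd c ` fst c) (h :: 'e \<Rightarrow> real)"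
  shows "(\<lambda>q. if q \<in> fst c then \<psi> q * h (snd c q) else 0) \<in> smooth_functions A"
proof (rule smooth_functions_local)
  note cc = admissible_is_chart[OF c]
  fix p
  show "\<exists>f'\<in>smooth_functions A. \<forall>\<^sub>F q in nhds p. (if q \<in> fst c then \<psi> q * h (snd c q) else 0) = f' q"
  proof (cases "p \<in> fst c")
    case True
    obtain f where f: "f \<in> smooth_functions A" "\<forall>\<^sub>F q in nhds p. f q = h (snd c q)"
      using lift_function[OF c True _ _ h] cc True by (auto simp: is_chart_def)
    have "\<forall>\<^sub>F q in nhds p. q \<in> fst c" using cc True by (intro eventually_in_open) (auto simp: is_chart_def)
    with f(2) have "\<forall>\<^sub>F q in nhds p. (if q \<in> fst c then \<psi> q * h (snd c q) else 0) = \<psi> q * f q"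
      by eventually_elim auto
    then show ?thesis using sf_mult[OF \<psi> f(1)] by (intro bexI[where x="\<lambda>q. \<psi> q * f q"])
  next
    case False
    then have "\<forall>\<^sub>F q in nhds p. q \<in> - K" using K by (intro eventually_in_open) auto
    then have "\<forall>\<^sub>F q in nhds p. (if q \<in> fst c then \<psi> q * h (snd c q) else 0) = 0"
      by eventually_elim (use K in auto)
    then show ?thesis by (intro bexI[where x="\<lambda>q. 0"]) auto
  qed
qed

end

section \<open>Tangent vectors and vector fields\<close>

lemma fun_sum_apply: "(\<Sum>i\<in>I. f i) x = (\<Sum>i\<in>I. f i x)" for f :: "'i \<Rightarrow> 'x \<Rightarrow> 'y::comm_monoid_add"
  by (induction I rule: infinite_finite_induct) auto

context manifold begin

lemma tangentD:
  assumes "v \<in> tangent A p"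
  shows "f \<in> smooth_functions A \<Longrightarrow> h \<in> smooth_functions A \<Longrightarrow> v (\<lambda>x. f x + h x) = v f + v h"
    and "f \<in> smooth_functions A \<Longrightarrow> v (\<lambda>x. a * f x) = a * v f"
    and "f \<in> smooth_functions A \<Longrightarrow> h \<in> smooth_functions A \<Longrightarrow> v (\<lambda>x. f x * h x) = v f * h p + f p * v h"
    and "f \<notin> smooth_functions A \<Longrightarrow> v f = 0"
  using assms by (auto simp: tangent_def)

lemma tangent_const [simp]:
  assumes "v \<in> tangent A p"
  shows "v (\<lambda>x. a) = 0"
proof -
  have "v (\<lambda>x. 1 * 1) = v (\<lambda>x. 1) * 1 + 1 * v (\<lambda>x. 1)" by (rule tangentD(3)[OF assms sf_const sf_const])
  then have "v (\<lambda>x. 1) = 0" by simp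
  then show ?thesis using tangentD(2)[OF assms sf_const, of a 1] by simp
qed

lemma tangent_sum:
  assumes "v \<in> tangent A p" "finite I" "\<And>i. i \<in> I \<Longrightarrow> f i \<in> smooth_functions A"
  shows "v (\<lambda>x. \<Sum>i\<in>I. f i x) = (\<Sum>i\<in>I. v (f i))"
  using assms(2,3)
proof (induction I rule: finite_induct)
  case empty then show ?case using tangent_const[OF assms(1)] by simp
next
  case (insert i I) then show ?case
    using tangentD(1)[OF assms(1), of "f i" "\<lambda>x. \<Sum>i\<in>I. f i x"] sf_sum[of I f] by simp
qed

lemma tangent_diff:
  assumes "v \<in> tangent A p" "f \<in> smooth_functions A" "h \<in> smooth_functions A"
  shows "v (\<lambda>x. f x - h x) = v f - v h"
  using tangentD(1)[OF assms(1,2) sf_minus[OF assms(3)]] tangentD(2)[OF assms(1,3), of "- 1"] by simp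

text \<open>A derivation only sees germs: multiply the difference of the two functions by a bump.\<close>

lemma tangent_local:
  assumes v: "v \<in> tangent A p" and f: "f \<in> smooth_functions A" "h \<in> smooth_functions A"
    and eq: "\<forall>\<^sub>F q in nhds p. f q = h q"
  shows "v f = v h"
proof -
  obtain U where U: "open U" "p \<in> U" "\<And>q. q \<in> U \<Longrightarrow> f q = h q" using eq unfolding eventually_nhds by blast
  obtain c where c: "c \<in> A" "p \<in> fst c" using chart_at .
  obtain \<psi> K where \<psi>: "\<psi> \<in> smooth_functions A" "\<forall>\<^sub>F q in nhds p. \<psi> q = 1"
    "closed K" "K \<subseteq> fst c \<inter> U" "\<And>q. q \<notin> K \<Longrightarrow> \<psi> q = 0"
    by (rule bump_function[OF admissible_in[OF c(1)] c(2) U(1,2)]) (rule that)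
  have "(\<lambda>q. \<psi> q * (f q - h q)) = (\<lambda>q. 0)"
  proof
    show "\<psi> q * (f q - h q) = 0" for q using \<psi>(4,5) U(3) by (cases "q \<in> K") auto
  qed
  then have "v (\<lambda>q. \<psi> q * (f q - h q)) = 0" using v by simp
  moreover have "v (\<lambda>q. \<psi> q * (f q - h q)) = v \<psi> * (f p - h p) + \<psi> p * v (\<lambda>q. f q - h q)"
    by (intro tangentD(3)[OF v] \<psi> sf_diff f)
  moreover have "\<psi> p = 1" "f p = h p" using eventually_nhds_x_imp_x[OF \<psi>(2)] eventually_nhds_x_imp_x[OF eq] by auto
  ultimately show ?thesis using tangent_diff[OF v f] by simp
qed

lemma tangent_zero [simp]: "0 \<in> tangent A p"
  by (auto simp: tangent_def)

lemma tangent_add [simp]: "u \<in> tangent A p \<Longrightarrow> v \<in> tangent A p \<Longrightarrow> u + v \<in> tangent A p"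
  by (auto simp: tangent_def algebra_simps)

lemma tangent_tscale [simp]: "u \<in> tangent A p \<Longrightarrow> tscale a u \<in> tangent A p"
  by (auto simp: tangent_def tscale_def algebra_simps)

lemma tangent_uminus [simp]: "u \<in> tangent A p \<Longrightarrow> - u \<in> tangent A p"
  by (auto simp: tangent_def algebra_simps)

lemma tangent_minus [simp]: "u \<in> tangent A p \<Longrightarrow> v \<in> tangent A p \<Longrightarrow> u - v \<in> tangent A p"
  using tangent_add[of u p "- v"] by simp

lemma tangent_setsum [simp]: "(\<And>i. i \<in> I \<Longrightarrow> u i \<in> tangent A p) \<Longrightarrow> sum u I \<in> tangent A p"
  by (induction I rule: infinite_finite_induct) auto

text \<open>A coordinate vector may be evaluated by differentiating any local representative of the function.\<close>

lemma coord_vector_eval: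
  assumes c: "admissible_chart A c" and q: "q \<in> fst c" and f: "f \<in> smooth_functions A"
    and F: "\<forall>\<^sub>F q' in nhds q. f q' = F (snd c q')" "(F has_derivative F') (at (snd c q))"
  shows "coord_vector A c q w f = F' w"
proof -
  note cc = admissible_is_chart[OF c]
  have "\<forall>\<^sub>F y in nhds (snd c q). F y = (f \<circ> chart_inv c) y"
    using eventually_chart_inv[OF cc q F(1)]
    by eventually_elim (use is_chart_inv[OF cc] in auto)
  then obtain U where U: "open U" "snd c q \<in> U" "\<And>y. y \<in> U \<Longrightarrow> F y = (f \<circ> chart_inv c) y"
    unfolding eventually_nhds by blast
  have "((f \<circ> chart_inv c) has_derivative F') (at (snd c q))"
    by (rule has_derivative_transform_within_open[OF F(2) U])
  from fun_cong[OF frechet_derivative_at[OF this], of w] show ?thesis by (simp add: coord_vector_def f)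
qed

lemma chart_function_derivative:
  assumes c: "admissible_chart A c" and q: "q \<in> fst c" and f: "f \<in> smooth_functions A"
  shows "((f \<circ> chart_inv c) has_derivative (\<lambda>w. coord_vector A c q w f)) (at (snd c q))"
proof -
  have "((f \<circ> chart_inv c) has_derivative frechet_derivative (f \<circ> chart_inv c) (at (snd c q))) (at (snd c q))"
    using smooth_on_has_derivative[OF _ smooth_function_chart[OF f c], of "snd c q"] q c
    by (auto simp: admissible_chart_def is_chart_def comp_def)
  then show ?thesis using f by (simp add: coord_vector_def)
qed

lemma coord_vector_nonsmooth: "f \<notin> smooth_functions A \<Longrightarrow> coord_vector A c q w f = 0"
  by (simp add: coord_vector_def)

lemma coord_vector_linear:
  assumes c: "admissible_chart A c" and q: "q \<in> fst c"
  shows "coord_vector A c q (u + w) = coord_vector A c q u + coord_vector A c q w"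
    and "coord_vector A c q (a *\<^sub>R u) = tscale a (coord_vector A c q u)"
    and "coord_vector A c q 0 = 0"
proof -
  have l: "linear (\<lambda>w. coord_vector A c q w f)" if "f \<in> smooth_functions A" for f
    using chart_function_derivative[OF c q that] has_derivative_bounded_linear bounded_linear.linear by blast
  have "coord_vector A c q (u + w) f = (coord_vector A c q u + coord_vector A c q w) f" for f u w
    using linear_add[OF l] coord_vector_nonsmooth by (cases "f \<in> smooth_functions A") auto
  then show "coord_vector A c q (u + w) = coord_vector A c q u + coord_vector A c q w" for u w by (rule ext)
  have "coord_vector A c q (a *\<^sub>R u) f = tscale a (coord_vector A c q u) f" for f a u
    using linear_cmul[OF l] coord_vector_nonsmooth by (cases "f \<in> smooth_functions A") (auto simp: tscale_def)
  then show s: "coord_vector A c q (a *\<^sub>R u) = tscale a (coord_vector A c q u)" for a u by (rule ext)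
  show "coord_vector A c q 0 = 0" using s[of 0 0] by (simp add: fun_eq_iff tscale_def)
qed

lemma coord_vector_sum:
  assumes c: "admissible_chart A c" and q: "q \<in> fst c"
  shows "coord_vector A c q (\<Sum>i\<in>I. a i *\<^sub>R w i) = (\<Sum>i\<in>I. tscale (a i) (coord_vector A c q (w i)))"
  by (induction I rule: infinite_finite_induct) (simp_all add: coord_vector_linear[OF assms])

lemma coord_vector_tangent [simp]:
  assumes c: "admissible_chart A c" and q: "q \<in> fst c"
  shows "coord_vector A c q w \<in> tangent A q"
proof -
  note cc = admissible_is_chart[OF c]
  have e: "\<forall>\<^sub>F q' in nhds q. q' \<in> fst c" using cc q by (intro eventually_in_open) (auto simp: is_chart_def)
  have ci: "(f \<circ> chart_inv c) (snd c q') = f q'" if "q' \<in> fst c" for f :: "'a \<Rightarrow> real" and q'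
    using is_chart_inv[OF cc] that by simp
  note d = chart_function_derivative[OF c q]
  have 1: "coord_vector A c q w (\<lambda>x. a * f x) = a * coord_vector A c q w f"
    if f: "f \<in> smooth_functions A" for a f
    by (rule coord_vector_eval[OF c q sf_mult[OF sf_const f] _ has_derivative_mult_right[OF d[OF f]]])
      (rule eventually_mono[OF e], simp only: ci)
  have 2: "coord_vector A c q w (\<lambda>x. f x + h x) = coord_vector A c q w f + coord_vector A c q w h"
    if f: "f \<in> smooth_functions A" and h: "h \<in> smooth_functions A" for f h
    by (rule coord_vector_eval[OF c q sf_add[OF f h] _ has_derivative_add[OF d[OF f] d[OF h]]])
      (rule eventually_mono[OF e], simp only: ci)
  have 3: "coord_vector A c q w (\<lambda>x. f x * h x)
      = (f \<circ> chart_inv c) (snd c q) * coord_vector A c q w h + coord_vector A c q w f * (h \<circ> chart_inv c) (snd c q)"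
    if f: "f \<in> smooth_functions A" and h: "h \<in> smooth_functions A" for f h
    by (rule coord_vector_eval[OF c q sf_mult[OF f h] _ has_derivative_mult[OF d[OF f] d[OF h]]])
      (rule eventually_mono[OF e], simp only: ci)
  show ?thesis
    unfolding tangent_def by (auto simp: 1 2 3 is_chart_inv[OF cc] q coord_vector_nonsmooth)
qed

lemma coordinate_functions:
  assumes c: "admissible_chart A c" and p: "p \<in> fst c"
  obtains \<xi> where "\<And>w. \<xi> w \<in> smooth_functions A" "\<And>w. \<forall>\<^sub>F q in nhds p. \<xi> w q = snd c q \<bullet> w"
proof -
  have "\<exists>f. f \<in> smooth_functions A \<and> (\<forall>\<^sub>F q in nhds p. f q = snd c q \<bullet> w)" for w
    using lift_function[OF c p open_UNIV _ smooth_on_inner[OF open_UNIV smooth_on_id[OF open_UNIV] smooth_on_const[of _ w]]]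
    by (metis UNIV_I)
  then show ?thesis using that by metis
qed

lemma coord_vector_coordinate:
  assumes c: "admissible_chart A c" and q: "q \<in> fst c"
    and f: "f \<in> smooth_functions A" "\<forall>\<^sub>F q' in nhds q. f q' = snd c q' \<bullet> w"
  shows "coord_vector A c q u f = u \<bullet> w"
  by (rule coord_vector_eval[OF c q f]) (auto intro!: derivative_eq_intros)

lemma coord_vector_inj:
  assumes c: "admissible_chart A c" and q: "q \<in> fst c" and eq: "coord_vector A c q u = coord_vector A c q w"
  shows "u = w"
proof -
  obtain \<xi> where \<xi>: "\<And>w. \<xi> w \<in> smooth_functions A" "\<And>w. \<forall>\<^sub>F q' in nhds q. \<xi> w q' = snd c q' \<bullet> w"
    by (rule coordinate_functions[OF c q]) (rule that)
  have "u \<bullet> b = w \<bullet> b" for b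
    using coord_vector_coordinate[OF c q \<xi>, of u b] coord_vector_coordinate[OF c q \<xi>, of w b] eq by simp
  then show ?thesis using euclidean_eqI by blast
qed

text \<open>Hadamard's lemma writes a function near \<open>p\<close> as \<open>f(p) + \<Sum> (x - p)\<^sub>b h\<^sub>b\<close>; so a derivation is determined by its values on
  the coordinates.\<close>

lemma tangent_coord:
  assumes c: "admissible_chart A c" and p: "p \<in> fst c" and v: "v \<in> tangent A p"
    and \<xi>: "\<And>b. \<xi> b \<in> smooth_functions A" "\<And>b. b \<in> Basis \<Longrightarrow> \<forall>\<^sub>F q in nhds p. \<xi> b q = snd c q \<bullet> b"
  shows "v = coord_vector A c p (\<Sum>b\<in>Basis. v (\<xi> b) *\<^sub>R b)"
proof
  fix f :: "'a \<Rightarrow> real"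
  note cc = admissible_is_chart[OF c]
  let ?x = "snd c p" and ?F = "\<lambda>x. f (chart_inv c x)"
  show "v f = coord_vector A c p (\<Sum>b\<in>Basis. v (\<xi> b) *\<^sub>R b) f"
  proof (cases "f \<in> smooth_functions A")
    case f: True
    have op: "open (snd c ` fst c)" using cc by (auto simp: is_chart_def)
    then obtain r where r: "r > 0" "ball ?x r \<subseteq> snd c ` fst c" using p open_contains_ball by blast
    let ?B = "ball ?x r"
    have B: "convex ?B" "open ?B" "?x \<in> ?B" using r by auto
    have sF: "smooth_on ?B ?F"
      by (rule smooth_on_subset[OF op B(2) r(2) smooth_function_chart[OF f c]])
    let ?h = "\<lambda>b. ray_mean 0 ?x (\<lambda>y. frechet_derivative ?F (at y) b)"
    have sh: "smooth_on ?B (?h b)" for b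
      using Ck_on_ray_mean[OF B smooth_on_Ck[OF smooth_on_dd[OF sF]]] by (simp add: smooth_on_def)
    have "\<exists>g. g \<in> smooth_functions A \<and> (\<forall>\<^sub>F q in nhds p. g q = ?h b (snd c q))" for b
      by (rule lift_function[OF c p B(2,3) sh[of b]]) blast
    then have "\<exists>H. \<forall>b. H b \<in> smooth_functions A \<and> (\<forall>\<^sub>F q in nhds p. H b q = ?h b (snd c q))"
      by (intro choice allI)
    then obtain H where H: "\<And>b. H b \<in> smooth_functions A" "\<And>b. \<forall>\<^sub>F q in nhds p. H b q = ?h b (snd c q)"
      by blast
    let ?g = "\<lambda>q. f p + (\<Sum>b\<in>Basis. (\<xi> b q - ?x \<bullet> b) * H b q)"
    have "\<forall>\<^sub>F q in nhds p. \<forall>b\<in>Basis. \<xi> b q = snd c q \<bullet> b \<and> H b q = ?h b (snd c q)"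
      by (intro eventually_ball_finite ballI eventually_conj \<xi> H finite_Basis)
    moreover have "\<forall>\<^sub>F q in nhds p. q \<in> fst c \<and> snd c q \<in> ?B"
      by (rule eventually_chart[OF cc p eventually_in_open[OF B(2,3)]])
    ultimately have "\<forall>\<^sub>F q in nhds p. f q = ?g q"
    proof eventually_elim
      case (elim q)
      let ?y = "snd c q"
      have y: "?y \<in> ?B" using elim(2) by blast
      have lin: "linear (frechet_derivative ?F (at z))" if "z \<in> ?B" for z
        using smooth_on_has_derivative[OF B(2) sF that] has_derivative_bounded_linear bounded_linear.linear by blast
      have "?F ?y - ?F ?x = ray_mean 0 ?x (\<lambda>z. frechet_derivative ?F (at z) (?y - ?x)) ?y"
        by (rule ray_mean_parts(2)[OF B(1,2,3) y smooth_on_Ck[OF sF], symmetric])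
      also have "\<dots> = ray_mean 0 ?x (\<lambda>z. \<Sum>b\<in>Basis. ((?y - ?x) \<bullet> b) *\<^sub>R frechet_derivative ?F (at z) b) ?y"
        by (rule ray_mean_cong[OF B(1,3) y]) (rule linear_basis_sum[OF lin])
      also have "\<dots> = (\<Sum>b\<in>Basis. ray_mean 0 ?x (\<lambda>z. ((?y - ?x) \<bullet> b) *\<^sub>R frechet_derivative ?F (at z) b) ?y)"
        by (rule ray_mean_sum[OF B(1,3) y finite_Basis])
          (intro continuous_on_scaleR continuous_on_const smooth_on_continuous[OF smooth_on_dd[OF sF]])
      finally have "f q - f p = (\<Sum>b\<in>Basis. ((?y - ?x) \<bullet> b) * ?h b ?y)"
        unfolding ray_mean_scaleR using elim(2) p by (simp add: is_chart_inv[OF cc])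
      moreover have "(\<Sum>b\<in>Basis. (\<xi> b q - ?x \<bullet> b) * H b q) = (\<Sum>b\<in>Basis. ((?y - ?x) \<bullet> b) * ?h b ?y)"
        using elim(1) by (intro sum.cong) (auto simp: inner_diff_left)
      ultimately show ?case by simp
    qed
    then have "v f = v ?g"
      by (intro tangent_local[OF v f]) (intro sf_add sf_sum sf_mult sf_diff sf_const \<xi> H)
    also have "\<dots> = v (\<lambda>q. \<Sum>b\<in>Basis. (\<xi> b q - ?x \<bullet> b) * H b q)"
      using tangentD(1)[OF v sf_const, of "\<lambda>q. \<Sum>b\<in>Basis. (\<xi> b q - ?x \<bullet> b) * H b q" "f p"] tangent_const[OF v]
      by (simp add: sf_sum sf_mult sf_diff \<xi>(1) H(1))
    also have "\<dots> = (\<Sum>b\<in>Basis. v (\<lambda>q. (\<xi> b q - ?x \<bullet> b) * H b q))"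
      by (rule tangent_sum[OF v finite_Basis]) (intro sf_mult sf_diff sf_const \<xi> H)
    also have "\<dots> = (\<Sum>b\<in>Basis. v (\<xi> b) * frechet_derivative ?F (at ?x) b)"
    proof (intro sum.cong refl)
      fix b :: 'e assume "b \<in> Basis"
      have "\<xi> b p = ?x \<bullet> b" "H b p = ?h b ?x"
        using eventually_nhds_x_imp_x[OF \<xi>(2)[OF \<open>b \<in> Basis\<close>]] eventually_nhds_x_imp_x[OF H(2)] by auto
      moreover have "?h b ?x = frechet_derivative ?F (at ?x) b" by (simp add: ray_mean_def)
      moreover have "v (\<lambda>q. (\<xi> b q - ?x \<bullet> b) * H b q) = v (\<lambda>q. \<xi> b q - ?x \<bullet> b) * H b p + (\<xi> b p - ?x \<bullet> b) * v (H b)"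
        by (rule tangentD(3)[OF v sf_diff[OF \<xi>(1) sf_const] H(1)])
      moreover have "v (\<lambda>q. \<xi> b q - ?x \<bullet> b) = v (\<xi> b) - 0"
        using tangent_diff[OF v \<xi>(1) sf_const] tangent_const[OF v] by simp
      ultimately show "v (\<lambda>q. (\<xi> b q - ?x \<bullet> b) * H b q) = v (\<xi> b) * frechet_derivative ?F (at ?x) b"
        by simp
    qed
    also have "\<dots> = (\<Sum>b\<in>Basis. tscale (v (\<xi> b)) (coord_vector A c p b)) f"
      using f by (simp add: fun_sum_apply tscale_def coord_vector_def comp_def)
    finally show ?thesis by (simp add: coord_vector_sum[OF c p])
  qed (simp add: tangentD(4)[OF v] coord_vector_nonsmooth)
qed

lemma tangent_coord_ex:
  assumes "admissible_chart A c" "p \<in> fst c" "v \<in> tangent A p"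
  obtains w where "v = coord_vector A c p w"
proof -
  obtain \<xi> where "\<And>w. \<xi> w \<in> smooth_functions A" "\<And>w. \<forall>\<^sub>F q' in nhds p. \<xi> w q' = snd c q' \<bullet> w"
    by (rule coordinate_functions[OF assms(1,2)]) (rule that)
  from tangent_coord[OF assms this] show ?thesis by (rule that)
qed

lemma vfD: "X \<in> vector_fields A \<Longrightarrow> X p \<in> tangent A p"
  "X \<in> vector_fields A \<Longrightarrow> f \<in> smooth_functions A \<Longrightarrow> (\<lambda>p. X p f) \<in> smooth_functions A"
  by (auto simp: vector_fields_def)

lemma vf_zero [simp]: "0 \<in> vector_fields A"
  by (auto simp: vector_fields_def)

lemma vf_add [simp]: "X \<in> vector_fields A \<Longrightarrow> Y \<in> vector_fields A \<Longrightarrow> X + Y \<in> vector_fields A"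
  by (auto simp: vector_fields_def intro: sf_add)

lemma vf_uminus [simp]: "X \<in> vector_fields A \<Longrightarrow> - X \<in> vector_fields A"
  by (auto simp: vector_fields_def intro: sf_minus)

lemma vf_minus [simp]: "X \<in> vector_fields A \<Longrightarrow> Y \<in> vector_fields A \<Longrightarrow> X - Y \<in> vector_fields A"
  using vf_add[of X "- Y"] by simp

lemma vf_fscale [simp]: "h \<in> smooth_functions A \<Longrightarrow> X \<in> vector_fields A \<Longrightarrow> fscale h X \<in> vector_fields A"
  by (auto simp: vector_fields_def fscale_def) (auto simp: tscale_def intro: sf_mult)

lemma vf_sum [simp]: "(\<And>i. i \<in> I \<Longrightarrow> X i \<in> vector_fields A) \<Longrightarrow> sum X I \<in> vector_fields A"
  by (induction I rule: infinite_finite_induct) auto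

lemma vf_bracket [simp]:
  assumes X: "X \<in> vector_fields A" and Y: "Y \<in> vector_fields A"
  shows "lie_bracket X Y \<in> vector_fields A"
  unfolding vector_fields_def
proof (intro CollectI conjI allI ballI)
  fix p
  note x = vfD(1)[OF X] and y = vfD(1)[OF Y]
  note x2 = vfD(2)[OF X] and y2 = vfD(2)[OF Y]
  have 1: "lie_bracket X Y p (\<lambda>x. a * f x) = a * lie_bracket X Y p f" if f: "f \<in> smooth_functions A" for a f
    by (simp add: lie_bracket_def tangentD(2)[OF x] tangentD(2)[OF y] f x2 y2 right_diff_distrib)
  have 2: "lie_bracket X Y p (\<lambda>x. f x + h x) = lie_bracket X Y p f + lie_bracket X Y p h"
    if f: "f \<in> smooth_functions A" and h: "h \<in> smooth_functions A" for f h
    by (simp add: lie_bracket_def tangentD(1)[OF x] tangentD(1)[OF y] f h x2 y2)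
  have 3: "lie_bracket X Y p (\<lambda>x. f x * h x) = lie_bracket X Y p f * h p + f p * lie_bracket X Y p h"
    if f: "f \<in> smooth_functions A" and h: "h \<in> smooth_functions A" for f h
    by (simp add: lie_bracket_def tangentD(1,3)[OF x] tangentD(1,3)[OF y] f h x2 y2 sf_mult)
      (simp add: algebra_simps)
  have 4: "lie_bracket X Y p f = 0" if "f \<notin> smooth_functions A" for f
    using that by (simp add: lie_bracket_def tangentD(4)[OF x] tangentD(4)[OF y] tangent_const[OF x] tangent_const[OF y])
  show "lie_bracket X Y p \<in> tangent A p"
    unfolding tangent_def by (auto simp: 1 2 3 4)
next
  fix f assume f: "f \<in> smooth_functions A"
  show "(\<lambda>p. lie_bracket X Y p f) \<in> smooth_functions A"
    unfolding lie_bracket_def by (rule sf_diff[OF vfD(2)[OF X vfD(2)[OF Y f]] vfD(2)[OF Y vfD(2)[OF X f]]])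
qed

end

section \<open>Local frames, brackets and sections\<close>

lemma tscale_one [simp]: "tscale 1 v = v" and tscale_zero [simp]: "tscale 0 v = 0" "tscale a 0 = 0"
  and tscale_tscale: "tscale a (tscale b v) = tscale (a * b) v"
  and tscale_add: "tscale a (u + v) = tscale a u + tscale a v"
  and tscale_minus1: "tscale (- 1) v = - v"
  by (auto simp: tscale_def fun_eq_iff algebra_simps)

lemma fscale_apply: "fscale h X p = tscale (h p) (X p)"
  by (simp add: fscale_def)

lemma fscale_one [simp]: "fscale (\<lambda>_. 1) X = X" and fscale_minus1: "fscale (\<lambda>_. - 1) X = - X"
  by (auto simp: fscale_def fun_eq_iff tscale_def)

context manifold begin

text \<open>Coordinate fields multiplied by a bump. Inside the chart they are coordinate vectors, outside they vanish; hence
  they are global sections of each distribution that contains the coordinate vectors in question.\<close>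

lemma coordinate_fields:
  assumes c: "admissible_chart A c" and p: "p \<in> fst c"
  obtains E where "\<And>w. E w \<in> vector_fields A" "\<forall>\<^sub>F q in nhds p. \<forall>w. E w q = coord_vector A c q w"
    "\<And>q. q \<in> fst c \<Longrightarrow> \<exists>a. \<forall>w. E w q = coord_vector A c q (a *\<^sub>R w)"
    "\<And>q w. q \<notin> fst c \<Longrightarrow> E w q = 0"
    "\<And>u w. E (u + w) = E u + E w" "\<And>a w. E (a *\<^sub>R w) = fscale (\<lambda>_. a) (E w)"
proof -
  obtain \<psi> K where \<psi>: "\<psi> \<in> smooth_functions A" "\<forall>\<^sub>F q in nhds p. \<psi> q = 1"
    "closed K" "K \<subseteq> fst c \<inter> UNIV" "\<And>q. q \<notin> K \<Longrightarrow> \<psi> q = 0"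
    by (rule bump_function[OF c p open_UNIV UNIV_I]) (rule that)
  note cc = admissible_is_chart[OF c]
  define E where "E = (\<lambda>w q. if q \<in> fst c then tscale (\<psi> q) (coord_vector A c q w) else 0)"
  show ?thesis
  proof (rule that[of E])
    show "E w \<in> vector_fields A" for w
      unfolding vector_fields_def
    proof (intro CollectI conjI allI ballI)
      show "E w q \<in> tangent A q" for q using c by (simp add: E_def)
      fix f assume f: "f \<in> smooth_functions A"
      have "(\<lambda>q. if q \<in> fst c then \<psi> q * frechet_derivative (\<lambda>x. f (chart_inv c x)) (at (snd c q)) w else 0) \<in> smooth_functions A"
        using \<psi>(4) by (intro bump_times_chart_function[OF c \<psi>(1,3) _ \<psi>(5) smooth_on_dd[OF smooth_function_chart[OF f c]]]) auto
      also have "(\<lambda>q. if q \<in> fst c then \<psi> q * frechet_derivative (\<lambda>x. f (chart_inv c x)) (at (snd c q)) w else 0) = (\<lambda>q. E w q f)"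
        by (auto simp: E_def fun_eq_iff tscale_def coord_vector_def comp_def f)
      finally show "(\<lambda>q. E w q f) \<in> smooth_functions A" .
    qed
    have "\<forall>\<^sub>F q in nhds p. q \<in> fst c" using cc p by (intro eventually_in_open) (auto simp: is_chart_def)
    with \<psi>(2) show "\<forall>\<^sub>F q in nhds p. \<forall>w. E w q = coord_vector A c q w"
      by eventually_elim (simp add: E_def)
    show "\<exists>a. \<forall>w. E w q = coord_vector A c q (a *\<^sub>R w)" if "q \<in> fst c" for q
      using that by (intro exI[of _ "\<psi> q"]) (simp add: E_def coord_vector_linear[OF c])
    show "E w q = 0" if "q \<notin> fst c" for q w using that by (simp add: E_def)
    show "E (u + w) = E u + E w" for u w
      by (rule ext) (simp add: E_def coord_vector_linear[OF c] tscale_add)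
    show "E (a *\<^sub>R w) = fscale (\<lambda>_. a) (E w)" for a w
      by (rule ext) (simp add: E_def coord_vector_linear[OF c] fscale_apply tscale_tscale mult.commute)
  qed
qed

lemma eventually_in_chart: "is_chart c \<Longrightarrow> p \<in> fst c \<Longrightarrow> \<forall>\<^sub>F q in nhds p. q \<in> fst c"
  by (intro eventually_in_open) (auto simp: is_chart_def)

lemma field_decomposition:
  assumes c: "admissible_chart A c" and p: "p \<in> fst c" and X: "X \<in> vector_fields A"
    and \<xi>: "\<And>w. \<xi> w \<in> smooth_functions A" "\<And>w. \<forall>\<^sub>F q in nhds p. \<xi> w q = snd c q \<bullet> w"
    and E: "\<forall>\<^sub>F q in nhds p. \<forall>w. E w q = coord_vector A c q w"
  shows "\<forall>\<^sub>F q in nhds p. X q = (\<Sum>b\<in>Basis. fscale (\<lambda>q. X q (\<xi> b)) (E b)) q"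
proof -
  note cc = admissible_is_chart[OF c]
  have "\<forall>\<^sub>F q in nhds p. \<forall>b\<in>Basis. \<xi> b q = snd c q \<bullet> b"
    by (intro eventually_ball_finite ballI \<xi> finite_Basis)
  then have "\<forall>\<^sub>F q in nhds p. \<forall>\<^sub>F q' in nhds q. \<forall>b\<in>Basis. \<xi> b q' = snd c q' \<bullet> b"
    by (simp add: eventually_eventually)
  with E eventually_in_chart[OF cc p] show ?thesis
  proof eventually_elim
    case (elim q)
    have \<xi>q: "\<forall>\<^sub>F q' in nhds q. \<xi> b q' = snd c q' \<bullet> b" if "b \<in> Basis" for b
      using elim(3) by eventually_elim (use that in blast)
    have "X q = coord_vector A c q (\<Sum>b\<in>Basis. X q (\<xi> b) *\<^sub>R b)"
      by (rule tangent_coord[OF c elim(2) vfD(1)[OF X] \<xi>(1) \<xi>q])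
    then show ?case
      using elim(1) by (simp add: coord_vector_sum[OF c elim(2)] fun_sum_apply fscale_apply)
  qed
qed

text \<open>Second partial derivatives commute.\<close>

lemma bracket_coordinate_fields:
  assumes c: "admissible_chart A c" and p: "p \<in> fst c"
    and E: "\<And>w. E w \<in> vector_fields A" "\<forall>\<^sub>F q in nhds p. \<forall>w. E w q = coord_vector A c q w"
  shows "\<forall>\<^sub>F q in nhds p. lie_bracket (E u) (E w) q = 0"
proof -
  note cc = admissible_is_chart[OF c]
  have oi: "open (snd c ` fst c)" using cc by (auto simp: is_chart_def)
  have "\<forall>\<^sub>F q in nhds p. \<forall>\<^sub>F q' in nhds q. \<forall>w. E w q' = coord_vector A c q' w"
    using E(2) by (simp add: eventually_eventually)
  with eventually_in_chart[OF cc p] show ?thesis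
  proof eventually_elim
    case (elim q)
    have "lie_bracket (E u) (E w) q f = 0" for f
    proof (cases "f \<in> smooth_functions A")
      case f: True
      let ?F = "f \<circ> chart_inv c"
      have sF: "smooth_on (snd c ` fst c) ?F" using smooth_function_chart[OF f c] by (simp add: comp_def)
      have ev: "\<forall>\<^sub>F q' in nhds q. E v q' f = frechet_derivative ?F (at (snd c q')) v" for v
        using elim(2) by eventually_elim (simp add: coord_vector_def f)
      have Eq: "E v q = coord_vector A c q v" for v using eventually_nhds_x_imp_x[OF elim(2)] by blast
      have "E u q (\<lambda>q'. E w q' f) = frechet_derivative (\<lambda>y. frechet_derivative ?F (at y) w) (at (snd c q)) u" for u w
        unfolding Eq
        by (rule coord_vector_eval[OF c elim(1) vfD(2)[OF E(1) f] ev smooth_on_has_derivative[OF oi smooth_on_dd[OF sF]]])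
          (use elim(1) in blast)
      then show ?thesis
        using second_derivative_symmetric[OF oi _ sF, of "snd c q" u w] elim(1) by (simp add: lie_bracket_def)
    next
      case False
      then show ?thesis using vfD(1)[OF vf_bracket[OF E(1)[of u] E(1)[of w]]] tangentD(4) by blast
    qed
    then show ?case by (simp add: fun_eq_iff)
  qed
qed

lemma section_extension:
  assumes X: "X \<in> vector_fields A" and D: "\<And>q. 0 \<in> D q" "\<And>q a u. u \<in> D q \<Longrightarrow> tscale a u \<in> D q"
    and ev: "\<forall>\<^sub>F q in nhds p. X q \<in> D q"
  obtains X' where "X' \<in> sections A D" "\<forall>\<^sub>F q in nhds p. X' q = X q"
proof -
  obtain U where U: "open U" "p \<in> U" "\<And>q. q \<in> U \<Longrightarrow> X q \<in> D q" using ev unfolding eventually_nhds by blast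
  obtain c where c: "c \<in> A" "p \<in> fst c" using chart_at .
  obtain \<psi> K where \<psi>: "\<psi> \<in> smooth_functions A" "\<forall>\<^sub>F q in nhds p. \<psi> q = 1"
    "closed K" "K \<subseteq> fst c \<inter> U" "\<And>q. q \<notin> K \<Longrightarrow> \<psi> q = 0"
    by (rule bump_function[OF admissible_in[OF c(1)] c(2) U(1,2)]) (rule that)
  show ?thesis
  proof (rule that[of "fscale \<psi> X"])
    have "fscale \<psi> X q \<in> D q" for q
      using D U(3) \<psi>(4,5) by (cases "q \<in> K") (auto simp: fscale_apply)
    then show "fscale \<psi> X \<in> sections A D" using \<psi>(1) X by (simp add: sections_def)
    show "\<forall>\<^sub>F q in nhds p. fscale \<psi> X q = X q" using \<psi>(2) by eventually_elim (simp add: fscale_apply)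
  qed
qed

lemma jacobi:
  assumes X: "X \<in> vector_fields A" and Y: "Y \<in> vector_fields A" and Z: "Z \<in> vector_fields A"
  shows "lie_bracket X (lie_bracket Y Z) + lie_bracket Y (lie_bracket Z X) + lie_bracket Z (lie_bracket X Y) = 0"
proof (intro ext)
  fix p f
  note t = tangent_diff[OF vfD(1)[OF X, of p]] tangent_diff[OF vfD(1)[OF Y, of p]] tangent_diff[OF vfD(1)[OF Z, of p]]
  note d = vfD(2)[OF X] vfD(2)[OF Y] vfD(2)[OF Z]
  show "(lie_bracket X (lie_bracket Y Z) + lie_bracket Y (lie_bracket Z X) + lie_bracket Z (lie_bracket X Y)) p f = 0 p f"
  proof (cases "f \<in> smooth_functions A")
    case True
    then show ?thesis by (simp add: lie_bracket_def t d)
  next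
    case False
    have "lie_bracket X (lie_bracket Y Z) + lie_bracket Y (lie_bracket Z X) + lie_bracket Z (lie_bracket X Y) \<in> vector_fields A"
      using X Y Z by simp
    from tangentD(4)[OF vfD(1)[OF this] False] show ?thesis by simp
  qed
qed

end

section \<open>The metric and the Levi-Civita connection\<close>

locale riemannian = manifold A for A :: "('a::{t2_space,second_countable_topology}, 'e::euclidean_space) atlas" +
  fixes g :: "'a form2"
  assumes metric: "riemannian_metric A g"
begin

lemma g_sym: "u \<in> tangent A p \<Longrightarrow> v \<in> tangent A p \<Longrightarrow> g p u v = g p v u"
  and g_add: "u \<in> tangent A p \<Longrightarrow> v \<in> tangent A p \<Longrightarrow> w \<in> tangent A p \<Longrightarrow> g p (u + v) w = g p u w + g p v w"
  and g_scale: "u \<in> tangent A p \<Longrightarrow> v \<in> tangent A p \<Longrightarrow> g p (tscale a u) v = a * g p u v"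
  and g_pos: "u \<in> tangent A p \<Longrightarrow> u \<noteq> 0 \<Longrightarrow> g p u u > 0"
  and g_smooth: "X \<in> vector_fields A \<Longrightarrow> Y \<in> vector_fields A \<Longrightarrow> (\<lambda>p. g p (X p) (Y p)) \<in> smooth_functions A"
  using metric unfolding riemannian_metric_def by blast+

lemma g_add_right: "u \<in> tangent A p \<Longrightarrow> v \<in> tangent A p \<Longrightarrow> w \<in> tangent A p \<Longrightarrow> g p w (u + v) = g p w u + g p w v"
  using g_add[of u p v w] g_sym[of w p] by simp

lemma g_scale_right: "u \<in> tangent A p \<Longrightarrow> v \<in> tangent A p \<Longrightarrow> g p v (tscale a u) = a * g p v u"
  using g_scale[of u p v a] g_sym[of v p] by simp

lemma g_zero: "v \<in> tangent A p \<Longrightarrow> g p 0 v = 0" and g_zero_right: "v \<in> tangent A p \<Longrightarrow> g p v 0 = 0"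
  using g_scale[of 0 p v 0] g_scale_right[of 0 p v 0] by auto

lemma g_minus: "u \<in> tangent A p \<Longrightarrow> v \<in> tangent A p \<Longrightarrow> g p (- u) v = - g p u v"
  and g_minus_right: "u \<in> tangent A p \<Longrightarrow> v \<in> tangent A p \<Longrightarrow> g p v (- u) = - g p v u"
  using g_scale[of u p v "- 1"] g_scale_right[of u p v "- 1"] by (auto simp: tscale_minus1)

lemma g_diff: "u \<in> tangent A p \<Longrightarrow> v \<in> tangent A p \<Longrightarrow> w \<in> tangent A p \<Longrightarrow> g p (u - v) w = g p u w - g p v w"
  and g_diff_right: "u \<in> tangent A p \<Longrightarrow> v \<in> tangent A p \<Longrightarrow> w \<in> tangent A p \<Longrightarrow> g p w (u - v) = g p w u - g p w v"
  using g_add[of u p "- v" w] g_add_right[of u p "- v" w] by (auto simp: g_minus g_minus_right)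

lemma g_sum: "(\<And>i. i \<in> I \<Longrightarrow> u i \<in> tangent A p) \<Longrightarrow> v \<in> tangent A p \<Longrightarrow> g p (sum u I) v = (\<Sum>i\<in>I. g p (u i) v)"
  by (induction I rule: infinite_finite_induct) (auto simp: g_zero g_add)

lemma g_definite: "u \<in> tangent A p \<Longrightarrow> g p u u = 0 \<Longrightarrow> u = 0"
  using g_pos by fastforce

end

locale connection = riemannian A g
  for A :: "('a::{t2_space,second_countable_topology}, 'e::euclidean_space) atlas" and g :: "'a form2" +
  fixes D :: "'a connection"
  assumes lc: "levi_civita A g D"
begin

lemma D_vf [simp]: "X \<in> vector_fields A \<Longrightarrow> Y \<in> vector_fields A \<Longrightarrow> D X Y \<in> vector_fields A"
  and D_add_left: "X \<in> vector_fields A \<Longrightarrow> Y \<in> vector_fields A \<Longrightarrow> Z \<in> vector_fields A \<Longrightarrow> D (X + Y) Z = D X Z + D Y Z"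
  and D_add_right: "X \<in> vector_fields A \<Longrightarrow> Y \<in> vector_fields A \<Longrightarrow> Z \<in> vector_fields A \<Longrightarrow> D X (Y + Z) = D X Y + D X Z"
  and D_scale_left: "h \<in> smooth_functions A \<Longrightarrow> X \<in> vector_fields A \<Longrightarrow> Y \<in> vector_fields A \<Longrightarrow> D (fscale h X) Y = fscale h (D X Y)"
  and D_scale_right: "h \<in> smooth_functions A \<Longrightarrow> X \<in> vector_fields A \<Longrightarrow> Y \<in> vector_fields A \<Longrightarrow>
    D X (fscale h Y) = fscale (\<lambda>p. X p h) Y + fscale h (D X Y)"
  and D_torsion: "X \<in> vector_fields A \<Longrightarrow> Y \<in> vector_fields A \<Longrightarrow> D X Y - D Y X = lie_bracket X Y"
  and D_metric: "X \<in> vector_fields A \<Longrightarrow> Y \<in> vector_fields A \<Longrightarrow> Z \<in> vector_fields A \<Longrightarrow>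
    X p (\<lambda>q. g q (Y q) (Z q)) = g p (D X Y p) (Z p) + g p (Y p) (D X Z p)"
  using lc unfolding levi_civita_def by blast+

lemma D_zero_left: "Y \<in> vector_fields A \<Longrightarrow> D 0 Y = 0" and D_zero_right: "X \<in> vector_fields A \<Longrightarrow> D X 0 = 0"
  using D_add_left[of 0 0 Y] D_add_right[of X 0 0] by auto

lemma D_minus_left: "X \<in> vector_fields A \<Longrightarrow> Y \<in> vector_fields A \<Longrightarrow> D (- X) Y = - D X Y"
  and D_minus_right: "X \<in> vector_fields A \<Longrightarrow> Y \<in> vector_fields A \<Longrightarrow> D X (- Y) = - D X Y"
  using D_add_left[of X "- X" Y] D_add_right[of X Y "- Y"]
  by (auto simp: D_zero_left D_zero_right add_eq_0_iff)

lemma D_diff_left: "X \<in> vector_fields A \<Longrightarrow> Y \<in> vector_fields A \<Longrightarrow> Z \<in> vector_fields A \<Longrightarrow> D (X - Y) Z = D X Z - D Y Z"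
  and D_diff_right: "X \<in> vector_fields A \<Longrightarrow> Y \<in> vector_fields A \<Longrightarrow> Z \<in> vector_fields A \<Longrightarrow> D X (Y - Z) = D X Y - D X Z"
  using D_add_left[of X "- Y" Z] D_add_right[of X Y "- Z"] by (auto simp: D_minus_left D_minus_right)

lemma D_sum_left: "(\<And>i. i \<in> I \<Longrightarrow> X i \<in> vector_fields A) \<Longrightarrow> Y \<in> vector_fields A \<Longrightarrow> D (sum X I) Y = (\<Sum>i\<in>I. D (X i) Y)"
  by (induction I rule: infinite_finite_induct) (auto simp: D_zero_left D_add_left)

lemma D_sum_right: "(\<And>i. i \<in> I \<Longrightarrow> Y i \<in> vector_fields A) \<Longrightarrow> X \<in> vector_fields A \<Longrightarrow> D X (sum Y I) = (\<Sum>i\<in>I. D X (Y i))"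
  by (induction I rule: infinite_finite_induct) (auto simp: D_zero_right D_add_right)

lemma vanishing_bump:
  assumes "\<forall>\<^sub>F q in nhds p. Z q = (0 :: 'a tvec)"
  obtains \<psi> where "\<psi> \<in> smooth_functions A" "\<psi> p = 1" "fscale \<psi> Z = 0"
proof -
  obtain U where U: "open U" "p \<in> U" "\<And>q. q \<in> U \<Longrightarrow> Z q = 0" using assms unfolding eventually_nhds by blast
  obtain c where c: "c \<in> A" "p \<in> fst c" using chart_at .
  obtain \<psi> K where \<psi>: "\<psi> \<in> smooth_functions A" "\<forall>\<^sub>F q in nhds p. \<psi> q = 1"
    "closed K" "K \<subseteq> fst c \<inter> U" "\<And>q. q \<notin> K \<Longrightarrow> \<psi> q = 0"
    by (rule bump_function[OF admissible_in[OF c(1)] c(2) U(1,2)]) (rule that)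
  show ?thesis
  proof (rule that[OF \<psi>(1)])
    show "\<psi> p = 1" using eventually_nhds_x_imp_x[OF \<psi>(2)] .
    have "fscale \<psi> Z q = 0" for q using \<psi>(4,5) U(3) by (cases "q \<in> K") (auto simp: fscale_apply)
    then show "fscale \<psi> Z = 0" by (simp add: fun_eq_iff)
  qed
qed

text \<open>Apply the Leibniz rule to \<open>\<psi> (Y - Y') = 0\<close> with a bump \<open>\<psi>\<close>.\<close>

lemma D_local_right:
  assumes X: "X \<in> vector_fields A" and Y: "Y \<in> vector_fields A" and Y': "Y' \<in> vector_fields A"
    and eq: "\<forall>\<^sub>F q in nhds p. Y q = Y' q"
  shows "D X Y p = D X Y' p"
proof -
  have ev: "\<forall>\<^sub>F q in nhds p. (Y - Y') q = 0" using eq by eventually_elim simp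
  obtain \<psi> where \<psi>: "\<psi> \<in> smooth_functions A" "\<psi> p = 1" "fscale \<psi> (Y - Y') = 0"
    by (rule vanishing_bump[OF ev]) (rule that)
  have "0 = D X (fscale \<psi> (Y - Y')) p" by (simp add: \<psi> D_zero_right X)
  also have "\<dots> = D X (Y - Y') p"
    using eventually_nhds_x_imp_x[OF eq] by (simp add: D_scale_right \<psi>(1,2) X Y Y' fscale_apply)
  finally show ?thesis by (simp add: D_diff_right X Y Y')
qed

text \<open>Near \<open>p\<close> the field \<open>X - X'\<close> is a combination of coordinate fields whose coefficients vanish at \<open>p\<close>.\<close>

lemma D_pointwise_left:
  assumes X: "X \<in> vector_fields A" and X': "X' \<in> vector_fields A" and Y: "Y \<in> vector_fields A"
    and eq: "X p = X' p"
  shows "D X Y p = D X' Y p"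
proof -
  obtain c where c: "c \<in> A" and p: "p \<in> fst c" using chart_at .
  note ac = admissible_in[OF c]
  obtain \<xi> where \<xi>: "\<And>w. \<xi> w \<in> smooth_functions A" "\<And>w. \<forall>\<^sub>F q' in nhds p. \<xi> w q' = snd c q' \<bullet> w"
    by (rule coordinate_functions[OF ac p]) (rule that)
  obtain E where E: "\<And>w. E w \<in> vector_fields A" "\<forall>\<^sub>F q in nhds p. \<forall>w. E w q = coord_vector A c q w"
    by (rule coordinate_fields[OF ac p]) (rule that)
  define Z where "Z = X - X'"
  have Z: "Z \<in> vector_fields A" "Z p = 0" using X X' eq by (auto simp: Z_def)
  let ?S = "\<Sum>b\<in>Basis. fscale (\<lambda>q. Z q (\<xi> b)) (E b)"
  have S: "?S \<in> vector_fields A" by (intro vf_sum vf_fscale vfD(2)[OF Z(1)] \<xi> E)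
  have "\<forall>\<^sub>F q in nhds p. (Z - ?S) q = 0"
    using field_decomposition[OF ac p Z(1) \<xi> E(2)] by eventually_elim simp
  then obtain \<psi> where \<psi>: "\<psi> \<in> smooth_functions A" "\<psi> p = 1" "fscale \<psi> (Z - ?S) = 0"
    by (rule vanishing_bump) (rule that)
  have "0 = D (fscale \<psi> (Z - ?S)) Y p" by (simp add: \<psi> D_zero_left Y)
  also have "\<dots> = D (Z - ?S) Y p" using S Z \<psi>(1,2) Y by (simp add: D_scale_left fscale_apply)
  also have "\<dots> = D Z Y p - D ?S Y p" using S Z Y by (simp add: D_diff_left)
  also have "D ?S Y = (\<Sum>b\<in>Basis. fscale (\<lambda>q. Z q (\<xi> b)) (D (E b) Y))"
    by (subst D_sum_left) (auto simp: vfD(2)[OF Z(1)] \<xi> E Y D_scale_left)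
  also have "\<dots> p = 0" by (simp add: fun_sum_apply fscale_apply Z)
  finally have "D Z Y p = 0" by (simp add: fun_eq_iff)
  moreover have "D Z Y = D X Y - D X' Y" unfolding Z_def by (rule D_diff_left[OF X X' Y])
  ultimately show ?thesis by simp
qed

end

text \<open>Orthogonal projection with respect to a positive definite form. The map \<open>T\<close> represents \<open>G a\<close> by an element of \<open>W\<close>; it
  is injective on \<open>W\<close>, hence maps \<open>W\<close> onto \<open>W\<close>.\<close>

lemma pos_def_projection:
  fixes G :: "'e::euclidean_space \<Rightarrow> 'e \<Rightarrow> real"
  assumes lin: "\<And>b. linear (\<lambda>a. G a b)" "\<And>a. linear (G a)" and pos: "\<And>a. a \<noteq> 0 \<Longrightarrow> G a a > 0"
    and W: "subspace W"
  obtains w where "w \<in> W" "\<And>z. z \<in> W \<Longrightarrow> G (u - w) z = 0"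
proof -
  obtain B where B: "B \<subseteq> W" "pairwise orthogonal B" "\<And>x. x \<in> B \<Longrightarrow> norm x = 1"
    "independent B" "card B = dim W" "span B = W"
    using orthonormal_basis_subspace[OF W] by metis
  have fin: "finite B" using B(4) independent_imp_finite by blast
  define T where "T = (\<lambda>a. \<Sum>b\<in>B. G a b *\<^sub>R b)"
  have T: "linear T" unfolding T_def
    by (intro linear_compose_sum ballI linear_compose[OF lin(1), of "\<lambda>x. x *\<^sub>R _", unfolded comp_def]
        bounded_linear.linear bounded_linear_scaleR_left)
  have TW: "T a \<in> W" for a unfolding T_def using B(1) W by (intro subspace_sum subspace_scale) auto
  have T0: "G a z = 0" if a: "T a = 0" and z: "z \<in> W" for a z
  proof -
    have "G a b = 0" if "b \<in> B" for b
    proof -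
      have "T a \<bullet> b = (\<Sum>b'\<in>B. if b' = b then G a b else 0)"
        unfolding T_def inner_sum_left
      proof (intro sum.cong refl)
        fix b' assume "b' \<in> B"
        show "G a b' *\<^sub>R b' \<bullet> b = (if b' = b then G a b else 0)"
        proof (cases "b' = b")
          case True then show ?thesis using B(3)[OF that] by (simp add: norm_eq_1)
        next
          case False
          then have "b' \<bullet> b = 0" using B(2) \<open>b' \<in> B\<close> that by (auto simp: pairwise_def orthogonal_def)
          then show ?thesis using False by simp
        qed
      qed
      then show ?thesis using a that fin by simp
    qed
    moreover have "z \<in> span B" using z B(6) by simp
    ultimately show ?thesis using linear_eq_0_on_span[OF lin(2)] by blast
  qed
  have "inj_on T W"
    unfolding linear_inj_on_iff_eq_0[OF T W]
  proof (intro ballI impI)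
    fix a assume "a \<in> W" "T a = 0"
    then have "G a a = 0" using T0 by blast
    then show "a = 0" using pos by fastforce
  qed
  then have "dim (T ` W) = dim W" using dim_image_eq[OF T] W by (simp add: span_eq_iff[THEN iffD2])
  moreover have "T ` W \<subseteq> W" "subspace (T ` W)" using TW linear_subspace_image[OF T W] by auto
  ultimately have "T ` W = W" using subspace_dim_equal W by (metis order_refl)
  then obtain w where w: "w \<in> W" "T u = T w" using TW[of u] by (metis imageE)
  have "T (u - w) = 0" using w linear_diff[OF T] by simp
  from T0[OF this] show ?thesis by (rule that[OF w(1)])
qed

section \<open>The covariant derivative of the complex structure\<close>

locale lagrangian = connection A g D + B: riemannian A' gB
  for A :: "('a::{t2_space,second_countable_topology}, 'e::euclidean_space) atlas" and g :: "'a form2"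
    and D :: "'a connection"
    and A' :: "('b::{t2_space,second_countable_topology}, 'f::euclidean_space) atlas" and gB :: "'b form2" +
  fixes J :: "'a endo" and \<omega> :: "'a form1" and B1 :: "'a vfield" and \<pi> :: "'a \<Rightarrow> 'b"
  assumes lck: "lck_manifold A J g \<omega>" and lee: "lee_vector_field A g \<omega> B1"
    and lagr: "lagrangian_submersion A J g A' gB \<pi>"
    and B1v: "B1 \<in> sections A (vertical A A' \<pi>)"
begin

abbreviation "Ver \<equiv> vertical A A' \<pi>"
abbreviation "Hor \<equiv> horizontal A A' g \<pi>"
abbreviation "SV \<equiv> sections A Ver"
abbreviation "SH \<equiv> sections A Hor"
abbreviation "d\<pi> \<equiv> differential A' \<pi>"

lemma J_tangent [simp]: "u \<in> tangent A p \<Longrightarrow> J p u \<in> tangent A p"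
  and J_J [simp]: "u \<in> tangent A p \<Longrightarrow> J p (J p u) = - u"
  and J_add: "u \<in> tangent A p \<Longrightarrow> v \<in> tangent A p \<Longrightarrow> J p (u + v) = J p u + J p v"
  and J_scale: "u \<in> tangent A p \<Longrightarrow> J p (tscale a u) = tscale a (J p u)"
  and J_vf [simp]: "X \<in> vector_fields A \<Longrightarrow> app J X \<in> vector_fields A"
  and nijenhuis_zero: "X \<in> vector_fields A \<Longrightarrow> Y \<in> vector_fields A \<Longrightarrow> nijenhuis J X Y = 0"
  and J_isometry [simp]: "u \<in> tangent A p \<Longrightarrow> v \<in> tangent A p \<Longrightarrow> g p (J p u) (J p v) = g p u v"
  using lck unfolding lck_manifold_def hermitian_manifold_def almost_complex_def by auto

lemma dOmega: "X \<in> vector_fields A \<Longrightarrow> Y \<in> vector_fields A \<Longrightarrow> Z \<in> vector_fields A \<Longrightarrow>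
    ext_deriv2 (fundamental_form J g) X Y Z p = wedge12 \<omega> (fundamental_form J g) X Y Z p"
  and B1_vf [simp]: "B1 \<in> vector_fields A"
  and B1: "v \<in> tangent A p \<Longrightarrow> \<omega> p v = g p v (B1 p)"
  using lck lee unfolding lck_manifold_def lee_vector_field_def by auto

lemma J_zero [simp]: "J p 0 = 0"
  using J_scale[of 0 p 0] by simp

lemma J_minus: "u \<in> tangent A p \<Longrightarrow> J p (- u) = - J p u"
  using J_scale[of u p "- 1"] by (simp add: tscale_minus1)

lemma J_diff: "u \<in> tangent A p \<Longrightarrow> v \<in> tangent A p \<Longrightarrow> J p (u - v) = J p u - J p v"
  using J_add[of u p "- v"] by (simp add: J_minus)

lemma J_adjoint: "u \<in> tangent A p \<Longrightarrow> v \<in> tangent A p \<Longrightarrow> g p (J p u) v = - g p u (J p v)"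
  using J_isometry[of u p "J p v"] by (simp add: g_minus_right)

lemma app_apply: "app J X p = J p (X p)"
  by (simp add: app_def)

lemma app_app: "X \<in> vector_fields A \<Longrightarrow> app J (app J X) = - X"
  by (auto simp: app_def vfD fun_eq_iff)

lemma app_uminus: "X \<in> vector_fields A \<Longrightarrow> app J (- X) = - app J X"
  by (simp add: app_def J_minus vfD fun_eq_iff)

lemma bracket_D: "X \<in> vector_fields A \<Longrightarrow> Y \<in> vector_fields A \<Longrightarrow> lie_bracket X Y p = D X Y p - D Y X p"
  by (simp add: D_torsion[symmetric])

text \<open>The derivative \<open>(\<nabla>\<^sub>X J)Y\<close>.\<close>

definition DJ :: "'a vfield \<Rightarrow> 'a vfield \<Rightarrow> 'a vfield" where
  "DJ X Y = D X (app J Y) - app J (D X Y)"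

lemma DJ_vf [simp]: "X \<in> vector_fields A \<Longrightarrow> Y \<in> vector_fields A \<Longrightarrow> DJ X Y \<in> vector_fields A"
  by (simp add: DJ_def)

lemma DJ_skew:
  assumes X: "X \<in> vector_fields A" and Y: "Y \<in> vector_fields A" and Z: "Z \<in> vector_fields A"
  shows "g p (DJ X Y p) (Z p) = - g p (DJ X Z p) (Y p)"
proof -
  note t = vfD(1)[OF X] vfD(1)[OF Y] vfD(1)[OF Z] vfD(1)[OF D_vf[OF X Y]] vfD(1)[OF D_vf[OF X Z]]
    vfD(1)[OF D_vf[OF X J_vf[OF Y]]] vfD(1)[OF D_vf[OF X J_vf[OF Z]]]
  have eq: "(\<lambda>q. g q (app J Y q) (Z q)) = (\<lambda>q. - 1 * g q (Y q) (app J Z q))"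
    by (rule ext) (simp add: app_apply J_adjoint t)
  have "X p (\<lambda>q. g q (app J Y q) (Z q)) = - 1 * X p (\<lambda>q. g q (Y q) (app J Z q))"
    unfolding eq by (rule tangentD(2)[OF vfD(1)[OF X] g_smooth[OF Y J_vf[OF Z]]])
  then have "g p (D X (app J Y) p) (Z p) + g p (app J Y p) (D X Z p)
      = - (g p (D X Y p) (app J Z p) + g p (Y p) (D X (app J Z) p))"
    by (simp add: D_metric X Y Z)
  then show ?thesis
    by (simp add: DJ_def app_apply g_diff J_adjoint t g_sym[of "Y p"])
qed

lemma DJ_J:
  assumes X: "X \<in> vector_fields A" and Y: "Y \<in> vector_fields A" and Z: "Z \<in> vector_fields A"
  shows "g p (DJ X (app J Y) p) (Z p) = g p (DJ X Y p) (app J Z p)"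
proof -
  note t = vfD(1)[OF X] vfD(1)[OF Y] vfD(1)[OF Z] vfD(1)[OF D_vf[OF X Y]]
    vfD(1)[OF D_vf[OF X J_vf[OF Y]]]
  show ?thesis
    by (simp add: DJ_def app_app D_minus_right X Y app_apply g_diff g_minus J_adjoint t g_minus_right)
qed

text \<open>Write all brackets as differences of covariant derivatives; the terms without \<open>\<nabla>J\<close> cancel.\<close>

lemma dOmega_DJ:
  assumes X: "X \<in> vector_fields A" and Y: "Y \<in> vector_fields A" and Z: "Z \<in> vector_fields A"
  shows "ext_deriv2 (fundamental_form J g) X Y Z p =
    - (g p (DJ X Y p) (Z p) + g p (DJ Y Z p) (X p) + g p (DJ Z X p) (Y p))"
proof -
  note t = vfD(1)[OF X] vfD(1)[OF Y] vfD(1)[OF Z]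
  have tD: "D U W q \<in> tangent A q" if "U \<in> {X, Y, Z}" "W \<in> {X, Y, Z}" for U W q
    using that X Y Z by (auto intro!: vfD(1) D_vf)
  have tDJ: "D U (app J W) q \<in> tangent A q" if "U \<in> {X, Y, Z}" "W \<in> {X, Y, Z}" for U W q
    using that X Y Z by (auto intro!: vfD(1) D_vf J_vf)
  have m: "U p (\<lambda>q. g q (V q) (J q (W q))) = g p (D U V p) (J p (W p)) + g p (V p) (D U (app J W) p)"
    if "U \<in> {X, Y, Z}" "V \<in> {X, Y, Z}" "W \<in> {X, Y, Z}" for U V W
    using D_metric[of U V "app J W" p] that X Y Z by (auto simp: app_apply)
  have b: "lie_bracket U W p = D U W p - D W U p" if "U \<in> {X, Y, Z}" "W \<in> {X, Y, Z}" for U W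
    using bracket_D[of U W] that X Y Z by blast
  have s1: "g p (DJ X Y p) (Z p) = - g p (DJ X Z p) (Y p)" by (rule DJ_skew[OF X Y Z])
  have s2: "g p (DJ Z X p) (Y p) = - g p (DJ Z Y p) (X p)" by (rule DJ_skew[OF Z X Y])
  have e: "g p (DJ U V p) (W p) = g p (W p) (D U (app J V) p) + g p (D U V p) (J p (W p))"
    if "U \<in> {X, Y, Z}" "V \<in> {X, Y, Z}" "W \<in> {X, Y, Z}" for U V W
  proof -
    have "W p \<in> tangent A p" using that t by auto
    then show ?thesis using tD[OF that(1,2), of p] tDJ[OF that(1,2), of p]
      by (simp add: DJ_def app_apply g_diff J_adjoint g_sym[of "D U (app J V) p"])
  qed
  show ?thesis
    unfolding s1 s2 by (simp add: ext_deriv2_def fundamental_form_def m b e g_diff tD t)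
qed

lemma nijenhuis_DJ:
  assumes X: "X \<in> vector_fields A" and Y: "Y \<in> vector_fields A" and Z: "Z \<in> vector_fields A"
  shows "g p (DJ (app J X) Y p) (Z p) - g p (DJ (app J Y) X p) (Z p)
    - g p (DJ Y X p) (app J Z p) + g p (DJ X Y p) (app J Z p) = 0"
proof -
  note JX = J_vf[OF X] and JY = J_vf[OF Y]
  note t = vfD(1)[OF Z] vfD(1)[OF D_vf[OF X Y]] vfD(1)[OF D_vf[OF Y X]]
    vfD(1)[OF D_vf[OF JX Y]] vfD(1)[OF D_vf[OF JY X]] vfD(1)[OF D_vf[OF X JY]] vfD(1)[OF D_vf[OF Y JX]]
    vfD(1)[OF D_vf[OF JX JY]] vfD(1)[OF D_vf[OF JY JX]]
  have "0 = nijenhuis J X Y p" using nijenhuis_zero[OF X Y] by simp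
  also have "\<dots> = (D (app J X) (app J Y) p - D (app J Y) (app J X) p) - (D X Y p - D Y X p)
    - J p (D (app J X) Y p - D Y (app J X) p) - J p (D X (app J Y) p - D (app J Y) X p)"
    by (simp add: nijenhuis_def app_apply D_torsion[symmetric] X Y)
  finally have "0 = g p ((D (app J X) (app J Y) p - D (app J Y) (app J X) p) - (D X Y p - D Y X p)
    - J p (D (app J X) Y p - D Y (app J X) p) - J p (D X (app J Y) p - D (app J Y) X p)) (Z p)"
    using g_zero[OF vfD(1)[OF Z], of p] by simp
  then show ?thesis
    by (simp add: DJ_def app_apply J_diff g_diff J_adjoint t g_minus_right)
qed

text \<open>On each Hermitian manifold the vanishing of the Nijenhuis tensor gives
  \<open>2 g((\<nabla>\<^sub>X J)Y, Z) = d\<Omega>(X, JY, JZ) - d\<Omega>(X, Y, Z)\<close>; then insert \<open>d\<Omega> = \<omega> \<and> \<Omega>\<close>.\<close>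

lemma DJ_formula:
  assumes X: "X \<in> vector_fields A" and Y: "Y \<in> vector_fields A" and Z: "Z \<in> vector_fields A"
  shows "2 * g p (DJ X Y p) (Z p) =
    g p (J p (Y p)) (B1 p) * g p (X p) (Z p) - g p (J p (Z p)) (B1 p) * g p (X p) (Y p)
    + g p (Y p) (B1 p) * g p (X p) (J p (Z p)) - g p (Z p) (B1 p) * g p (X p) (J p (Y p))"
proof -
  note JY = J_vf[OF Y] and JZ = J_vf[OF Z]
  note t = vfD(1)[OF X, of p] vfD(1)[OF Y, of p] vfD(1)[OF Z, of p]
  have m: "U \<in> vector_fields A \<Longrightarrow> V \<in> vector_fields A \<Longrightarrow> g p (DJ U V p) (- W p) = - g p (DJ U V p) (W p)"
    if "W \<in> vector_fields A" for U V W
    using that by (simp add: g_minus_right vfD(1))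
  have DJm: "DJ (- U) V = - DJ U V" if "U \<in> vector_fields A" "V \<in> vector_fields A" for U V
    using that by (simp add: DJ_def D_minus_left app_uminus)
  have gm: "g p (- DJ U V p) (W p) = - g p (DJ U V p) (W p)"
    if "U \<in> vector_fields A" "V \<in> vector_fields A" "W \<in> vector_fields A" for U V W
    using that by (simp add: g_minus vfD(1))
  have 1: "ext_deriv2 (fundamental_form J g) X (app J Y) (app J Z) p - ext_deriv2 (fundamental_form J g) X Y Z p
      = 2 * g p (DJ X Y p) (Z p)"
  proof -
    have a: "g p (DJ X (app J Y) p) (app J Z p) = - g p (DJ X Y p) (Z p)"
      using DJ_J[OF X Y JZ, of p] by (simp add: app_app Z m X Y)
    have n: "g p (DJ (app J Y) (app J Z) p) (X p) - g p (DJ (- Z) Y p) (X p)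
        - g p (DJ (app J Z) Y p) (app J X p) + g p (DJ Y (app J Z) p) (app J X p) = 0"
      using nijenhuis_DJ[OF Y JZ X, of p] by (simp add: app_app Z)
    have b: "g p (DJ Y (app J Z) p) (app J X p) = - g p (DJ Y Z p) (X p)"
      using DJ_J[OF Y Z J_vf[OF X], of p] by (simp add: app_app X Y Z m)
    have c: "g p (DJ (app J Z) X p) (app J Y p) = - g p (DJ (app J Z) Y p) (app J X p)"
      using DJ_skew[OF JZ X JY, of p] DJ_J[OF JZ Y X, of p] by simp
    have d: "g p (DJ (- Z) Y p) (X p) = g p (DJ Z X p) (Y p)"
      using DJ_skew[OF Z Y X, of p] by (simp add: DJm Z Y gm X)
    show ?thesis
      using n unfolding dOmega_DJ[OF X JY JZ] dOmega_DJ[OF X Y Z] a b c d by simp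
  qed
  have "2 * g p (DJ X Y p) (Z p) = wedge12 \<omega> (fundamental_form J g) X (app J Y) (app J Z) p
      - wedge12 \<omega> (fundamental_form J g) X Y Z p"
    unfolding 1[symmetric] dOmega[OF X JY JZ] dOmega[OF X Y Z] ..
  moreover have "g p (J p (Y p)) (Z p) = - g p (Y p) (J p (Z p))" by (rule J_adjoint[OF t(2,3)])
  ultimately show ?thesis
    unfolding wedge12_def fundamental_form_def using t by (simp add: app_apply B1 g_minus_right g_minus algebra_simps)
qed

end

section \<open>Lagrangian submersions\<close>

lemma fun_zero_iff: "F = 0 \<longleftrightarrow> (\<forall>x. F x = 0)" for F :: "'x \<Rightarrow> 'y::zero"
  by (simp add: fun_eq_iff)

lemma app_zero_iff: "app P Y = 0 \<longleftrightarrow> (\<forall>p. P p (Y p) = 0)"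
  by (subst fun_zero_iff) (simp only: app_def)

context lagrangian begin

lemma submersion:
  shows \<pi>_smooth: "smooth_map A A' \<pi>" and d_image: "d\<pi> ` tangent A p = tangent A' (\<pi> p)"
    and d_isometry: "v \<in> Hor p \<Longrightarrow> gB (\<pi> p) (d\<pi> v) (d\<pi> v) = g p v v"
    and J_image: "J p ` Ver p = Hor p"
  using lagr unfolding lagrangian_submersion_def riemannian_submersion_def by auto

lemma pullback_smooth:
  assumes f: "f \<in> smooth_functions A'"
  shows "f \<circ> \<pi> \<in> smooth_functions A"
  unfolding smooth_functions_def
proof (intro CollectI ballI)
  fix c assume c: "c \<in> A"
  note cc = admissible_is_chart[OF admissible_in[OF c]]
  have oi: "open (snd c ` fst c)" using cc by (auto simp: is_chart_def)
  show "smooth_on (snd c ` fst c) (f \<circ> \<pi> \<circ> chart_inv c)"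
  proof (rule smooth_on_local[OF oi])
    fix x assume x: "x \<in> snd c ` fst c"
    obtain d where d: "d \<in> A'" "\<pi> (chart_inv c x) \<in> fst d" using B.chart_at .
    note dc = admissible_is_chart[OF B.admissible_in[OF d(1)]]
    have "open (\<pi> -` fst d)"
      using \<pi>_smooth dc open_vimage[of "fst d" \<pi>] by (auto simp: smooth_map_def is_chart_def)
    then have oU: "open (snd c ` (fst c \<inter> \<pi> -` fst d))" by (rule chart_image_open[OF cc])
    have tr: "smooth_on (snd c ` (fst c \<inter> \<pi> -` fst d)) (\<lambda>x. snd d (\<pi> (chart_inv c x)))"
      using \<pi>_smooth c d by (auto simp: smooth_map_def comp_def)
    have "smooth_on (snd c ` (fst c \<inter> \<pi> -` fst d)) (\<lambda>x. f (chart_inv d (snd d (\<pi> (chart_inv c x)))))"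
      by (rule smooth_on_compose[OF oU _ _ B.smooth_function_chart[OF f B.admissible_in[OF d(1)]] tr])
        (use dc is_chart_inv[OF cc] in \<open>auto simp: is_chart_def\<close>)
    then have "smooth_on (snd c ` (fst c \<inter> \<pi> -` fst d)) (f \<circ> \<pi> \<circ> chart_inv c)"
      by (rule smooth_on_cong[OF oU, rotated]) (use is_chart_inv[OF cc] is_chart_inv[OF dc] in auto)
    moreover have "x \<in> snd c ` (fst c \<inter> \<pi> -` fst d)" using x d(2) is_chart_inv[OF cc] by force
    ultimately show "\<exists>U. open U \<and> x \<in> U \<and> U \<subseteq> snd c ` fst c \<and> smooth_on U (f \<circ> \<pi> \<circ> chart_inv c)"
      using oU by blast
  qed
qed

lemma d_add: "d\<pi> (u + v) = d\<pi> u + d\<pi> v" and d_scale: "d\<pi> (tscale a u) = tscale a (d\<pi> u)"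
  and d_zero: "d\<pi> 0 = 0" and d_diff: "d\<pi> (u - v) = d\<pi> u - d\<pi> v"
  by (auto simp: differential_def fun_eq_iff tscale_def)

lemma d_tangent [simp]: "u \<in> tangent A p \<Longrightarrow> d\<pi> u \<in> tangent A' (\<pi> p)"
  using d_image by blast

lemma Ver_tangent: "u \<in> Ver p \<Longrightarrow> u \<in> tangent A p" and Ver_d: "u \<in> Ver p \<Longrightarrow> d\<pi> u = 0"
  and Hor_tangent: "u \<in> Hor p \<Longrightarrow> u \<in> tangent A p"
  by (auto simp: vertical_def horizontal_def)

lemma Ver_zero [simp]: "0 \<in> Ver p" and Ver_add: "u \<in> Ver p \<Longrightarrow> v \<in> Ver p \<Longrightarrow> u + v \<in> Ver p"
  and Ver_scale: "u \<in> Ver p \<Longrightarrow> tscale a u \<in> Ver p"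
  and Ver_diff: "u \<in> Ver p \<Longrightarrow> v \<in> Ver p \<Longrightarrow> u - v \<in> Ver p"
  by (auto simp: vertical_def d_add d_scale d_zero d_diff)

lemma Hor_zero [simp]: "0 \<in> Hor p" and Hor_add: "u \<in> Hor p \<Longrightarrow> v \<in> Hor p \<Longrightarrow> u + v \<in> Hor p"
  and Hor_scale: "u \<in> Hor p \<Longrightarrow> tscale a u \<in> Hor p"
  and Hor_diff: "u \<in> Hor p \<Longrightarrow> v \<in> Hor p \<Longrightarrow> u - v \<in> Hor p"
  by (auto simp: horizontal_def Ver_tangent g_zero g_add g_scale g_diff)

declare Ver_tangent [simp] Hor_tangent [simp]

lemma Hor_sum: "(\<And>i. i \<in> I \<Longrightarrow> u i \<in> Hor p) \<Longrightarrow> sum u I \<in> Hor p"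
  by (induction I rule: infinite_finite_induct) (auto intro: Hor_add)

lemma orth: "h \<in> Hor p \<Longrightarrow> v \<in> Ver p \<Longrightarrow> g p h v = 0" "h \<in> Hor p \<Longrightarrow> v \<in> Ver p \<Longrightarrow> g p v h = 0"
  using g_sym[OF Ver_tangent[of v p] Hor_tangent[of h p]] unfolding horizontal_def by auto

lemma Ver_Hor_zero: "u \<in> Ver p \<Longrightarrow> u \<in> Hor p \<Longrightarrow> u = 0"
  by (rule g_definite[OF Ver_tangent]) (auto simp: orth)

lemma J_Ver: "v \<in> Ver p \<Longrightarrow> J p v \<in> Hor p"
  using J_image by blast

lemma J_Hor: "h \<in> Hor p \<Longrightarrow> J p h \<in> Ver p"
proof -
  assume "h \<in> Hor p"
  then obtain v where "v \<in> Ver p" "h = J p v" using J_image by blast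
  then have "J p h = tscale (- 1) v" by (simp add: tscale_minus1)
  then show "J p h \<in> Ver p" using Ver_scale[OF \<open>v \<in> Ver p\<close>] by simp
qed

lemma Hor_iff: "u \<in> tangent A p \<Longrightarrow> J p u \<in> Ver p \<longleftrightarrow> u \<in> Hor p"
proof
  assume "u \<in> tangent A p" "J p u \<in> Ver p"
  then have "- u \<in> Hor p" using J_Ver[of "J p u" p] by simp
  then show "u \<in> Hor p" using Hor_scale[of "- u" p "- 1"] by (simp add: tscale_minus1)
qed (rule J_Hor)

text \<open>The projection is taken in a chart, where the tangent space becomes a Euclidean space with a different inner
  product.\<close>

lemma decomposition:
  assumes u: "u \<in> tangent A p"
  obtains v where "v \<in> Ver p" "u - v \<in> Hor p"
proof -
  obtain c where c: "c \<in> A" and p: "p \<in> fst c" using chart_at .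
  note ac = admissible_in[OF c]
  let ?e = "coord_vector A c p"
  note l = coord_vector_linear[OF ac p] and t = coord_vector_tangent[OF ac p]
  obtain w where w: "u = ?e w" by (rule tangent_coord_ex[OF ac p u]) (rule that)
  have "subspace {w. ?e w \<in> Ver p}"
    by (auto simp: subspace_def l intro: Ver_add Ver_scale)
  moreover have "linear (\<lambda>a. g p (?e a) (?e b))" "linear (\<lambda>a. g p (?e b) (?e a))" for b
    by (auto intro!: linearI simp: l g_add g_scale g_add_right g_scale_right t)
  moreover have "g p (?e a) (?e a) > 0" if "a \<noteq> 0" for a
  proof (rule g_pos[OF t])
    show "?e a \<noteq> 0" using that coord_vector_inj[OF ac p, of a 0] l(3) by auto
  qed
  ultimately obtain z where z: "z \<in> {w. ?e w \<in> Ver p}" "\<And>y. y \<in> {w. ?e w \<in> Ver p} \<Longrightarrow> g p (?e (w - z)) (?e y) = 0"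
    using pos_def_projection[of "\<lambda>a b. g p (?e a) (?e b)" "{w. ?e w \<in> Ver p}" w] by blast
  have d: "?e (w - z) = u - ?e z" using l(1)[of w "(- 1) *\<^sub>R z"] unfolding l(2) by (simp add: w tscale_minus1)
  have "u - ?e z \<in> Hor p"
    unfolding horizontal_def
  proof (intro CollectI conjI ballI)
    show "u - ?e z \<in> tangent A p" by (intro tangent_minus u t)
    fix v assume v: "v \<in> Ver p"
    obtain y where "v = ?e y" by (rule tangent_coord_ex[OF ac p Ver_tangent[OF v]]) (rule that)
    then show "g p (u - ?e z) v = 0" using z(2)[of y] v by (simp add: d)
  qed
  then show ?thesis using that z(1) by blast
qed

lemma vproj_ex1: "u \<in> tangent A p \<Longrightarrow> \<exists>!v. v \<in> Ver p \<and> u - v \<in> Hor p"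
proof -
  assume u: "u \<in> tangent A p"
  show ?thesis
  proof (rule ex_ex1I)
    show "\<exists>v. v \<in> Ver p \<and> u - v \<in> Hor p" by (rule decomposition[OF u]) blast
    fix v w assume v: "v \<in> Ver p \<and> u - v \<in> Hor p" and w: "w \<in> Ver p \<and> u - w \<in> Hor p"
    have "v - w \<in> Ver p" using v w Ver_diff by blast
    moreover have "v - w \<in> Hor p" using Hor_diff[of "u - w" p "u - v"] v w by (simp add: algebra_simps)
    ultimately show "v = w" using Ver_Hor_zero by fastforce
  qed
qed

lemma vproj_eq: "v \<in> Ver p \<Longrightarrow> u - v \<in> Hor p \<Longrightarrow> vproj A A' g \<pi> p u = v"
  unfolding vproj_def
proof (rule the1_equality[OF vproj_ex1])
  assume "v \<in> Ver p" "u - v \<in> Hor p"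
  then show "u \<in> tangent A p" using tangent_add[of "u - v" p v] by simp
qed simp

lemma vproj_Hor: "h \<in> Hor p \<Longrightarrow> vproj A A' g \<pi> p h = 0" and vproj_Ver: "v \<in> Ver p \<Longrightarrow> vproj A A' g \<pi> p v = v"
  by (auto intro!: vproj_eq)

lemma vproj_zero_iff: "u \<in> tangent A p \<Longrightarrow> vproj A A' g \<pi> p u = 0 \<longleftrightarrow> u \<in> Hor p"
proof
  assume u: "u \<in> tangent A p" and "vproj A A' g \<pi> p u = 0"
  then show "u \<in> Hor p" using theI'[OF vproj_ex1[OF u]] unfolding vproj_def by simp
qed (rule vproj_Hor)

text \<open>Polarisation of the isometry condition, which speaks of horizontal vectors only; the vertical part of \<open>u\<close> is invisible to
  both sides.\<close>

lemma gB_d: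
  assumes u: "u \<in> tangent A p" and h: "h \<in> Hor p"
  shows "gB (\<pi> p) (d\<pi> u) (d\<pi> h) = g p u h"
proof -
  obtain v where v: "v \<in> Ver p" "u - v \<in> Hor p" by (rule decomposition[OF u]) (rule that)
  let ?k = "u - v"
  have "d\<pi> u = d\<pi> ?k" using Ver_d[OF v(1)] by (simp add: d_diff)
  moreover have "gB (\<pi> p) (d\<pi> ?k) (d\<pi> h) = g p ?k h"
  proof -
    note t = d_tangent[OF Hor_tangent[OF v(2)]] d_tangent[OF Hor_tangent[OF h]]
    have "gB (\<pi> p) (d\<pi> ?k + d\<pi> h) (d\<pi> ?k + d\<pi> h) = g p (?k + h) (?k + h)"
      unfolding d_add[symmetric] by (rule d_isometry[OF Hor_add[OF v(2) h]])
    moreover have "gB (\<pi> p) (d\<pi> h) (d\<pi> ?k) = gB (\<pi> p) (d\<pi> ?k) (d\<pi> h)" by (rule B.g_sym[OF t(2,1)])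
    moreover have "g p h ?k = g p ?k h" by (rule g_sym[OF Hor_tangent[OF h] Hor_tangent[OF v(2)]])
    ultimately show ?thesis
      using d_isometry[OF v(2)] d_isometry[OF h] Hor_tangent[OF h] Hor_tangent[OF v(2)] t
      by (simp only: B.g_add B.g_add_right B.tangent_add g_add g_add_right tangent_add)
  qed
  moreover have "g p ?k h = g p u h" using u v(1) h by (simp add: g_diff orth)
  ultimately show ?thesis by simp
qed

lemma SV_vf [simp]: "X \<in> SV \<Longrightarrow> X \<in> vector_fields A" and SV_Ver: "X \<in> SV \<Longrightarrow> X p \<in> Ver p"
  and SH_vf [simp]: "X \<in> SH \<Longrightarrow> X \<in> vector_fields A" and SH_Hor: "X \<in> SH \<Longrightarrow> X p \<in> Hor p"
  by (auto simp: sections_def)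

lemma sectionsI: "X \<in> vector_fields A \<Longrightarrow> (\<And>p. X p \<in> E p) \<Longrightarrow> X \<in> sections A E"
  unfolding sections_def by blast

lemma J_SV: "V \<in> SV \<Longrightarrow> app J V \<in> SH" and J_SH: "X \<in> SH \<Longrightarrow> app J X \<in> SV"
  by (auto intro!: sectionsI simp: app_apply J_Ver J_Hor SV_Ver SH_Hor)

lemma g_SH_SV: "X \<in> SH \<Longrightarrow> V \<in> SV \<Longrightarrow> g p (X p) (V p) = 0"
  by (rule orth(1)[OF SH_Hor SV_Ver])

text \<open>The Lee field is vertical, so its products with \<open>Y\<close> and \<open>JV\<close> drop out of \<open>DJ_formula\<close>.\<close>

lemma DJ_horizontal:
  assumes X: "X \<in> SH" and Y: "Y \<in> SH" and V: "V \<in> SV"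
  shows "2 * g p (DJ X Y p) (J p (V p)) =
    g p (J p (Y p)) (B1 p) * g p (X p) (J p (V p)) + g p (X p) (Y p) * g p (B1 p) (V p)"
proof -
  have 1: "g p (J p (V p)) (B1 p) = 0" "g p (Y p) (B1 p) = 0" "g p (X p) (V p) = 0"
    by (rule orth(1)[OF J_Ver[OF SV_Ver[OF V]] SV_Ver[OF B1v]] orth(1)[OF SH_Hor[OF Y] SV_Ver[OF B1v]]
        orth(1)[OF SH_Hor[OF X] SV_Ver[OF V]])+
  have t: "V p \<in> tangent A p" "B1 p \<in> tangent A p" "X p \<in> tangent A p"
    by (rule vfD(1)[OF SV_vf[OF V]] vfD(1)[OF B1_vf] vfD(1)[OF SH_vf[OF X]])+
  show ?thesis
    using DJ_formula[OF SH_vf[OF X] SH_vf[OF Y] J_vf[OF SV_vf[OF V]], of p] 1 t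
    by (simp add: app_apply g_minus g_minus_right g_sym[of "B1 p" p "V p"])
qed

text \<open>As \<open>\<pi>\<^sub>* JY = 0\<close>, the left-hand side is \<open>- g(\<nabla>\<^sub>X JY, JV) = - g((\<nabla>\<^sub>X J)Y, JV) - g(\<nabla>\<^sub>X Y, V)\<close>, and the first
  summand is the right-hand side.\<close>

lemma second_form_condition_iff:
  assumes X: "X \<in> SH" and Y: "Y \<in> SH" and V: "V \<in> SV" and DP: "pullback_connection A A' \<pi> DB DP"
  shows "gB (\<pi> p) (second_fundamental_form A' \<pi> D DP X (app J Y) p) (d\<pi> (J p (V p)))
            = - (1/2) * g p (J p (Y p)) (B1 p) * g p (X p) (J p (V p))
              - (1/2) * g p (X p) (Y p) * g p (B1 p) (V p)
    \<longleftrightarrow> g p (D X Y p) (V p) = 0"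
proof -
  note XY = D_vf[OF SH_vf[OF X] SH_vf[OF Y]] and XJY = D_vf[OF SH_vf[OF X] J_vf[OF SH_vf[OF Y]]]
  have "(\<lambda>q. d\<pi> (app J Y q)) = 0"
    using Ver_d[OF SV_Ver[OF J_SH[OF Y]]] by (simp add: fun_eq_iff)
  moreover have "DP X 0 = 0"
  proof -
    have "0 \<in> fields_along A A' \<pi>" by (simp add: fields_along_def)
    then have "DP X (0 + 0) = DP X 0 + DP X 0" using DP SH_vf[OF X] unfolding pullback_connection_def by blast
    then show ?thesis by simp
  qed
  ultimately have "second_fundamental_form A' \<pi> D DP X (app J Y) p = - d\<pi> (D X (app J Y) p)"
    by (simp add: second_fundamental_form_def)
  then have "gB (\<pi> p) (second_fundamental_form A' \<pi> D DP X (app J Y) p) (d\<pi> (J p (V p)))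
      = - gB (\<pi> p) (d\<pi> (D X (app J Y) p)) (d\<pi> (J p (V p)))"
    using vfD(1)[OF XJY, of p] vfD(1)[OF SV_vf[OF V], of p] by (simp add: B.g_minus)
  also have "\<dots> = - g p (D X (app J Y) p) (J p (V p))"
    using gB_d[OF vfD(1)[OF XJY] J_Ver[OF SV_Ver[OF V]]] by simp
  also have "g p (D X (app J Y) p) (J p (V p)) = g p (DJ X Y p) (J p (V p)) + g p (D X Y p) (V p)"
    using vfD(1)[OF XJY, of p] vfD(1)[OF XY, of p] vfD(1)[OF SV_vf[OF V], of p]
    by (simp add: DJ_def app_apply g_diff)
  finally show ?thesis using DJ_horizontal[OF X Y V, of p] by (auto simp: field_simps)
qed

text \<open>Since \<open>V\<close> is vertical and \<open>JW\<close> horizontal, \<open>\<T>\<^sub>V JW\<close> is the vertical part of \<open>\<nabla>\<^sub>V JW\<close>.\<close>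

lemma oneill_condition_iff:
  assumes V: "V \<in> SV" and W: "W \<in> SV"
  shows "oneill_T A A' g D \<pi> V (app J W) = 0 \<longleftrightarrow> (\<forall>p. D V (app J W) p \<in> Hor p)"
proof -
  have JW: "vproj A A' g \<pi> q (app J W q) = 0" for q
    by (rule vproj_Hor[OF SH_Hor[OF J_SV[OF W]]])
  have 1: "app (vproj A A' g \<pi>) V = V"
    by (rule ext) (simp only: app_def vproj_Ver[OF SV_Ver[OF V]])
  have 2: "app (vproj A A' g \<pi>) (app J W) = 0"
    by (rule ext) (simp only: app_def[of "vproj A A' g \<pi>"] JW zero_fun_apply)
  have 3: "app (hproj A A' g \<pi>) (app J W) = app J W"
    by (rule ext) (simp only: app_def[of "hproj A A' g \<pi>"] hproj_def JW diff_zero)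
  have 4: "app (hproj A A' g \<pi>) 0 = 0"
  proof
    fix x
    have "(0 :: 'a vfield) x = 0" by (rule zero_fun_apply)
    then show "app (hproj A A' g \<pi>) 0 x = 0 x"
      by (simp only: app_def hproj_def vproj_Hor[OF Hor_zero] diff_zero)
  qed
  have e: "oneill_T A A' g D \<pi> V (app J W) = app (vproj A A' g \<pi>) (D V (app J W))"
    by (simp add: oneill_T_def Let_def 1 2 3 4 D_zero_right V)
  show ?thesis
    unfolding e app_zero_iff
    by (rule iff_allI, rule vproj_zero_iff, rule vfD(1)[OF D_vf[OF SV_vf[OF V] J_vf[OF SV_vf[OF W]]]])
qed

end

section \<open>The factors of a local product are totally geodesic\<close>

context connection begin

lemma D_orthogonal:
  assumes X: "X \<in> vector_fields A" and Y: "Y \<in> vector_fields A" and Z: "Z \<in> vector_fields A"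
    and orth: "\<And>q. g q (Y q) (Z q) = 0"
  shows "g p (D X Y p) (Z p) = - g p (Y p) (D X Z p)"
  using D_metric[OF X Y Z, of p] tangent_const[OF vfD(1)[OF X], of p 0] by (simp add: orth)

text \<open>The number \<open>g(\<nabla>\<^sub>X Y, Z)\<close> only depends on the values at \<open>p\<close>, so all three fields may be replaced by commuting
  coordinate fields. Twice the number is then minus the derivative of \<open>g(X, Y)\<close> along the second factor, and \<open>g(X, Y)\<close> is a
  coefficient of the metric of the first factor.\<close>

lemma locally_product_geodesic:
  assumes lp: "locally_product A g D1 D2"
    and orth: "\<And>p u v. u \<in> D1 p \<Longrightarrow> v \<in> D2 p \<Longrightarrow> g p u v = 0"
    and zero: "\<And>p. 0 \<in> D1 p" "\<And>p. 0 \<in> D2 p"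
    and X: "X \<in> sections A D1" and Y: "Y \<in> sections A D1" and Z: "Z \<in> sections A D2"
  shows "g p (D X Y p) (Z p) = 0"
proof -
  from lp[unfolded locally_product_def, rule_format, of p]
  obtain c W1 W2 S1 S2 and h1 h2 :: "'e \<Rightarrow> 'e \<Rightarrow> 'e \<Rightarrow> real" where
    c: "admissible_chart A c" and p: "p \<in> fst c" and W: "subspace W1" "subspace W2" "W1 \<inter> W2 = {0}"
      "{a + b | a b. a \<in> W1 \<and> b \<in> W2} = UNIV"
    and S: "S1 \<subseteq> W1" "S2 \<subseteq> W2" "snd c ` fst c = {a + b | a b. a \<in> S1 \<and> b \<in> S2}"
    and Ds: "\<forall>q\<in>fst c. coord_vector A c q ` W1 = D1 q \<and> coord_vector A c q ` W2 = D2 q"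
    and gh: "\<forall>a\<in>S1. \<forall>b\<in>S2. \<forall>u1\<in>W1. \<forall>u2\<in>W2. \<forall>v1\<in>W1. \<forall>v2\<in>W2.
           let q = chart_inv c (a + b)
           in g q (coord_vector A c q (u1 + u2)) (coord_vector A c q (v1 + v2)) = h1 a u1 v1 + h2 b u2 v2"
    by (elim exE conjE) (rule that)
  note cc = admissible_is_chart[OF c]
  obtain E where E: "\<And>w. E w \<in> vector_fields A" "\<forall>\<^sub>F q in nhds p. \<forall>w. E w q = coord_vector A c q w"
    "\<And>q. q \<in> fst c \<Longrightarrow> \<exists>a. \<forall>w. E w q = coord_vector A c q (a *\<^sub>R w)"
    "\<And>q w. q \<notin> fst c \<Longrightarrow> E w q = 0"
    by (rule coordinate_fields[OF c p]) (rule that)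
  have Ep: "E w p = coord_vector A c p w" for w using eventually_nhds_x_imp_x[OF E(2)] by blast
  have E1: "E w q \<in> D1 q" if "w \<in> W1" for w q
  proof (cases "q \<in> fst c")
    case True
    obtain a where "E w q = coord_vector A c q (a *\<^sub>R w)" using E(3)[OF True] by blast
    moreover have "a *\<^sub>R w \<in> W1" using W(1) that subspace_scale by blast
    ultimately show ?thesis using Ds True by blast
  qed (simp add: E(4) zero)
  have E2: "E w q \<in> D2 q" if "w \<in> W2" for w q
  proof (cases "q \<in> fst c")
    case True
    obtain a where "E w q = coord_vector A c q (a *\<^sub>R w)" using E(3)[OF True] by blast
    moreover have "a *\<^sub>R w \<in> W2" using W(2) that subspace_scale by blast
    ultimately show ?thesis using Ds True by blast
  qed (simp add: E(4) zero)
  have vX: "X \<in> vector_fields A" "X p \<in> D1 p" and vY: "Y \<in> vector_fields A" "\<And>q. Y q \<in> D1 q"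
    and vZ: "Z \<in> vector_fields A" "\<And>q. Z q \<in> D2 q"
    using X Y Z by (auto simp: sections_def)
  obtain u where u: "u \<in> W1" "X p = E u p" using Ds p vX(2) Ep by (metis imageE)
  obtain v where v: "v \<in> W1" "Y p = E v p" using Ds p vY(2) Ep by (metis imageE)
  obtain w where w: "w \<in> W2" "Z p = E w p" using Ds p vZ(2) Ep by (metis imageE)
  have br: "D (E a) (E b) p = D (E b) (E a) p" for a b
    using eventually_nhds_x_imp_x[OF bracket_coordinate_fields[where u=a and w=b, OF c p E(1,2)]]
      fun_cong[OF D_torsion[OF E(1)[of a] E(1)[of b]], of p] by simp
  have "g p (D X Y p) (Z p) = g p (D (E u) Y p) (Z p)"
    using D_pointwise_left[where p=p, OF vX(1) E(1) vY(1) u(2)] by simp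
  also have "\<dots> = - g p (E v p) (D (E u) Z p)"
    using D_orthogonal[where p=p, OF E(1)[of u] vY(1) vZ(1) orth[OF vY(2) vZ(2)]] v(2) by simp
  also have "\<dots> = g p (D (E u) (E v) p) (E w p)"
    using D_orthogonal[where p=p, OF E(1)[of u] E(1)[of v] vZ(1) orth[OF E1[OF v(1)] vZ(2)]] w(2) by simp
  finally have 1: "g p (D X Y p) (Z p) = g p (D (E u) (E v) p) (E w p)" .
  have 2: "g p (D (E u) (E v) p) (E w p) = - g p (E v p) (D (E w) (E u) p)"
    using D_orthogonal[where p=p, OF E(1)[of u] E(1)[of v] E(1)[of w] orth[OF E1[OF v(1)] E2[OF w(1)]]] br[of u w] by simp
  have 3: "g p (D (E u) (E v) p) (E w p) = - g p (E u p) (D (E w) (E v) p)"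
    using D_orthogonal[where p=p, OF E(1)[of v] E(1)[of u] E(1)[of w] orth[OF E1[OF u(1)] E2[OF w(1)]]] br[of v w] br[of u v] by simp
  let ?f = "\<lambda>q. g q (E u q) (E v q)"
  have f: "?f \<in> smooth_functions A" by (rule g_smooth[OF E(1) E(1)])
  have "E w p ?f = 0"
  proof -
    let ?x = "snd c p"
    note d = chart_function_derivative[OF c p f]
    obtain a b where ab: "a \<in> S1" "b \<in> S2" "?x = a + b" using p S(3) by blast
    have "\<forall>\<^sub>F y in nhds ?x. y \<in> snd c ` fst c \<and> (\<forall>w. E w (chart_inv c y) = coord_vector A c (chart_inv c y) w)"
      by (rule eventually_chart_inv[OF cc p E(2)])
    then have "\<forall>\<^sub>F y in nhds ?x. (\<forall>t. y = ?x + t *\<^sub>R w \<longrightarrow> (?f \<circ> chart_inv c) y = h1 a u v - h1 a 0 0)"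
    proof eventually_elim
      case (elim y)
      show ?case
      proof (intro allI impI)
        fix t assume y: "y = ?x + t *\<^sub>R w"
        obtain a' b' where ab': "a' \<in> S1" "b' \<in> S2" "y = a' + b'" using elim S(3) by blast
        have "a' - a = b - b' + t *\<^sub>R w" using ab(3) ab'(3) y by (simp add: algebra_simps)
        moreover have "a' - a \<in> W1" using ab ab' S(1) W(1) subspace_diff by blast
        moreover have "b - b' + t *\<^sub>R w \<in> W2"
          using ab ab' S(2) W(2) w(1) subspace_diff subspace_add subspace_scale by (metis subsetD)
        ultimately have "a' - a \<in> W1 \<inter> W2" by simp
        then have "a' = a" unfolding W(3) by simp
        have "g (chart_inv c (a' + b')) (coord_vector A c (chart_inv c (a' + b')) (u + 0))
           (coord_vector A c (chart_inv c (a' + b')) (v + 0)) = h1 a' u v + h2 b' 0 0"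
          by (rule gh[rule_format, OF ab'(1,2) u(1) subspace_0[OF W(2)] v(1) subspace_0[OF W(2)], unfolded Let_def])
        moreover have "g (chart_inv c (a' + b')) (coord_vector A c (chart_inv c (a' + b')) (0 + 0))
           (coord_vector A c (chart_inv c (a' + b')) (0 + 0)) = h1 a' 0 0 + h2 b' 0 0"
          by (rule gh[rule_format, OF ab'(1,2) subspace_0[OF W(1)] subspace_0[OF W(2)] subspace_0[OF W(1)] subspace_0[OF W(2)], unfolded Let_def])
        moreover have "chart_inv c y \<in> fst c" using elim is_chart_inv[OF cc] by blast
        ultimately show "(?f \<circ> chart_inv c) y = h1 a u v - h1 a 0 0"
          using elim \<open>a' = a\<close> ab'(3) by (simp add: coord_vector_linear(3)[OF c] g_zero)
      qed
    qed
    moreover have "filterlim (\<lambda>t::real. ?x + t *\<^sub>R w) (nhds ?x) (nhds 0)"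
    proof -
      have "((\<lambda>t::real. ?x + t *\<^sub>R w) \<longlongrightarrow> ?x + 0 *\<^sub>R w) (nhds 0)" by (intro tendsto_intros filterlim_ident)
      then show ?thesis by simp
    qed
    ultimately have "\<forall>\<^sub>F s in nhds (0::real). \<forall>t. ?x + s *\<^sub>R w = ?x + t *\<^sub>R w \<longrightarrow>
        (?f \<circ> chart_inv c) (?x + s *\<^sub>R w) = h1 a u v - h1 a 0 0"
      by (rule eventually_compose_filterlim)
    then obtain U where U: "open U" "0 \<in> U"
      "\<And>s::real. s \<in> U \<Longrightarrow> (?f \<circ> chart_inv c) (?x + s *\<^sub>R w) = h1 a u v - h1 a 0 0"
      unfolding eventually_nhds by blast
    have "((\<lambda>s::real. h1 a u v - h1 a 0 0) has_derivative (\<lambda>_. 0)) (at 0)" by simp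
    then have "((\<lambda>s::real. (?f \<circ> chart_inv c) (?x + s *\<^sub>R w)) has_derivative (\<lambda>_. 0)) (at 0)"
      by (rule has_derivative_transform_within_open[OF _ U(1,2)]) (rule U(3)[symmetric])
    moreover have "((\<lambda>s::real. (?f \<circ> chart_inv c) (?x + s *\<^sub>R w)) has_derivative
        (\<lambda>s. coord_vector A c p (s *\<^sub>R w) ?f)) (at 0)"
    proof (rule has_derivative_compose[of "\<lambda>s. ?x + s *\<^sub>R w"])
      show "((\<lambda>s::real. ?x + s *\<^sub>R w) has_derivative (\<lambda>s. s *\<^sub>R w)) (at 0)"
        by (auto intro!: derivative_eq_intros)
      show "((?f \<circ> chart_inv c) has_derivative (\<lambda>w. coord_vector A c p w ?f)) (at (?x + 0 *\<^sub>R w))"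
        using d by simp
    qed
    ultimately have "(\<lambda>s::real. coord_vector A c p (s *\<^sub>R w) ?f) = (\<lambda>_. 0)"
      by (rule has_derivative_unique[symmetric])
    from fun_cong[OF this, of 1] show ?thesis by (simp add: Ep)
  qed
  then have "g p (D (E w) (E u) p) (E v p) + g p (E u p) (D (E w) (E v) p) = 0"
    using D_metric[OF E(1)[of w] E(1)[of u] E(1)[of v], of p] by simp
  moreover have "g p (D (E w) (E u) p) (E v p) = g p (E v p) (D (E w) (E u) p)"
    by (rule g_sym[OF vfD(1)[OF D_vf[OF E(1) E(1)]] vfD(1)[OF E(1)]])
  ultimately show ?thesis using 1 2 3 by simp
qed

end

lemma locally_product_swap:
  assumes "locally_product A g D1 D2"
  shows "locally_product A g D2 D1"
  unfolding locally_product_def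
proof
  fix p
  from assms[unfolded locally_product_def, rule_format, of p]
  obtain c W1 W2 S1 S2 and h1 h2 :: "'b \<Rightarrow> 'b \<Rightarrow> 'b \<Rightarrow> real" where
    1: "admissible_chart A c" "p \<in> fst c" "subspace W1" "subspace W2" "W1 \<inter> W2 = {0}"
      "{a + b | a b. a \<in> W1 \<and> b \<in> W2} = UNIV"
      "S1 \<subseteq> W1" "S2 \<subseteq> W2" "snd c ` fst c = {a + b | a b. a \<in> S1 \<and> b \<in> S2}"
      "\<forall>q\<in>fst c. coord_vector A c q ` W1 = D1 q \<and> coord_vector A c q ` W2 = D2 q" and
    2: "\<forall>a\<in>S1. \<forall>b\<in>S2. \<forall>u1\<in>W1. \<forall>u2\<in>W2. \<forall>v1\<in>W1. \<forall>v2\<in>W2.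
           let q = chart_inv c (a + b)
           in g q (coord_vector A c q (u1 + u2)) (coord_vector A c q (v1 + v2)) = h1 a u1 v1 + h2 b u2 v2"
    by (elim exE conjE) (rule that)
  have s: "{a + b | a b. a \<in> P \<and> b \<in> Q} = {a + b | a b. a \<in> Q \<and> b \<in> P}" for P Q :: "'b set"
    by (metis (no_types, opaque_lifting) add.commute)
  have 3: "\<forall>a\<in>S2. \<forall>b\<in>S1. \<forall>u1\<in>W2. \<forall>u2\<in>W1. \<forall>v1\<in>W2. \<forall>v2\<in>W1.
           let q = chart_inv c (a + b)
           in g q (coord_vector A c q (u1 + u2)) (coord_vector A c q (v1 + v2)) = h2 a u1 v1 + h1 b u2 v2"
  proof (intro ballI)
    fix a b u1 u2 v1 v2
    assume h: "a \<in> S2" "b \<in> S1" "u1 \<in> W2" "u2 \<in> W1" "v1 \<in> W2" "v2 \<in> W1"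
    show "let q = chart_inv c (a + b)
           in g q (coord_vector A c q (u1 + u2)) (coord_vector A c q (v1 + v2)) = h2 a u1 v1 + h1 b u2 v2"
      using 2[rule_format, OF h(2,1,4,3,6,5)] unfolding Let_def
      by (simp only: add.commute[of b a] add.commute[of u2 u1] add.commute[of v2 v1] add.commute[of "h1 b u2 v2"])
  qed
  show "\<exists>c W1 W2 S1 S2. \<exists>h1 h2 :: 'b \<Rightarrow> 'b \<Rightarrow> 'b \<Rightarrow> real.
        admissible_chart A c \<and> p \<in> fst c \<and>
        subspace W1 \<and> subspace W2 \<and> W1 \<inter> W2 = {0} \<and> {a + b | a b. a \<in> W1 \<and> b \<in> W2} = UNIV \<and>
        S1 \<subseteq> W1 \<and> S2 \<subseteq> W2 \<and> snd c ` fst c = {a + b | a b. a \<in> S1 \<and> b \<in> S2} \<and>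
        (\<forall>q\<in>fst c. coord_vector A c q ` W1 = D2 q \<and> coord_vector A c q ` W2 = D1 q) \<and>
        (\<forall>a\<in>S1. \<forall>b\<in>S2. \<forall>u1\<in>W1. \<forall>u2\<in>W2. \<forall>v1\<in>W1. \<forall>v2\<in>W2.
           let q = chart_inv c (a + b)
           in g q (coord_vector A c q (u1 + u2)) (coord_vector A c q (v1 + v2)) = h1 a u1 v1 + h2 b u2 v2)"
    using 1 3 s[of W1 W2] s[of S1 S2]
    by (intro exI[of _ c] exI[of _ W2] exI[of _ W1] exI[of _ S2] exI[of _ S1] exI[of _ h2] exI[of _ h1]) (simp add: Int_commute)
qed

context lagrangian begin

definition totally_geodesic :: bool where
  "totally_geodesic \<longleftrightarrow>
    (\<forall>X\<in>SH. \<forall>Y\<in>SH. \<forall>V\<in>SV. \<forall>p. g p (D X Y p) (V p) = 0) \<and>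
    (\<forall>U\<in>SV. \<forall>V\<in>SV. \<forall>X\<in>SH. \<forall>p. g p (D U V p) (X p) = 0)"

lemma locally_product_imp_totally_geodesic:
  assumes "locally_product A g Hor Ver"
  shows totally_geodesic
  unfolding totally_geodesic_def
  using locally_product_geodesic[OF assms] locally_product_geodesic[OF locally_product_swap[OF assms]]
  by (auto simp: orth)

section \<open>Horizontal frames and the meaning of the two conditions\<close>

text \<open>A vector \<open>u\<close> is horizontal if and only if \<open>Ju\<close> is vertical. So the horizontal lift of \<open>w\<close> solves the linear system
  \<open>d\<pi>(u) = w\<close>, \<open>d\<pi>(Ju) = 0\<close>, which has smooth coefficients and is injective because a vector that is both vertical and
  horizontal vanishes. The functions \<open>\<zeta> b\<close> are the coordinates of the base, pulled back to \<open>M\<close>.\<close>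

lemma horizontal_frame:
  fixes p :: 'a
  obtains L :: "'f \<Rightarrow> 'a vfield" and \<zeta> :: "'f \<Rightarrow> 'a \<Rightarrow> real" where
    "\<And>w. L w \<in> SH" "\<And>b. \<zeta> b \<in> smooth_functions A" "\<And>q v b. v \<in> Ver q \<Longrightarrow> v (\<zeta> b) = 0"
    "\<And>u w. L (u + w) = L u + L w" "\<And>a w. L (a *\<^sub>R w) = fscale (\<lambda>_. a) (L w)"
    "\<forall>\<^sub>F q in nhds p. (\<forall>w. \<forall>b\<in>Basis. L w q (\<zeta> b) = w \<bullet> b) \<and>
      (\<forall>h\<in>Hor q. h = L (\<Sum>b\<in>Basis. h (\<zeta> b) *\<^sub>R b) q)"
proof -
  obtain c where cA: "c \<in> A" and p: "p \<in> fst c" using chart_at .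
  note c = admissible_in[OF cA]
  note cc = admissible_is_chart[OF c]
  note ci = is_chart_inv[OF cc]
  obtain d where dA: "d \<in> A'" and dp: "\<pi> p \<in> fst d" using B.chart_at .
  note d = B.admissible_in[OF dA]
  obtain E where E: "\<And>w. E w \<in> vector_fields A" "\<forall>\<^sub>F q in nhds p. \<forall>w. E w q = coord_vector A c q w"
    "\<And>u w. E (u + w) = E u + E w" "\<And>a w. E (a *\<^sub>R w) = fscale (\<lambda>_. a) (E w)"
    by (rule coordinate_fields[OF c p]) (rule that)
  obtain \<eta> where \<eta>: "\<And>w. \<eta> w \<in> smooth_functions A'" "\<And>w. \<forall>\<^sub>F q in nhds (\<pi> p). \<eta> w q = snd d q \<bullet> w"
    by (rule B.coordinate_functions[OF d dp]) (rule that)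
  define \<zeta> where "\<zeta> = (\<lambda>b. \<eta> b \<circ> \<pi>)"
  have \<zeta>: "\<zeta> b \<in> smooth_functions A" for b unfolding \<zeta>_def by (rule pullback_smooth[OF \<eta>(1)])
  have \<zeta>d: "v (\<zeta> b) = d\<pi> v (\<eta> b)" for v b by (simp add: \<zeta>_def differential_def \<eta>)
  have \<pi>c: "filterlim \<pi> (nhds (\<pi> q)) (nhds q)" for q
    using \<pi>_smooth by (auto simp: smooth_map_def continuous_on_eq_continuous_within continuous_at
        tendsto_at_iff_tendsto_nhds)
  have evd: "\<forall>\<^sub>F q in nhds p. \<pi> q \<in> fst d \<and> (\<forall>b\<in>Basis. \<forall>\<^sub>F r in nhds (\<pi> q). \<eta> b r = snd d r \<bullet> b)"
  proof (rule eventually_compose_filterlim[OF _ \<pi>c])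
    have "\<forall>\<^sub>F q in nhds (\<pi> p). \<forall>b\<in>Basis. \<forall>\<^sub>F r in nhds q. \<eta> b r = snd d r \<bullet> b"
      using \<eta>(2) by (intro eventually_ball_finite ballI) (simp_all add: eventually_eventually)
    with B.eventually_in_chart[OF admissible_is_chart[OF d] dp]
    show "\<forall>\<^sub>F q in nhds (\<pi> p). q \<in> fst d \<and> (\<forall>b\<in>Basis. \<forall>\<^sub>F r in nhds q. \<eta> b r = snd d r \<bullet> b)"
      by eventually_elim blast
  qed
  have evN: "\<forall>\<^sub>F q in nhds p. q \<in> fst c \<and> (\<forall>w. E w q = coord_vector A c q w) \<and>
      \<pi> q \<in> fst d \<and> (\<forall>b\<in>Basis. \<forall>\<^sub>F r in nhds (\<pi> q). \<eta> b r = snd d r \<bullet> b)"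
    using eventually_in_chart[OF cc p] E(2) evd by eventually_elim blast
  from eventually_nhds[THEN iffD1, OF evN]
  obtain N where N: "open N" "p \<in> N" and Nall: "\<forall>q\<in>N. q \<in> fst c \<and> (\<forall>w. E w q = coord_vector A c q w) \<and>
      \<pi> q \<in> fst d \<and> (\<forall>b\<in>Basis. \<forall>\<^sub>F r in nhds (\<pi> q). \<eta> b r = snd d r \<bullet> b)"
    by (elim exE conjE) (rule that)
  have Nc: "q \<in> fst c" and NE: "E w q = coord_vector A c q w" and Nd: "\<pi> q \<in> fst d" if "q \<in> N" for q w
    using Nall[rule_format, OF that] by simp_all
  have Ne: "\<forall>\<^sub>F r in nhds (\<pi> q). \<eta> b r = snd d r \<bullet> b" if "q \<in> N" "b \<in> Basis" for q b
    using Nall[rule_format, OF that(1)] that(2) by simp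
  have dd: "d\<pi> v = coord_vector A' d (\<pi> q) (\<Sum>b\<in>Basis. v (\<zeta> b) *\<^sub>R b)" if "q \<in> N" "v \<in> tangent A q" for q v
    unfolding \<zeta>d by (rule B.tangent_coord[OF d Nd[OF that(1)] d_tangent[OF that(2)] \<eta>(1) Ne[OF that(1)]])
  have d0: "v \<in> Ver q" if "q \<in> N" "v \<in> tangent A q" "\<And>b. b \<in> Basis \<Longrightarrow> v (\<zeta> b) = 0" for q v
    using dd[OF that(1,2)] that(2,3) B.coord_vector_linear(3)[OF d Nd[OF that(1)]]
    unfolding vertical_def by simp
  let ?O = "snd c ` (fst c \<inter> N)"
  have oO: "open ?O" by (rule chart_image_open[OF cc N(1)])
  have O: "chart_inv c x \<in> N \<and> chart_inv c x \<in> fst c \<and> x \<in> snd c ` fst c" if "x \<in> ?O" for x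
    using that ci by auto
  \<comment> \<open>The system of the horizontal lift, in the coordinates of the base.\<close>
  define T where "T = (\<lambda>x u. ((\<Sum>b\<in>Basis. E u (chart_inv c x) (\<zeta> b) *\<^sub>R b) :: 'f,
      (\<Sum>b\<in>Basis. app J (E u) (chart_inv c x) (\<zeta> b) *\<^sub>R b) :: 'f))"
  have linT: "linear (T x)" for x
  proof (rule linearI)
    have "app J (E (u + v)) q f = app J (E u) q f + app J (E v) q f" for u v q f
      by (simp add: app_apply E(3) J_add vfD(1)[OF E(1)])
    then show "T x (u + v) = T x u + T x v" for u v
      by (simp add: T_def E(3) scaleR_left_distrib sum.distrib)
    have "app J (E (a *\<^sub>R u)) q f = a * app J (E u) q f" for a u q f
      by (simp add: app_apply E(4) fscale_apply J_scale vfD(1)[OF E(1)]) (simp add: tscale_def)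
    then show "T x (a *\<^sub>R u) = a *\<^sub>R T x u" for a u
      by (simp add: T_def E(4) fscale_apply tscale_def scaleR_sum_right)
  qed
  have smT: "smooth_on ?O (\<lambda>x. T x u)" for u
  proof -
    have 1: "smooth_on ?O (\<lambda>x. X (chart_inv c x) (\<zeta> b))" if "X \<in> vector_fields A" for X b
      using smooth_on_subset[OF _ oO _ smooth_function_chart[OF vfD(2)[OF that \<zeta>] c]] cc
      by (auto simp: is_chart_def)
    have "smooth_on ?O (\<lambda>x. ((\<Sum>b\<in>Basis. E u (chart_inv c x) (\<zeta> b) *\<^sub>R b) :: 'f, 0 :: 'f)
      + (0, (\<Sum>b\<in>Basis. app J (E u) (chart_inv c x) (\<zeta> b) *\<^sub>R b)))"
      by (intro smooth_on_add oO smooth_on_bounded_linear[OF oO, of "\<lambda>z. (z, 0)"] smooth_on_bounded_linear[OF oO, of "\<lambda>z. (0, z)"]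
          smooth_on_sum smooth_on_scaleR smooth_on_const 1 E(1) J_vf bounded_linear_Pair bounded_linear_ident bounded_linear_zero)
    then show ?thesis by (simp add: T_def)
  qed
  have T0: "E u (chart_inv c x) = 0" if x: "x \<in> ?O" and T: "T x u = 0" for x u
  proof -
    let ?q = "chart_inv c x"
    have q: "?q \<in> N" using O[OF x] by blast
    have 0: "E u ?q (\<zeta> b) = 0" "app J (E u) ?q (\<zeta> b) = 0" if "b \<in> Basis" for b
    proof -
      have "(\<Sum>b\<in>Basis. E u ?q (\<zeta> b) *\<^sub>R b) = (0::'f)" "(\<Sum>b\<in>Basis. app J (E u) ?q (\<zeta> b) *\<^sub>R b) = (0::'f)"
        using T by (simp_all add: T_def zero_prod_def)
      then have "(\<Sum>b\<in>Basis. E u ?q (\<zeta> b) *\<^sub>R b) \<bullet> b = 0" "(\<Sum>b\<in>Basis. app J (E u) ?q (\<zeta> b) *\<^sub>R b) \<bullet> b = 0"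
        by simp_all
      then show "E u ?q (\<zeta> b) = 0" "app J (E u) ?q (\<zeta> b) = 0" using that by simp_all
    qed
    have "E u ?q \<in> Ver ?q" by (rule d0[OF q vfD(1)[OF E(1)] 0(1)])
    moreover have "app J (E u) ?q \<in> Ver ?q" by (rule d0[OF q vfD(1)[OF J_vf[OF E(1)]] 0(2)])
    then have "E u ?q \<in> Hor ?q" using Hor_iff[OF vfD(1)[OF E(1)]] by (simp add: app_apply)
    ultimately show ?thesis by (rule Ver_Hor_zero)
  qed
  have injT: "inj (T x)" if x: "x \<in> ?O" for x
  proof -
    have "u = 0" if "T x u = 0" for u
    proof -
      have "coord_vector A c (chart_inv c x) u = coord_vector A c (chart_inv c x) 0"
        using T0[OF x that] NE[of "chart_inv c x" u] O[OF x] coord_vector_linear(3)[OF c] by simp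
      then show ?thesis using coord_vector_inj[OF c] O[OF x] by blast
    qed
    then show ?thesis using linear_injective_0[OF linT] by blast
  qed
  have ex: "\<exists>u. T x u = (w, 0)" if x: "x \<in> ?O" for x w
  proof -
    let ?q = "chart_inv c x"
    have q: "?q \<in> N" "?q \<in> fst c" using O[OF x] by auto
    have "coord_vector A' d (\<pi> ?q) w \<in> tangent A' (\<pi> ?q)" by (rule B.coord_vector_tangent[OF d Nd[OF q(1)]])
    then obtain v0 where v0: "v0 \<in> tangent A ?q" "d\<pi> v0 = coord_vector A' d (\<pi> ?q) w"
      using d_image[of ?q] by (metis imageE)
    obtain v1 where v1: "v1 \<in> Ver ?q" "v0 - v1 \<in> Hor ?q" by (rule decomposition[OF v0(1)]) (rule that)
    obtain u where u: "v0 - v1 = coord_vector A c ?q u"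
      by (rule tangent_coord_ex[OF c q(2) Hor_tangent[OF v1(2)]]) (rule that)
    have Eu: "E u ?q = v0 - v1" using NE[OF q(1)] u by simp
    have "d\<pi> (E u ?q) = coord_vector A' d (\<pi> ?q) w" unfolding Eu using v0(2) Ver_d[OF v1(1)] by (simp add: d_diff)
    then have 1: "(\<Sum>b\<in>Basis. E u ?q (\<zeta> b) *\<^sub>R b) = w"
      using B.coord_vector_inj[OF d Nd[OF q(1)]] dd[OF q(1) vfD(1)[OF E(1)], of u] by metis
    have "d\<pi> (app J (E u) ?q) = 0" unfolding app_apply Eu by (rule Ver_d[OF J_Hor[OF v1(2)]])
    then have 2: "app J (E u) ?q (\<zeta> b) = 0" for b unfolding \<zeta>d by simp
    show ?thesis by (rule exI[of _ u]) (simp add: T_def 1 2)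
  qed
  define U where "U = (\<lambda>w x. SOME u. T x u = (w, 0))"
  have U: "T x (U w x) = (w, 0)" if "x \<in> ?O" for x w unfolding U_def by (rule someI_ex[OF ex[OF that]])
  have smU: "smooth_on ?O (U w)" for w
    by (rule smooth_linear_solve[OF oO linT injT smT smooth_on_const U])
  have UL: "E (U w (snd c q)) q \<in> Hor q \<and> (\<forall>b\<in>Basis. E (U w (snd c q)) q (\<zeta> b) = w \<bullet> b)" if q: "q \<in> N" for q w
  proof -
    have x: "snd c q \<in> ?O" "chart_inv c (snd c q) = q" using Nc[OF q] q ci by auto
    have e1: "(\<Sum>b\<in>Basis. E (U w (snd c q)) q (\<zeta> b) *\<^sub>R b) = w"
      and e2: "(\<Sum>b\<in>Basis. app J (E (U w (snd c q))) q (\<zeta> b) *\<^sub>R b) = (0::'f)"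
      using U[OF x(1), of w] x(2) by (auto simp: T_def)
    have "E (U w (snd c q)) q (\<zeta> b) = w \<bullet> b" if "b \<in> Basis" for b
      using arg_cong[OF e1, of "\<lambda>z. z \<bullet> b"] that by simp
    moreover have "app J (E (U w (snd c q))) q \<in> Ver q"
    proof (rule d0[OF q vfD(1)[OF J_vf[OF E(1)]]])
      fix b :: 'f assume "b \<in> Basis"
      then show "app J (E (U w (snd c q))) q (\<zeta> b) = 0" using arg_cong[OF e2, of "\<lambda>z. z \<bullet> b"] by simp
    qed
    then have "E (U w (snd c q)) q \<in> Hor q" using Hor_iff[OF vfD(1)[OF E(1)]] by (simp add: app_apply)
    ultimately show ?thesis by blast
  qed
  have pO: "snd c p \<in> ?O" using p N by blast
  have "\<exists>X\<in>SH. \<forall>\<^sub>F q in nhds p. X q = E (U w (snd c q)) q" for w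
  proof -
    have "\<exists>f. f \<in> smooth_functions A \<and> (\<forall>\<^sub>F q in nhds p. f q = U w (snd c q) \<bullet> i)" for i
      by (rule lift_function[OF c p oO pO smooth_on_inner[OF oO smU smooth_on_const[of _ i]]]) blast
    then have "\<exists>F. \<forall>i. F i \<in> smooth_functions A \<and> (\<forall>\<^sub>F q in nhds p. F i q = U w (snd c q) \<bullet> i)"
      by (intro choice allI)
    then obtain F where F: "\<And>i. F i \<in> smooth_functions A" "\<And>i. \<forall>\<^sub>F q in nhds p. F i q = U w (snd c q) \<bullet> i" by blast
    let ?X = "\<Sum>i\<in>Basis. fscale (F i) (E i)"
    have X: "?X \<in> vector_fields A" by (intro vf_sum vf_fscale F E)
    have "\<forall>\<^sub>F q in nhds p. \<forall>i\<in>Basis. F i q = U w (snd c q) \<bullet> i"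
      by (intro eventually_ball_finite ballI F finite_Basis)
    then have Xe: "\<forall>\<^sub>F q in nhds p. ?X q = E (U w (snd c q)) q"
      using eventually_in_open[OF N]
    proof eventually_elim
      case (elim q)
      have "E (U w (snd c q)) q = coord_vector A c q (\<Sum>i\<in>Basis. (U w (snd c q) \<bullet> i) *\<^sub>R i)"
        using NE[OF elim(2)] by (simp add: euclidean_representation)
      also have "\<dots> = (\<Sum>i\<in>Basis. tscale (U w (snd c q) \<bullet> i) (coord_vector A c q i))"
        by (rule coord_vector_sum[OF c Nc[OF elim(2)]])
      finally show ?case using elim(1) NE[OF elim(2)] by (simp add: fun_sum_apply fscale_apply)
    qed
    then have evH: "\<forall>\<^sub>F q in nhds p. ?X q \<in> Hor q"
      using eventually_in_open[OF N] by eventually_elim (use UL in simp)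
    obtain X' where X': "X' \<in> SH" "\<forall>\<^sub>F q in nhds p. X' q = ?X q"
    proof (rule section_extension[where D=Hor and p=p, OF X])
      show "tscale a u \<in> Hor q" if "u \<in> Hor q" for q a u by (rule Hor_scale[OF that])
    qed (use evH that in auto)
    from X'(2) Xe have "\<forall>\<^sub>F q in nhds p. X' q = E (U w (snd c q)) q" by eventually_elim simp
    then show ?thesis using X'(1) by blast
  qed
  then have "\<exists>K. \<forall>w. K w \<in> SH \<and> (\<forall>\<^sub>F q in nhds p. K w q = E (U w (snd c q)) q)"
    by (intro choice allI) blast
  then obtain K where K: "\<And>w. K w \<in> SH" "\<And>w. \<forall>\<^sub>F q in nhds p. K w q = E (U w (snd c q)) q" by blast
  define L where "L = (\<lambda>w::'f. \<Sum>b\<in>Basis. fscale (\<lambda>_. w \<bullet> b) (K b))"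
  have SHL: "L w \<in> SH" for w
  proof (rule sectionsI)
    show "L w \<in> vector_fields A" unfolding L_def by (intro vf_sum vf_fscale sf_const SH_vf K)
    have "L w q = (\<Sum>b\<in>Basis. tscale (w \<bullet> b) (K b q))" for q by (simp add: L_def fun_sum_apply fscale_apply)
    moreover have "(\<Sum>b\<in>Basis. tscale (w \<bullet> b) (K b q)) \<in> Hor q" for q
      by (rule Hor_sum) (rule Hor_scale[OF SH_Hor[OF K(1)]])
    ultimately show "L w q \<in> Hor q" for q by simp
  qed
  show ?thesis
  proof (rule that[of L \<zeta>, OF SHL \<zeta>])
    show "v (\<zeta> b) = 0" if "v \<in> Ver q" for q v b unfolding \<zeta>d Ver_d[OF that] by simp
    show "L (u + w) = L u + L w" for u w
      by (simp add: L_def fun_eq_iff fun_sum_apply fscale_apply tscale_def inner_left_distrib distrib_right sum.distrib)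
    show "L (a *\<^sub>R w) = fscale (\<lambda>_. a) (L w)" for a w
      by (simp add: L_def fun_eq_iff fun_sum_apply fscale_apply tscale_def sum_distrib_left mult.assoc)
    have "\<forall>\<^sub>F q in nhds p. \<forall>b\<in>Basis. K b q = E (U b (snd c q)) q"
      by (intro eventually_ball_finite ballI K finite_Basis)
    then show "\<forall>\<^sub>F q in nhds p. (\<forall>w. \<forall>b\<in>Basis. L w q (\<zeta> b) = w \<bullet> b) \<and>
      (\<forall>h\<in>Hor q. h = L (\<Sum>b\<in>Basis. h (\<zeta> b) *\<^sub>R b) q)"
      using eventually_in_open[OF N]
    proof eventually_elim
      case (elim q)
      have 1: "L w q (\<zeta> b) = w \<bullet> b" if "b \<in> Basis" for w b
      proof -
        have "L w q (\<zeta> b) = (\<Sum>i\<in>Basis. (w \<bullet> i) * (i \<bullet> b))"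
          using elim UL that by (simp add: L_def fun_sum_apply fscale_apply tscale_def)
        also have "\<dots> = (\<Sum>i\<in>Basis. (w \<bullet> i) *\<^sub>R i) \<bullet> b" by (simp add: inner_sum_left)
        finally show ?thesis by (simp add: euclidean_representation)
      qed
      moreover have "h = L (\<Sum>b\<in>Basis. h (\<zeta> b) *\<^sub>R b) q" if h: "h \<in> Hor q" for h
      proof -
        let ?w = "\<Sum>b\<in>Basis. h (\<zeta> b) *\<^sub>R b"
        have m: "h - L ?w q \<in> Hor q" by (rule Hor_diff[OF h SH_Hor[OF SHL]])
        have "h - L ?w q \<in> Ver q"
          by (rule d0[OF elim(2) Hor_tangent[OF m]]) (simp add: 1)
        then show ?thesis using Ver_Hor_zero[OF _ m] by simp
      qed
      ultimately show ?case by blast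
    qed
  qed
qed

lemma horizontal_extension:
  assumes "h \<in> Hor p"
  obtains X where "X \<in> SH" "X p = h"
proof -
  obtain L :: "'f \<Rightarrow> 'a vfield" and \<zeta> :: "'f \<Rightarrow> 'a \<Rightarrow> real" where L: "\<And>w. L w \<in> SH"
    "\<forall>\<^sub>F q in nhds p. (\<forall>w. \<forall>b\<in>Basis. L w q (\<zeta> b) = w \<bullet> b) \<and>
      (\<forall>h\<in>Hor q. h = L (\<Sum>b\<in>Basis. h (\<zeta> b) *\<^sub>R b) q)"
    by (rule horizontal_frame[of p]) (rule that)
  from eventually_nhds_x_imp_x[OF L(2)] have "h = L (\<Sum>b\<in>Basis. h (\<zeta> b) *\<^sub>R b) p" using assms by blast
  then show ?thesis using that[OF L(1)] by metis
qed

lemma vertical_extension: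
  assumes v: "v \<in> Ver p"
  obtains V where "V \<in> SV" "V p = v"
proof -
  obtain X where X: "X \<in> SH" "X p = J p v" by (rule horizontal_extension[OF J_Ver[OF v]]) (rule that)
  have "app J (- X) p = v" using X v by (simp add: app_apply J_minus)
  moreover have "- X \<in> SH"
    by (rule sectionsI) (use X Hor_scale[OF SH_Hor[OF X(1)], where a="- 1"] in \<open>auto simp: tscale_minus1\<close>)
  ultimately show ?thesis using that J_SH by blast
qed

lemma conditions_iff_totally_geodesic:
  assumes DP: "pullback_connection A A' \<pi> DB DP"
  shows "(\<forall>X\<in>SH. \<forall>Y\<in>SH. \<forall>V\<in>SV. \<forall>W\<in>SV.
       (\<forall>p. gB (\<pi> p) (second_fundamental_form A' \<pi> D DP X (app J Y) p) (d\<pi> (J p (V p)))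
            = - (1/2) * g p (J p (Y p)) (B1 p) * g p (X p) (J p (V p))
              - (1/2) * g p (X p) (Y p) * g p (B1 p) (V p)) \<and>
       oneill_T A A' g D \<pi> V (app J W) = 0) \<longleftrightarrow> totally_geodesic" (is "?L \<longleftrightarrow> _")
proof -
  have zero: "0 \<in> SH" "0 \<in> SV" by (auto intro!: sectionsI)
  have swap: "g p (D V X p) (U p) = - g p (X p) (D V U p)" if "U \<in> SV" "V \<in> SV" "X \<in> SH" for U V X p
    by (rule D_orthogonal[OF SV_vf[OF that(2)] SH_vf[OF that(3)] SV_vf[OF that(1)] g_SH_SV[OF that(3,1)]])
  have T: "oneill_T A A' g D \<pi> V (app J W) = 0 \<longleftrightarrow> (\<forall>U\<in>SV. \<forall>p. g p (D V U p) (app J W p) = 0)"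
    if V: "V \<in> SV" and W: "W \<in> SV" for V W
    unfolding oneill_condition_iff[OF V W]
  proof (intro iffI ballI allI)
    note JW = J_SV[OF W]
    fix U p
    assume U: "U \<in> SV" and "\<forall>p. D V (app J W) p \<in> Hor p"
    then have "g p (D V (app J W) p) (U p) = 0" using orth(1) SV_Ver by blast
    then show "g p (D V U p) (app J W p) = 0"
      using swap[OF U V JW, of p] g_sym[OF vfD(1)[OF D_vf[OF SV_vf[OF V] SV_vf[OF U]]] vfD(1)[OF SH_vf[OF JW]], of p] by simp
  next
    note JW = J_SV[OF W]
    fix p assume a: "\<forall>U\<in>SV. \<forall>p. g p (D V U p) (app J W p) = 0"
    have "g p (D V (app J W) p) u = 0" if "u \<in> Ver p" for u
    proof -
      obtain U where U: "U \<in> SV" "U p = u" by (rule vertical_extension[OF \<open>u \<in> Ver p\<close>]) (rule that)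
      show ?thesis
        using swap[OF U(1) V JW, of p] a U g_sym[OF vfD(1)[OF D_vf[OF SV_vf[OF V] SV_vf[OF U(1)]]] vfD(1)[OF SH_vf[OF JW]], of p]
        by simp
    qed
    then show "D V (app J W) p \<in> Hor p"
      unfolding horizontal_def using vfD(1)[OF D_vf[OF SV_vf[OF V] SH_vf[OF JW]]] by blast
  qed
  have JJ: "app J (app J (- X)) = X" "app J (- X) \<in> SV" if X: "X \<in> SH" for X
  proof -
    show "app J (app J (- X)) = X" using app_app[of "- X"] X by simp
    have "- X \<in> SH"
      by (rule sectionsI) (use X Hor_scale[OF SH_Hor[OF X], where a="- 1"] in \<open>auto simp: tscale_minus1\<close>)
    then show "app J (- X) \<in> SV" by (rule J_SH)
  qed
  show ?thesis
  proof
    assume L: ?L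
    have "g p (D X Y p) (V p) = 0" if "X \<in> SH" "Y \<in> SH" "V \<in> SV" for X Y V p
      using L that zero second_form_condition_iff[OF that DP, of p] by blast
    moreover have "g p (D V U p) (X p) = 0" if "U \<in> SV" "V \<in> SV" "X \<in> SH" for U V X p
    proof -
      have "oneill_T A A' g D \<pi> V (app J (app J (- X))) = 0" using L zero that(2) JJ(2)[OF that(3)] by blast
      then show ?thesis using T[OF that(2) JJ(2)[OF that(3)]] that(1) JJ(1)[OF that(3)] by simp
    qed
    ultimately show totally_geodesic unfolding totally_geodesic_def by blast
  next
    assume tg: totally_geodesic
    show ?L
    proof (intro ballI conjI allI)
      fix X Y V W p assume s: "X \<in> SH" "Y \<in> SH" "V \<in> SV" "W \<in> SV"
      show "gB (\<pi> p) (second_fundamental_form A' \<pi> D DP X (app J Y) p) (d\<pi> (J p (V p)))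
            = - (1/2) * g p (J p (Y p)) (B1 p) * g p (X p) (J p (V p))
              - (1/2) * g p (X p) (Y p) * g p (B1 p) (V p)"
        unfolding second_form_condition_iff[OF s(1-3) DP] using tg s unfolding totally_geodesic_def by blast
      show "oneill_T A A' g D \<pi> V (app J W) = 0"
        unfolding T[OF s(3,4)] using tg s J_SV unfolding totally_geodesic_def by blast
    qed
  qed
qed

end

section \<open>Curvature\<close>

context connection begin

text \<open>The curvature tensor, with the sign for which \<open>R X Y = [\<nabla>\<^sub>X, \<nabla>\<^sub>Y] - \<nabla>\<^bsub>[X, Y]\<^esub>\<close>.\<close>

definition R :: "'a vfield \<Rightarrow> 'a vfield \<Rightarrow> 'a vfield \<Rightarrow> 'a vfield" where
  "R X Y Z = D X (D Y Z) - D Y (D X Z) - D (lie_bracket X Y) Z"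

lemma R_vf [simp]: "X \<in> vector_fields A \<Longrightarrow> Y \<in> vector_fields A \<Longrightarrow> Z \<in> vector_fields A \<Longrightarrow> R X Y Z \<in> vector_fields A"
  by (simp add: R_def)

lemma bracket_flip: "lie_bracket Y X = - lie_bracket X Y"
  by (simp add: lie_bracket_def fun_eq_iff)

lemma R_flip: "X \<in> vector_fields A \<Longrightarrow> Y \<in> vector_fields A \<Longrightarrow> Z \<in> vector_fields A \<Longrightarrow> R Y X Z = - R X Y Z"
  by (simp add: R_def bracket_flip[of Y X] D_minus_left)

text \<open>For a connection without torsion the cyclic sum is the Jacobi identity.\<close>

lemma R_bianchi:
  assumes X: "X \<in> vector_fields A" and Y: "Y \<in> vector_fields A" and Z: "Z \<in> vector_fields A"
  shows "R X Y Z + R Y Z X + R Z X Y = 0"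
proof -
  have t: "D U (lie_bracket V W) - D (lie_bracket V W) U = lie_bracket U (lie_bracket V W)"
    if "U \<in> {X, Y, Z}" "V \<in> {X, Y, Z}" "W \<in> {X, Y, Z}" for U V W
    using that X Y Z by (intro D_torsion) auto
  have b: "D U (lie_bracket V W) = D U (D V W) - D U (D W V)"
    if "U \<in> {X, Y, Z}" "V \<in> {X, Y, Z}" "W \<in> {X, Y, Z}" for U V W
    using that X Y Z by (subst D_torsion[symmetric]) (auto intro!: D_diff_right D_vf)
  have "R X Y Z + R Y Z X + R Z X Y =
      (D X (lie_bracket Y Z) - D (lie_bracket Y Z) X) + (D Y (lie_bracket Z X) - D (lie_bracket Z X) Y)
      + (D Z (lie_bracket X Y) - D (lie_bracket X Y) Z)"
    unfolding R_def b[of X Y Z, simplified] b[of Y Z X, simplified] b[of Z X Y, simplified] by (simp add: algebra_simps)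
  also have "\<dots> = lie_bracket X (lie_bracket Y Z) + lie_bracket Y (lie_bracket Z X) + lie_bracket Z (lie_bracket X Y)"
    using t[of X Y Z] t[of Y Z X] t[of Z X Y] by simp
  finally show ?thesis using jacobi[OF X Y Z] by simp
qed

lemma R_add_left:
  assumes "X \<in> vector_fields A" "X' \<in> vector_fields A" "Y \<in> vector_fields A" "Z \<in> vector_fields A"
  shows "R (X + X') Y Z = R X Y Z + R X' Y Z"
proof -
  have "lie_bracket (X + X') Y = lie_bracket X Y + lie_bracket X' Y"
    using assms by (simp add: D_torsion[symmetric] D_add_left D_add_right)
  then show ?thesis using assms by (simp add: R_def D_add_left D_add_right)
qed

lemma R_add_right:
  assumes "X \<in> vector_fields A" "Y \<in> vector_fields A" "Y' \<in> vector_fields A" "Z \<in> vector_fields A"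
  shows "R X (Y + Y') Z = R X Y Z + R X Y' Z"
proof -
  have "- R X (Y + Y') Z = - (R X Y Z + R X Y' Z)"
    using R_add_left[OF assms(2,3,1,4)] R_flip[OF assms(1,2,4)] R_flip[OF assms(1,3,4)]
      R_flip[OF assms(1) vf_add[OF assms(2,3)] assms(4)] by simp
  then show ?thesis by (simp only: neg_equal_iff_equal)
qed

lemma R_local:
  assumes X: "X \<in> vector_fields A" and X': "X' \<in> vector_fields A"
    and Y: "Y \<in> vector_fields A" and Y': "Y' \<in> vector_fields A" and Z: "Z \<in> vector_fields A"
    and eX: "\<forall>\<^sub>F q in nhds p. X q = X' q" and eY: "\<forall>\<^sub>F q in nhds p. Y q = Y' q"
  shows "R X Y Z p = R X' Y' Z p"
proof -
  have D2: "D P (D Q Z) p = D P' (D Q' Z) p"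
    if P: "P \<in> vector_fields A" "P' \<in> vector_fields A" "\<forall>\<^sub>F q in nhds p. P q = P' q"
      and Q: "Q \<in> vector_fields A" "Q' \<in> vector_fields A" "\<forall>\<^sub>F q in nhds p. Q q = Q' q" for P P' Q Q'
  proof -
    have "\<forall>\<^sub>F q in nhds p. D Q Z q = D Q' Z q"
      using Q(3) by eventually_elim (rule D_pointwise_left[OF Q(1,2) Z])
    then have "D P (D Q Z) p = D P (D Q' Z) p" by (rule D_local_right[OF P(1) D_vf[OF Q(1) Z] D_vf[OF Q(2) Z]])
    also have "\<dots> = D P' (D Q' Z) p"
      by (rule D_pointwise_left[OF P(1,2) D_vf[OF Q(2) Z] eventually_nhds_x_imp_x[OF P(3)]])
    finally show ?thesis .
  qed
  have D1: "D P Q p = D P' Q' p"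
    if P: "P \<in> vector_fields A" "P' \<in> vector_fields A" "\<forall>\<^sub>F q in nhds p. P q = P' q"
      and Q: "Q \<in> vector_fields A" "Q' \<in> vector_fields A" "\<forall>\<^sub>F q in nhds p. Q q = Q' q" for P P' Q Q'
    using D_local_right[OF P(1) Q(1,2,3)] D_pointwise_left[where p=p, OF P(1,2) Q(2) eventually_nhds_x_imp_x[OF P(3)]] by simp
  have "lie_bracket X Y p = lie_bracket X' Y' p"
    using D1[OF X X' eX Y Y' eY] D1[OF Y Y' eY X X' eX] fun_cong[OF D_torsion[OF X Y], of p] fun_cong[OF D_torsion[OF X' Y'], of p] by simp
  then have "D (lie_bracket X Y) Z p = D (lie_bracket X' Y') Z p"
    by (rule D_pointwise_left[OF vf_bracket[OF X Y] vf_bracket[OF X' Y'] Z])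
  then show ?thesis
    using D2[OF X X' eX Y Y' eY] D2[OF Y Y' eY X X' eX] by (simp add: R_def)
qed

lemma R_skew:
  assumes X: "X \<in> vector_fields A" and Y: "Y \<in> vector_fields A" and Z: "Z \<in> vector_fields A" and W: "W \<in> vector_fields A"
  shows "g p (R X Y Z p) (W p) = - g p (Z p) (R X Y W p)"
proof -
  have 2: "P p (\<lambda>q. Q q (\<lambda>r. g r (Z r) (W r))) =
      g p (D P (D Q Z) p) (W p) + g p (D Q Z p) (D P W p) + (g p (D P Z p) (D Q W p) + g p (Z p) (D P (D Q W) p))"
    if P: "P \<in> vector_fields A" and Q: "Q \<in> vector_fields A" for P Q
  proof -
    have "(\<lambda>q. Q q (\<lambda>r. g r (Z r) (W r))) = (\<lambda>q. g q (D Q Z q) (W q) + g q (Z q) (D Q W q))"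
      by (rule ext) (rule D_metric[OF Q Z W])
    then have "P p (\<lambda>q. Q q (\<lambda>r. g r (Z r) (W r))) = P p (\<lambda>q. g q (D Q Z q) (W q)) + P p (\<lambda>q. g q (Z q) (D Q W q))"
      using tangentD(1)[OF vfD(1)[OF P] g_smooth[OF D_vf[OF Q Z] W] g_smooth[OF Z D_vf[OF Q W]], of p] by simp
    then show ?thesis by (simp add: D_metric P Q Z W)
  qed
  have "lie_bracket X Y p (\<lambda>r. g r (Z r) (W r)) = X p (\<lambda>q. Y q (\<lambda>r. g r (Z r) (W r))) - Y p (\<lambda>q. X q (\<lambda>r. g r (Z r) (W r)))"
    by (simp add: lie_bracket_def)
  then have "g p (D (lie_bracket X Y) Z p) (W p) + g p (Z p) (D (lie_bracket X Y) W p)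
    = (g p (D X (D Y Z) p) (W p) + g p (Z p) (D X (D Y W) p)) - (g p (D Y (D X Z) p) (W p) + g p (Z p) (D Y (D X W) p))"
    by (simp add: 2 X Y D_metric[OF vf_bracket[OF X Y] Z W])
  then show ?thesis
    using X Y Z W by (simp add: R_def g_diff g_diff_right vfD(1))
qed

end

section \<open>Totally geodesic distributions force flatness\<close>

context lagrangian begin

lemma SH_add: "X \<in> SH \<Longrightarrow> Y \<in> SH \<Longrightarrow> X + Y \<in> SH" and SH_diff: "X \<in> SH \<Longrightarrow> Y \<in> SH \<Longrightarrow> X - Y \<in> SH"
  and SH_fscale: "h \<in> smooth_functions A \<Longrightarrow> X \<in> SH \<Longrightarrow> fscale h X \<in> SH"
  by (auto intro!: sectionsI Hor_add Hor_diff Hor_scale simp: SH_Hor fscale_apply)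

lemma SV_add: "X \<in> SV \<Longrightarrow> Y \<in> SV \<Longrightarrow> X + Y \<in> SV" and SV_diff: "X \<in> SV \<Longrightarrow> Y \<in> SV \<Longrightarrow> X - Y \<in> SV"
  and SV_fscale: "h \<in> smooth_functions A \<Longrightarrow> X \<in> SV \<Longrightarrow> fscale h X \<in> SV"
  by (auto intro!: sectionsI Ver_add Ver_diff Ver_scale simp: SV_Ver fscale_apply)

lemma SH_uminus: "X \<in> SH \<Longrightarrow> - X \<in> SH" and SV_uminus: "V \<in> SV \<Longrightarrow> - V \<in> SV"
  using SH_fscale[OF sf_const, of X "- 1"] SV_fscale[OF sf_const, of V "- 1"] by (auto simp: fscale_minus1)

lemma SH_zero: "0 \<in> SH" and SV_zero: "0 \<in> SV"
  by (auto intro!: sectionsI)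

lemma SH_sum: "(\<And>i. i \<in> I \<Longrightarrow> X i \<in> SH) \<Longrightarrow> sum X I \<in> SH"
  by (induction I rule: infinite_finite_induct) (auto intro: SH_add SH_zero)

lemma SH_SV_zero: "X \<in> SH \<Longrightarrow> X \<in> SV \<Longrightarrow> X = 0"
proof -
  assume a: "X \<in> SH" "X \<in> SV"
  have "X p = 0" for p by (rule Ver_Hor_zero[OF SV_Ver[OF a(2)] SH_Hor[OF a(1)]])
  then show "X = 0" by (subst fun_zero_iff) blast
qed

lemma app_diff: "X \<in> vector_fields A \<Longrightarrow> Y \<in> vector_fields A \<Longrightarrow> app J (X - Y) = app J X - app J Y"
  by (simp add: app_def J_diff vfD(1) fun_eq_iff)

lemma app_zero: "app J 0 = 0"
  by (simp add: app_zero_iff)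

lemma app_inj: "X \<in> vector_fields A \<Longrightarrow> app J X = 0 \<Longrightarrow> X = 0"
  using app_app[of X] by (simp add: app_zero)

lemma point_split:
  assumes X: "X \<in> vector_fields A"
  obtains Y V where "Y \<in> SH" "V \<in> SV" "X p = (Y + V) p"
proof -
  obtain v where v: "v \<in> Ver p" "X p - v \<in> Hor p" by (rule decomposition[OF vfD(1)[OF X]]) (rule that)
  obtain Y where Y: "Y \<in> SH" "Y p = X p - v" by (rule horizontal_extension[OF v(2)]) (rule that)
  obtain V where V: "V \<in> SV" "V p = v" by (rule vertical_extension[OF v(1)]) (rule that)
  show ?thesis by (rule that[OF Y(1) V(1)]) (simp add: Y V)
qed

lemma D_point_split:
  assumes X: "X \<in> vector_fields A"
  obtains Y V where "Y \<in> SH" "V \<in> SV" "\<And>Z. Z \<in> vector_fields A \<Longrightarrow> D X Z p = D Y Z p + D V Z p"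
proof -
  obtain Y V where YV: "Y \<in> SH" "V \<in> SV" "X p = (Y + V) p" by (rule point_split[OF X]) (rule that)
  show ?thesis
  proof (rule that[OF YV(1,2)])
    fix Z assume Z: "Z \<in> vector_fields A"
    have "D X Z p = D (Y + V) Z p"
      by (rule D_pointwise_left[OF X vf_add[OF SH_vf[OF YV(1)] SV_vf[OF YV(2)]] Z YV(3)])
    also have "D (Y + V) Z = D Y Z + D V Z" by (rule D_add_left[OF SH_vf[OF YV(1)] SV_vf[OF YV(2)] Z])
    finally show "D X Z p = D Y Z p + D V Z p" by (simp only: plus_fun_def)
  qed
qed

lemma Ver_eq_Hor_perp: "u \<in> tangent A p \<Longrightarrow> (\<And>h. h \<in> Hor p \<Longrightarrow> g p u h = 0) \<Longrightarrow> u \<in> Ver p"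
proof -
  assume u: "u \<in> tangent A p" and perp: "\<And>h. h \<in> Hor p \<Longrightarrow> g p u h = 0"
  obtain v where v: "v \<in> Ver p" "u - v \<in> Hor p" by (rule decomposition[OF u]) (rule that)
  have "g p (u - v) (u - v) = g p u (u - v) - g p v (u - v)" using u v by (simp add: g_diff)
  also have "\<dots> = 0" using perp[OF v(2)] orth(2)[OF v(2,1)] by simp
  finally have "u - v = 0" by (rule g_definite[OF Hor_tangent[OF v(2)]])
  then show "u \<in> Ver p" using v(1) by simp
qed

lemma DJ_zero_J:
  assumes X: "X \<in> vector_fields A" and Y: "Y \<in> vector_fields A" and 0: "DJ X Y = 0"
  shows "DJ X (app J Y) = 0"
proof -
  have "DJ X (app J Y) p = 0" for p
  proof (rule g_definite[OF vfD(1)[OF DJ_vf[OF X J_vf[OF Y]]]])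
    show "g p (DJ X (app J Y) p) (DJ X (app J Y) p) = 0"
      using DJ_J[OF X Y DJ_vf[OF X J_vf[OF Y]], of p] vfD(1)[OF J_vf[OF DJ_vf[OF X J_vf[OF Y]]], of p]
      by (simp add: 0 g_zero)
  qed
  then show ?thesis by (simp add: fun_zero_iff)
qed

lemma SH_is_J:
  assumes X: "X \<in> SH"
  shows "\<exists>V\<in>SV. X = app J V"
proof
  show "app J (- X) \<in> SV" by (rule J_SH[OF SH_uminus[OF X]])
  show "X = app J (app J (- X))" using app_app[of "- X"] X by simp
qed

lemma SV_is_J:
  assumes V: "V \<in> SV"
  shows "\<exists>X\<in>SH. V = app J X"
proof
  show "app J (- V) \<in> SH" by (rule J_SV[OF SV_uminus[OF V]])
  show "V = app J (app J (- V))" using app_app[of "- V"] V by simp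
qed

lemma frame_sum:
  fixes L :: "'w::real_vector \<Rightarrow> 'a vfield"
  assumes "\<And>u w. L (u + w) = L u + L w" "\<And>a w. L (a *\<^sub>R w) = fscale (\<lambda>_. a) (L w)"
  shows "L (\<Sum>b\<in>I. a b *\<^sub>R w b) q = (\<Sum>b\<in>I. tscale (a b) (L (w b) q))"
proof -
  have 0: "L 0 q = 0" using fun_cong[OF assms(2)[of 0 0], of q] by (simp add: fscale_apply)
  show ?thesis
    by (induction I rule: infinite_finite_induct) (simp_all add: assms fscale_apply 0)
qed

text \<open>The horizontal part of \<open>X\<close> has the coefficients \<open>X(\<zeta> b)\<close>, since vertical vectors annihilate \<open>\<zeta> b\<close>. In particular
  it is smooth.\<close>

lemma local_split:
  assumes X: "X \<in> vector_fields A"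
  obtains Y V where "Y \<in> SH" "V \<in> SV" "\<forall>\<^sub>F q in nhds p. X q = (Y + V) q"
proof -
  obtain L :: "'f \<Rightarrow> 'a vfield" and \<zeta> :: "'f \<Rightarrow> 'a \<Rightarrow> real" where L: "\<And>w. L w \<in> SH"
    and \<zeta>: "\<And>b. \<zeta> b \<in> smooth_functions A" "\<And>q v b. v \<in> Ver q \<Longrightarrow> v (\<zeta> b) = 0"
    and Ll: "\<And>u w. L (u + w) = L u + L w" "\<And>a w. L (a *\<^sub>R w) = fscale (\<lambda>_. a) (L w)"
    and Lev: "\<forall>\<^sub>F q in nhds p. (\<forall>w. \<forall>b\<in>Basis. L w q (\<zeta> b) = w \<bullet> b) \<and>
      (\<forall>h\<in>Hor q. h = L (\<Sum>b\<in>Basis. h (\<zeta> b) *\<^sub>R b) q)"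
    by (rule horizontal_frame[of p]) (rule that)
  let ?Y = "\<Sum>b\<in>Basis. fscale (\<lambda>q. X q (\<zeta> b)) (L b)"
  have Y: "?Y \<in> SH" by (intro SH_sum SH_fscale vfD(2)[OF X] \<zeta> L)
  have ev: "\<forall>\<^sub>F q in nhds p. (X - ?Y) q \<in> Ver q"
    using Lev
  proof eventually_elim
    case (elim q)
    obtain v where v: "v \<in> Ver q" "X q - v \<in> Hor q" by (rule decomposition[OF vfD(1)[OF X]]) (rule that)
    have "X q - v = L (\<Sum>b\<in>Basis. (X q - v) (\<zeta> b) *\<^sub>R b) q" using elim v(2) by blast
    also have "\<dots> = (\<Sum>b\<in>Basis. tscale ((X q - v) (\<zeta> b)) (L b q))" by (rule frame_sum[of L, OF Ll])
    also have "\<dots> = ?Y q" using \<zeta>(2)[OF v(1)] by (simp add: fun_sum_apply fscale_apply)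
    finally have "(X - ?Y) q = v" by (simp add: algebra_simps)
    then show ?case using v(1) by simp
  qed
  obtain V where V: "V \<in> SV" "\<forall>\<^sub>F q in nhds p. V q = (X - ?Y) q"
  proof (rule section_extension[where D=Ver and p=p, OF vf_minus[OF X SH_vf[OF Y]]])
    show "tscale a u \<in> Ver q" if "u \<in> Ver q" for q a u by (rule Ver_scale[OF that])
  qed (use ev that in auto)
  show ?thesis
  proof (rule that[OF Y V(1)])
    show "\<forall>\<^sub>F q in nhds p. X q = (?Y + V) q" using V(2) by eventually_elim simp
  qed
qed

context
  assumes tg: totally_geodesic
begin

text \<open>Only \<open>g(\<nabla>\<^sub>X Y, V) = 0\<close> for vertical \<open>X\<close> is new, and there the number is \<open>- g(Y, \<nabla>\<^sub>X V)\<close>.\<close>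

lemma D_SH: "X \<in> vector_fields A \<Longrightarrow> Y \<in> SH \<Longrightarrow> D X Y \<in> SH"
proof (rule sectionsI)
  assume X: "X \<in> vector_fields A" and Y: "Y \<in> SH"
  note XY = D_vf[OF X SH_vf[OF Y]]
  show "D X Y \<in> vector_fields A" by (rule XY)
  fix p
  obtain P Q where PQ: "P \<in> SH" "Q \<in> SV" "\<And>Z. Z \<in> vector_fields A \<Longrightarrow> D X Z p = D P Z p + D Q Z p"
    by (rule D_point_split[OF X]) (rule that)
  have "g p (D X Y p) v = 0" if "v \<in> Ver p" for v
  proof -
    obtain V where V: "V \<in> SV" "V p = v" by (rule vertical_extension[OF \<open>v \<in> Ver p\<close>]) (rule that)
    have 1: "g p (D P Y p) (V p) = 0" using tg PQ(1) Y V(1) unfolding totally_geodesic_def by blast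
    have "g p (D Q V p) (Y p) = 0" using tg PQ(2) Y V(1) unfolding totally_geodesic_def by blast
    then have 2: "g p (D Q Y p) (V p) = 0"
      using D_orthogonal[where p=p, OF SV_vf[OF PQ(2)] SH_vf[OF Y] SV_vf[OF V(1)] g_SH_SV[OF Y V(1)]]
        g_sym[OF vfD(1)[OF D_vf[OF SV_vf[OF PQ(2)] SV_vf[OF V(1)]]] vfD(1)[OF SH_vf[OF Y]], of p] by simp
    show ?thesis
      using 1 2 PQ(3)[OF SH_vf[OF Y]] PQ(1,2) Y V by (auto simp: g_add vfD(1))
  qed
  then show "D X Y p \<in> Hor p" using vfD(1)[OF XY] unfolding horizontal_def by blast
qed

lemma D_SV: "X \<in> vector_fields A \<Longrightarrow> V \<in> SV \<Longrightarrow> D X V \<in> SV"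
proof (rule sectionsI)
  assume X: "X \<in> vector_fields A" and V: "V \<in> SV"
  note XV = D_vf[OF X SV_vf[OF V]]
  show "D X V \<in> vector_fields A" by (rule XV)
  fix p
  show "D X V p \<in> Ver p"
  proof (rule Ver_eq_Hor_perp[OF vfD(1)[OF XV]])
    fix h assume "h \<in> Hor p"
    then obtain Y where Y: "Y \<in> SH" "Y p = h" by (rule horizontal_extension) (rule that)
    have "g p (D X V p) (Y p) = - g p (V p) (D X Y p)"
      by (rule D_orthogonal[OF X SV_vf[OF V] SH_vf[OF Y(1)]]) (rule orth(2)[OF SH_Hor[OF Y(1)] SV_Ver[OF V]])
    then show "g p (D X V p) h = 0"
      using orth(2)[OF SH_Hor[OF D_SH[OF X Y(1)]] SV_Ver[OF V]] Y(2) by simp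
  qed
qed

lemma B1_orth: "Y \<in> SH \<Longrightarrow> g p (Y p) (B1 p) = 0" "V \<in> SV \<Longrightarrow> g p (J p (V p)) (B1 p) = 0"
  using orth(1)[OF SH_Hor SV_Ver[OF B1v]] orth(1)[OF J_Ver[OF SV_Ver] SV_Ver[OF B1v]] by blast+

text \<open>\<open>(\<nabla>\<^sub>X J)Y\<close> is vertical since both distributions are parallel, but \<open>DJ_formula\<close> has no vertical component for
  horizontal \<open>X\<close>, \<open>Y\<close>.\<close>

lemma DJ_SH_SH: assumes X: "X \<in> SH" and Y: "Y \<in> SH" shows "DJ X Y = 0"
proof -
  have m: "DJ X Y \<in> SV"
    unfolding DJ_def by (intro SV_diff D_SV J_SH D_SH X Y SH_vf)
  have "DJ X Y p = 0" for p
  proof (rule g_definite[OF vfD(1)[OF SV_vf[OF m]]])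
    show "g p (DJ X Y p) (DJ X Y p) = 0"
      using DJ_formula[OF SH_vf[OF X] SH_vf[OF Y] SV_vf[OF m], of p] B1_orth(1)[OF Y] B1_orth(2)[OF m]
        g_SH_SV[OF X m] orth(1)[OF SH_Hor[OF X] J_Hor[OF SH_Hor[OF Y]]] by simp
  qed
  then show ?thesis by (simp add: fun_zero_iff)
qed

text \<open>The horizontal component of \<open>(\<nabla>\<^sub>X J)Y = 0\<close>.\<close>

lemma lee_relation:
  assumes X: "X \<in> SH" and Y: "Y \<in> SH" and Z: "Z \<in> SH"
  shows "g p (J p (Y p)) (B1 p) * g p (X p) (Z p) = g p (J p (Z p)) (B1 p) * g p (X p) (Y p)"
  using DJ_formula[OF SH_vf[OF X] SH_vf[OF Y] SH_vf[OF Z], of p] DJ_SH_SH[OF X Y] B1_orth(1)[OF Y] B1_orth(1)[OF Z]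
    g_zero[OF vfD(1)[OF SH_vf[OF Z]], of p] by simp

text \<open>The two Lee terms that remain in \<open>DJ_formula\<close> cancel by \<open>lee_relation\<close>, applied to \<open>JU\<close> and \<open>JW\<close>.\<close>

lemma DJ_SV_SV: assumes U: "U \<in> SV" and W: "W \<in> SV" shows "DJ U W = 0"
proof -
  have m: "DJ U W \<in> SH"
    unfolding DJ_def by (intro SH_diff D_SH J_SV D_SV U W SV_vf)
  note t = vfD(1)[OF SV_vf[OF U]] vfD(1)[OF SV_vf[OF W]] vfD(1)[OF SH_vf[OF m]] vfD(1)[OF B1_vf]
  have "DJ U W p = 0" for p
  proof (rule g_definite[OF t(3)])
    let ?Z = "DJ U W"
    have "g p (J p (app J W p)) (B1 p) * g p (app J U p) (?Z p) = g p (J p (?Z p)) (B1 p) * g p (app J U p) (app J W p)"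
      by (rule lee_relation[OF J_SV[OF U] J_SV[OF W] m])
    then have "g p (W p) (B1 p) * g p (U p) (J p (?Z p)) = g p (J p (?Z p)) (B1 p) * g p (U p) (W p)"
      using t by (simp add: app_apply g_minus J_adjoint[of "U p" p "?Z p"])
    then show "g p (?Z p) (?Z p) = 0"
      using DJ_formula[OF SV_vf[OF U] SV_vf[OF W] SH_vf[OF m], of p] B1_orth(1)[OF m] B1_orth(2)[OF W]
        orth(2)[OF SH_Hor[OF m] SV_Ver[OF U]] by simp
  qed
  then show ?thesis by (simp add: fun_zero_iff)
qed

lemma DJ_mixed: "X \<in> SH \<Longrightarrow> V \<in> SV \<Longrightarrow> DJ X V = 0" "X \<in> SH \<Longrightarrow> V \<in> SV \<Longrightarrow> DJ V X = 0"
proof -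
  assume X: "X \<in> SH" and V: "V \<in> SV"
  obtain Y where Y: "Y \<in> SH" "V = app J Y" using SV_is_J[OF V] by blast
  show "DJ X V = 0" unfolding Y(2) by (rule DJ_zero_J[OF SH_vf[OF X] SH_vf[OF Y(1)] DJ_SH_SH[OF X Y(1)]])
  obtain W where W: "W \<in> SV" "X = app J W" using SH_is_J[OF X] by blast
  show "DJ V X = 0" unfolding W(2) by (rule DJ_zero_J[OF SV_vf[OF V] SV_vf[OF W(1)] DJ_SV_SV[OF V W(1)]])
qed

lemma D_J:
  assumes X: "X \<in> vector_fields A" and Y: "Y \<in> SH \<or> Y \<in> SV"
  shows "D X (app J Y) = app J (D X Y)"
proof
  fix p
  have vY: "Y \<in> vector_fields A" using Y by auto
  obtain P Q where PQ: "P \<in> SH" "Q \<in> SV" "\<And>Z. Z \<in> vector_fields A \<Longrightarrow> D X Z p = D P Z p + D Q Z p"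
    by (rule D_point_split[OF X]) (rule that)
  have "DJ P Y = 0" "DJ Q Y = 0"
    using Y DJ_SH_SH[OF PQ(1), of Y] DJ_SV_SV[OF PQ(2), of Y] DJ_mixed(1)[OF PQ(1), of Y] DJ_mixed(2)[OF _ PQ(2), of Y] by blast+
  then have "D P (app J Y) p = J p (D P Y p)" "D Q (app J Y) p = J p (D Q Y p)"
    by (auto simp: DJ_def app_apply[symmetric])
  then show "D X (app J Y) p = app J (D X Y) p"
    using PQ vY by (simp add: app_apply J_add vfD(1))
qed

lemma R_SH: "X \<in> vector_fields A \<Longrightarrow> Y \<in> vector_fields A \<Longrightarrow> Z \<in> SH \<Longrightarrow> R X Y Z \<in> SH"
  and R_SV: "X \<in> vector_fields A \<Longrightarrow> Y \<in> vector_fields A \<Longrightarrow> V \<in> SV \<Longrightarrow> R X Y V \<in> SV"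
  unfolding R_def by (intro SH_diff D_SH vf_bracket; assumption) (intro SV_diff D_SV vf_bracket; assumption)

lemma R_J:
  assumes X: "X \<in> vector_fields A" and Y: "Y \<in> vector_fields A" and Z: "Z \<in> SH \<or> Z \<in> SV"
  shows "R X Y (app J Z) = app J (R X Y Z)"
proof -
  have vZ: "Z \<in> vector_fields A" using Z by auto
  have DZ: "D P Z \<in> SH \<or> D P Z \<in> SV" if "P \<in> vector_fields A" for P
    using Z D_SH[OF that] D_SV[OF that] by blast
  show ?thesis
    using X Y vZ by (simp add: R_def D_J Z DZ app_diff)
qed

text \<open>By the Bianchi identity \<open>R X Y V\<close> is horizontal, and it is vertical because the vertical distribution is parallel. The
  second claim follows by applying \<open>J\<close>.\<close>

lemma R_HH: assumes X: "X \<in> SH" and Y: "Y \<in> SH"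
  shows "V \<in> SV \<Longrightarrow> R X Y V = 0" "Z \<in> SH \<Longrightarrow> R X Y Z = 0"
proof -
  show 1: "R X Y V = 0" if V: "V \<in> SV" for V
  proof -
    have "R X Y V = - (R Y V X + R V X Y)"
      using R_bianchi[OF SH_vf[OF X] SH_vf[OF Y] SV_vf[OF V]] by (subst eq_neg_iff_add_eq_0) (simp only: add.assoc)
    moreover have "- (R Y V X + R V X Y) \<in> SH" by (intro SH_uminus SH_add R_SH X Y SH_vf SV_vf V)
    ultimately have "R X Y V \<in> SH" by (simp only:)
    then show ?thesis by (rule SH_SV_zero[OF _ R_SV[OF SH_vf[OF X] SH_vf[OF Y] V]])
  qed
  show "R X Y Z = 0" if Z: "Z \<in> SH"
    using app_inj[OF R_vf[OF SH_vf[OF X] SH_vf[OF Y] SH_vf[OF Z]]] 1[OF J_SH[OF Z]] R_J[OF SH_vf[OF X] SH_vf[OF Y], of Z] Z by simp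
qed

lemma R_VV: assumes U: "U \<in> SV" and V: "V \<in> SV"
  shows "X \<in> SH \<Longrightarrow> R U V X = 0"
proof -
  assume X: "X \<in> SH"
  have "R U V X = - (R V X U + R X U V)"
    using R_bianchi[OF SV_vf[OF U] SV_vf[OF V] SH_vf[OF X]] by (subst eq_neg_iff_add_eq_0) (simp only: add.assoc)
  moreover have "- (R V X U + R X U V) \<in> SV" by (intro SV_uminus SV_add R_SV U V SH_vf SV_vf X)
  ultimately have "R U V X \<in> SV" by (simp only:)
  then show ?thesis by (rule SH_SV_zero[OF R_SH[OF SV_vf[OF U] SV_vf[OF V] X]])
qed

text \<open>By the Bianchi identity the trilinear map \<open>R(X, JY)Z\<close> of horizontal fields is symmetric in all arguments, and it is
  skew as an endomorphism of \<open>Z\<close>. A four-linear form that is symmetric in one pair and skew in an overlapping pair is zero.\<close>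

lemma R_HV:
  assumes X: "X \<in> SH" and U: "U \<in> SV" and Z: "Z \<in> SH"
  shows "R X U Z = 0"
proof -
  have s1: "R X (app J Y) Z = R Z (app J Y) X" if X: "X \<in> SH" and Y: "Y \<in> SH" and Z: "Z \<in> SH" for X Y Z
  proof -
    note v = SH_vf[OF X] SV_vf[OF J_SH[OF Y]] SH_vf[OF Z]
    have "R X (app J Y) Z + R (app J Y) Z X + R Z X (app J Y) = 0" by (rule R_bianchi[OF v])
    then show ?thesis using R_HH(1)[OF Z X J_SH[OF Y]] R_flip[OF v(3,2,1)] by simp
  qed
  have s2: "R X (app J Y) Z = R X (app J Z) Y" if X: "X \<in> SH" and Y: "Y \<in> SH" and Z: "Z \<in> SH" for X Y Z
  proof -
    note v = SH_vf[OF X] SV_vf[OF J_SH[OF Y]] SV_vf[OF J_SH[OF Z]]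
    have "R X (app J Y) (app J Z) + R (app J Y) (app J Z) X + R (app J Z) X (app J Y) = 0" by (rule R_bianchi[OF v])
    then have "R X (app J Y) (app J Z) - R X (app J Z) (app J Y) = 0"
      using R_VV[OF J_SH[OF Y] J_SH[OF Z] X] R_flip[OF v(1,3,2)] by simp
    then have "app J (R X (app J Y) Z - R X (app J Z) Y) = 0"
      using v R_J[OF v(1,2), of Z] R_J[OF v(1,3), of Y] Y Z by (simp add: app_diff)
    then have "R X (app J Y) Z - R X (app J Z) Y = 0"
      by (rule app_inj[rotated]) (use v Y Z in simp)
    then show ?thesis by simp
  qed
  obtain Y where Y: "Y \<in> SH" "U = app J Y" using SV_is_J[OF U] by blast
  have "R X (app J Y) Z p = 0" for p
  proof -
    define T where "T = (\<lambda>X Y Z W. g p (R X (app J Y) Z p) (W p))"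
    have t1: "T X Y Z W = T Z Y X W" and t2: "T X Y Z W = T X Z Y W" and t3: "T X Y Z W = - T X Y W Z"
      if "X \<in> SH" "Y \<in> SH" "Z \<in> SH" "W \<in> SH" for X Y Z W
    proof -
      show "T X Y Z W = T Z Y X W" unfolding T_def by (simp add: s1[OF that(1-3)])
      show "T X Y Z W = T X Z Y W" unfolding T_def by (simp add: s2[OF that(1-3)])
      show "T X Y Z W = - T X Y W Z"
        unfolding T_def using R_skew[OF SH_vf[OF that(1)] SV_vf[OF J_SH[OF that(2)]] SH_vf[OF that(3)] SH_vf[OF that(4)], of p]
          g_sym[OF vfD(1)[OF R_vf[OF SH_vf[OF that(1)] SV_vf[OF J_SH[OF that(2)]] SH_vf[OF that(4)]]] vfD(1)[OF SH_vf[OF that(3)]], of p]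
        by simp
    qed
    have m: "R X (app J Y) Z \<in> SH" by (rule R_SH[OF SH_vf[OF X] SV_vf[OF J_SH[OF Y(1)]] Z])
    have "T X Y Z W = 0" if W: "W \<in> SH" for W
      using t2[OF X Y(1) Z W] t3[OF X Z Y(1) W] t2[OF X Z W Y(1)] t3[OF X W Z Y(1)] t2[OF X W Y(1) Z]
        t3[OF X Y(1) W Z] by linarith
    then have "g p (R X (app J Y) Z p) (R X (app J Y) Z p) = 0" using m unfolding T_def by blast
    then show ?thesis by (rule g_definite[OF vfD(1)[OF SH_vf[OF m]]])
  qed
  then show ?thesis unfolding Y(2) by (simp add: fun_zero_iff)
qed

text \<open>The curvature is additive and local in \<open>X\<close> and \<open>Y\<close>, so \<open>local_split\<close> reduces to the three cases above.\<close>

lemma R_zero: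
  assumes X: "X \<in> vector_fields A" and Y: "Y \<in> vector_fields A" and Z: "Z \<in> SH"
  shows "R X Y Z = 0"
proof -
  have "R X Y Z p = 0" for p
  proof -
    obtain P Q where P: "P \<in> SH" "Q \<in> SV" "\<forall>\<^sub>F q in nhds p. X q = (P + Q) q"
      by (rule local_split[OF X]) (rule that)
    obtain P' Q' where P': "P' \<in> SH" "Q' \<in> SV" "\<forall>\<^sub>F q in nhds p. Y q = (P' + Q') q"
      by (rule local_split[OF Y]) (rule that)
    note v = SH_vf[OF P(1)] SV_vf[OF P(2)] SH_vf[OF P'(1)] SV_vf[OF P'(2)] SH_vf[OF Z]
    have "R X Y Z p = R (P + Q) (P' + Q') Z p"
      by (rule R_local[OF X vf_add[OF v(1,2)] Y vf_add[OF v(3,4)] v(5) P(3) P'(3)])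
    also have "R (P + Q) (P' + Q') Z = R P (P' + Q') Z + R Q (P' + Q') Z"
      by (rule R_add_left[OF v(1,2) vf_add[OF v(3,4)] v(5)])
    also have "R P (P' + Q') Z = R P P' Z + R P Q' Z" by (rule R_add_right[OF v(1,3,4,5)])
    also have "R Q (P' + Q') Z = R Q P' Z + R Q Q' Z" by (rule R_add_right[OF v(2,3,4,5)])
    also have "R P P' Z = 0" by (rule R_HH(2)[OF P(1) P'(1) Z])
    also have "R P Q' Z = 0" by (rule R_HV[OF P(1) P'(2) Z])
    also have "R Q P' Z = 0" using R_flip[OF v(3,2,5)] R_HV[OF P'(1) P(2) Z] by simp
    also have "R Q Q' Z = 0" by (rule R_VV[OF P(2) P'(2) Z])
    finally show ?thesis by (simp only: plus_fun_def zero_fun_def add_0)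
  qed
  then show ?thesis by (subst fun_zero_iff) blast
qed

end

end

section \<open>Parallel frames\<close>

context manifold begin

text \<open>In a chart the derivative vanishes on a ball.\<close>

lemma locally_constant:
  assumes f: "f \<in> smooth_functions A" and ev: "\<forall>\<^sub>F q in nhds p. \<forall>X\<in>vector_fields A. X q f = 0"
  shows "\<forall>\<^sub>F q in nhds p. f q = f p"
proof -
  obtain c where cA: "c \<in> A" and p: "p \<in> fst c" using chart_at .
  note c = admissible_in[OF cA]
  note cc = admissible_is_chart[OF c]
  obtain E where E: "\<And>w. E w \<in> vector_fields A" "\<forall>\<^sub>F q in nhds p. \<forall>w. E w q = coord_vector A c q w"
    by (rule coordinate_fields[OF c p]) (rule that)
  have "\<forall>\<^sub>F q in nhds p. \<forall>w. coord_vector A c q w f = 0"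
    using ev E(2) by eventually_elim (use E(1) in metis)
  from eventually_chart_inv[OF cc p this] obtain U where U: "open U" "snd c p \<in> U"
    "\<forall>y\<in>U. y \<in> snd c ` fst c \<and> (\<forall>w. coord_vector A c (chart_inv c y) w f = 0)"
    unfolding eventually_nhds by (elim exE conjE) (rule that)
  then obtain r where r: "r > 0" "ball (snd c p) r \<subseteq> U" using open_contains_ball by blast
  let ?B = "ball (snd c p) r"
  have d: "((f \<circ> chart_inv c) has_derivative (\<lambda>_. 0)) (at y within ?B)" if "y \<in> ?B" for y
  proof -
    have y: "chart_inv c y \<in> fst c" "snd c (chart_inv c y) = y" "\<And>w. coord_vector A c (chart_inv c y) w f = 0"
      using that r(2) U(3) is_chart_inv[OF cc] by (blast, blast, blast)
    have "((f \<circ> chart_inv c) has_derivative (\<lambda>w. coord_vector A c (chart_inv c y) w f)) (at y)"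
      using chart_function_derivative[OF c y(1) f] unfolding y(2) .
    then show ?thesis using has_derivative_at_withinI unfolding y(3) by blast
  qed
  have const: "(f \<circ> chart_inv c) y = (f \<circ> chart_inv c) (snd c p)" if "y \<in> ?B" for y
    using has_derivative_zero_unique[OF convex_ball, of "snd c p" r "f \<circ> chart_inv c"] d that r(1)
    by (metis centre_in_ball)
  have "\<forall>\<^sub>F q in nhds p. q \<in> fst c \<and> snd c q \<in> ?B"
    by (rule eventually_chart[OF cc p]) (rule eventually_in_open, use r(1) in auto)
  then show ?thesis
  proof eventually_elim
    case (elim q)
    then show ?case using const[of "snd c q"] p by (simp add: is_chart_inv[OF cc])
  qed
qed

lemma admissible_reparametrization:
  assumes c: "admissible_chart A c" and U: "open U" "U \<subseteq> snd c ` fst c" and V: "open V"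
    and h: "homeomorphism U V F G" and sF: "smooth_on U F" and sG: "smooth_on V G"
  defines "c' \<equiv> (fst c \<inter> snd c -` U, F \<circ> snd c)"
  shows "admissible_chart A c'" "snd c' ` fst c' = V" "\<And>y. y \<in> V \<Longrightarrow> chart_inv c' y = chart_inv c (G y)"
proof -
  note cc = admissible_is_chart[OF c]
  note ci = is_chart_inv[OF cc]
  have FG: "\<And>x. x \<in> U \<Longrightarrow> F x \<in> V" "\<And>y. y \<in> V \<Longrightarrow> G y \<in> U" "\<And>x. x \<in> U \<Longrightarrow> G (F x) = x" "\<And>y. y \<in> V \<Longrightarrow> F (G y) = y"
    using h by (auto simp: homeomorphism_def)
  have im: "snd c' ` fst c' = V"
  proof
    show "snd c' ` fst c' \<subseteq> V" using FG by (auto simp: c'_def)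
    show "V \<subseteq> snd c' ` fst c'"
    proof
      fix y assume y: "y \<in> V"
      then obtain q where q: "q \<in> fst c" "G y = snd c q" using FG(2) U(2) by blast
      have "q \<in> fst c'" "y = snd c' q" using q FG(2,4)[OF y] by (auto simp: c'_def)
      then show "y \<in> snd c' ` fst c'" by blast
    qed
  qed
  then show "snd c' ` fst c' = V" .
  have inj: "inj_on (snd c') (fst c')"
  proof (rule inj_onI)
    fix q r assume qr: "q \<in> fst c'" "r \<in> fst c'" "snd c' q = snd c' r"
    then have "snd c q = snd c r" using FG(3) by (auto simp: c'_def) metis
    then show "q = r" using qr ci(1) by (auto simp: c'_def) metis
  qed
  show inv: "chart_inv c' y = chart_inv c (G y)" if y: "y \<in> V" for y
  proof -
    have "chart_inv c (G y) \<in> fst c'" "snd c' (chart_inv c (G y)) = y"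
      using ci(2,3) U(2) FG(2,4)[OF y] by (auto simp: c'_def)
    then show ?thesis unfolding chart_inv_def[of c'] using inj by (metis inv_into_f_f)
  qed
  have ch: "is_chart c'"
    unfolding is_chart_def im
  proof (intro conjI inj V)
    show "open (fst c')" unfolding c'_def fst_conv by (rule chart_preimage_open[OF cc U(1)])
    have "continuous_on (fst c') (snd c)"
      by (rule continuous_on_subset[of "fst c"]) (use cc in \<open>auto simp: is_chart_def c'_def\<close>)
    then have "continuous_on (fst c') (\<lambda>q. F (snd c q))"
      by (rule continuous_on_compose2[OF smooth_on_continuous[OF sF]]) (auto simp: c'_def)
    then show "continuous_on (fst c') (snd c')" by (simp add: c'_def comp_def)
    have "continuous_on V (\<lambda>y. chart_inv c (G y))"
      by (rule continuous_on_compose2[of "snd c ` fst c" _ _ G]) (use cc smooth_on_continuous[OF sG] FG(2) U(2) in \<open>auto simp: is_chart_def\<close>)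
    then show "continuous_on V (chart_inv c')" by (rule continuous_on_eq) (simp add: inv)
  qed
  show "admissible_chart A c'"
    unfolding admissible_chart_def
  proof (intro conjI ch ballI)
    fix d assume d: "d \<in> A"
    have dc: "is_chart d" by (rule admissible_is_chart[OF admissible_in[OF d]])
    have od: "open (fst d)" "open (fst c')" using dc ch by (auto simp: is_chart_def)
    have cd: "smooth_on (snd c ` (fst c \<inter> fst d)) (\<lambda>x. snd d (chart_inv c x))"
      "smooth_on (snd d ` (fst c \<inter> fst d)) (\<lambda>x. snd c (chart_inv d x))"
      using c d by (auto simp: admissible_chart_def compatible_def comp_def)
    have o1: "open (snd c' ` (fst c' \<inter> fst d))" by (rule chart_image_open[OF ch od(1)])
    have o2: "open (snd d ` (fst c' \<inter> fst d))" using chart_image_open[OF dc od(2)] by (simp add: Int_commute)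
    have o3: "open (snd c ` (fst c \<inter> fst d))" by (rule chart_image_open[OF cc od(1)])
    have o4: "open (snd d ` (fst c \<inter> fst d))" using chart_image_open[OF dc, of "fst c"] cc by (simp add: is_chart_def Int_commute)
    show "compatible c' d"
      unfolding compatible_def
    proof
      have sub: "snd c' ` (fst c' \<inter> fst d) \<subseteq> V" using im by blast
      have "smooth_on (snd c' ` (fst c' \<inter> fst d)) (\<lambda>y. snd d (chart_inv c (G y)))"
      proof (rule smooth_on_compose[OF o1 o3 _ cd(1) smooth_on_subset[OF V o1 sub sG]])
        show "G ` snd c' ` (fst c' \<inter> fst d) \<subseteq> snd c ` (fst c \<inter> fst d)"
          using FG(3) by (auto simp: c'_def)
      qed
      then show "smooth_on (snd c' ` (fst c' \<inter> fst d)) (snd d \<circ> chart_inv c')"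
        by (rule smooth_on_cong[OF o1, rotated]) (use inv sub in auto)
      have "smooth_on (snd d ` (fst c' \<inter> fst d)) (\<lambda>y. snd c (chart_inv d y))"
        by (rule smooth_on_subset[OF o4 o2 _ cd(2)]) (auto simp: c'_def)
      then have "smooth_on (snd d ` (fst c' \<inter> fst d)) (\<lambda>y. F (snd c (chart_inv d y)))"
        by (rule smooth_on_compose[OF o2 U(1) _ sF, rotated]) (use is_chart_inv[OF dc] in \<open>auto simp: c'_def\<close>)
      then show "smooth_on (snd d ` (fst c' \<inter> fst d)) (snd c' \<circ> chart_inv d)"
        by (simp add: c'_def comp_def)
    qed
  qed
qed

lemma coord_vector_reparametrization:
  assumes c: "admissible_chart A c" and U: "open U" "U \<subseteq> snd c ` fst c" and V: "open V"
    and h: "homeomorphism U V F G"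
    and G: "(G has_derivative G') (at (F (snd c q)))" and q: "q \<in> fst c \<inter> snd c -` U"
  shows "coord_vector A (fst c \<inter> snd c -` U, F \<circ> snd c) q w = coord_vector A c q (G' w)"
proof
  fix f :: "'a \<Rightarrow> real"
  let ?c' = "(fst c \<inter> snd c -` U, F \<circ> snd c)"
  have GF: "G (F x) = x" if "x \<in> U" for x using h that by (auto simp: homeomorphism_def)
  show "coord_vector A ?c' q w f = coord_vector A c q (G' w) f"
  proof (cases "f \<in> smooth_functions A")
    case f: True
    have FV: "F (snd c q) \<in> V" using q h by (auto simp: homeomorphism_def)
    have G: "(G has_derivative G') (at (F (snd c q)))" by (rule G)
    have "((f \<circ> chart_inv c) has_derivative (\<lambda>w. coord_vector A c q w f)) (at (G (F (snd c q))))"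
      using chart_function_derivative[OF c _ f, of q] q GF by simp
    from has_derivative_compose[OF G this]
    have 1: "((\<lambda>y. (f \<circ> chart_inv c) (G y)) has_derivative (\<lambda>w. coord_vector A c q (G' w) f)) (at (F (snd c q)))" .
    have inv: "chart_inv ?c' y = chart_inv c (G y)" if y: "y \<in> V" for y
    proof -
      have Gy: "G y \<in> U" "F (G y) = y" using h y by (auto simp: homeomorphism_def)
      note ci = is_chart_inv[OF admissible_is_chart[OF c]]
      have a: "chart_inv c (G y) \<in> fst ?c'" "snd ?c' (chart_inv c (G y)) = y" using ci(2,3) U(2) Gy by auto
      have "inj_on (snd ?c') (fst ?c')"
      proof (rule inj_onI)
        fix s r assume sr: "s \<in> fst ?c'" "r \<in> fst ?c'" "snd ?c' s = snd ?c' r"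
        then have "snd c s = snd c r" using GF by auto metis
        then show "s = r" using sr ci(1) by auto metis
      qed
      then show ?thesis unfolding chart_inv_def[of ?c'] using a by (metis inv_into_f_f)
    qed
    have "((f \<circ> chart_inv ?c') has_derivative (\<lambda>w. coord_vector A c q (G' w) f)) (at (F (snd c q)))"
      by (rule has_derivative_transform_within_open[OF 1 V FV]) (simp add: inv)
    from fun_cong[OF frechet_derivative_at[OF this], of w]
    show ?thesis using f by (simp add: coord_vector_def)
  qed (simp add: coord_vector_def)
qed

end

context lagrangian begin

context
  assumes tg: totally_geodesic
begin

text \<open>Write \<open>s = \<Sum> a\<^sub>b L\<^sub>b\<close> in the horizontal frame \<open>L\<close>. With \<open>\<nabla>\<^sub>v L\<^sub>w = L(C\<^sub>0(v) w)\<close> the field \<open>s\<close> is parallel if and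
  only if \<open>da = - C\<^sub>0 a\<close>, and the integrability condition of this system is \<open>R(E\<^sub>u, E\<^sub>v) L\<^sub>w = 0\<close>. Working in the frame \<open>L\<close>,
  the solution is horizontal by construction.\<close>

lemma parallel_frame:
  fixes p :: 'a
  obtains s :: "'f \<Rightarrow> 'a vfield" where "\<And>w. s w \<in> SH"
    "\<And>u w. s (u + w) = s u + s w" "\<And>a w. s (a *\<^sub>R w) = fscale (\<lambda>_. a) (s w)"
    "\<And>w. s w p = 0 \<Longrightarrow> w = 0" "\<forall>\<^sub>F q in nhds p. \<forall>X\<in>vector_fields A. \<forall>w. D X (s w) q = 0"
proof -
  obtain c where cA: "c \<in> A" and p: "p \<in> fst c" using chart_at .
  note c = admissible_in[OF cA]
  note cc = admissible_is_chart[OF c]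
  note ci = is_chart_inv[OF cc]
  obtain E where E: "\<And>w. E w \<in> vector_fields A" "\<forall>\<^sub>F q in nhds p. \<forall>w. E w q = coord_vector A c q w"
    and El: "\<And>u w. E (u + w) = E u + E w" "\<And>a w. E (a *\<^sub>R w) = fscale (\<lambda>_. a) (E w)"
    by (rule coordinate_fields[OF c p]) (rule that)
  obtain L :: "'f \<Rightarrow> 'a vfield" and \<zeta> :: "'f \<Rightarrow> 'a \<Rightarrow> real" where L: "\<And>w. L w \<in> SH"
    and \<zeta>: "\<And>b. \<zeta> b \<in> smooth_functions A"
    and Ll: "\<And>u w. L (u + w) = L u + L w" "\<And>a w. L (a *\<^sub>R w) = fscale (\<lambda>_. a) (L w)"
    and Lev: "\<forall>\<^sub>F q in nhds p. (\<forall>w. \<forall>b\<in>Basis. L w q (\<zeta> b) = w \<bullet> b) \<and>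
      (\<forall>h\<in>Hor q. h = L (\<Sum>b\<in>Basis. h (\<zeta> b) *\<^sub>R b) q)"
    by (rule horizontal_frame[of p]) (rule that)
  have vL: "L w \<in> vector_fields A" for w using L by simp
  have Lsum: "L (\<Sum>b\<in>I. a b *\<^sub>R w b) q = (\<Sum>b\<in>I. tscale (a b) (L (w b) q))" for I :: "'f set" and a w q
    by (rule frame_sum[of L, OF Ll])
  have L0: "L 0 q = 0" for q using Lsum[of "\<lambda>_. 0" id "{}" q] by simp
  define k where "k = (\<lambda>v w b q. D (E v) (L w) q (\<zeta> b))"
  have k: "k v w b \<in> smooth_functions A" for v w b
    unfolding k_def by (rule vfD(2)[OF D_vf[OF E(1) vL] \<zeta>])
  define C0 where "C0 = (\<lambda>q v w. (\<Sum>b\<in>Basis. k v w b q *\<^sub>R b) :: 'f)"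
  have k1: "k (u + v) w b q = k u w b q + k v w b q" "k (a *\<^sub>R v) w b q = a * k v w b q" for u v w b q a
    by (simp_all add: k_def El D_add_left E vL D_scale_left fscale_apply) (simp add: tscale_def)
  have k2: "k v (u + w) b q = k v u b q + k v w b q" for v u w b q
    by (simp add: k_def Ll D_add_right E vL)
  have k3: "k v (a *\<^sub>R w) b q = a * k v w b q" for v w b q a
    by (simp add: k_def Ll D_scale_right E vL fscale_apply tangent_const[OF vfD(1)[OF E(1)]]) (simp add: tscale_def)
  have l1: "linear (\<lambda>v. C0 q v w)" and l2: "linear (C0 q v)" for q v w
    by (auto intro!: linearI simp: C0_def k1 k2 k3 scaleR_left_distrib sum.distrib scaleR_sum_right)
  have C0b: "C0 q v w \<bullet> b = k v w b q" if "b \<in> Basis" for q v w b using that by (simp add: C0_def)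
  have evE: "\<forall>\<^sub>F q in nhds p. \<forall>\<^sub>F r in nhds q. \<forall>w. E w r = coord_vector A c r w"
    using E(2) by (simp add: eventually_eventually)
  have evL: "\<forall>\<^sub>F q in nhds p. \<forall>\<^sub>F r in nhds q. (\<forall>w. \<forall>b\<in>Basis. L w r (\<zeta> b) = w \<bullet> b) \<and>
      (\<forall>h\<in>Hor r. h = L (\<Sum>b\<in>Basis. h (\<zeta> b) *\<^sub>R b) r)"
    using Lev by (simp only: eventually_eventually)
  have evall: "\<forall>\<^sub>F q in nhds p. q \<in> fst c \<and> (\<forall>\<^sub>F r in nhds q. \<forall>w. E w r = coord_vector A c r w) \<and>
    (\<forall>\<^sub>F r in nhds q. (\<forall>w. \<forall>b\<in>Basis. L w r (\<zeta> b) = w \<bullet> b) \<and>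
      (\<forall>h\<in>Hor r. h = L (\<Sum>b\<in>Basis. h (\<zeta> b) *\<^sub>R b) r))"
    using eventually_in_chart[OF cc p] evE evL by eventually_elim (intro conjI)
  from eventually_chart_inv[OF cc p evall]
  have "\<forall>\<^sub>F x in nhds (snd c p). x \<in> snd c ` fst c \<and> (\<forall>\<^sub>F r in nhds (chart_inv c x). \<forall>w. E w r = coord_vector A c r w) \<and>
    (\<forall>\<^sub>F r in nhds (chart_inv c x). (\<forall>w. \<forall>b\<in>Basis. L w r (\<zeta> b) = w \<bullet> b) \<and>
      (\<forall>h\<in>Hor r. h = L (\<Sum>b\<in>Basis. h (\<zeta> b) *\<^sub>R b) r))"
    by eventually_elim (elim conjE, intro conjI)
  from eventually_nhds_metric[THEN iffD1, OF this]
  obtain \<rho> where \<rho>: "\<rho> > 0" and \<rho>x: "\<forall>x. dist x (snd c p) < \<rho> \<longrightarrow> x \<in> snd c ` fst c \<and>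
    (\<forall>\<^sub>F r in nhds (chart_inv c x). \<forall>w. E w r = coord_vector A c r w) \<and>
    (\<forall>\<^sub>F r in nhds (chart_inv c x). (\<forall>w. \<forall>b\<in>Basis. L w r (\<zeta> b) = w \<bullet> b) \<and>
      (\<forall>h\<in>Hor r. h = L (\<Sum>b\<in>Basis. h (\<zeta> b) *\<^sub>R b) r))" by (elim exE conjE) (rule that)
  let ?x0 = "snd c p"
  have im: "x \<in> snd c ` fst c" "chart_inv c x \<in> fst c" "snd c (chart_inv c x) = x"
    and Ex: "\<forall>\<^sub>F r in nhds (chart_inv c x). \<forall>w. E w r = coord_vector A c r w"
    and Lx: "\<forall>\<^sub>F r in nhds (chart_inv c x). (\<forall>w. \<forall>b\<in>Basis. L w r (\<zeta> b) = w \<bullet> b) \<and>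
      (\<forall>h\<in>Hor r. h = L (\<Sum>b\<in>Basis. h (\<zeta> b) *\<^sub>R b) r)" if "x \<in> ball ?x0 \<rho>" for x
    using \<rho>x[rule_format, of x] that ci(2,3)[of x] by (simp_all add: dist_commute)
  have Eq: "E w (chart_inv c x) = coord_vector A c (chart_inv c x) w" if "x \<in> ball ?x0 \<rho>" for x w
    using eventually_nhds_x_imp_x[OF Ex[OF that]] by blast
  have Lq: "L w (chart_inv c x) (\<zeta> b) = w \<bullet> b" if "x \<in> ball ?x0 \<rho>" "b \<in> Basis" for x w b
    using eventually_nhds_x_imp_x[OF Lx[OF that(1)]] that(2) by blast
  define C where "C = (\<lambda>x v w. - C0 (chart_inv c x) v w)"
  have subB: "ball ?x0 \<rho> \<subseteq> snd c ` fst c" using im(1) by blast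
  have smf: "smooth_on (ball ?x0 \<rho>) (\<lambda>x. f (chart_inv c x))" if "f \<in> smooth_functions A" for f
    by (rule smooth_on_subset[OF _ open_ball subB smooth_function_chart[OF that c]]) (use cc in \<open>simp add: is_chart_def\<close>)
  have smC0: "smooth_on (ball ?x0 \<rho>) (\<lambda>x. C0 (chart_inv c x) v w)" for v w
    unfolding C0_def by (intro smooth_on_sum smooth_on_scaleR smooth_on_const open_ball smf k)
  \<comment> \<open>The horizontal distribution is parallel, so the derivative of the frame is expressed by the frame.\<close>
  have DL: "\<forall>\<^sub>F r in nhds (chart_inv c x). D (E v) (L w) r = (\<Sum>b\<in>Basis. fscale (k v w b) (L b)) r"
    if x: "x \<in> ball ?x0 \<rho>" for x v w
    using Lx[OF x]
  proof eventually_elim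
    case (elim r)
    have "D (E v) (L w) r \<in> Hor r" by (rule SH_Hor[OF D_SH[OF tg E(1) L]])
    then have "D (E v) (L w) r = L (\<Sum>b\<in>Basis. k v w b r *\<^sub>R b) r" using elim unfolding k_def by blast
    then show ?case by (simp add: Lsum fun_sum_apply fscale_apply)
  qed
  have dk: "frechet_derivative (\<lambda>y. C0 (chart_inv c y) v w) (at x) u \<bullet> b = E u (chart_inv c x) (k v w b)"
    if x: "x \<in> ball ?x0 \<rho>" and b: "b \<in> Basis" for x v w u b
  proof -
    have 1: "((k v w b \<circ> chart_inv c) has_derivative (\<lambda>u. coord_vector A c (chart_inv c x) u (k v w b))) (at x)"
      using chart_function_derivative[OF c im(2)[OF x] k, of v w b] im(3)[OF x] by simp
    have "((\<lambda>y. C0 (chart_inv c y) v w \<bullet> b) has_derivative (\<lambda>u. frechet_derivative (\<lambda>y. C0 (chart_inv c y) v w) (at x) u \<bullet> b)) (at x)"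
      by (intro has_derivative_inner_left smooth_on_has_derivative[OF open_ball smC0 x])
    then have 2: "((k v w b \<circ> chart_inv c) has_derivative (\<lambda>u. frechet_derivative (\<lambda>y. C0 (chart_inv c y) v w) (at x) u \<bullet> b)) (at x)"
      by (simp add: C0b[OF b] comp_def)
    from fun_cong[OF has_derivative_unique[OF 2 1], of u] show ?thesis using Eq[OF x] by simp
  qed
  have DDL: "(D (E u) (D (E v) (L w)) (chart_inv c x)) (\<zeta> b) =
      (frechet_derivative (\<lambda>y. C0 (chart_inv c y) v w) (at x) u + C0 (chart_inv c x) u (C0 (chart_inv c x) v w)) \<bullet> b"
    if x: "x \<in> ball ?x0 \<rho>" and b: "b \<in> Basis" for x u v w b
  proof -
    let ?q = "chart_inv c x"
    have "D (E u) (D (E v) (L w)) ?q = D (E u) (\<Sum>i\<in>Basis. fscale (k v w i) (L i)) ?q"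
      by (rule D_local_right[OF E(1) D_vf[OF E(1) vL] _ DL[OF x]]) (intro vf_sum vf_fscale k vL)
    also have "D (E u) (\<Sum>i\<in>Basis. fscale (k v w i) (L i)) = (\<Sum>i\<in>Basis. fscale (\<lambda>q. E u q (k v w i)) (L i) + fscale (k v w i) (D (E u) (L i)))"
      by (subst D_sum_right) (auto simp: k vL E D_scale_right)
    finally have e: "D (E u) (D (E v) (L w)) ?q = (\<Sum>i\<in>Basis. fscale (\<lambda>q. E u q (k v w i)) (L i) + fscale (k v w i) (D (E u) (L i))) ?q" .
    have "D (E u) (D (E v) (L w)) ?q (\<zeta> b) = (\<Sum>i\<in>Basis. E u ?q (k v w i) * (i \<bullet> b) + k v w i ?q * k u i b ?q)"
      unfolding e using Lq[OF x b] by (simp add: fun_sum_apply fscale_apply) (simp add: tscale_def k_def)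
    also have "\<dots> = E u ?q (k v w b) + (\<Sum>i\<in>Basis. k v w i ?q * k u i b ?q)"
      using b by (simp add: sum.distrib inner_Basis if_distrib[of "\<lambda>z. _ * z"] cong: if_cong)
    also have "(\<Sum>i\<in>Basis. k v w i ?q * k u i b ?q) = C0 ?q u (C0 ?q v w) \<bullet> b"
    proof -
      have "C0 ?q u (C0 ?q v w) = (\<Sum>i\<in>Basis. (C0 ?q v w \<bullet> i) *\<^sub>R C0 ?q u i)" by (rule linear_basis_sum[OF l2])
      then show ?thesis using b by (simp add: inner_sum_left C0b)
    qed
    finally show ?thesis using dk[OF x b] by (simp add: inner_add_left)
  qed
  have br: "lie_bracket (E u) (E v) (chart_inv c x) = 0" if "x \<in> ball ?x0 \<rho>" for x u v
    by (rule eventually_nhds_x_imp_x[OF bracket_coordinate_fields[OF c im(2)[OF that] E(1) Ex[OF that]]])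
  have flat0: "frechet_derivative (\<lambda>y. C0 (chart_inv c y) v w) (at x) u + C0 (chart_inv c x) u (C0 (chart_inv c x) v w)
      = frechet_derivative (\<lambda>y. C0 (chart_inv c y) u w) (at x) v + C0 (chart_inv c x) v (C0 (chart_inv c x) u w)"
    if x: "x \<in> ball ?x0 \<rho>" for x u v w
  proof (rule euclidean_eqI)
    fix b :: 'f assume b: "b \<in> Basis"
    let ?q = "chart_inv c x"
    have "R (E u) (E v) (L w) ?q = 0" using fun_cong[OF R_zero[OF tg E(1)[of u] E(1)[of v] L[of w]], of ?q] by simp
    moreover have "D (lie_bracket (E u) (E v)) (L w) ?q = D 0 (L w) ?q"
      by (rule D_pointwise_left[OF vf_bracket[OF E(1) E(1)] vf_zero vL]) (simp add: br[OF x])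
    ultimately have "D (E u) (D (E v) (L w)) ?q = D (E v) (D (E u) (L w)) ?q"
      by (simp add: R_def D_zero_left vL)
    then show "(frechet_derivative (\<lambda>y. C0 (chart_inv c y) v w) (at x) u + C0 (chart_inv c x) u (C0 (chart_inv c x) v w)) \<bullet> b
      = (frechet_derivative (\<lambda>y. C0 (chart_inv c y) u w) (at x) v + C0 (chart_inv c x) v (C0 (chart_inv c x) u w)) \<bullet> b"
      using DDL[OF x b, of u v w] DDL[OF x b, of v u w] by simp
  qed
  have dC: "frechet_derivative (\<lambda>y. C y u a) (at x) v = - frechet_derivative (\<lambda>y. C0 (chart_inv c y) u a) (at x) v"
    if x: "x \<in> ball ?x0 \<rho>" for x u v a
    using fun_cong[OF frechet_derivative_at[OF has_derivative_minus[OF smooth_on_has_derivative[OF open_ball smC0[of u a] x]]], of v]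
    unfolding C_def by (rule sym)
  have linC1: "linear (\<lambda>v. C x v a)" and linC2: "linear (C x v)" for x v a
    unfolding C_def using linear_compose_neg[OF l1] linear_compose_neg[OF l2] by auto
  have smC: "smooth_on (ball ?x0 \<rho>) (\<lambda>x. C x v a)" for v a
    unfolding C_def by (rule smooth_on_minus[OF open_ball smC0])
  have flatC: "frechet_derivative (\<lambda>y. C y u a) (at x) v + C x u (C x v a) =
      frechet_derivative (\<lambda>y. C y v a) (at x) u + C x v (C x u a)"
    if x: "x \<in> ball ?x0 \<rho>" for x u v a
    using flat0[OF x, where u=u and v=v and w=a] unfolding dC[OF x]
    by (simp add: C_def linear_neg[OF l2] algebra_simps)
  obtain r where r: "0 < r" "r \<le> \<rho>"
    and sol: "\<And>a0. \<exists>a. a ?x0 = a0 \<and> (\<forall>x\<in>ball ?x0 r. (a has_derivative (\<lambda>v. C x v (a x))) (at x))"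
    by (rule flat_linear_system[of \<rho> ?x0 C, OF \<rho> linC1 linC2 smC flatC]) (auto intro: that)
  have rsub: "ball ?x0 r \<subseteq> ball ?x0 \<rho>" using r by auto
  from sol have "\<exists>a. \<forall>w. a w ?x0 = w \<and> (\<forall>x\<in>ball ?x0 r. (a w has_derivative (\<lambda>v. C x v (a w x))) (at x))"
    by (intro choice allI)
  then obtain a where a0: "\<And>w. a w ?x0 = w"
    and da: "\<And>w x. x \<in> ball ?x0 r \<Longrightarrow> (a w has_derivative (\<lambda>v. C x v (a w x))) (at x)" by blast
  have sma: "smooth_on (ball ?x0 r) (a w)" for w
  proof (rule smooth_on_bootstrap[OF open_ball da], assumption)
    fix k' v assume "Ck_on k' (ball ?x0 r) (a w)"
    then show "Ck_on k' (ball ?x0 r) (\<lambda>x. C x v (a w x))"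
      by (intro Ck_on_linear_family[OF open_ball linC2 Ck_on_subset[OF open_ball open_ball rsub smooth_on_Ck[OF smC]]])
  qed
  have px: "?x0 \<in> ball ?x0 r" using r by simp
  have "\<exists>\<alpha>. \<forall>w i. \<alpha> w i \<in> smooth_functions A \<and> (\<forall>\<^sub>F q in nhds p. \<alpha> w i q = a w (snd c q) \<bullet> i)"
  proof (intro choice allI)
    fix w i
    show "\<exists>f. f \<in> smooth_functions A \<and> (\<forall>\<^sub>F q in nhds p. f q = a w (snd c q) \<bullet> i)"
      by (rule lift_function[OF c p open_ball px smooth_on_inner[OF open_ball sma smooth_on_const[of _ i]]]) blast
  qed
  then obtain \<alpha> where \<alpha>: "\<And>w i. \<alpha> w i \<in> smooth_functions A"
    and \<alpha>ev: "\<And>w i. \<forall>\<^sub>F q in nhds p. \<alpha> w i q = a w (snd c q) \<bullet> i" by blast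
  define s0 where "s0 = (\<lambda>w. \<Sum>i\<in>Basis. fscale (\<alpha> w i) (L i))"
  have s0: "s0 w \<in> SH" for w unfolding s0_def by (intro SH_sum SH_fscale \<alpha> L)
  have s0p: "s0 w p = L w p" for w
  proof -
    have "\<alpha> w i p = w \<bullet> i" for i using eventually_nhds_x_imp_x[OF \<alpha>ev[of w i]] by (simp add: a0)
    then have "s0 w p = (\<Sum>i\<in>Basis. tscale (w \<bullet> i) (L i p))" by (simp add: s0_def fun_sum_apply fscale_apply)
    also have "\<dots> = L (\<Sum>i\<in>Basis. (w \<bullet> i) *\<^sub>R i) p" by (rule Lsum[symmetric])
    finally show ?thesis by (simp add: euclidean_representation)
  qed
  have par0: "\<forall>\<^sub>F q in nhds p. \<forall>X\<in>vector_fields A. D X (s0 w) q = 0" for w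
  proof -
    have "\<forall>\<^sub>F q in nhds p. \<forall>i\<in>Basis. \<alpha> w i q = a w (snd c q) \<bullet> i"
      by (intro eventually_ball_finite ballI finite_Basis \<alpha>ev)
    then have ev1: "\<forall>\<^sub>F q in nhds p. \<forall>\<^sub>F r in nhds q. \<forall>i\<in>Basis. \<alpha> w i r = a w (snd c r) \<bullet> i"
      by (simp only: eventually_eventually)
    have ev2: "\<forall>\<^sub>F q in nhds p. q \<in> fst c \<and> snd c q \<in> ball ?x0 r"
      by (rule eventually_chart[OF cc p eventually_in_open[OF open_ball px]])
    from ev1 ev2 show ?thesis
    proof eventually_elim
      case (elim q)
      let ?y = "snd c q"
      have x: "?y \<in> ball ?x0 \<rho>" "chart_inv c ?y = q" "?y \<in> ball ?x0 r"
        using elim(2) subsetD[OF rsub] ci(1) by blast+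
      note Eqq = Eq[OF x(1), unfolded x(2)]
      have E\<alpha>: "E u q (\<alpha> w i) = - C0 q u (a w ?y) \<bullet> i" if i: "i \<in> Basis" for u i
      proof -
        have "\<forall>\<^sub>F r in nhds q. \<alpha> w i r = a w (snd c r) \<bullet> i" using elim(1) by eventually_elim (use i in blast)
        then show ?thesis
          unfolding Eqq using elim(2) x(2)
          by (subst coord_vector_eval[OF c _ \<alpha> _ has_derivative_inner_left[OF da[OF x(3)]]]) (auto simp: C_def)
      qed
      have DE: "D (E u) (s0 w) q = 0" for u
      proof -
        have "D (E u) (s0 w) = (\<Sum>i\<in>Basis. fscale (\<lambda>q. E u q (\<alpha> w i)) (L i) + fscale (\<alpha> w i) (D (E u) (L i)))"
          unfolding s0_def by (subst D_sum_right) (auto simp: \<alpha> vL E D_scale_right)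
        then have "D (E u) (s0 w) q = (\<Sum>i\<in>Basis. tscale (E u q (\<alpha> w i)) (L i q) + tscale (\<alpha> w i q) (D (E u) (L i) q))"
          by (simp add: fun_sum_apply fscale_apply)
        also have "\<dots> = (\<Sum>i\<in>Basis. tscale (- C0 q u (a w ?y) \<bullet> i) (L i q)) + (\<Sum>i\<in>Basis. tscale (a w ?y \<bullet> i) (L (C0 q u i) q))"
          unfolding sum.distrib
        proof (intro arg_cong2[where f="(+)"] sum.cong refl)
          fix i :: 'f assume i: "i \<in> Basis"
          show "tscale (E u q (\<alpha> w i)) (L i q) = tscale (- C0 q u (a w ?y) \<bullet> i) (L i q)" by (simp add: E\<alpha>[OF i])
          have "\<alpha> w i q = a w ?y \<bullet> i" using eventually_nhds_x_imp_x[OF elim(1)] i by blast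
          moreover have "D (E u) (L i) q = L (C0 q u i) q"
            using eventually_nhds_x_imp_x[OF DL[OF x(1), of u i]] x(2) by (simp add: C0_def Lsum fun_sum_apply fscale_apply)
          ultimately show "tscale (\<alpha> w i q) (D (E u) (L i) q) = tscale (a w ?y \<bullet> i) (L (C0 q u i) q)" by simp
        qed
        also have "\<dots> = L (\<Sum>i\<in>Basis. (- C0 q u (a w ?y) \<bullet> i) *\<^sub>R i) q + L (\<Sum>i\<in>Basis. (a w ?y \<bullet> i) *\<^sub>R C0 q u i) q"
          unfolding Lsum ..
        also have "\<dots> = L (- C0 q u (a w ?y)) q + L (C0 q u (a w ?y)) q"
          unfolding linear_basis_sum[OF l2, of q u "a w ?y", symmetric] euclidean_representation ..
        also have "\<dots> = (L (- C0 q u (a w ?y)) + L (C0 q u (a w ?y))) q" by simp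
        also have "\<dots> = 0" unfolding Ll(1)[symmetric] by (simp add: L0)
        finally show ?thesis .
      qed
      show ?case
      proof
        fix X assume X: "X \<in> vector_fields A"
        obtain u where "X q = coord_vector A c q u"
          by (rule tangent_coord_ex[OF c conjunct1[OF elim(2)] vfD(1)[OF X]]) (rule that)
        then have "X q = E u q" using Eqq by simp
        then show "D X (s0 w) q = 0" using D_pointwise_left[where p=q, OF X E(1)[of u] SH_vf[OF s0[of w]]] DE by simp
      qed
    qed
  qed
  define s where "s = (\<lambda>w::'f. \<Sum>b\<in>Basis. fscale (\<lambda>_. w \<bullet> b) (s0 b))"
  show ?thesis
  proof (rule that[of s])
    show "s w \<in> SH" for w unfolding s_def by (intro SH_sum SH_fscale sf_const s0)
    show "s (u + w) = s u + s w" for u w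
      by (simp add: s_def fun_eq_iff fun_sum_apply fscale_apply tscale_def inner_left_distrib distrib_right sum.distrib)
    show "s (t *\<^sub>R w) = fscale (\<lambda>_. t) (s w)" for t w
      by (simp add: s_def fun_eq_iff fun_sum_apply fscale_apply tscale_def sum_distrib_left mult.assoc)
    show "w = 0" if "s w p = 0" for w
    proof -
      have "s w p = (\<Sum>b\<in>Basis. tscale (w \<bullet> b) (L b p))" by (simp add: s_def fun_sum_apply fscale_apply s0p)
      also have "\<dots> = L w p" using Lsum[of "\<lambda>b. w \<bullet> b" id Basis p] by (simp add: euclidean_representation)
      finally have "L w p = 0" using that by simp
      then have "w \<bullet> b = 0" if "b \<in> Basis" for b
        using eventually_nhds_x_imp_x[OF Lev] that by (metis zero_fun_apply)
      then show ?thesis using euclidean_all_zero_iff by blast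
    qed
    have "\<forall>\<^sub>F q in nhds p. \<forall>b\<in>Basis. \<forall>X\<in>vector_fields A. D X (s0 b) q = 0"
      by (intro eventually_ball_finite ballI par0 finite_Basis)
    then show "\<forall>\<^sub>F q in nhds p. \<forall>X\<in>vector_fields A. \<forall>w. D X (s w) q = 0"
    proof eventually_elim
      case (elim q)
      show ?case
      proof (intro ballI allI)
        fix X w assume X: "X \<in> vector_fields A"
        have "D X (s w) = (\<Sum>b\<in>Basis. fscale (\<lambda>q. X q (\<lambda>_. w \<bullet> b)) (s0 b) + fscale (\<lambda>_. w \<bullet> b) (D X (s0 b)))"
          unfolding s_def by (subst D_sum_right) (auto simp: X s0 D_scale_right)
        then show "D X (s w) q = 0"
          using elim X by (simp add: fun_sum_apply fscale_apply tangent_const[OF vfD(1)[OF X]])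
      qed
    qed
  qed
qed

end

end

section \<open>The product chart\<close>

lemma linear_inv_bij:
  assumes T: "linear T" "bij T"
  shows "linear (inv T)"
proof (rule linearI)
  show "inv T (u + v) = inv T u + inv T v" for u v
    by (rule inv_f_eq[OF bij_is_inj[OF T(2)]]) (simp add: linear_add[OF T(1)] surj_f_inv_f[OF bij_is_surj[OF T(2)]])
  show "inv T (a *\<^sub>R u) = a *\<^sub>R inv T u" for a u
    by (rule inv_f_eq[OF bij_is_inj[OF T(2)]]) (simp add: linear_cmul[OF T(1)] surj_f_inv_f[OF bij_is_surj[OF T(2)]])
qed

context lagrangian begin

lemma app_add: "X \<in> vector_fields A \<Longrightarrow> Y \<in> vector_fields A \<Longrightarrow> app J (X + Y) = app J X + app J Y"
  by (simp add: app_def J_add vfD(1) fun_eq_iff)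

lemma app_fscale: "X \<in> vector_fields A \<Longrightarrow> app J (fscale h X) = fscale h (app J X)"
  by (simp add: app_def fscale_def J_scale vfD(1))

context
  assumes tg: totally_geodesic
begin

text \<open>As \<open>J\<close> is parallel, it maps a parallel frame of the horizontal distribution to one of the vertical distribution. Scalar
  products of parallel fields are constant, which carries linear independence from \<open>p\<close> to the points nearby.\<close>

lemma product_frame:
  fixes p :: 'a
  obtains S :: "'f \<times> 'f \<Rightarrow> 'a vfield" where "\<And>\<zeta>. S \<zeta> \<in> vector_fields A"
    "\<And>\<zeta> \<zeta>'. S (\<zeta> + \<zeta>') = S \<zeta> + S \<zeta>'" "\<And>a \<zeta>. S (a *\<^sub>R \<zeta>) = fscale (\<lambda>_. a) (S \<zeta>)"
    "\<And>w q. S (w, 0) q \<in> Hor q" "\<And>z q. S (0, z) q \<in> Ver q"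
    "\<And>\<zeta>. S \<zeta> p = 0 \<Longrightarrow> \<zeta> = 0"
    "\<forall>\<^sub>F q in nhds p. \<forall>X\<in>vector_fields A. \<forall>\<zeta>. D X (S \<zeta>) q = 0"
    "\<forall>\<^sub>F q in nhds p. \<forall>\<zeta> \<zeta>'. g q (S \<zeta> q) (S \<zeta>' q) = g p (S \<zeta> p) (S \<zeta>' p)"
    "\<forall>\<^sub>F q in nhds p. (\<forall>h\<in>Hor q. \<exists>w. h = S (w, 0) q) \<and> (\<forall>v\<in>Ver q. \<exists>z. v = S (0, z) q)"
proof -
  obtain s :: "'f \<Rightarrow> 'a vfield" where s: "\<And>w. s w \<in> SH"
    and sl: "\<And>u w. s (u + w) = s u + s w" "\<And>a w. s (a *\<^sub>R w) = fscale (\<lambda>_. a) (s w)"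
    and si: "\<And>w. s w p = 0 \<Longrightarrow> w = 0" and par: "\<forall>\<^sub>F q in nhds p. \<forall>X\<in>vector_fields A. \<forall>w. D X (s w) q = 0"
    by (rule parallel_frame[OF tg, of p]) (rule that)
  have s0: "s 0 = 0" using sl(2)[of 0 0] by (simp add: fscale_def fun_eq_iff tscale_def)
  have vs: "s w \<in> vector_fields A" for w using s by simp
  define S where "S = (\<lambda>\<zeta>. s (fst \<zeta>) + app J (s (snd \<zeta>)))"
  have vS: "S \<zeta> \<in> vector_fields A" for \<zeta> using vs by (simp add: S_def)
  have Sl: "S (\<zeta> + \<zeta>') = S \<zeta> + S \<zeta>'" "S (a *\<^sub>R \<zeta>) = fscale (\<lambda>_. a) (S \<zeta>)" for \<zeta> \<zeta>' a
  proof -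
    show "S (\<zeta> + \<zeta>') = S \<zeta> + S \<zeta>'" by (simp add: S_def sl app_add vs algebra_simps)
    show "S (a *\<^sub>R \<zeta>) = fscale (\<lambda>_. a) (S \<zeta>)"
      unfolding S_def fst_scaleR snd_scaleR sl(2) app_fscale[OF vs] by (simp add: fscale_def fun_eq_iff tscale_def algebra_simps)
  qed
  have S1: "S (w, 0) = s w" and S2: "S (0, z) = app J (s z)" for w z by (simp_all add: S_def s0 app_zero)
  have SH1: "S (w, 0) q \<in> Hor q" for w q unfolding S1 by (rule SH_Hor[OF s])
  have SV2: "S (0, z) q \<in> Ver q" for z q unfolding S2 by (rule SV_Ver[OF J_SH[OF s]])
  have Si: "\<zeta> = 0" if "S \<zeta> p = 0" for \<zeta>
  proof -
    let ?h = "s (fst \<zeta>) p" and ?v = "app J (s (snd \<zeta>)) p"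
    have hv: "?h \<in> Hor p" "?v \<in> Ver p" by (rule SH_Hor[OF s]) (rule SV_Ver[OF J_SH[OF s]])
    have "?h + ?v = 0" using that by (simp add: S_def)
    then have "?h = - ?v" by (simp add: eq_neg_iff_add_eq_0)
    also have "- ?v \<in> Ver p" using Ver_scale[OF hv(2), of "- 1"] by (simp add: tscale_minus1)
    finally have h0: "?h = 0" using Ver_Hor_zero hv(1) by blast
    then have "?v = 0" using \<open>?h + ?v = 0\<close> by simp
    then have "J p (J p (s (snd \<zeta>) p)) = 0" by (simp add: app_apply)
    then have "s (snd \<zeta>) p = 0" using vfD(1)[OF vs[of "snd \<zeta>"], of p] by simp
    then show ?thesis using si h0 by (simp add: prod_eq_iff)
  qed
  have parS: "\<forall>\<^sub>F q in nhds p. \<forall>X\<in>vector_fields A. \<forall>\<zeta>. D X (S \<zeta>) q = 0"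
    using par
  proof eventually_elim
    case (elim q)
    show ?case
    proof (intro ballI allI)
      fix X and \<zeta> :: "'f \<times> 'f" assume X: "X \<in> vector_fields A"
      have "D X (app J (s (snd \<zeta>))) q = J q (D X (s (snd \<zeta>)) q)"
        using fun_cong[OF D_J[OF tg X, of "s (snd \<zeta>)"], of q] s by (simp add: app_apply)
      also have "\<dots> = 0"
      proof -
        have d: "D X (s (snd \<zeta>)) q = 0" using elim X by blast
        show ?thesis unfolding d by (rule J_zero)
      qed
      finally have 2: "D X (app J (s (snd \<zeta>))) q = 0" .
      have 1: "D X (s (fst \<zeta>)) q = 0" using elim X by blast
      have "D X (S \<zeta>) = D X (s (fst \<zeta>)) + D X (app J (s (snd \<zeta>)))"
        unfolding S_def by (rule D_add_right[OF X vs J_vf[OF vs]])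
      then show "D X (S \<zeta>) q = 0" by (simp only: plus_fun_def 1 2) (simp add: zero_fun_def)
    qed
  qed
  have Ssum: "S \<zeta> q = (\<Sum>i\<in>Basis. tscale (\<zeta> \<bullet> i) (S i q))" for \<zeta> q
    using frame_sum[of S "\<lambda>i. \<zeta> \<bullet> i" id Basis q, OF Sl] by (simp add: euclidean_representation)
  have const: "\<forall>\<^sub>F q in nhds p. \<forall>\<zeta> \<zeta>'. g q (S \<zeta> q) (S \<zeta>' q) = g p (S \<zeta> p) (S \<zeta>' p)"
  proof -
    have "\<forall>\<^sub>F q in nhds p. g q (S i q) (S j q) = g p (S i p) (S j p)" for i j
    proof (rule locally_constant[OF g_smooth[OF vS vS]])
      show "\<forall>\<^sub>F q in nhds p. \<forall>X\<in>vector_fields A. X q (\<lambda>q. g q (S i q) (S j q)) = 0"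
        using parS
      proof eventually_elim
        case (elim q)
        show ?case
        proof
          fix X assume X: "X \<in> vector_fields A"
          have z: "D X (S i) q = 0" "D X (S j) q = 0" using elim X by blast+
          show "X q (\<lambda>q. g q (S i q) (S j q)) = 0"
            unfolding D_metric[OF X vS vS] z g_zero[OF vfD(1)[OF vS]] g_zero_right[OF vfD(1)[OF vS]] by simp
        qed
      qed
    qed
    then have "\<forall>\<^sub>F q in nhds p. \<forall>i\<in>Basis. \<forall>j\<in>Basis. g q (S i q) (S j q) = g p (S i p) (S j p)"
      by (intro eventually_ball_finite ballI finite_Basis)
    then show ?thesis
    proof eventually_elim
      case (elim q)
      have ex: "g r (S \<zeta> r) (S \<zeta>' r) = (\<Sum>i\<in>Basis. \<Sum>j\<in>Basis. (\<zeta> \<bullet> i) * ((\<zeta>' \<bullet> j) * g r (S i r) (S j r)))" for r \<zeta> \<zeta>'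
      proof -
        have exp: "g r (S \<zeta> r) T = (\<Sum>i\<in>Basis. (\<zeta> \<bullet> i) * g r (S i r) T)" if T: "T \<in> tangent A r" for \<zeta> T
        proof -
          have "g r (S \<zeta> r) T = g r (\<Sum>i\<in>Basis. tscale (\<zeta> \<bullet> i) (S i r)) T" using arg_cong[OF Ssum] .
          also have "\<dots> = (\<Sum>i\<in>Basis. g r (tscale (\<zeta> \<bullet> i) (S i r)) T)"
            by (rule g_sum[OF tangent_tscale[OF vfD(1)[OF vS]] T])
          finally show ?thesis by (simp only: g_scale[OF vfD(1)[OF vS] T])
        qed
        have ih: "g r (S i r) (S \<zeta>' r) = (\<Sum>j\<in>Basis. (\<zeta>' \<bullet> j) * g r (S i r) (S j r))" for i
          unfolding g_sym[OF vfD(1)[OF vS] vfD(1)[OF vS], of r i] by (rule exp[OF vfD(1)[OF vS]])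
        have "g r (S \<zeta> r) (S \<zeta>' r) = (\<Sum>i\<in>Basis. (\<zeta> \<bullet> i) * g r (S i r) (S \<zeta>' r))"
          by (rule exp[OF vfD(1)[OF vS]])
        then show ?thesis by (simp only: ih sum_distrib_left)
      qed
      show ?case
      proof (intro allI)
        fix \<zeta> \<zeta>'
        have "g q (S \<zeta> q) (S \<zeta>' q) = (\<Sum>i\<in>Basis. \<Sum>j\<in>Basis. (\<zeta> \<bullet> i) * ((\<zeta>' \<bullet> j) * g q (S i q) (S j q)))" by (rule ex)
        also have "\<dots> = (\<Sum>i\<in>Basis. \<Sum>j\<in>Basis. (\<zeta> \<bullet> i) * ((\<zeta>' \<bullet> j) * g p (S i p) (S j p)))"
          using elim by (intro sum.cong refl) (simp only:)
        also have "\<dots> = g p (S \<zeta> p) (S \<zeta>' p)" by (rule ex[symmetric])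
        finally show "g q (S \<zeta> q) (S \<zeta>' q) = g p (S \<zeta> p) (S \<zeta>' p)" .
      qed
    qed
  qed
  have span: "\<forall>\<^sub>F q in nhds p. (\<forall>h\<in>Hor q. \<exists>w. h = S (w, 0) q) \<and> (\<forall>v\<in>Ver q. \<exists>z. v = S (0, z) q)"
  proof -
    obtain L :: "'f \<Rightarrow> 'a vfield" and \<zeta> :: "'f \<Rightarrow> 'a \<Rightarrow> real" where L: "\<And>w. L w \<in> SH"
      and Ll: "\<And>u w. L (u + w) = L u + L w" "\<And>a w. L (a *\<^sub>R w) = fscale (\<lambda>_. a) (L w)"
      and Lev: "\<forall>\<^sub>F q in nhds p. (\<forall>w. \<forall>b\<in>Basis. L w q (\<zeta> b) = w \<bullet> b) \<and>
        (\<forall>h\<in>Hor q. h = L (\<Sum>b\<in>Basis. h (\<zeta> b) *\<^sub>R b) q)"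
      by (rule horizontal_frame[of p]) (rule that)
    have L0: "L 0 q = 0" for q using frame_sum[of L "\<lambda>_. 0" id "{}" q, OF Ll] by simp
    from Lev const show ?thesis
    proof eventually_elim
      case (elim q)
      have Leq: "h = L (\<Sum>b\<in>Basis. h (\<zeta> b) *\<^sub>R b) q" if "h \<in> Hor q" for h using elim(1) that by blast
      \<comment> \<open>The horizontal space has the dimension of the base, so injectivity of \<open>\<phi>\<close> suffices.\<close>
      define \<phi> where "\<phi> = (\<lambda>w. (\<Sum>b\<in>Basis. s w q (\<zeta> b) *\<^sub>R b) :: 'f)"
      have lin: "linear \<phi>"
        by (auto intro!: linearI simp: \<phi>_def sl fscale_apply tscale_def scaleR_left_distrib sum.distrib scaleR_sum_right)
      have "inj \<phi>"
      proof (subst linear_injective_0[OF lin], intro allI impI)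
        fix w assume "\<phi> w = 0"
        then have "s w q = 0" using Leq[OF SH_Hor[OF s[of w]]] L0 by (simp add: \<phi>_def)
        then have "g p (S (w, 0) p) (S (w, 0) p) = 0"
          using elim(2)[rule_format, of "(w, 0)" "(w, 0)"] by (simp add: S1 g_zero)
        then have "S (w, 0) p = 0" by (rule g_definite[OF vfD(1)[OF vS]])
        then show "w = 0" using Si[of "(w, 0)"] by (simp add: zero_prod_def)
      qed
      then have surj: "surj \<phi>" using linear_injective_imp_surjective[OF lin] by blast
      have H: "\<exists>w. h = s w q" if h: "h \<in> Hor q" for h
      proof -
        obtain w where "(\<Sum>b\<in>Basis. h (\<zeta> b) *\<^sub>R b) = \<phi> w" using surj by (metis surjD)
        then show ?thesis using Leq[OF h] Leq[OF SH_Hor[OF s[of w]]] unfolding \<phi>_def by metis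
      qed
      have "\<exists>z. v = app J (s z) q" if v: "v \<in> Ver q" for v
      proof -
        obtain z where z: "J q (tscale (- 1) v) = s z q" using H[OF J_Ver[OF Ver_scale[OF v]]] by blast
        have "app J (s z) q = v" using v unfolding app_apply z[symmetric] by (simp add: tscale_minus1)
        then show ?thesis by blast
      qed
      then show ?case using H unfolding S1 S2 by blast
    qed
  qed
  show ?thesis by (rule that[of S, OF vS Sl SH1 SV2 Si parS const span])
qed

text \<open>Let \<open>S\<close> be the parallel frame, indexed by \<open>\<zeta>\<close>. The forms \<open>g(S\<^sub>i, _)\<close> are closed, since
  \<open>d(g(S, _))(u, v) = g(S, \<nabla>\<^sub>u E\<^sub>v - \<nabla>\<^sub>v E\<^sub>u) = 0\<close>. A primitive \<open>F\<close> of all of them satisfies \<open>dF(S \<zeta>) = N \<zeta>\<close> with the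
  constant Gram matrix \<open>N\<close>. Composed with a linear map \<open>\<kappa>\<close> it becomes a chart in which \<open>S \<zeta>\<close> is the constant coordinate
  vector \<open>\<Phi> \<zeta>\<close>. The inverse of the chart has the smooth derivative \<open>w \<mapsto> S(\<Phi>\<^sup>-\<^sup>1 w)\<close>, hence is smooth.\<close>

lemma totally_geodesic_imp_locally_product: "locally_product A g Hor Ver"
  unfolding locally_product_def
proof
  fix p :: 'a
  obtain c where cA: "c \<in> A" and p: "p \<in> fst c" using chart_at .
  note c = admissible_in[OF cA]
  note cc = admissible_is_chart[OF c]
  note ci = is_chart_inv[OF cc]
  obtain E where E: "\<And>w. E w \<in> vector_fields A" "\<forall>\<^sub>F q in nhds p. \<forall>w. E w q = coord_vector A c q w"
    and El: "\<And>u w. E (u + w) = E u + E w" "\<And>a w. E (a *\<^sub>R w) = fscale (\<lambda>_. a) (E w)"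
    by (rule coordinate_fields[OF c p]) (rule that)
  obtain \<xi> where \<xi>: "\<And>w. \<xi> w \<in> smooth_functions A" "\<And>w. \<forall>\<^sub>F q in nhds p. \<xi> w q = snd c q \<bullet> w"
    by (rule coordinate_functions[OF c p]) (rule that)
  obtain S :: "'f \<times> 'f \<Rightarrow> 'a vfield" where S: "\<And>\<zeta>. S \<zeta> \<in> vector_fields A"
    and Sl: "\<And>\<zeta> \<zeta>'. S (\<zeta> + \<zeta>') = S \<zeta> + S \<zeta>'" "\<And>a \<zeta>. S (a *\<^sub>R \<zeta>) = fscale (\<lambda>_. a) (S \<zeta>)"
    and S1: "\<And>w q. S (w, 0) q \<in> Hor q" and S2: "\<And>z q. S (0, z) q \<in> Ver q"
    and Si: "\<And>\<zeta>. S \<zeta> p = 0 \<Longrightarrow> \<zeta> = 0"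
    and par: "\<forall>\<^sub>F q in nhds p. \<forall>X\<in>vector_fields A. \<forall>\<zeta>. D X (S \<zeta>) q = 0"
    and const: "\<forall>\<^sub>F q in nhds p. \<forall>\<zeta> \<zeta>'. g q (S \<zeta> q) (S \<zeta>' q) = g p (S \<zeta> p) (S \<zeta>' p)"
    and span: "\<forall>\<^sub>F q in nhds p. (\<forall>h\<in>Hor q. \<exists>w. h = S (w, 0) q) \<and> (\<forall>v\<in>Ver q. \<exists>z. v = S (0, z) q)"
    by (rule product_frame[of p]) (rule that)
  note St = vfD(1)[OF S] and Et = vfD(1)[OF E(1)]
  have evE: "\<forall>\<^sub>F q in nhds p. \<forall>\<^sub>F r in nhds q. \<forall>w. E w r = coord_vector A c r w"
    using E(2) by (simp only: eventually_eventually)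
  have ev\<xi>: "\<forall>\<^sub>F q in nhds p. \<forall>b\<in>Basis. \<forall>\<^sub>F r in nhds q. \<xi> b r = snd c r \<bullet> b"
    using \<xi>(2) by (intro eventually_ball_finite ballI finite_Basis) (simp only: eventually_eventually)
  define P where "P = (\<lambda>q. q \<in> fst c \<and> (\<forall>\<^sub>F r in nhds q. \<forall>w. E w r = coord_vector A c r w) \<and>
    (\<forall>b\<in>Basis. \<forall>\<^sub>F r in nhds q. \<xi> b r = snd c r \<bullet> b) \<and> (\<forall>X\<in>vector_fields A. \<forall>\<zeta>. D X (S \<zeta>) q = 0) \<and>
    (\<forall>\<zeta> \<zeta>'. g q (S \<zeta> q) (S \<zeta>' q) = g p (S \<zeta> p) (S \<zeta>' p)) \<and>
    (\<forall>h\<in>Hor q. \<exists>w. h = S (w, 0) q) \<and> (\<forall>v\<in>Ver q. \<exists>z. v = S (0, z) q))"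
  have "\<forall>\<^sub>F q in nhds p. P q"
    using eventually_in_chart[OF cc p] evE ev\<xi> par const span unfolding P_def by eventually_elim (intro conjI; blast)
  from eventually_nhds_metric[THEN iffD1, OF eventually_chart_inv[OF cc p this]]
  obtain \<rho> where \<rho>: "\<rho> > 0" "\<forall>x. dist x (snd c p) < \<rho> \<longrightarrow> x \<in> snd c ` fst c \<and> P (chart_inv c x)"
    by (elim exE conjE) (rule that)
  define x0 where "x0 = snd c p"
  define B where "B = ball x0 \<rho>"
  have B: "convex B" "open B" "x0 \<in> B" using \<rho>(1) by (auto simp: B_def)
  have BP: "x \<in> snd c ` fst c" "P (chart_inv c x)" "snd c (chart_inv c x) = x" if "x \<in> B" for x
    using \<rho>(2)[rule_format, of x] that ci(2)[of x] by (auto simp: B_def x0_def dist_commute)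
  have q0: "chart_inv c x0 = p" using ci(1)[OF p] by (simp add: x0_def)
  have Bim: "B \<subseteq> snd c ` fst c" using BP(1) by blast
  have Pin: "chart_inv c x \<in> fst c" and PE: "\<forall>\<^sub>F r in nhds (chart_inv c x). \<forall>w. E w r = coord_vector A c r w"
    and P\<xi>: "\<And>b. b \<in> Basis \<Longrightarrow> \<forall>\<^sub>F r in nhds (chart_inv c x). \<xi> b r = snd c r \<bullet> b"
    and Ppar: "\<And>X \<zeta>. X \<in> vector_fields A \<Longrightarrow> D X (S \<zeta>) (chart_inv c x) = 0"
    and Pc: "\<And>\<zeta> \<zeta>'. g (chart_inv c x) (S \<zeta> (chart_inv c x)) (S \<zeta>' (chart_inv c x)) = g p (S \<zeta> p) (S \<zeta>' p)"
    and Ph: "\<And>h. h \<in> Hor (chart_inv c x) \<Longrightarrow> \<exists>w. h = S (w, 0) (chart_inv c x)"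
    and Pv: "\<And>v. v \<in> Ver (chart_inv c x) \<Longrightarrow> \<exists>z. v = S (0, z) (chart_inv c x)" if "x \<in> B" for x
    using BP(2)[OF that] unfolding P_def by blast+
  have PEq: "E w (chart_inv c x) = coord_vector A c (chart_inv c x) w" if "x \<in> B" for x w
    using eventually_nhds_x_imp_x[OF PE[OF that]] by blast
  have smf: "smooth_on B (\<lambda>x. f (chart_inv c x))" if "f \<in> smooth_functions A" for f
    by (rule smooth_on_subset[OF _ B(2) Bim smooth_function_chart[OF that c]]) (use cc in \<open>simp add: is_chart_def\<close>)
  define e where "e = (\<lambda>x \<zeta>. (\<Sum>b\<in>Basis. S \<zeta> (chart_inv c x) (\<xi> b) *\<^sub>R b) :: 'e)"
  have line: "linear (e x)" for x
    by (rule linearI) (simp_all add: e_def Sl fscale_apply tscale_def scaleR_left_distrib sum.distrib scaleR_sum_right)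
  have sme: "smooth_on B (\<lambda>x. e x \<zeta>)" for \<zeta>
    unfolding e_def by (intro smooth_on_sum smooth_on_scaleR smooth_on_const B(2) smf vfD(2)[OF S] \<xi>)
  have Se: "S \<zeta> (chart_inv c x) = coord_vector A c (chart_inv c x) (e x \<zeta>)" if x: "x \<in> B" for x \<zeta>
    unfolding e_def by (rule tangent_coord[OF c Pin[OF x] St \<xi>(1) P\<xi>[OF x]])
  have bije: "bij (e x)" if x: "x \<in> B" for x
  proof (rule bijI)
    let ?q = "chart_inv c x"
    show "inj (e x)"
    proof (subst linear_injective_0[OF line], intro allI impI)
      fix \<zeta> assume "e x \<zeta> = 0"
      then have "S \<zeta> ?q = 0" using Se[OF x] coord_vector_linear(3)[OF c Pin[OF x]] by simp
      then have "g p (S \<zeta> p) (S \<zeta> p) = 0" using Pc[OF x, of \<zeta> \<zeta>] by (simp add: g_zero)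
      then show "\<zeta> = 0" by (intro Si g_definite[OF St])
    qed
    show "surj (e x)"
    proof (rule surjI[of _ "\<lambda>u. SOME \<zeta>. e x \<zeta> = u"], rule someI_ex)
      fix u
      have u: "coord_vector A c ?q u \<in> tangent A ?q" by (rule coord_vector_tangent[OF c Pin[OF x]])
      obtain v where v: "v \<in> Ver ?q" "coord_vector A c ?q u - v \<in> Hor ?q" by (rule decomposition[OF u]) (rule that)
      obtain w z where "v = S (0, z) ?q" "coord_vector A c ?q u - v = S (w, 0) ?q" using Ph[OF x v(2)] Pv[OF x v(1)] by blast
      then have "coord_vector A c ?q u = S (w, 0) ?q + S (0, z) ?q" by (simp add: algebra_simps)
      also have "\<dots> = (S (w, 0) + S (0, z)) ?q" by simp
      also have "S (w, 0) + S (0, z) = S (w, z)" by (simp add: Sl(1)[symmetric])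
      finally have "coord_vector A c ?q u = coord_vector A c ?q (e x (w, z))" using Se[OF x] by simp
      then have "e x (w, z) = u" using coord_vector_inj[OF c Pin[OF x]] by metis
      then show "\<exists>\<zeta>. e x \<zeta> = u" by blast
    qed
  qed
  \<comment> \<open>The metric duals of the frame, whose closedness makes the Poincare lemma apply.\<close>
  define hh where "hh = (\<lambda>i v q. g q (S i q) (E v q))"
  have hh: "hh i v \<in> smooth_functions A" for i v unfolding hh_def by (rule g_smooth[OF S E(1)])
  define \<eta> where "\<eta> = (\<lambda>x v. (\<Sum>i\<in>Basis. hh i v (chart_inv c x) *\<^sub>R i) :: 'f \<times> 'f)"
  have hhl: "hh i (u + v) q = hh i u q + hh i v q" "hh i (a *\<^sub>R v) q = a * hh i v q" for i u v a q
    by (simp_all add: hh_def El fscale_apply g_add_right g_scale_right St Et)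
  have lin\<eta>: "linear (\<eta> x)" for x
    by (auto intro!: linearI simp: \<eta>_def hhl scaleR_left_distrib sum.distrib scaleR_sum_right)
  have sm\<eta>: "smooth_on B (\<lambda>x. \<eta> x v)" for v
    unfolding \<eta>_def by (intro smooth_on_sum smooth_on_scaleR smooth_on_const B(2) smf hh)
  have closed: "frechet_derivative (\<lambda>z. \<eta> z u) (at x) v = frechet_derivative (\<lambda>z. \<eta> z v) (at x) u" if x: "x \<in> B" for x u v
  proof (rule euclidean_eqI)
    fix i :: "'f \<times> 'f" assume i: "i \<in> Basis"
    let ?q = "chart_inv c x"
    have 1: "frechet_derivative (\<lambda>z. \<eta> z u) (at x) v \<bullet> i = g ?q (S i ?q) (D (E v) (E u) ?q)" for u v
    proof -
      have a: "((hh i u \<circ> chart_inv c) has_derivative (\<lambda>v. coord_vector A c ?q v (hh i u))) (at x)"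
        using chart_function_derivative[OF c Pin[OF x] hh, of i u] BP(3)[OF x] by simp
      have "((\<lambda>y. \<eta> y u \<bullet> i) has_derivative (\<lambda>v. frechet_derivative (\<lambda>z. \<eta> z u) (at x) v \<bullet> i)) (at x)"
        by (intro has_derivative_inner_left smooth_on_has_derivative[OF B(2) sm\<eta> x])
      then have b: "((hh i u \<circ> chart_inv c) has_derivative (\<lambda>v. frechet_derivative (\<lambda>z. \<eta> z u) (at x) v \<bullet> i)) (at x)"
        using i by (simp add: \<eta>_def comp_def)
      have "frechet_derivative (\<lambda>z. \<eta> z u) (at x) v \<bullet> i = E v ?q (hh i u)"
        using fun_cong[OF has_derivative_unique[OF b a], of v] PEq[OF x] by simp
      also have "\<dots> = g ?q (D (E v) (S i) ?q) (E u ?q) + g ?q (S i ?q) (D (E v) (E u) ?q)"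
        unfolding hh_def by (rule D_metric[OF E(1) S E(1)])
      finally show ?thesis using Ppar[OF x E(1)] g_zero[OF Et] by simp
    qed
    have "lie_bracket (E u) (E v) ?q = 0"
      by (rule eventually_nhds_x_imp_x[OF bracket_coordinate_fields[OF c Pin[OF x] E(1) PE[OF x]]])
    then have "D (E u) (E v) ?q = D (E v) (E u) ?q" using bracket_D[OF E(1) E(1), of u v ?q] by simp
    then show "frechet_derivative (\<lambda>z. \<eta> z u) (at x) v \<bullet> i = frechet_derivative (\<lambda>z. \<eta> z v) (at x) u \<bullet> i"
      unfolding 1 by simp
  qed
  obtain F where F: "\<And>x. x \<in> B \<Longrightarrow> (F has_derivative \<eta> x) (at x)"
    by (rule poincare_lemma[OF B lin\<eta> smooth_on_Ck[OF sm\<eta>] closed]) (auto intro: that)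
  define N where "N = (\<lambda>\<zeta>. (\<Sum>i\<in>Basis. g p (S i p) (S \<zeta> p) *\<^sub>R i) :: 'f \<times> 'f)"
  have linN: "linear N"
    by (rule linearI) (simp_all add: N_def Sl fscale_apply g_add_right g_scale_right St scaleR_left_distrib sum.distrib scaleR_sum_right)
  have \<eta>e: "\<eta> x (e x \<zeta>) = N \<zeta>" if x: "x \<in> B" for x \<zeta>
    unfolding \<eta>_def N_def hh_def PEq[OF x] Se[OF x, symmetric] Pc[OF x] ..
  have Ssum: "S \<zeta> q = (\<Sum>i\<in>Basis. tscale (\<zeta> \<bullet> i) (S i q))" for \<zeta> q
    using frame_sum[of S "\<lambda>i. \<zeta> \<bullet> i" id Basis q, OF Sl] by (simp add: euclidean_representation)
  have "inj N"
  proof (subst linear_injective_0[OF linN], intro allI impI)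
    fix \<zeta> assume N0: "N \<zeta> = 0"
    have "g p (S i p) (S \<zeta> p) = 0" if "i \<in> Basis" for i
      using arg_cong[OF N0, of "\<lambda>z. z \<bullet> i"] that by (simp add: N_def)
    then have "g p (S \<zeta> p) (S \<zeta> p) = 0"
      by (subst (1) Ssum[of \<zeta>], subst g_sum) (auto simp: St g_scale)
    then show "\<zeta> = 0" by (intro Si g_definite[OF St])
  qed
  then have bijN: "bij N" using linear_injective_imp_surjective[OF linN] by (simp add: bij_def)
  define \<Phi> where "\<Phi> = e x0"
  have lin\<Phi>: "linear \<Phi>" and bij\<Phi>: "bij \<Phi>" using line bije[OF B(3)] by (simp_all add: \<Phi>_def)
  \<comment> \<open>With this choice the derivative of the new chart at \<open>x0\<close> is the identity.\<close>
  define \<kappa> where "\<kappa> = \<Phi> \<circ> inv N"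
  have lini: "linear (inv N)" "linear (inv \<Phi>)"
    by (rule linear_inv_bij[OF linN bijN], rule linear_inv_bij[OF lin\<Phi> bij\<Phi>])
  have lin\<kappa>: "linear \<kappa>" unfolding \<kappa>_def by (rule linear_compose[OF lini(1) lin\<Phi>])
  have bl\<kappa>: "bounded_linear \<kappa>" using lin\<kappa> linear_conv_bounded_linear by blast
  define H where "H = (\<lambda>x. \<kappa> (F x))"
  define M where "M = (\<lambda>x v. \<kappa> (\<eta> x v))"
  have Me: "M x (e x \<zeta>) = \<Phi> \<zeta>" if "x \<in> B" for x \<zeta>
    unfolding M_def \<kappa>_def \<eta>e[OF that] comp_def using bijN by (simp add: bij_is_inj)
  have dH: "(H has_derivative M x) (at x)" if "x \<in> B" for x
    unfolding H_def M_def by (rule bounded_linear.has_derivative[OF bl\<kappa> F[OF that]])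
  have linM: "linear (M x)" for x unfolding M_def using linear_compose[OF lin\<eta> lin\<kappa>] by (simp add: comp_def)
  have smM: "smooth_on B (\<lambda>x. M x v)" for v unfolding M_def by (rule smooth_on_bounded_linear[OF B(2) bl\<kappa> sm\<eta>])
  have smH: "smooth_on B H"
    by (rule smooth_on_bootstrap[OF B(2) dH]) (auto intro: smooth_on_Ck[OF smM])
  define H' where "H' = (\<lambda>x. Blinfun (M x))"
  have H': "blinfun_apply (H' x) = M x" for x
    unfolding H'_def by (rule bounded_linear_Blinfun_apply) (use linM linear_conv_bounded_linear in blast)
  have id: "id_blinfun o\<^sub>L H' x0 = id_blinfun"
  proof (rule blinfun_eqI)
    fix u
    obtain \<zeta> where "u = e x0 \<zeta>" using bije[OF B(3)] by (metis bij_is_surj surjD)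
    then show "blinfun_apply (id_blinfun o\<^sub>L H' x0) u = blinfun_apply id_blinfun u"
      using Me[OF B(3), of \<zeta>] by (simp add: H' \<Phi>_def)
  qed
  have contH': "continuous_on B H'"
    by (rule continuous_on_blinfun_componentwise) (simp add: H' smooth_on_continuous[OF smM])
  obtain U V G G' where U: "open U" "U \<subseteq> B" "x0 \<in> U" and V: "open V" "H x0 \<in> V" and hom: "homeomorphism U V H G"
    and dG0: "\<And>y. y \<in> V \<Longrightarrow> (G has_derivative (G' y)) (at y)"
    and G'0: "\<And>y. y \<in> V \<Longrightarrow> G' y = inv (blinfun_apply (H' (G y)))"
    and bij': "\<And>y. y \<in> V \<Longrightarrow> bij (blinfun_apply (H' (G y)))"
    by (rule inverse_function_theorem[OF B(2) _ contH' B(3) id, of H]) (use dH H' in \<open>auto intro: that\<close>)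
  have GU: "G y \<in> U" "H (G y) = y" if "y \<in> V" for y using hom that by (auto simp: homeomorphism_def)
  have HV: "H x \<in> V" "G (H x) = x" if "x \<in> U" for x using hom that by (auto simp: homeomorphism_def)
  have dG: "(G has_derivative (\<lambda>w. e (G y) (inv \<Phi> w))) (at y)" if y: "y \<in> V" for y
  proof -
    have "G' y w = e (G y) (inv \<Phi> w)" for w
      unfolding G'0[OF y]
    proof (rule inv_f_eq)
      show "inj (blinfun_apply (H' (G y)))" using bij'[OF y] by (rule bij_is_inj)
      show "blinfun_apply (H' (G y)) (e (G y) (inv \<Phi> w)) = w"
        using Me[of "G y" "inv \<Phi> w"] GU(1)[OF y] U(2) bij\<Phi> by (auto simp: H' bij_is_surj surj_f_inv_f)
    qed
    then have "G' y = (\<lambda>w. e (G y) (inv \<Phi> w))" by (rule ext)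
    then show ?thesis using dG0[OF y] by simp
  qed
  have smG: "smooth_on V G"
  proof (rule smooth_on_bootstrap[OF V(1) dG], assumption)
    fix k w assume k: "Ck_on k V G"
    show "Ck_on k V (\<lambda>y. e (G y) (inv \<Phi> w))"
      by (rule Ck_on_compose[OF V(1) B(2) _ smooth_on_Ck[OF sme] k]) (use GU(1) U(2) in auto)
  qed
  \<comment> \<open>The image of a chart of a local product has to be a product set, so the chart is shrunk to a neighbourhood of this form.\<close>
  have cont\<Phi>: "continuous_on UNIV \<Phi>" "continuous_on UNIV (inv \<Phi>)"
    using lin\<Phi> lini(2) by (auto intro!: linear_continuous_on simp: linear_conv_bounded_linear[symmetric])
  have i\<Phi>: "inv \<Phi> (\<Phi> \<zeta>) = \<zeta>" "\<Phi> (inv \<Phi> u) = u" for \<zeta> u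
    using bij\<Phi> by (auto simp: bij_is_inj bij_is_surj surj_f_inv_f)
  have "open (\<Phi> -` V)" using cont\<Phi>(1) V(1) open_vimage by blast
  moreover have "inv \<Phi> (H x0) \<in> \<Phi> -` V" using V(2) i\<Phi> by simp
  ultimately obtain A1 A2 where A12: "open A1" "open A2" "inv \<Phi> (H x0) \<in> A1 \<times> A2" "A1 \<times> A2 \<subseteq> \<Phi> -` V"
    by (rule open_prod_elim)
  define Q where "Q = \<Phi> ` (A1 \<times> A2)"
  have QV: "Q \<subseteq> V" using A12(4) by (auto simp: Q_def)
  have "Q = inv \<Phi> -` (A1 \<times> A2)"
  proof
    show "Q \<subseteq> inv \<Phi> -` (A1 \<times> A2)" by (auto simp: Q_def i\<Phi>)
    show "inv \<Phi> -` (A1 \<times> A2) \<subseteq> Q"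
    proof
      fix y assume "y \<in> inv \<Phi> -` (A1 \<times> A2)"
      then have "inv \<Phi> y \<in> A1 \<times> A2" by (simp only: vimage_eq)
      then have "\<Phi> (inv \<Phi> y) \<in> Q" unfolding Q_def by (rule imageI)
      then show "y \<in> Q" by (simp add: i\<Phi>)
    qed
  qed
  then have oQ: "open Q" using cont\<Phi>(2) open_Times[OF A12(1,2)] open_vimage by metis
  define U2 where "U2 = U \<inter> H -` Q"
  have oU2: "open U2" unfolding U2_def
    by (rule continuous_open_preimage[OF continuous_on_subset[OF smooth_on_continuous[OF smH] U(2)] U(1) oQ])
  have U2B: "U2 \<subseteq> B" using U(2) by (auto simp: U2_def)
  have hom2: "homeomorphism U2 Q H G"
  proof (rule homeomorphism_of_subsets[OF hom])
    show "U2 \<subseteq> U" by (auto simp: U2_def)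
    show "Q \<subseteq> V" by (rule QV)
    show "H ` U2 = Q" using GU QV by (force simp: U2_def)
  qed
  note rep = admissible_reparametrization[OF c oU2 subset_trans[OF U2B Bim] oQ hom2
      smooth_on_subset[OF B(2) oU2 U2B smH] smooth_on_subset[OF V(1) oQ QV smG]]
  define c' where "c' = (fst c \<inter> snd c -` U2, H \<circ> snd c)"
  note rep = rep[folded c'_def]
  have x0U2: "x0 \<in> U2"
  proof -
    have "\<Phi> (inv \<Phi> (H x0)) \<in> Q" unfolding Q_def using A12(3) by (rule imageI)
    then show ?thesis using U(3) by (simp add: U2_def i\<Phi>)
  qed
  have pc': "p \<in> fst c'" using p x0U2 by (simp add: c'_def x0_def)
  have cv: "coord_vector A c' q w = S (inv \<Phi> w) q" if q: "q \<in> fst c'" for q w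
  proof -
    have q': "q \<in> fst c \<inter> snd c -` U2" "snd c q \<in> U" "snd c q \<in> B" "chart_inv c (snd c q) = q"
      using q U2B ci(1) by (auto simp: c'_def U2_def)
    have "coord_vector A c' q w = coord_vector A c q (e (G (H (snd c q))) (inv \<Phi> w))"
      unfolding c'_def
      by (rule coord_vector_reparametrization[OF c oU2 subset_trans[OF U2B Bim] oQ hom2 dG[OF HV(1)[OF q'(2)]] q'(1)])
    also have "\<dots> = S (inv \<Phi> w) q" using Se[OF q'(3), of "inv \<Phi> w"] HV(2)[OF q'(2)] q'(4) by simp
    finally show ?thesis .
  qed
  have Pq: "snd c q \<in> B" "chart_inv c (snd c q) = q" if "q \<in> fst c'" for q
    using that U2B ci(1) by (auto simp: c'_def U2_def)
  define W1 where "W1 = range (\<lambda>w. \<Phi> (w, 0))"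
  define W2 where "W2 = range (\<lambda>z. \<Phi> (0, z))"
  define S1' where "S1' = (\<lambda>w. \<Phi> (w, 0)) ` A1"
  define S2' where "S2' = (\<lambda>z. \<Phi> (0, z)) ` A2"
  define h where "h = (\<lambda>(a::'e) u v. g p (S (inv \<Phi> u) p) (S (inv \<Phi> v) p))"
  have split: "\<Phi> (w, z) = \<Phi> (w, 0) + \<Phi> (0, z)" for w z using linear_add[OF lin\<Phi>, of "(w, 0)" "(0, z)"] by simp
  have l12: "linear (\<lambda>w. \<Phi> (w, 0))" "linear (\<lambda>z. \<Phi> (0, z))"
  proof -
    have "linear (\<lambda>w::'f. (w, 0::'f))" "linear (\<lambda>z::'f. (0::'f, z))" by (auto intro!: linearI)
    then show "linear (\<lambda>w. \<Phi> (w, 0))" "linear (\<lambda>z. \<Phi> (0, z))"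
      using linear_compose[OF _ lin\<Phi>] by (auto simp: comp_def)
  qed
  have "subspace W1" "subspace W2"
    unfolding W1_def W2_def by (rule linear_subspace_image[OF l12(1) subspace_UNIV]) (rule linear_subspace_image[OF l12(2) subspace_UNIV])
  moreover have "W1 \<inter> W2 = {0}"
  proof
    show "W1 \<inter> W2 \<subseteq> {0}"
    proof
      fix u assume "u \<in> W1 \<inter> W2"
      then have "u \<in> range (\<lambda>w. \<Phi> (w, 0))" "u \<in> range (\<lambda>z. \<Phi> (0, z))" by (simp_all add: W1_def W2_def)
      then obtain w z where "u = \<Phi> (w, 0)" "u = \<Phi> (0, z)" by (elim rangeE)
      then have "(w, 0) = (0, z)" using bij\<Phi> by (metis bij_is_inj injD)
      then show "u \<in> {0}" using \<open>u = \<Phi> (w, 0)\<close> linear_0[OF lin\<Phi>] by (simp add: zero_prod_def)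
    qed
    show "{0} \<subseteq> W1 \<inter> W2" using \<open>subspace W1\<close> \<open>subspace W2\<close> subspace_0 by blast
  qed
  moreover have "{a + b | a b. a \<in> W1 \<and> b \<in> W2} = UNIV"
  proof -
    have "u \<in> {a + b | a b. a \<in> W1 \<and> b \<in> W2}" for u
    proof -
      obtain w z where "inv \<Phi> u = (w, z)" by (cases "inv \<Phi> u")
      then have "u = \<Phi> (w, 0) + \<Phi> (0, z)" using split[of w z] i\<Phi>(2)[of u] by simp
      moreover have "\<Phi> (w, 0) \<in> W1" "\<Phi> (0, z) \<in> W2" by (simp_all add: W1_def W2_def)
      ultimately show ?thesis by blast
    qed
    then show ?thesis by blast
  qed
  moreover have "S1' \<subseteq> W1" "S2' \<subseteq> W2" by (auto simp: S1'_def S2'_def W1_def W2_def)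
  moreover have im': "snd c' ` fst c' = {a + b | a b. a \<in> S1' \<and> b \<in> S2'}"
    unfolding rep(2)
  proof (intro set_eqI iffI)
    fix y assume "y \<in> Q"
    then obtain w z where "w \<in> A1" "z \<in> A2" "y = \<Phi> (w, z)" unfolding Q_def by (elim imageE SigmaE) simp
    moreover from this have "\<Phi> (w, 0) \<in> S1'" "\<Phi> (0, z) \<in> S2'" by (simp_all add: S1'_def S2'_def)
    ultimately show "y \<in> {a + b | a b. a \<in> S1' \<and> b \<in> S2'}" using split[of w z] by blast
  next
    fix y assume "y \<in> {a + b | a b. a \<in> S1' \<and> b \<in> S2'}"
    then obtain a b where ab: "y = a + b" "a \<in> S1'" "b \<in> S2'" by blast
    obtain w where w: "w \<in> A1" "a = \<Phi> (w, 0)" using ab(2) unfolding S1'_def by (elim imageE)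
    obtain z where z: "z \<in> A2" "b = \<Phi> (0, z)" using ab(3) unfolding S2'_def by (elim imageE)
    have "y = \<Phi> (w, z)" unfolding ab(1) w(2) z(2) split[symmetric] ..
    then show "y \<in> Q" unfolding Q_def using w(1) z(1) by simp
  qed
  moreover have "coord_vector A c' q ` W1 = Hor q \<and> coord_vector A c' q ` W2 = Ver q" if q: "q \<in> fst c'" for q
  proof -
    have "coord_vector A c' q ` W1 = range (\<lambda>w. S (w, 0) q)" "coord_vector A c' q ` W2 = range (\<lambda>z. S (0, z) q)"
      unfolding W1_def W2_def image_image cv[OF q] i\<Phi> by (rule refl)+
    moreover have "range (\<lambda>w. S (w, 0) q) = Hor q" 
    proof (intro equalityI subsetI)
      fix u assume "u \<in> Hor q"
      then have "\<exists>w. u = S (w, 0) q" using Ph[OF Pq(1)[OF q]] unfolding Pq(2)[OF q] by blast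
      then show "u \<in> range (\<lambda>w. S (w, 0) q)" by blast
    qed (use S1 in blast)
    moreover have "range (\<lambda>z. S (0, z) q) = Ver q" 
    proof (intro equalityI subsetI)
      fix u assume "u \<in> Ver q"
      then have "\<exists>z. u = S (0, z) q" using Pv[OF Pq(1)[OF q]] unfolding Pq(2)[OF q] by blast
      then show "u \<in> range (\<lambda>z. S (0, z) q)" by blast
    qed (use S2 in blast)
    ultimately show ?thesis by simp
  qed
  moreover have "let q = chart_inv c' (a + b)
           in g q (coord_vector A c' q (u1 + u2)) (coord_vector A c' q (v1 + v2)) = h a u1 v1 + h b u2 v2"
    if ab: "a \<in> S1'" "b \<in> S2'" and u: "u1 \<in> W1" "u2 \<in> W2" and v: "v1 \<in> W1" "v2 \<in> W2" for a b u1 u2 v1 v2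
  proof -
    let ?q = "chart_inv c' (a + b)"
    have "a + b \<in> snd c' ` fst c'" unfolding im' using ab by blast
    then have q: "?q \<in> fst c'" using is_chart_inv(3)[OF admissible_is_chart[OF rep(1)]] by blast
    obtain w z where wz: "u1 = \<Phi> (w, 0)" "u2 = \<Phi> (0, z)" using u by (auto simp: W1_def W2_def)
    obtain w' z' where wz': "v1 = \<Phi> (w', 0)" "v2 = \<Phi> (0, z')" using v by (auto simp: W1_def W2_def)
    have Sp: "S (w, z) p = S (w, 0) p + S (0, z) p" for w z using Sl(1)[of "(w, 0)" "(0, z)"] by simp
    have "g ?q (coord_vector A c' ?q (u1 + u2)) (coord_vector A c' ?q (v1 + v2)) = g ?q (S (w, z) ?q) (S (w', z') ?q)"
      unfolding cv[OF q] wz wz' split[symmetric] i\<Phi> ..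
    also have "\<dots> = g p (S (w, z) p) (S (w', z') p)" using Pc[OF Pq(1)[OF q]] Pq(2)[OF q] by simp
    also have "\<dots> = g p (S (w, 0) p) (S (w', 0) p) + g p (S (0, z) p) (S (0, z') p)"
      unfolding Sp[of w z] Sp[of w' z'] by (simp add: g_add g_add_right St orth[OF S1 S2])
    also have "\<dots> = h a u1 v1 + h b u2 v2" unfolding h_def wz wz' i\<Phi> ..
    finally show ?thesis by (simp only: Let_def)
  qed
  ultimately show "\<exists>c W1 W2 S1 S2. \<exists>h1 h2 :: 'e \<Rightarrow> 'e \<Rightarrow> 'e \<Rightarrow> real.
        admissible_chart A c \<and> p \<in> fst c \<and>
        subspace W1 \<and> subspace W2 \<and> W1 \<inter> W2 = {0} \<and> {a + b | a b. a \<in> W1 \<and> b \<in> W2} = UNIV \<and>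
        S1 \<subseteq> W1 \<and> S2 \<subseteq> W2 \<and> snd c ` fst c = {a + b | a b. a \<in> S1 \<and> b \<in> S2} \<and>
        (\<forall>q\<in>fst c. coord_vector A c q ` W1 = Hor q \<and> coord_vector A c q ` W2 = Ver q) \<and>
        (\<forall>a\<in>S1. \<forall>b\<in>S2. \<forall>u1\<in>W1. \<forall>u2\<in>W2. \<forall>v1\<in>W1. \<forall>v2\<in>W2.
           let q = chart_inv c (a + b)
           in g q (coord_vector A c q (u1 + u2)) (coord_vector A c q (v1 + v2)) = h1 a u1 v1 + h2 b u2 v2)"
    using rep(1) pc'
    by (intro exI[of _ c'] exI[of _ W1] exI[of _ W2] exI[of _ S1'] exI[of _ S2'] exI[of _ h] exI[of _ h] conjI ballI) simp_all
qed

end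

end

theorem theorem5p3:
  fixes A :: "('a::{t2_space,second_countable_topology}, 'e::euclidean_space) atlas"
    and J :: "'a endo" and g :: "'a form2" and \<omega> :: "'a form1" and B1 :: "'a vfield"
    and A' :: "('b::{t2_space,second_countable_topology}, 'f::euclidean_space) atlas"
    and gB :: "'b form2" and \<pi> :: "'a \<Rightarrow> 'b"
    and D :: "'a connection" and DB :: "'b connection"
    and DP :: "'a vfield \<Rightarrow> ('a \<Rightarrow> 'b tvec) \<Rightarrow> ('a \<Rightarrow> 'b tvec)"
  assumes "lck_manifold A J g \<omega>"
    and "lee_vector_field A g \<omega> B1"
    and "riemannian_manifold A' gB"
    and "lagrangian_submersion A J g A' gB \<pi>"
    and "levi_civita A g D"
    and "levi_civita A' gB DB"
    and "pullback_connection A A' \<pi> DB DP"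
    and "B1 \<in> sections A (vertical A A' \<pi>)"
  shows "locally_product A g (horizontal A A' g \<pi>) (vertical A A' \<pi>) \<longleftrightarrow>
    (\<forall>X\<in>sections A (horizontal A A' g \<pi>). \<forall>Y\<in>sections A (horizontal A A' g \<pi>).
     \<forall>V\<in>sections A (vertical A A' \<pi>). \<forall>W\<in>sections A (vertical A A' \<pi>).
       (\<forall>p. gB (\<pi> p) (second_fundamental_form A' \<pi> D DP X (app J Y) p)
                     (differential A' \<pi> (J p (V p)))
            = - (1/2) * g p (J p (Y p)) (B1 p) * g p (X p) (J p (V p))
              - (1/2) * g p (X p) (Y p) * g p (B1 p) (V p)) \<and>
       oneill_T A A' g D \<pi> V (app J W) = 0)"
proof -
  have M: "riemannian_manifold A g" using assms(1) by (simp add: lck_manifold_def hermitian_manifold_def)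
  interpret lagrangian A g D A' gB J \<omega> B1 \<pi>
    using assms M by unfold_locales (simp_all add: riemannian_manifold_def)
  show ?thesis
    unfolding conditions_iff_totally_geodesic[OF assms(7)]
    using locally_product_imp_totally_geodesic totally_geodesic_imp_locally_product by blast
qed

end
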